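(* The following promise problem $\Theta$ is $\mathbf{NP}$-complete. Instance: a planar $3$-regular graph $G$ and a number $r$ with $0<r<1$. Promise: $\sigma(G)=2$. Question: does $G$ have a sigma coloring $c$ using exactly $\sigma(G)$ distinct labels such that for some label, the set of vertices receiving that label has at most $r|V(G)|$ vertices?
   Context: All graphs are finite and simple. For a graph $G$, a vertex labeling $c: V(G)\to\mathbb{N}$ is a sigma coloring of $G$ if for every two adjacent vertices $u,v$ of $G$ we have $\sum_{w\sim u} c(w)\neq \sum_{w\sim v} c(w)$, where $w\sim x$ means $w$ is adjacent to $x$. The sigma chromatic number $\sigma(G)$ is the minimum number of distinct labels used by a sigma coloring of $G$. A graph is $3$-regular if every vertex has degree $3$. *)

theory Defs
  imports
    "HOL-Analysis.Analysis"
    "HOL-Computational_Algebra.Polynomial"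
    "Graph_Theory.Pair_Digraph"
begin

section \<open>Graphs, planarity and sigma colorings\<close>

text \<open>
  Finite simple graphs are rendered by the locale predicate \<^const>\<open>pair_graph\<close>: finite, loop-free
  and symmetric, where an edge joining \<open>u\<close> and \<open>v\<close> is represented by both pairs \<open>(u, v)\<close> and \<open>(v, u)\<close>.
  Hence the out-degree of a vertex is its degree.
\<close>

definition regular_graph :: "nat \<Rightarrow> 'a pair_pre_digraph \<Rightarrow> bool" where
  "regular_graph d G \<longleftrightarrow> (\<forall>v\<in>pverts G. out_degree (with_proj G) v = d)"

text \<open>
  A plane drawing: vertices are distinct points \<open>pos v\<close>, the edge with ends \<open>u\<close> and \<open>v\<close> is drawn as an
  arc \<open>\<gamma> {u, v}\<close> joining them and avoiding the other vertices, and different edges meet only at vertices.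
\<close>

definition plane_drawing ::
  "'a pair_pre_digraph \<Rightarrow> ('a \<Rightarrow> complex) \<Rightarrow> ('a set \<Rightarrow> real \<Rightarrow> complex) \<Rightarrow> bool" where
  "plane_drawing G pos \<gamma> \<longleftrightarrow>
     inj_on pos (pverts G) \<and>
     (\<forall>(u, v)\<in>parcs G.
        arc (\<gamma> {u, v}) \<and>
        {pathstart (\<gamma> {u, v}), pathfinish (\<gamma> {u, v})} = {pos u, pos v} \<and>
        path_image (\<gamma> {u, v}) \<inter> pos ` pverts G = {pos u, pos v}) \<and>
     (\<forall>(u, v)\<in>parcs G. \<forall>(x, y)\<in>parcs G. {u, v} \<noteq> {x, y} \<longrightarrow>
        path_image (\<gamma> {u, v}) \<inter> path_image (\<gamma> {x, y}) \<subseteq> pos ` pverts G)"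

definition planar_graph :: "'a pair_pre_digraph \<Rightarrow> bool" where
  "planar_graph G \<longleftrightarrow> (\<exists>pos \<gamma>. plane_drawing G pos \<gamma>)"

definition neighbors :: "'a pair_pre_digraph \<Rightarrow> 'a \<Rightarrow> 'a set" where
  "neighbors G v = {w. (v, w) \<in> parcs G}"

definition sigma_coloring :: "'a pair_pre_digraph \<Rightarrow> ('a \<Rightarrow> nat) \<Rightarrow> bool" where
  "sigma_coloring G c \<longleftrightarrow>
     (\<forall>(u, v)\<in>parcs G. (\<Sum>w\<in>neighbors G u. c w) \<noteq> (\<Sum>w\<in>neighbors G v. c w))"

definition sigma_chromatic_number :: "'a pair_pre_digraph \<Rightarrow> nat" where
  "sigma_chromatic_number G = (LEAST k. \<exists>c. sigma_coloring G c \<and> card (c ` pverts G) = k)"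


section \<open>Polynomial-time computation\<close>

text \<open>
  Deterministic multi-tape Turing machines. Tapes are two-way infinite, symbol \<open>0\<close> is the blank,
  computation starts in state \<open>0\<close> and halts on reaching state \<open>1\<close>. The transition function maps a state
  and the list of scanned symbols to a new state and, for each tape, a symbol to write and a head
  movement.
\<close>

record turing_machine =
  tm_tapes :: nat
  tm_states :: nat
  tm_symbols :: nat
  tm_delta :: "nat \<Rightarrow> nat list \<Rightarrow> nat \<times> (nat \<times> int) list"

definition wf_tm :: "turing_machine \<Rightarrow> bool" where
  "wf_tm M \<longleftrightarrow>
     tm_tapes M \<ge> 1 \<and> tm_states M \<ge> 2 \<and> tm_symbols M \<ge> 3 \<and>
     (\<forall>q < tm_states M. \<forall>ss. length ss = tm_tapes M \<and> set ss \<subseteq> {..<tm_symbols M} \<longrightarrow>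
        (case tm_delta M q ss of (q', acts) \<Rightarrow>
           q' < tm_states M \<and> length acts = tm_tapes M \<and>
           set acts \<subseteq> {..<tm_symbols M} \<times> {-1, 0, 1}))"

type_synonym tm_config = "nat \<times> (int \<times> (int \<Rightarrow> nat)) list"

definition tm_step :: "turing_machine \<Rightarrow> tm_config \<Rightarrow> tm_config" where
  "tm_step M = (\<lambda>(q, ts).
     if q = 1 then (q, ts)
     else case tm_delta M q (map (\<lambda>(h, t). t h) ts) of (q', acts) \<Rightarrow>
       (q', map2 (\<lambda>(s, d) (h, t). (h + d, t(h := s))) acts ts))"

definition string_tape :: "bool list \<Rightarrow> int \<Rightarrow> nat" where
  "string_tape x i =
     (if 0 \<le> i \<and> i < int (length x) then (if x ! nat i then 2 else 1) else 0)"

definition tm_init :: "turing_machine \<Rightarrow> bool list \<Rightarrow> tm_config" where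
  "tm_init M x = (0, (0, string_tape x) # replicate (tm_tapes M - 1) (0, \<lambda>_. 0))"

text \<open>Input and output are both on the first tape; final head positions are irrelevant.\<close>

definition tm_computes_within ::
  "turing_machine \<Rightarrow> (bool list \<Rightarrow> bool list) \<Rightarrow> (nat \<Rightarrow> nat) \<Rightarrow> bool" where
  "tm_computes_within M f T \<longleftrightarrow>
     (\<forall>x. \<exists>t \<le> T (length x). \<exists>ts.
        (tm_step M ^^ t) (tm_init M x) = (1, ts) \<and> snd (hd ts) = string_tape (f x))"

definition poly_time_computable :: "(bool list \<Rightarrow> bool list) \<Rightarrow> bool" where
  "poly_time_computable f \<longleftrightarrow>
     (\<exists>M (p :: nat poly). wf_tm M \<and> tm_computes_within M f (poly p))"

definition poly_time_decidable :: "(bool list \<Rightarrow> bool) \<Rightarrow> bool" where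
  "poly_time_decidable V \<longleftrightarrow> poly_time_computable (\<lambda>x. [V x])"


section \<open>NP-completeness of promise problems\<close>

definition pair_string :: "bool list \<Rightarrow> bool list \<Rightarrow> bool list" where
  "pair_string x y = concat (map (\<lambda>b. [b, b]) x) @ [False, True] @ y"

text \<open>
  A promise problem is a pair \<open>(Q, R)\<close> of sets of strings, a promise and a question: on inputs in \<open>Q\<close>
  one has to decide membership in \<open>R\<close>, and nothing is required on inputs outside \<open>Q\<close>. Its
  yes-instances are \<open>Q \<inter> R\<close> and its no-instances are \<open>Q - R\<close>. A language \<open>L\<close> is the promise problem
  \<open>(UNIV, L)\<close>.
\<close>

type_synonym promise_problem = "bool list set \<times> bool list set"

definition promise_NP :: "promise_problem set" where
  "promise_NP = {(Q, R). \<exists>V (p :: nat poly). poly_time_decidable V \<and>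
     (\<forall>x\<in>Q. x \<in> R \<longleftrightarrow> (\<exists>w. length w \<le> poly p (length x) \<and> V (pair_string x w)))}"

definition NP :: "bool list set set" where
  "NP = {L. (UNIV, L) \<in> promise_NP}"

definition NP_hard_promise :: "promise_problem \<Rightarrow> bool" where
  "NP_hard_promise = (\<lambda>(Q, R). \<forall>L\<in>NP. \<exists>f. poly_time_computable f \<and>
     (\<forall>x. f x \<in> Q \<and> (x \<in> L \<longleftrightarrow> f x \<in> R)))"

definition NP_complete_promise :: "promise_problem \<Rightarrow> bool" where
  "NP_complete_promise P \<longleftrightarrow> P \<in> promise_NP \<and> NP_hard_promise P"


section \<open>The problem \<open>\<Theta>\<close>\<close>

fun nat_string :: "nat \<Rightarrow> bool list" where
  "nat_string n = (if n = 0 then [] else odd n # nat_string (n div 2))"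

declare nat_string.simps [simp del]

text \<open>
  A graph on the vertex set \<open>{0..<n}\<close> is written as its adjacency matrix, row by row; a rational
  number is written as a fraction, not necessarily reduced, of two numbers in binary.
\<close>

definition adjacency_string :: "nat \<Rightarrow> nat rel \<Rightarrow> bool list" where
  "adjacency_string n E = map (\<lambda>k. (k div n, k mod n) \<in> E) [0..<n * n]"

definition encodes :: "bool list \<Rightarrow> nat pair_pre_digraph \<Rightarrow> rat \<Rightarrow> bool" where
  "encodes x G r \<longleftrightarrow> (\<exists>n a b.
     pverts G = {..<n} \<and> b > 0 \<and> r = of_nat a / of_nat b \<and>
     x = pair_string (adjacency_string n (parcs G)) (pair_string (nat_string a) (nat_string b)))"

definition Theta_instance :: "nat pair_pre_digraph \<Rightarrow> rat \<Rightarrow> bool" where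
  "Theta_instance G r \<longleftrightarrow>
     pair_graph G \<and> planar_graph G \<and> regular_graph 3 G \<and> 0 < r \<and> r < 1"

definition Theta_question :: "nat pair_pre_digraph \<Rightarrow> rat \<Rightarrow> bool" where
  "Theta_question G r \<longleftrightarrow>
     (\<exists>c. sigma_coloring G c \<and> card (c ` pverts G) = sigma_chromatic_number G \<and>
        (\<exists>l\<in>c ` pverts G.
           of_nat (card {v\<in>pverts G. c v = l}) \<le> r * of_nat (card (pverts G))))"

definition Theta :: promise_problem where
  "Theta =
     ({x. \<exists>G r. encodes x G r \<and> Theta_instance G r \<and> sigma_chromatic_number G = 2},
      {x. \<exists>G r. encodes x G r \<and> Theta_instance G r \<and> Theta_question G r})"

text \<open>A string encodes at most one pair of a graph and a number.\<close>

lemma pair_string_inject: "pair_string x y = pair_string x' y' \<longleftrightarrow> x = x' \<and> y = y'"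
proof (induction x arbitrary: x')
  case Nil
  then show ?case by (cases x') (auto simp: pair_string_def)
next
  case (Cons b x)
  then show ?case by (cases x') (auto simp: pair_string_def)
qed

lemma nat_string_inject: "nat_string m = nat_string n \<longleftrightarrow> m = n"
proof (induction m arbitrary: n rule: less_induct)
  case (less m)
  show ?case
  proof (cases "m = 0 \<or> n = 0")
    case True
    then show ?thesis by (auto simp: nat_string.simps[of m] nat_string.simps[of n])
  next
    case False
    have "nat_string (m div 2) = nat_string (n div 2) \<longleftrightarrow> m div 2 = n div 2"
      using False by (intro less) auto
    then have "nat_string m = nat_string n \<longleftrightarrow> (odd m \<longleftrightarrow> odd n) \<and> m div 2 = n div 2"
      using False by (subst nat_string.simps[of m], subst nat_string.simps[of n]) auto
    also have "\<dots> \<longleftrightarrow> m = n" by (auto elim!: evenE oddE)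
    finally show ?thesis .
  qed
qed

lemma adjacency_string_inject:
  assumes "adjacency_string n E = adjacency_string n' E'"
    and "E \<subseteq> {..<n} \<times> {..<n}" "E' \<subseteq> {..<n'} \<times> {..<n'}"
  shows "n = n' \<and> E = E'"
proof -
  have "n * n = n' * n'" using arg_cong[OF assms(1), of length] by (simp add: adjacency_string_def)
  then have n: "n' = n" by (metis power2_eq_square power2_eq_imp_eq zero_le)
  have "(i, j) \<in> E \<longleftrightarrow> (i, j) \<in> E'" if "i < n" "j < n" for i j
  proof -
    have "i * n + j < Suc i * n" using that by simp
    also have "\<dots> \<le> n * n" using that by (intro mult_right_mono) auto
    finally have k: "i * n + j < n * n" .
    then have "adjacency_string n E ! (i * n + j) = adjacency_string n E' ! (i * n + j)"
      using assms(1) n by simp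
    with k that show ?thesis by (simp add: adjacency_string_def)
  qed
  then show ?thesis using assms(2,3) n by auto
qed

lemma encodes_unique:
  assumes "encodes x G r" "encodes x G' r'" "pair_graph G" "pair_graph G'"
  shows "G = G' \<and> r = r'"
proof -
  have sub: "parcs H \<subseteq> {..<m} \<times> {..<m}"
    if "pair_graph H" "pverts H = {..<m}" for H :: "nat pair_pre_digraph" and m
  proof -
    interpret pair_graph H by fact
    show ?thesis using wellformed' that(2) by auto
  qed
  obtain n a b where 1: "pverts G = {..<n}" "r = of_nat a / of_nat b"
    "x = pair_string (adjacency_string n (parcs G)) (pair_string (nat_string a) (nat_string b))"
    using assms(1) by (auto simp: encodes_def)
  obtain n' a' b' where 2: "pverts G' = {..<n'}" "r' = of_nat a' / of_nat b'"
    "x = pair_string (adjacency_string n' (parcs G')) (pair_string (nat_string a') (nat_string b'))"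
    using assms(2) by (auto simp: encodes_def)
  have eq: "adjacency_string n (parcs G) = adjacency_string n' (parcs G')" "a = a'" "b = b'"
    using 1(3) 2(3) by (auto simp: pair_string_inject nat_string_inject)
  have "n = n' \<and> parcs G = parcs G'"
    using adjacency_string_inject[OF eq(1)] sub assms(3,4) 1(1) 2(1) by blast
  with 1 2 eq show ?thesis by simp
qed

end

theory Submission
  imports Defs
begin

text \<open>
  In a bipartite cubic graph each of the two sides is a label class of a sigma colouring with two labels, so the
  sigma chromatic number is 2. If \<open>S\<close> is a label class of such a colouring, then the vertices without
  neighbours in \<open>S\<close> are independent, hence at most half of all vertices, and the others account for
  at least one of the \<open>3 * card S\<close> edge ends at \<open>S\<close> each. So \<open>S\<close> contains at least one sixth
  of the vertices, and equality holds iff the vertices with exactly one neighbour in \<open>S\<close> and those with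
  none form a bipartition. For \<open>r = 1 / 6\<close> the question is therefore an exact cover problem.

  Hardness comes from a direct reduction. A computation tableau of a verifier becomes a CNF
  formula, and its clause-variable matrix becomes a grid of boxes, each with 108 vertices: the value of
  a variable travels down its column, and the truth value of the part of a clause read so far travels along its row.
  Boxes for matrix entries \<open>0\<close> let the two signals cross, boxes for literals allow a row signal to be
  switched on, and the boxes in the first and last column force a row to start with false and to end with true.
  Each box is planar and bipartite, and its finitely many relevant properties are checked by computation.

  Polynomial-time computability is established for a small calculus of bounded arithmetic functions that is
  compiled to counter programs and these to Turing machines.
\<close>

section \<open>Counter programs and their compilation to Turing machines\<close>

text \<open>Equality in the counting argument does not say which side of the bipartition consists of
  the vertices with a neighbour in \<open>S\<close>: besides the intended exact covers, where every
  even vertex sees \<open>S\<close> once, there are those with the parities exchanged. Which of the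
  two holds is constant along edges, so it has to be fixed somewhere. Boxes of type 3 do this: the
  odd vertices of their right component admit no exact cover, so the first column fixes the parity,
  and the connectedness of the inner boxes carries it along each row. The promise comes for free, as
  the parity of the vertex number is a bipartition of every box and connecting edges join opposite
  parities. For membership the obstacle is that \<open>r\<close> is given in binary while counter
  programs hold numbers in unary; the size condition is therefore compared bit by bit with a small
  carry. For hardness, clause schemas and box tables are constants of the machine, so a bit of the
  adjacency matrix is found by arithmetic on indices and finite case distinctions, without ever
  writing down a formula.\<close>

datatype cmd =
    Inc nat
  | Dec nat
  | Out bool
  | While nat nat "cmd list"
  | If nat nat "cmd list" "cmd list"

text \<open>
  The tape of register \<open>r\<close> never changes: the value of the register is the position of its head.
  Symbol 3 marks position 0, and register 0 additionally scans the input, shifted by one position.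
\<close>

definition reg_symbol :: "bool list \<Rightarrow> nat \<Rightarrow> nat \<Rightarrow> nat" where
  "reg_symbol x r v =
     (if v = 0 then 3 else if r = 0 \<and> v \<le> length x then (if x ! (v - 1) then 2 else 1) else 0)"

text \<open>\<open>While r a c\<close> iterates \<open>c\<close> until register \<open>r\<close> scans the symbol \<open>a\<close>.\<close>

type_synonym pstate = "(nat \<Rightarrow> nat) \<times> bool list"

fun pstep :: "bool list \<Rightarrow> cmd list \<times> pstate \<Rightarrow> cmd list \<times> pstate" where
  "pstep x ([], s, z) = ([], s, z)"
| "pstep x (Inc r # k, s, z) = (k, s(r := Suc (s r)), z)"
| "pstep x (Dec r # k, s, z) = (k, s(r := s r - 1), z)"
| "pstep x (Out b # k, s, z) = (k, s, z @ [b])"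
| "pstep x (While r a c # k, s, z) =
     (if reg_symbol x r (s r) = a then k else c @ While r a c # k, s, z)"
| "pstep x (If r a c d # k, s, z) =
     ((if reg_symbol x r (s r) = a then c else d) @ k, s, z)"

text \<open>One number of steps serves all continuations \<open>k\<close>; this makes running times
  add up under concatenation and lets a loop body be inserted in front of its loop.\<close>

definition exec :: "bool list \<Rightarrow> cmd list \<Rightarrow> pstate \<Rightarrow> nat \<Rightarrow> pstate \<Rightarrow> bool" where
  "exec x c \<sigma> T \<sigma>' \<longleftrightarrow> (\<exists>t\<le>T. \<forall>k. (pstep x ^^ t) (c @ k, \<sigma>) = (k, \<sigma>'))"

lemma exec_mono: "exec x c \<sigma> T \<sigma>' \<Longrightarrow> T \<le> T' \<Longrightarrow> exec x c \<sigma> T' \<sigma>'"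
  unfolding exec_def using le_trans by blast

lemma exec_Nil: "exec x [] \<sigma> 0 \<sigma>"
  unfolding exec_def by (intro exI[of _ 0]) simp

lemma exec_append:
  assumes "exec x c \<sigma> T \<sigma>'" "exec x d \<sigma>' T' \<sigma>''"
  shows "exec x (c @ d) \<sigma> (T + T') \<sigma>''"
proof -
  obtain t t' where t: "t \<le> T" "\<And>k. (pstep x ^^ t) (c @ k, \<sigma>) = (k, \<sigma>')"
    and t': "t' \<le> T'" "\<And>k. (pstep x ^^ t') (d @ k, \<sigma>') = (k, \<sigma>'')"
    using assms unfolding exec_def by blast
  have "(pstep x ^^ (t' + t)) ((c @ d) @ k, \<sigma>) = (k, \<sigma>'')" for k
    using t(2)[of "d @ k"] t'(2)[of k] by (simp add: funpow_add)
  then show ?thesis unfolding exec_def using t(1) t'(1) by (intro exI[of _ "t' + t"]) auto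
qed

lemma exec_Cons:
  assumes "exec x [a] \<sigma> T \<sigma>'" "exec x d \<sigma>' T' \<sigma>''"
  shows "exec x (a # d) \<sigma> (T + T') \<sigma>''"
  using exec_append[OF assms] by simp

lemma exec_Inc: "exec x [Inc r] (s, z) 1 (s(r := Suc (s r)), z)"
  and exec_Dec: "exec x [Dec r] (s, z) 1 (s(r := s r - 1), z)"
  and exec_Out: "exec x [Out b] (s, z) 1 (s, z @ [b])"
  unfolding exec_def by (auto intro!: exI[of _ 1])

lemma exec_While_stop:
  "reg_symbol x r (s r) = a \<Longrightarrow> exec x [While r a c] (s, z) 1 (s, z)"
  unfolding exec_def by (auto intro!: exI[of _ 1])

lemma exec_prefix:
  assumes "\<And>k. pstep x (c @ k, \<sigma>) = (d @ k, \<sigma>)" "exec x d \<sigma> T \<sigma>'"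
  shows "exec x c \<sigma> (Suc T) \<sigma>'"
proof -
  obtain t where t: "t \<le> T" "\<And>k. (pstep x ^^ t) (d @ k, \<sigma>) = (k, \<sigma>')"
    using assms unfolding exec_def by blast
  have "(pstep x ^^ Suc t) (c @ k, \<sigma>) = (k, \<sigma>')" for k
    by (simp add: funpow_Suc_right assms(1) t(2) del: funpow.simps)
  then show ?thesis unfolding exec_def using t(1) by (intro exI[of _ "Suc t"]) auto
qed

lemma exec_While_step:
  assumes "reg_symbol x r (s r) \<noteq> a" "exec x c (s, z) T (s', z')"
    and "exec x [While r a c] (s', z') T' \<sigma>''"
  shows "exec x [While r a c] (s, z) (Suc (T + T')) \<sigma>''"
  by (rule exec_prefix[OF _ exec_append[OF assms(2,3)]]) (use assms(1) in simp)

lemma exec_If: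
  assumes "exec x (if reg_symbol x r (s r) = a then c else d) (s, z) T \<sigma>'"
  shows "exec x [If r a c d] (s, z) (Suc T) \<sigma>'"
  by (rule exec_prefix[OF _ assms]) simp

lemma reg_symbol_eq_3 [simp]: "reg_symbol x r v = 3 \<longleftrightarrow> v = 0"
  by (auto simp: reg_symbol_def)

lemma exec_clear: "exec x [While r 3 [Dec r]] (s, z) (2 * s r + 1) (s(r := 0), z)"
proof (induction "s r" arbitrary: s)
  case 0
  then have "s(r := 0) = s" by (simp add: fun_upd_idem)
  with 0 show ?case using exec_While_stop[of x r s 3 "[Dec r]" z] by simp
next
  case (Suc v)
  from Suc(1)[of "s(r := s r - 1)"] Suc(2)
  have "exec x [While r 3 [Dec r]] (s(r := s r - 1), z) (2 * v + 1) (s(r := 0), z)"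
    by (metis diff_Suc_1 fun_upd_same fun_upd_upd)
  from exec_While_step[OF _ exec_Dec this] Suc(2) show ?case
    by (auto intro: exec_mono)
qed

lemma exec_move:
  assumes "a \<noteq> b"
  shows "exec x [While a 3 [Dec a, Inc b]] (s, z) (3 * s a + 1) (s(a := 0, b := s b + s a), z)"
proof (induction "s a" arbitrary: s)
  case 0
  then have eq: "s(a := 0, b := s b + s a) = s" by (simp add: fun_upd_idem)
  have "exec x [While a 3 [Dec a, Inc b]] (s, z) 1 (s, z)"
    using 0 by (intro exec_While_stop) simp
  then show ?case unfolding eq by (rule exec_mono) simp
next
  case (Suc v)
  let ?s = "s(a := s a - 1, b := Suc (s b))"
  have 1: "exec x [Dec a, Inc b] (s, z) 2 (?s, z)"
    using exec_Cons[OF exec_Dec[of x a s z] exec_Inc[of x b]] assms by (simp add: numeral_2_eq_2)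
  have "?s a = v" using Suc(2) assms by simp
  from Suc(1)[of ?s, OF this[symmetric]] have
    "exec x [While a 3 [Dec a, Inc b]] (?s, z) (3 * v + 1) (?s(a := 0, b := ?s b + ?s a), z)"
    using \<open>?s a = v\<close> by simp
  moreover have "?s(a := 0, b := ?s b + ?s a) = s(a := 0, b := s b + s a)"
    using Suc(2) assms by (auto simp: fun_eq_iff)
  ultimately have 2: "exec x [While a 3 [Dec a, Inc b]] (?s, z) (3 * v + 1) (s(a := 0, b := s b + s a), z)"
    by metis
  have "reg_symbol x a (s a) \<noteq> 3" using Suc(2) by simp
  from exec_While_step[OF this 1 2] show ?case using Suc(2)
    by (auto elim: exec_mono)
qed

lemma exec_move2:
  assumes "a \<noteq> b" "a \<noteq> c" "b \<noteq> c"
  shows "exec x [While a 3 [Dec a, Inc b, Inc c]] (s, z) (4 * s a + 1)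
    (s(a := 0, b := s b + s a, c := s c + s a), z)"
proof (induction "s a" arbitrary: s)
  case 0
  then have eq: "s(a := 0, b := s b + s a, c := s c + s a) = s" by (simp add: fun_upd_idem)
  have "exec x [While a 3 [Dec a, Inc b, Inc c]] (s, z) 1 (s, z)"
    using 0 by (intro exec_While_stop) simp
  then show ?case unfolding eq by (rule exec_mono) simp
next
  case (Suc v)
  let ?s = "s(a := s a - 1, b := Suc (s b), c := Suc (s c))"
  have 1: "exec x [Dec a, Inc b, Inc c] (s, z) 3 (?s, z)"
    using exec_Cons[OF exec_Dec[of x a s z] exec_Cons[OF exec_Inc[of x b] exec_Inc[of x c]]] assms
    by (simp add: numeral_3_eq_3)
  have "?s a = v" using Suc(2) assms by simp
  from Suc(1)[of ?s, OF this[symmetric]] have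
    "exec x [While a 3 [Dec a, Inc b, Inc c]] (?s, z) (4 * v + 1)
      (?s(a := 0, b := ?s b + ?s a, c := ?s c + ?s a), z)"
    using \<open>?s a = v\<close> by simp
  moreover have "?s(a := 0, b := ?s b + ?s a, c := ?s c + ?s a) = s(a := 0, b := s b + s a, c := s c + s a)"
    using Suc(2) assms by (auto simp: fun_eq_iff)
  ultimately have 2: "exec x [While a 3 [Dec a, Inc b, Inc c]] (?s, z) (4 * v + 1)
      (s(a := 0, b := s b + s a, c := s c + s a), z)"
    by metis
  have "reg_symbol x a (s a) \<noteq> 3" using Suc(2) by simp
  from exec_While_step[OF this 1 2] show ?case using Suc(2)
    by (auto elim: exec_mono)
qed

subsection \<open>Compilation\<close>

text \<open>The control states of the compiled machine are the continuations of the program.\<close>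

function conts :: "cmd list \<Rightarrow> cmd list set" where
  "conts [] = {[]}"
| "conts (Inc r # k) = insert (Inc r # k) (conts k)"
| "conts (Dec r # k) = insert (Dec r # k) (conts k)"
| "conts (Out b # k) = insert (Out b # k) (conts k)"
| "conts (While r a c # k) =
     insert (While r a c # k) (conts k \<union> (\<lambda>d. d @ While r a c # k) ` conts c)"
| "conts (If r a c d # k) =
     insert (If r a c d # k) (conts k \<union> (\<lambda>e. e @ k) ` (conts c \<union> conts d))"
  by pat_completeness auto
termination by (relation "Wellfounded.measure (size_list size)") auto

lemma finite_conts: "finite (conts c)"
  by (induction c rule: conts.induct) auto

lemma self_in_conts: "c \<in> conts c"
  by (cases c rule: conts.cases) auto

lemma Nil_in_conts: "[] \<in> conts c"
  by (induction c rule: conts.induct) auto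

text \<open>The Boolean stands for the outcome of a test, so that closure of the control states can
  be shown without reference to register contents.\<close>

fun successor :: "bool \<Rightarrow> cmd list \<Rightarrow> cmd list" where
  "successor b [] = []"
| "successor b (While r a c # k) = (if b then k else c @ While r a c # k)"
| "successor b (If r a c d # k) = (if b then c else d) @ k"
| "successor b (a # k) = k"

lemma successor_append: "c \<noteq> [] \<Longrightarrow> successor b (c @ k) = successor b c @ k"
  by (cases "(b, c)" rule: successor.cases) auto

text \<open>Inside a loop body the continuation is \<open>e @ While r a c # k\<close> with a
  remainder \<open>e\<close> of the body. As long as \<open>e\<close> is nonempty a step only acts
  on \<open>e\<close>; once it is empty the loop itself is left over, which is a continuation as
  well.\<close>

lemma successor_conts: "d \<in> conts c \<Longrightarrow> successor b d \<in> conts c"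
proof (induction c arbitrary: d rule: conts.induct)
  case (5 r a c k)
  show ?case
  proof (cases "d = While r a c # k \<or> d \<in> conts k")
    case True
    then show ?thesis using 5(1) self_in_conts[of c] self_in_conts[of k] by auto
  next
    case False
    then obtain e where e: "e \<in> conts c" "d = e @ While r a c # k" using 5(3) by auto
    with False have "e \<noteq> []" by auto
    then show ?thesis using 5(2)[OF e(1)] e(2) by (auto simp: successor_append)
  qed
next
  case (6 r a c d' k)
  show ?case
  proof (cases "d = If r a c d' # k \<or> d \<in> conts k")
    case True
    then show ?thesis using 6(1) self_in_conts[of c] self_in_conts[of d'] by auto
  next
    case False
    then obtain e where e: "e \<in> conts c \<union> conts d'" "d = e @ k" using 6(4) by auto
    with False self_in_conts[of k] have "e \<noteq> []" by auto
    then show ?thesis using 6(2,3)[of e] e by (auto simp: successor_append)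
  qed
qed (auto simp: self_in_conts)

fun cmd_regs :: "cmd \<Rightarrow> nat set" where
  "cmd_regs (Inc r) = {r}"
| "cmd_regs (Dec r) = {r}"
| "cmd_regs (Out b) = {}"
| "cmd_regs (While r a c) = insert r (\<Union>(cmd_regs ` set c))"
| "cmd_regs (If r a c d) = insert r (\<Union>(cmd_regs ` set c) \<union> \<Union>(cmd_regs ` set d))"

lemma finite_cmd_regs: "finite (cmd_regs a)"
  by (induction a) auto

lemma conts_regs: "d \<in> conts c \<Longrightarrow> \<Union>(cmd_regs ` set d) \<subseteq> \<Union>(cmd_regs ` set c)"
  by (induction c arbitrary: d rule: conts.induct) (fastforce)+

section \<open>Simulation of a counter program by a machine\<close>

datatype ctl = Init | Copy | Back | Run "cmd list"

text \<open>The model puts input and output on the same tape. \<open>Copy\<close> therefore moves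
  the input to tape 1, erasing tape 0, and \<open>Back\<close> rewinds both heads until tape 1 scans
  the mark 3; the head of tape 0 is then one cell too far left. Tape \<open>Suc r\<close> belongs to
  register \<open>r\<close>.\<close>

fun ctl_step :: "cmd list \<Rightarrow> ctl \<Rightarrow> nat list \<Rightarrow> ctl \<times> (nat \<Rightarrow> nat \<times> int)" where
  "ctl_step p Init ss =
     (Copy, \<lambda>i. if i = 0 then (ss ! i, 0) else (3, if i = 1 then 1 else 0))"
| "ctl_step p Copy ss =
     (if ss ! 0 = 0 then (Back, \<lambda>i. (ss ! i, if i < 2 then -1 else 0))
      else (Copy, \<lambda>i. if i = 0 then (0, 1) else if i = 1 then (ss ! 0, 1) else (ss ! i, 0)))"
| "ctl_step p Back ss =
     (if ss ! 1 = 3 then (Run p, \<lambda>i. (ss ! i, if i = 0 then 1 else 0))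
      else (Back, \<lambda>i. (ss ! i, if i < 2 then -1 else 0)))"
| "ctl_step p (Run []) ss = (Run [], \<lambda>i. (ss ! i, 0))"
| "ctl_step p (Run (Inc r # k)) ss = (Run k, \<lambda>i. (ss ! i, if i = Suc r then 1 else 0))"
| "ctl_step p (Run (Dec r # k)) ss =
     (Run k, \<lambda>i. (ss ! i, if i = Suc r \<and> ss ! i \<noteq> 3 then -1 else 0))"
| "ctl_step p (Run (Out b # k)) ss =
     (Run k, \<lambda>i. if i = 0 then (if b then 2 else 1, 1) else (ss ! i, 0))"
| "ctl_step p (Run (While r a c # k)) ss =
     (Run (if ss ! Suc r = a then k else c @ While r a c # k), \<lambda>i. (ss ! i, 0))"
| "ctl_step p (Run (If r a c d # k)) ss =
     (Run ((if ss ! Suc r = a then c else d) @ k), \<lambda>i. (ss ! i, 0))"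

lemma ctl_step_Run: "\<exists>b. fst (ctl_step p (Run c) ss) = Run (successor b c)"
proof -
  have "\<exists>b. Run (if t then k else c @ k') = Run (if b then k else c @ k')"
    "\<exists>b. Run ((if t then c else d) @ k) = Run ((if b then c else d) @ k)" for t k k' c d by blast+
  then show ?thesis by (cases "(p, Run c, ss)" rule: ctl_step.cases) auto
qed

definition reg_tape :: "bool list \<Rightarrow> nat \<Rightarrow> int \<Rightarrow> nat" where
  "reg_tape x r j = (if j < 0 then 0 else reg_symbol x r (nat j))"

definition prog_tape :: "bool list \<Rightarrow> pstate \<Rightarrow> nat \<Rightarrow> int \<times> (int \<Rightarrow> nat)" where
  "prog_tape x = (\<lambda>(s, z) i. if i = 0 then (int (length z), string_tape z)
     else (int (s (i - 1)), reg_tape x (i - 1)))"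

lemma string_tape_snoc: "(string_tape z)(int (length z) := if b then 2 else 1) = string_tape (z @ [b])"
  by (auto simp: string_tape_def fun_eq_iff nth_append)

lemma reg_tape_take:
  "j < length x \<Longrightarrow> (reg_tape (take j x) 0)(int j + 1 := if x ! j then 2 else 1) = reg_tape (take (Suc j) x) 0"
proof -
  have *: "nat (int j + 1) = Suc j" by simp
  show "j < length x \<Longrightarrow> ?thesis"
    by (auto simp: * reg_tape_def reg_symbol_def fun_eq_iff min_def nat_eq_iff nth_take split: if_splits)
qed

text \<open>Machine states are positions in \<open>ys\<close>; the model starts in state 0 and halts
  in state 1, which fixes the first two entries.\<close>

locale compilation =
  fixes p :: "cmd list" and R :: nat and ys :: "ctl list"
  assumes R: "R > 0" "\<Union>(cmd_regs ` set p) \<subseteq> {..<R}"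
    and ys: "distinct ys" "set ys = {Init, Copy, Back} \<union> Run ` conts p"
      "ys ! 0 = Init" "ys ! 1 = Run []" "length ys \<ge> 2"
begin

definition idx :: "ctl \<Rightarrow> nat" where
  "idx c = (SOME n. n < length ys \<and> ys ! n = c)"

definition M :: turing_machine where
  "M = \<lparr>tm_tapes = Suc R, tm_states = length ys, tm_symbols = 4,
     tm_delta = (\<lambda>q ss. case ctl_step p (ys ! q) ss of (c, act) \<Rightarrow> (idx c, map act [0..<length ss]))\<rparr>"

lemma idx: "c \<in> set ys \<Longrightarrow> idx c < length ys \<and> ys ! idx c = c"
  unfolding idx_def in_set_conv_nth by (rule someI_ex) blast

lemma idx_nth: "n < length ys \<Longrightarrow> idx (ys ! n) = n"
  using idx[of "ys ! n"] ys(1) nth_eq_iff_index_eq by fastforce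

lemma idx_Init: "idx Init = 0" and idx_halt: "idx (Run []) = 1"
proof -
  have "0 < length ys" "1 < length ys" using ys(5) by linarith+
  then show "idx Init = 0" "idx (Run []) = 1"
    using idx_nth[of 0] idx_nth[of 1] ys(3,4) by simp_all
qed

lemma idx_eq_halt: "c \<in> set ys \<Longrightarrow> idx c = 1 \<longleftrightarrow> c = Run []"
  using idx idx_halt ys by metis

lemma ctl_step_in: "c \<in> set ys \<Longrightarrow> fst (ctl_step p c ss) \<in> set ys"
proof (cases c)
  case (Run k)
  assume "c \<in> set ys"
  with Run have "k \<in> conts p" using ys(2) by auto
  moreover obtain b where "fst (ctl_step p c ss) = Run (successor b k)"
    using ctl_step_Run Run by blast
  ultimately show ?thesis using successor_conts ys(2) by auto
qed (use ys(2) self_in_conts[of p] in auto)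

lemma ctl_step_act:
  assumes "length ss = Suc R" "set ss \<subseteq> {..<4}" "i < Suc R"
  shows "snd (ctl_step p c ss) i \<in> {..<4} \<times> {-1, 0, 1}"
proof -
  have "ss ! i \<in> set ss" "ss ! 0 \<in> set ss" using assms(1,3) by auto
  then have "ss ! i < 4" "ss ! 0 < 4" using assms(2) by auto
  then show ?thesis by (cases "(p, c, ss)" rule: ctl_step.cases) auto
qed

lemma wf_M: "wf_tm M"
proof -
  have "case tm_delta M q ss of (q', acts) \<Rightarrow>
           q' < tm_states M \<and> length acts = tm_tapes M \<and>
           set acts \<subseteq> {..<tm_symbols M} \<times> {-1, 0, 1}"
    if "q < length ys" "length ss = Suc R" "set ss \<subseteq> {..<4}" for q ss
  proof -
    obtain c act where 1: "ctl_step p (ys ! q) ss = (c, act)" by (rule that[OF prod.collapse[symmetric]])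
    have "c \<in> set ys" using ctl_step_in[of "ys ! q" ss] \<open>q < length ys\<close> 1 by simp
    moreover have "act i \<in> {..<4} \<times> {-1, 0, 1}" if "i < Suc R" for i
      using ctl_step_act[OF \<open>length ss = Suc R\<close> \<open>set ss \<subseteq> {..<4}\<close> that, of "ys ! q"] 1 by simp
    ultimately show ?thesis using \<open>length ss = Suc R\<close> idx 1
      by (auto simp: M_def image_subset_iff simp del: upt_Suc)
  qed
  then show ?thesis using ys(5) by (auto simp: wf_tm_def M_def)
qed

definition next_tape :: "nat \<times> int \<Rightarrow> int \<times> (int \<Rightarrow> nat) \<Rightarrow> int \<times> (int \<Rightarrow> nat)" where
  "next_tape = (\<lambda>(a, d) (h, t). (h + d, t(h := a)))"

text \<open>With the tapes given as a function of their index, a step can be verified tape by tape,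
  and the list operations of \<open>tm_step\<close> disappear.\<close>

lemma tm_step_M:
  assumes "c \<in> set ys" "c \<noteq> Run []"
    and "ctl_step p c (map (\<lambda>i. snd (tp i) (fst (tp i))) [0..<Suc R]) = (c', act)"
    and "\<And>i. i < Suc R \<Longrightarrow> next_tape (act i) (tp i) = tp' i"
  shows "tm_step M (idx c, map tp [0..<Suc R]) = (idx c', map tp' [0..<Suc R])"
proof -
  let ?ss = "map (\<lambda>i. snd (tp i) (fst (tp i))) [0..<Suc R]"
  define ts where "ts = map tp [0..<Suc R]"
  have 1: "map (\<lambda>(h, t). t h) ts = ?ss"
    unfolding ts_def map_map by (intro map_cong refl) (simp add: case_prod_beta)
  have 2: "map2 (\<lambda>(s, d) (h, t). (h + d, t(h := s))) (map act [0..<Suc R]) ts = map tp' [0..<Suc R]"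
    unfolding ts_def using assms(4)
    by (intro nth_equalityI) (auto simp: next_tape_def case_prod_beta simp del: upt_Suc)
  have "tm_delta M (idx c) ?ss = (idx c', map act [0..<Suc R])"
    using assms(3) idx[OF assms(1)] by (simp add: M_def del: upt_Suc)
  then show ?thesis unfolding ts_def[symmetric]
    using idx_eq_halt[OF assms(1)] assms(2) 1 2 by (simp add: tm_step_def del: upt_Suc)
qed

lemma nth_scan: "i < Suc R \<Longrightarrow> map (\<lambda>i. snd (tp i) (fst (tp i))) [0..<Suc R] ! i = snd (tp i) (fst (tp i))"
  by (simp del: upt_Suc)

text \<open>Steps correspond one to one, also after termination: the empty program is stationary
  like the halting state. Hence running times carry over unchanged.\<close>

lemma tm_step_prog:
  assumes "c \<in> conts p"
  shows "tm_step M (idx (Run c), map (prog_tape x \<sigma>) [0..<Suc R]) =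
    (case pstep x (c, \<sigma>) of (c', \<sigma>') \<Rightarrow> (idx (Run c'), map (prog_tape x \<sigma>') [0..<Suc R]))"
proof (cases "c = []")
  case True
  then show ?thesis by (cases \<sigma>) (simp add: idx_halt tm_step_def)
next
  case False
  obtain s z where \<sigma>: "\<sigma> = (s, z)" by (cases \<sigma>)
  have in_ys: "Run c \<in> set ys" "Run c \<noteq> Run []" using assms False ys(2) by auto
  let ?ss = "map (\<lambda>i. snd (prog_tape x \<sigma> i) (fst (prog_tape x \<sigma> i))) [0..<Suc R]"
  have scan: "?ss ! Suc r = reg_symbol x r (s r)" if "r < R" for r
    using that by (subst nth_scan) (auto simp: \<sigma> prog_tape_def reg_tape_def)
  have id: "next_tape (?ss ! i, 0) (prog_tape x \<sigma> i) = prog_tape x \<sigma> i" if "i < Suc R" for i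
    using that by (subst nth_scan) (auto simp: next_tape_def case_prod_beta)
  have mv: "next_tape (?ss ! i, d) (prog_tape x \<sigma> i) = (fst (prog_tape x \<sigma> i) + d, snd (prog_tape x \<sigma> i))"
    if "i < Suc R" for i d
    using that by (subst nth_scan) (auto simp: next_tape_def case_prod_beta)
  have regs: "\<Union>(cmd_regs ` set c) \<subseteq> {..<R}" using conts_regs[OF assms] R(2) by blast
  obtain a k where c: "c = a # k" using False by (cases c) auto
  show ?thesis
  proof (cases a)
    case (Inc r)
    then have r: "r < R" using regs c by auto
    have "tm_step M (idx (Run c), map (prog_tape x \<sigma>) [0..<Suc R]) =
        (idx (Run k), map (prog_tape x (s(r := Suc (s r)), z)) [0..<Suc R])"
      unfolding c Inc
      by (rule tm_step_M[OF _ _ ctl_step.simps(5)])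
        (use in_ys mv in \<open>auto simp: c Inc prog_tape_def \<sigma> simp del: upt_Suc\<close>)
    then show ?thesis by (simp add: c Inc \<sigma>)
  next
    case (Dec r)
    then have r: "r < R" using regs c by auto
    have "tm_step M (idx (Run c), map (prog_tape x \<sigma>) [0..<Suc R]) =
        (idx (Run k), map (prog_tape x (s(r := s r - 1), z)) [0..<Suc R])"
      unfolding c Dec
      by (rule tm_step_M[OF _ _ ctl_step.simps(6)])
        (use in_ys mv scan[OF r] in \<open>auto simp: c Dec prog_tape_def \<sigma> simp del: upt_Suc\<close>)
    then show ?thesis by (simp add: c Dec \<sigma>)
  next
    case (Out b)
    have "tm_step M (idx (Run c), map (prog_tape x \<sigma>) [0..<Suc R]) =
        (idx (Run k), map (prog_tape x (s, z @ [b])) [0..<Suc R])"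
      unfolding c Out
      by (rule tm_step_M[OF _ _ ctl_step.simps(7)])
        (use in_ys mv string_tape_snoc[of z b] in
          \<open>auto simp: c Out prog_tape_def next_tape_def \<sigma> simp del: upt_Suc\<close>)
    then show ?thesis by (simp add: c Out \<sigma>)
  next
    case (While r b d)
    then have r: "r < R" using regs c by auto
    have "tm_step M (idx (Run c), map (prog_tape x \<sigma>) [0..<Suc R]) =
        (idx (Run (if ?ss ! Suc r = b then k else d @ While r b d # k)), map (prog_tape x \<sigma>) [0..<Suc R])"
      unfolding c While
      by (rule tm_step_M[OF _ _ ctl_step.simps(8)]) (use in_ys id in \<open>auto simp: c While simp del: upt_Suc\<close>)
    then show ?thesis using scan[OF r] by (simp add: c While \<sigma> del: upt_Suc)
  next
    case (If r b d e)
    then have r: "r < R" using regs c by auto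
    have "tm_step M (idx (Run c), map (prog_tape x \<sigma>) [0..<Suc R]) =
        (idx (Run ((if ?ss ! Suc r = b then d else e) @ k)), map (prog_tape x \<sigma>) [0..<Suc R])"
      unfolding c If
      by (rule tm_step_M[OF _ _ ctl_step.simps(9)]) (use in_ys id in \<open>auto simp: c If simp del: upt_Suc\<close>)
    then show ?thesis using scan[OF r] by (simp add: c If \<sigma> del: upt_Suc)
  qed
qed

lemma pstep_fst: "\<exists>b. fst (pstep x (c, \<sigma>)) = successor b c"
proof -
  obtain s z where \<sigma>: "\<sigma> = (s, z)" by (cases \<sigma>)
  have "\<exists>b. (if t then k else c @ k') = (if b then k else c @ k')"
    "\<exists>b. ((if t then c else d) @ k) = ((if b then c else d) @ k)" for t and k k' c d :: "cmd list"
    by blast+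
  then show ?thesis unfolding \<sigma> by (cases "(x, (c, s, z))" rule: pstep.cases) auto
qed

lemma tm_steps_prog:
  assumes "c \<in> conts p"
  shows "(tm_step M ^^ t) (idx (Run c), map (prog_tape x \<sigma>) [0..<Suc R]) =
    (case (pstep x ^^ t) (c, \<sigma>) of (c', \<sigma>') \<Rightarrow> (idx (Run c'), map (prog_tape x \<sigma>') [0..<Suc R]))"
  using assms
proof (induction t arbitrary: c \<sigma>)
  case (Suc t)
  obtain c' \<sigma>' where 1: "pstep x (c, \<sigma>) = (c', \<sigma>')" by (rule that[OF prod.collapse[symmetric]])
  have "c' \<in> conts p" using pstep_fst[of x c \<sigma>] successor_conts[OF Suc.prems] 1 by auto
  from Suc.IH[OF this, of \<sigma>'] show ?case
    using tm_step_prog[OF Suc.prems, of x \<sigma>] 1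
    by (simp add: funpow_Suc_right del: funpow.simps upt_Suc)
qed (simp del: upt_Suc)

definition copy_tape :: "bool list \<Rightarrow> nat \<Rightarrow> nat \<Rightarrow> int \<times> (int \<Rightarrow> nat)" where
  "copy_tape x j i = (if i = 0 then (int j, \<lambda>l. if l < int j then 0 else string_tape x l)
     else if i = 1 then (int j + 1, reg_tape (take j x) 0) else (0, reg_tape x (i - 1)))"

definition back_tape :: "bool list \<Rightarrow> nat \<Rightarrow> nat \<Rightarrow> int \<times> (int \<Rightarrow> nat)" where
  "back_tape x j i = (if i = 0 then (int j - 1, string_tape [])
     else if i = 1 then (int j, reg_tape x 0) else (0, reg_tape x (i - 1)))"

lemma tm_init_M: "tm_init M x = (idx Init, map (\<lambda>i. (0, if i = 0 then string_tape x else (\<lambda>_. 0))) [0..<Suc R])"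
  by (auto simp: tm_init_def M_def idx_Init intro!: nth_equalityI simp: nth_Cons split: nat.splits simp del: upt_Suc)

lemma tm_step_Init: "tm_step M (tm_init M x) = (idx Copy, map (copy_tape x 0) [0..<Suc R])"
  unfolding tm_init_M
  by (rule tm_step_M[OF _ _ ctl_step.simps(1)])
    (use ys(2) in \<open>auto simp: next_tape_def copy_tape_def reg_tape_def reg_symbol_def fun_eq_iff
      string_tape_def nth_append simp del: upt_Suc\<close>)

lemma tm_step_Copy:
  assumes "j < length x"
  shows "tm_step M (idx Copy, map (copy_tape x j) [0..<Suc R]) = (idx Copy, map (copy_tape x (Suc j)) [0..<Suc R])"
proof -
  let ?ss = "map (\<lambda>i. snd (copy_tape x j i) (fst (copy_tape x j i))) [0..<Suc R]"
  have 0: "?ss ! 0 = (if x ! j then 2 else 1)"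
    using assms by (subst nth_scan) (auto simp: copy_tape_def string_tape_def)
  have "ctl_step p Copy ?ss =
    (Copy, \<lambda>i. if i = 0 then (0, 1) else if i = 1 then (?ss ! 0, 1) else (?ss ! i, 0))"
    using 0 by (simp del: upt_Suc)
  then show ?thesis
  proof (rule tm_step_M[rotated 2])
    fix i assume i: "i < Suc R"
    consider "i = 0" | "i = 1" | "i > 1" by linarith
    then show "next_tape (if i = 0 then (0, 1) else if i = 1 then (?ss ! 0, 1) else (?ss ! i, 0)) (copy_tape x j i) =
         copy_tape x (Suc j) i"
    proof cases
      case 1
      then show ?thesis by (auto simp: next_tape_def copy_tape_def fun_eq_iff)
    next
      case 2
      then show ?thesis using 0 reg_tape_take[OF assms] by (simp add: next_tape_def copy_tape_def del: upt_Suc)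
    next
      case 3
      then show ?thesis using i by (simp add: nth_scan next_tape_def copy_tape_def del: upt_Suc)
    qed
  qed (use ys(2) in auto)
qed

lemma tm_step_Copy_end:
  "tm_step M (idx Copy, map (copy_tape x (length x)) [0..<Suc R]) = (idx Back, map (back_tape x (length x)) [0..<Suc R])"
proof -
  let ?ss = "map (\<lambda>i. snd (copy_tape x (length x) i) (fst (copy_tape x (length x) i))) [0..<Suc R]"
  have 0: "?ss ! 0 = 0"
    by (subst nth_scan) (auto simp: copy_tape_def string_tape_def)
  have "ctl_step p Copy ?ss = (Back, \<lambda>i. (?ss ! i, if i < 2 then -1 else 0))"
    using 0 by (simp del: upt_Suc)
  then show ?thesis
    by (rule tm_step_M[rotated 2])
      (use ys(2) in \<open>auto simp: nth_scan next_tape_def copy_tape_def back_tape_def fun_eq_iff string_tape_def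
        simp del: upt_Suc\<close>)
qed

lemma tm_step_Back:
  "tm_step M (idx Back, map (back_tape x (Suc j)) [0..<Suc R]) = (idx Back, map (back_tape x j) [0..<Suc R])"
proof -
  let ?ss = "map (\<lambda>i. snd (back_tape x (Suc j) i) (fst (back_tape x (Suc j) i))) [0..<Suc R]"
  have 1: "?ss ! 1 \<noteq> 3"
    using R(1) by (subst nth_scan) (auto simp: back_tape_def reg_tape_def reg_symbol_def)
  have "ctl_step p Back ?ss = (Back, \<lambda>i. (?ss ! i, if i < 2 then -1 else 0))"
    using 1 by (simp del: upt_Suc)
  then show ?thesis
    by (rule tm_step_M[rotated 2])
      (use ys(2) in \<open>auto simp: nth_scan next_tape_def back_tape_def simp del: upt_Suc\<close>)
qed

lemma tm_step_Back_end:
  "tm_step M (idx Back, map (back_tape x 0) [0..<Suc R]) = (idx (Run p), map (prog_tape x (\<lambda>_. 0, [])) [0..<Suc R])"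
proof -
  let ?ss = "map (\<lambda>i. snd (back_tape x 0 i) (fst (back_tape x 0 i))) [0..<Suc R]"
  have 1: "?ss ! 1 = 3"
    using R(1) by (subst nth_scan) (auto simp: back_tape_def reg_tape_def reg_symbol_def)
  have "ctl_step p Back ?ss = (Run p, \<lambda>i. (?ss ! i, if i = 0 then 1 else 0))"
    using 1 by (simp del: upt_Suc)
  then show ?thesis
    by (rule tm_step_M[rotated 2])
      (use ys(2) in \<open>auto simp: nth_scan next_tape_def back_tape_def prog_tape_def simp del: upt_Suc\<close>)
qed

lemma tm_steps_Copy:
  "j \<le> length x \<Longrightarrow> (tm_step M ^^ j) (idx Copy, map (copy_tape x 0) [0..<Suc R]) =
     (idx Copy, map (copy_tape x j) [0..<Suc R])"
  by (induction j) (simp_all add: tm_step_Copy del: upt_Suc)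

lemma tm_steps_Back:
  "(tm_step M ^^ j) (idx Back, map (back_tape x j) [0..<Suc R]) =
     (idx Back, map (back_tape x 0) [0..<Suc R])"
proof (induction j)
  case (Suc j)
  then show ?case by (simp add: funpow_Suc_right tm_step_Back del: funpow.simps upt_Suc)
qed simp

lemma tm_steps_start:
  "(tm_step M ^^ (2 * length x + 3)) (tm_init M x) = (idx (Run p), map (prog_tape x (\<lambda>_. 0, [])) [0..<Suc R])"
proof -
  \<comment> \<open>From right to left: mark position 0, copy, turn round, rewind, start the
    program.\<close>
  have 1: "2 * length x + 3 = 1 + (length x + (1 + (length x + 1)))" by simp
  have 2: "(f ^^ 1) = f" for f :: "tm_config \<Rightarrow> tm_config" by simp
  show ?thesis unfolding 1 funpow_add o_apply 2
    by (simp only: tm_step_Init tm_steps_Copy le_refl tm_step_Copy_end tm_steps_Back tm_step_Back_end)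
qed

lemma computes:
  assumes "\<And>x. \<exists>s. exec x p (\<lambda>_. 0, []) (T (length x)) (s, f x)"
  shows "tm_computes_within M f (\<lambda>n. 2 * n + 3 + T n)"
  unfolding tm_computes_within_def
proof
  fix x
  obtain s t where t: "t \<le> T (length x)" "\<And>k. (pstep x ^^ t) (p @ k, \<lambda>_. 0, []) = (k, s, f x)"
    using assms[of x] unfolding exec_def by blast
  have "(tm_step M ^^ (t + (2 * length x + 3))) (tm_init M x) = (1, map (prog_tape x (s, f x)) [0..<Suc R])"
    using t(2)[of "[]"]
    by (simp only: funpow_add[of t "2 * length x + 3"] o_apply tm_steps_start tm_steps_prog[OF self_in_conts]
      append_Nil2 prod.case idx_halt)
  moreover have "snd (hd (map (prog_tape x (s, f x)) [0..<Suc R])) = string_tape (f x)"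
    by (simp add: hd_conv_nth prog_tape_def del: upt_Suc)
  ultimately show "\<exists>t\<le>2 * length x + 3 + T (length x). \<exists>ts. (tm_step M ^^ t) (tm_init M x) = (1, ts) \<and>
      snd (hd ts) = string_tape (f x)"
    using t(1) by (intro exI[of _ "t + (2 * length x + 3)"]) auto
qed

end

lemma poly_time_computable_program:
  fixes q :: "nat poly"
  assumes "\<And>x. \<exists>s. exec x p (\<lambda>_. 0, []) (poly q (length x)) (s, f x)"
  shows "poly_time_computable f"
proof -
  define A where "A = ({Copy, Back} \<union> Run ` conts p) - {Run []}"
  have "finite A" by (simp add: A_def finite_conts)
  then obtain xs where xs: "set xs = A" "distinct xs" using finite_distinct_list by blast
  let ?ys = "Init # Run [] # xs"
  obtain R where R: "\<Union>(cmd_regs ` set p) \<subseteq> {..<R}"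
    using finite_nat_iff_bounded[of "\<Union>(cmd_regs ` set p)"] by (auto simp: finite_cmd_regs)
  interpret compilation p "Suc R" ?ys
    using R xs Nil_in_conts[of p] by unfold_locales (auto simp: A_def)
  have "poly ([:3, 2:] + q) = (\<lambda>n. 2 * n + 3 + poly q n)" by (auto simp: fun_eq_iff)
  then have "tm_computes_within M f (poly ([:3, 2:] + q))"
    using computes[OF assms] by simp
  then show ?thesis unfolding poly_time_computable_def using wf_M by blast
qed

section \<open>Functions computable by counter programs in polynomial time\<close>

text \<open>
  A function takes the input string and an environment of \<open>n\<close> numbers, which counter programs hold
  in unary; environments are extended by \<open>0\<close> and indexed as de Bruijn indices.
\<close>

definition env_size :: "nat \<Rightarrow> bool list \<Rightarrow> (nat \<Rightarrow> nat) \<Rightarrow> nat" where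
  "env_size n x E = 2 + length x + (\<Sum>i<n. E i)"

definition is_env :: "nat \<Rightarrow> (nat \<Rightarrow> nat) \<Rightarrow> bool" where
  "is_env n E \<longleftrightarrow> (\<forall>i\<ge>n. E i = 0)"

definition poly_bounded :: "nat \<Rightarrow> (bool list \<Rightarrow> (nat \<Rightarrow> nat) \<Rightarrow> nat) \<Rightarrow> bool" where
  "poly_bounded n g \<longleftrightarrow> (\<exists>k. \<forall>x E. is_env n E \<longrightarrow> g x E \<le> env_size n x E ^ k)"

definition env_of :: "(nat \<Rightarrow> nat) \<Rightarrow> nat list \<Rightarrow> nat \<Rightarrow> nat" where
  "env_of s rs i = (if i < length rs then s (rs ! i) else 0)"

text \<open>The contract between program pieces: register 0 rests at 0, all registers from
  \<open>m\<close> on are empty, and on return only \<open>m\<close> has changed. Pieces are nested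
  by raising \<open>m\<close>.\<close>

definition computes ::
  "cmd list \<Rightarrow> (bool list \<Rightarrow> (nat \<Rightarrow> nat) \<Rightarrow> nat) \<Rightarrow> nat list \<Rightarrow> nat \<Rightarrow>
    (bool list \<Rightarrow> (nat \<Rightarrow> nat) \<Rightarrow> nat) \<Rightarrow> bool" where
  "computes c T rs m f \<longleftrightarrow> (\<forall>x s z. s 0 = 0 \<longrightarrow> (\<forall>r\<ge>m. s r = 0) \<longrightarrow>
     exec x c (s, z) (T x (env_of s rs)) (s(m := f x (env_of s rs)), z))"

definition comp :: "nat \<Rightarrow> (bool list \<Rightarrow> (nat \<Rightarrow> nat) \<Rightarrow> nat) \<Rightarrow> bool" where
  "comp n f \<longleftrightarrow> (\<forall>rs m. length rs = n \<longrightarrow> set rs \<subseteq> {0<..<m} \<longrightarrow> 0 < m \<longrightarrow>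
     (\<exists>c T. poly_bounded n T \<and> computes c T rs m f))"

lemma computesD:
  "computes c T rs m f \<Longrightarrow> s 0 = 0 \<Longrightarrow> (\<And>r. r \<ge> m \<Longrightarrow> s r = 0) \<Longrightarrow>
   exec x c (s, z) (T x (env_of s rs)) (s(m := f x (env_of s rs)), z)"
  unfolding computes_def by blast

lemma compE:
  assumes "comp n f" "length rs = n" "set rs \<subseteq> {0<..<m}" "0 < m"
  obtains c T where "poly_bounded n T" "computes c T rs m f"
  using assms unfolding comp_def by blast

lemma compI:
  assumes "\<And>rs m. length rs = n \<Longrightarrow> set rs \<subseteq> {0<..<m} \<Longrightarrow> 0 < m \<Longrightarrow>
     \<exists>c T. poly_bounded n T \<and> (\<forall>x s z. s 0 = 0 \<longrightarrow> (\<forall>r\<ge>m. s r = 0) \<longrightarrow>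
        exec x c (s, z) (T x (env_of s rs)) (s(m := f x (env_of s rs)), z))"
  shows "comp n f"
  using assms unfolding comp_def computes_def by blast

lemma is_env_env_of [simp]: "length rs = n \<Longrightarrow> is_env n (env_of s rs)"
  by (auto simp: is_env_def env_of_def)

lemma is_env_push [simp]: "is_env n E \<Longrightarrow> is_env (Suc n) (case_nat a E)"
  by (auto simp: is_env_def split: nat.splits)

lemma env_of_Cons [simp]: "env_of s (r # rs) = case_nat (s r) (env_of s rs)"
  by (auto simp: env_of_def fun_eq_iff split: nat.splits)

lemma env_of_cong: "(\<And>r. r \<in> set rs \<Longrightarrow> s r = s' r) \<Longrightarrow> env_of s rs = env_of s' rs"
  by (auto simp: env_of_def fun_eq_iff)

lemma env_size_push [simp]: "env_size (Suc n) x (case_nat a E) = a + env_size n x E"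
  by (simp add: env_size_def sum.lessThan_Suc_shift del: sum.lessThan_Suc)

subsection \<open>Polynomial bounds\<close>

lemma env_size_ge_2: "env_size n x E \<ge> 2" by (simp add: env_size_def)

lemma power_add_bound:
  assumes "(b :: nat) \<ge> 2" shows "b ^ k + b ^ l \<le> b ^ (Suc (k + l))"
proof -
  have "b ^ k \<le> b ^ (k + l)" "b ^ l \<le> b ^ (k + l)" using assms by (auto intro: power_increasing)
  then have "b ^ k + b ^ l \<le> 2 * b ^ (k + l)" by simp
  also have "\<dots> \<le> b * b ^ (k + l)" using assms by simp
  finally show ?thesis by simp
qed

lemma poly_boundedI: "(\<And>x E. is_env n E \<Longrightarrow> g x E \<le> env_size n x E ^ k) \<Longrightarrow> poly_bounded n g"
  unfolding poly_bounded_def by blast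

lemma pb_mono:
  "poly_bounded n g \<Longrightarrow> (\<And>x E. is_env n E \<Longrightarrow> h x E \<le> g x E) \<Longrightarrow> poly_bounded n h"
  unfolding poly_bounded_def using le_trans by meson

lemma pb_const: "poly_bounded n (\<lambda>x E. c)"
proof (rule poly_boundedI[of _ _ c])
  fix x :: "bool list" and E :: "nat \<Rightarrow> nat"
  have "c \<le> 2 ^ c" by (rule less_imp_le[OF less_exp])
  also have "\<dots> \<le> env_size n x E ^ c" by (intro power_mono env_size_ge_2) simp
  finally show "c \<le> env_size n x E ^ c" .
qed

lemma pb_env_size: "poly_bounded n (env_size n)"
  by (rule poly_boundedI[of _ _ 1]) simp

lemma pb_add:
  assumes "poly_bounded n g" "poly_bounded n h" shows "poly_bounded n (\<lambda>x E. g x E + h x E)"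
proof -
  obtain k l where "\<And>x E. is_env n E \<Longrightarrow> g x E \<le> env_size n x E ^ k"
    "\<And>x E. is_env n E \<Longrightarrow> h x E \<le> env_size n x E ^ l"
    using assms unfolding poly_bounded_def by blast
  then show ?thesis
    by (intro poly_boundedI[of _ _ "Suc (k + l)"] order_trans[OF add_mono power_add_bound[OF env_size_ge_2]])
qed

lemma pb_mult:
  assumes "poly_bounded n g" "poly_bounded n h" shows "poly_bounded n (\<lambda>x E. g x E * h x E)"
proof -
  obtain k l where "\<And>x E. is_env n E \<Longrightarrow> g x E \<le> env_size n x E ^ k"
    "\<And>x E. is_env n E \<Longrightarrow> h x E \<le> env_size n x E ^ l"
    using assms unfolding poly_bounded_def by blast
  then show ?thesis
    by (intro poly_boundedI[of _ _ "k + l"]) (simp add: power_add mult_mono)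
qed

lemma pb_power: "poly_bounded n g \<Longrightarrow> poly_bounded n (\<lambda>x E. g x E ^ k)"
  by (induction k) (auto intro: pb_mult pb_const)

lemma pb_Suc: "poly_bounded n g \<Longrightarrow> poly_bounded n (\<lambda>x E. Suc (g x E))"
  using pb_add[OF _ pb_const[of n 1], of g] by simp

lemma pb_nth: "poly_bounded n (\<lambda>x E. E i)"
proof (rule pb_mono[OF pb_env_size])
  fix x :: "bool list" and E :: "nat \<Rightarrow> nat"
  assume "is_env n E"
  moreover have "E i \<le> (\<Sum>j<n. E j)" if "i < n" using that by (intro member_le_sum) auto
  ultimately show "E i \<le> env_size n x E" by (cases "i < n") (auto simp: env_size_def is_env_def)
qed

lemma pb_length: "poly_bounded n (\<lambda>x E. length x)"
  by (rule pb_mono[OF pb_env_size]) (simp add: env_size_def)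

lemmas pb_intros = pb_const pb_add pb_mult pb_power pb_Suc pb_nth pb_length pb_env_size

lemma pb_push:
  assumes "poly_bounded (Suc n) g"
  shows "\<exists>k. \<forall>x E a. is_env n E \<longrightarrow> g x (case_nat a E) \<le> (a + env_size n x E) ^ k"
  using assms unfolding poly_bounded_def by (metis env_size_push is_env_push)

lemma pstep_growth: "pstep x (c, s, z) = (c', s', z') \<Longrightarrow> s' r \<le> Suc (s r)"
  by (cases "(x, (c, s, z))" rule: pstep.cases) auto

lemma psteps_growth: "(pstep x ^^ t) (c, s, z) = (c', s', z') \<Longrightarrow> s' r \<le> s r + t"
proof (induction t arbitrary: c' s' z')
  case (Suc t)
  obtain d u w where 1: "(pstep x ^^ t) (c, s, z) = (d, u, w)" using prod_cases3 by blast
  with Suc(2) have "pstep x (d, u, w) = (c', s', z')" by simp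
  from pstep_growth[OF this, of r] Suc(1)[OF 1] show ?case by simp
qed simp

lemma exec_growth: "exec x c (s, z) T (s', z') \<Longrightarrow> s' r \<le> s r + T"
  unfolding exec_def using psteps_growth[of _ x "c @ []" s z "[]" s' z' r] by (metis add_left_mono le_trans)

text \<open>Values are held in unary and a step increases a register by at most one, so a time bound
  is also a bound on the result. This is what makes the bounds compose.\<close>

lemma comp_bounded:
  assumes "comp n f" shows "poly_bounded n f"
proof -
  let ?rs = "[1..<Suc n]"
  obtain c T where T: "poly_bounded n T"
    and c0: "computes c T ?rs (Suc n) f"
    by (rule compE[OF assms, of ?rs "Suc n"]) auto
  note c = computesD[OF c0]
  show ?thesis
  proof (rule pb_mono[OF T])
    fix x E assume E: "is_env n E"
    define s where "s = case_nat 0 E"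
    have "env_of s ?rs = E"
      using E by (auto simp: env_of_def s_def is_env_def fun_eq_iff simp del: upt_Suc)
    moreover have "s r = 0" if "r \<ge> Suc n" for r using E that by (cases r) (auto simp: s_def is_env_def)
    moreover have "s 0 = 0" by (simp add: s_def)
    ultimately have "exec x c (s, []) (T x E) (s(Suc n := f x E), [])" and "s (Suc n) = 0"
      using c[of s x "[]"] by auto
    from exec_growth[OF this(1), of "Suc n"] this(2) show "f x E \<le> T x E" by simp
  qed
qed

subsection \<open>Basic functions\<close>

lemma exec_replicate_Inc: "exec x (replicate a (Inc r)) (s, z) a (s(r := s r + a), z)"
proof (induction a arbitrary: s)
  case (Suc a)
  have "s(r := Suc (s r), r := (s(r := Suc (s r))) r + a) = s(r := s r + Suc a)" by (simp add: fun_eq_iff)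
  from exec_Cons[OF exec_Inc[of x r s z] Suc[of "s(r := Suc (s r))"], unfolded this] show ?case
    by (simp del: fun_upd_apply)
qed (simp add: exec_Nil)

lemma comp_const: "comp n (\<lambda>x E. a)"
proof (rule compI, intro exI conjI allI impI)
  fix m :: nat and x s z
  assume "\<forall>r\<ge>m. s r = (0 :: nat)"
  then show "exec x (replicate a (Inc m)) (s, z) a (s(m := a), z)"
    using exec_replicate_Inc[of x a m s z] by simp
qed (rule pb_const)

text \<open>A register can only be read by counting it down; so the argument is moved to
  \<open>m\<close> and \<open>Suc m\<close> at once and restored from the latter.\<close>

lemma comp_nth:
  assumes "i < n" shows "comp n (\<lambda>x E. E i)"
proof (rule compI, intro exI conjI allI impI)
  fix rs :: "nat list" and m :: nat and x z and s :: "nat \<Rightarrow> nat"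
  assume rs: "length rs = n" "set rs \<subseteq> {0<..<m}" and s: "\<forall>r\<ge>m. s r = (0 :: nat)"
  let ?a = "rs ! i"
  have a: "?a < m" "?a \<noteq> m" "?a \<noteq> Suc m" using rs assms by (auto dest!: subsetD[OF _ nth_mem[of i rs]])
  from exec_move2[OF a(2,3), of x s z]
  have 1: "exec x [While ?a 3 [Dec ?a, Inc m, Inc (Suc m)]] (s, z) (4 * s ?a + 1)
     (s(?a := 0, m := s ?a, Suc m := s ?a), z)" using s by simp
  have 2: "exec x [While (Suc m) 3 [Dec (Suc m), Inc ?a]] (s(?a := 0, m := s ?a, Suc m := s ?a), z)
     (3 * s ?a + 1) (s(m := s ?a), z)"
    using exec_move[of "Suc m" ?a x "s(?a := 0, m := s ?a, Suc m := s ?a)" z] a s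
    by (auto simp: fun_upd_twist fun_upd_idem)
  show "exec x [While ?a 3 [Dec ?a, Inc m, Inc (Suc m)], While (Suc m) 3 [Dec (Suc m), Inc ?a]] (s, z)
     (7 * env_of s rs i + 2) (s(m := env_of s rs i), z)"
    using exec_Cons[OF 1 2] rs assms by (simp add: env_of_def)
qed (intro pb_intros)

lemma comp_Suc:
  assumes "comp n f" shows "comp n (\<lambda>x E. Suc (f x E))"
proof (rule compI)
  fix rs :: "nat list" and m :: nat assume rs: "length rs = n" "set rs \<subseteq> {0<..<m}" "0 < m"
  obtain c T where T: "poly_bounded n T"
    and c0: "computes c T rs m f"
    by (rule compE[OF assms rs])
  note c = computesD[OF c0]
  have "exec x (c @ [Inc m]) (s, z) (Suc (T x (env_of s rs))) (s(m := Suc (f x (env_of s rs))), z)"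
    if "s 0 = 0" "\<forall>r\<ge>m. s r = 0" for x s z
  proof -
    have "exec x c (s, z) (T x (env_of s rs)) (s(m := f x (env_of s rs)), z)" using c that by auto
    from exec_append[OF this exec_Inc[of x m]] show ?thesis by simp
  qed
  then show "\<exists>c T. poly_bounded n T \<and> (\<forall>x s z. s 0 = 0 \<longrightarrow> (\<forall>r\<ge>m. s r = 0) \<longrightarrow>
        exec x c (s, z) (T x (env_of s rs)) (s(m := Suc (f x (env_of s rs))), z))"
    using pb_Suc[OF T] by blast
qed

lemma comp_if_0:
  assumes "comp n f" "comp n g" "comp n h"
  shows "comp n (\<lambda>x E. if f x E = 0 then g x E else h x E)"
proof (rule compI)
  fix rs :: "nat list" and m :: nat assume rs: "length rs = n" "set rs \<subseteq> {0<..<m}" "0 < m"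
  obtain c T where T: "poly_bounded n T"
    and c0: "computes c T rs m f"
    by (rule compE[OF assms(1) rs])
  note c = computesD[OF c0]
  obtain d U where U: "poly_bounded n U"
    and d0: "computes d U rs m g"
    by (rule compE[OF assms(2) rs])
  note d = computesD[OF d0]
  obtain e V where V: "poly_bounded n V"
    and e0: "computes e V rs m h"
    by (rule compE[OF assms(3) rs])
  note e = computesD[OF e0]
  let ?T = "\<lambda>x E. T x E + Suc (U x E + (2 * f x E + 1 + V x E))"
  \<comment> \<open>Both branches expect \<open>m\<close> to be empty. If the test value is 0 it is;
    otherwise it has to be cleared first.\<close>
  have "exec x (c @ [If m 3 d (While m 3 [Dec m] # e)]) (s, z) (?T x (env_of s rs))
     (s(m := if f x (env_of s rs) = 0 then g x (env_of s rs) else h x (env_of s rs)), z)"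
    if s: "s 0 = 0" "\<forall>r\<ge>m. s r = 0" for x s z
  proof (rule exec_append[OF _ exec_If])
    let ?E = "env_of s rs"
    let ?s = "s(m := f x ?E)"
    have s0: "?s(m := 0) = s" using s by (auto simp: fun_eq_iff)
    show "exec x (if reg_symbol x m (?s m) = 3 then d else While m 3 [Dec m] # e) (?s, z)
       (U x ?E + (2 * f x ?E + 1 + V x ?E)) (s(m := if f x ?E = 0 then g x ?E else h x ?E), z)"
    proof (cases "f x ?E = 0")
      case True
      then have "?s = s" using s0 by simp
      then show ?thesis using True d[of s x z] s by (auto intro: exec_mono)
    next
      case False
      have "exec x (While m 3 [Dec m] # e) (?s, z) (2 * f x ?E + 1 + V x ?E) (s(m := h x ?E), z)"
      proof (rule exec_Cons)
        show "exec x [While m 3 [Dec m]] (?s, z) (2 * f x ?E + 1) (s, z)"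
          using exec_clear[of x m ?s z] s0 by simp
        show "exec x e (s, z) (V x ?E) (s(m := h x ?E), z)" using e[of s x z] s by auto
      qed
      then show ?thesis using False by (auto intro: exec_mono)
    qed
  next
    show "exec x c (s, z) (T x (env_of s rs)) (s(m := f x (env_of s rs)), z)" using c s by auto
  qed
  moreover have "poly_bounded n ?T"
    using comp_bounded[OF assms(1)] T U V by (intro pb_intros)
  ultimately show "\<exists>c T. poly_bounded n T \<and> (\<forall>x s z. s 0 = 0 \<longrightarrow> (\<forall>r\<ge>m. s r = 0) \<longrightarrow>
     exec x c (s, z) (T x (env_of s rs))
       (s(m := if f x (env_of s rs) = 0 then g x (env_of s rs) else h x (env_of s rs)), z))"
    by blast
qed

text \<open>The bound value is kept in \<open>Suc m\<close>, leaving \<open>m\<close> for the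
  result, and becomes the argument with index 0 of \<open>g\<close>.\<close>

lemma comp_let:
  assumes "comp n f" "comp (Suc n) g"
  shows "comp n (\<lambda>x E. g x (case_nat (f x E) E))"
proof (rule compI)
  fix rs :: "nat list" and m :: nat assume rs: "length rs = n" "set rs \<subseteq> {0<..<m}" "0 < m"
  from rs have rs': "set rs \<subseteq> {0<..<Suc m}" by auto
  obtain c T where T: "poly_bounded n T"
    and c0: "computes c T rs (Suc m) f"
    by (rule compE[OF assms(1) rs(1) rs' zero_less_Suc])
  note c = computesD[OF c0]
  have "length (Suc m # rs) = Suc n" "set (Suc m # rs) \<subseteq> {0<..<Suc (Suc m)}" "0 < Suc (Suc m)"
    using rs by auto
  then obtain d U where U: "poly_bounded (Suc n) U"
    and d0: "computes d U (Suc m # rs) (Suc (Suc m)) g"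
    by (rule compE[OF assms(2)])
  note d = computesD[OF d0]
  obtain k where k: "\<And>x E a. is_env n E \<Longrightarrow> U x (case_nat a E) \<le> (a + env_size n x E) ^ k"
    using pb_push[OF U] by blast
  obtain l where l: "\<And>x E a. is_env n E \<Longrightarrow> g x (case_nat a E) \<le> (a + env_size n x E) ^ l"
    using pb_push[OF comp_bounded[OF assms(2)]] by blast
  let ?S = "\<lambda>x E. f x E + env_size n x E"
  let ?T = "\<lambda>x E. T x E + (?S x E ^ k + ((2 * f x E + 1) + (3 * ?S x E ^ l + 1)))"
  have "exec x (c @ d @ [While (Suc m) 3 [Dec (Suc m)], While (Suc (Suc m)) 3 [Dec (Suc (Suc m)), Inc m]]) (s, z)
     (?T x (env_of s rs)) (s(m := g x (case_nat (f x (env_of s rs)) (env_of s rs))), z)"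
    if s: "s 0 = 0" "\<forall>r\<ge>m. s r = 0" for x s z
  proof -
    let ?E = "env_of s rs"
    let ?v = "f x ?E"
    let ?w = "g x (case_nat ?v ?E)"
    have E: "is_env n ?E" using rs by simp
    have 1: "exec x c (s, z) (T x ?E) (s(Suc m := ?v), z)" using c[of s x z] s by auto
    have "env_of (s(Suc m := ?v)) rs = ?E" using rs by (intro env_of_cong) auto
    then have 2: "exec x d (s(Suc m := ?v), z) (?S x ?E ^ k) (s(Suc m := ?v, Suc (Suc m) := ?w), z)"
      using d[of "s(Suc m := ?v)" x z] s k[OF E, of x ?v] by (auto intro: exec_mono)
    have "s(Suc m := ?v, Suc (Suc m) := ?w, Suc m := 0) = s(Suc (Suc m) := ?w)"
      using s by (auto simp: fun_eq_iff)
    then have 3: "exec x [While (Suc m) 3 [Dec (Suc m)]] (s(Suc m := ?v, Suc (Suc m) := ?w), z) (2 * ?v + 1)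
        (s(Suc (Suc m) := ?w), z)"
      using exec_clear[of x "Suc m" "s(Suc m := ?v, Suc (Suc m) := ?w)" z] by simp
    have "s(Suc (Suc m) := ?w, Suc (Suc m) := 0, m := ?w) = s(m := ?w)"
      using s by (auto simp: fun_eq_iff)
    then have 4: "exec x [While (Suc (Suc m)) 3 [Dec (Suc (Suc m)), Inc m]] (s(Suc (Suc m) := ?w), z)
        (3 * ?S x ?E ^ l + 1) (s(m := ?w), z)"
      using exec_move[of "Suc (Suc m)" m x "s(Suc (Suc m) := ?w)" z] s l[OF E, of x ?v]
      by (auto intro: exec_mono)
    show ?thesis using exec_append[OF 1 exec_append[OF 2 exec_Cons[OF 3 4]]] .
  qed
  moreover have "poly_bounded n ?T"
    using comp_bounded[OF assms(1)] T by (intro pb_intros)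
  ultimately show "\<exists>c T. poly_bounded n T \<and> (\<forall>x s z. s 0 = 0 \<longrightarrow> (\<forall>r\<ge>m. s r = 0) \<longrightarrow>
     exec x c (s, z) (T x (env_of s rs))
       (s(m := g x (case_nat (f x (env_of s rs)) (env_of s rs))), z))"
    by blast
qed

lemma comp_reindex:
  assumes "comp k g" "\<And>i. i < k \<Longrightarrow> p i < n"
  shows "comp n (\<lambda>x E. g x (\<lambda>i. if i < k then E (p i) else 0))"
proof (rule compI)
  fix rs :: "nat list" and m :: nat assume rs: "length rs = n" "set rs \<subseteq> {0<..<m}" "0 < m"
  let ?rs = "map (\<lambda>i. rs ! p i) [0..<k]"
  have "length ?rs = k" by simp
  moreover have "set ?rs \<subseteq> {0<..<m}" using rs assms(2) by (auto dest: nth_mem)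
  ultimately obtain c T where T: "poly_bounded k T"
    and c0: "computes c T ?rs m g"
    by (rule compE[OF assms(1) _ _ rs(3)])
  note c = computesD[OF c0]
  let ?P = "\<lambda>E i. if i < k then E (p i) else 0"
  have eq: "env_of s ?rs = ?P (env_of s rs)" for s
    using rs assms(2) by (auto simp: env_of_def fun_eq_iff)
  obtain l where l: "\<And>x E. is_env k E \<Longrightarrow> T x E \<le> env_size k x E ^ l"
    using T unfolding poly_bounded_def by blast
  \<comment> \<open>Each of the \<open>k\<close> arguments is some \<open>E j\<close>, possibly the
    same one every time.\<close>
  have sz: "env_size k x (?P E) \<le> (k + 1) * env_size n x E" for x E
  proof -
    have "(\<Sum>i<k. ?P E i) \<le> (\<Sum>i<k. \<Sum>j<n. E j)"
      by (intro sum_mono) (auto intro!: member_le_sum assms(2))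
    then show ?thesis by (auto simp: env_size_def algebra_simps)
  qed
  have "T x (?P E) \<le> ((k + 1) * env_size n x E) ^ l" for x E
    by (rule order_trans[OF l power_mono[OF sz]]) (auto simp: is_env_def)
  then have "exec x c (s, z) (((k + 1) * env_size n x (env_of s rs)) ^ l) (s(m := g x (?P (env_of s rs))), z)"
    if "s 0 = 0" "\<forall>r\<ge>m. s r = 0" for x s z
    using c[of s x z] that unfolding eq by (auto intro: exec_mono)
  moreover have "poly_bounded n (\<lambda>x E. ((k + 1) * env_size n x E) ^ l)" by (intro pb_intros)
  ultimately show "\<exists>c T. poly_bounded n T \<and> (\<forall>x s z. s 0 = 0 \<longrightarrow> (\<forall>r\<ge>m. s r = 0) \<longrightarrow>
     exec x c (s, z) (T x (env_of s rs)) (s(m := g x (?P (env_of s rs))), z))"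
    by (intro exI[of _ c] exI[of _ "\<lambda>x E. ((k + 1) * env_size n x E) ^ l"]) blast
qed

lemma comp_cong:
  assumes "comp n f" "\<And>x E. is_env n E \<Longrightarrow> f x E = g x E" shows "comp n g"
proof (rule compI)
  fix rs :: "nat list" and m :: nat assume rs: "length rs = n" "set rs \<subseteq> {0<..<m}" "0 < m"
  obtain c T where T: "poly_bounded n T" and c: "computes c T rs m f"
    by (rule compE[OF assms(1) rs])
  have "f x (env_of s rs) = g x (env_of s rs)" for x s using rs(1) by (intro assms(2)) simp
  with c have "computes c T rs m g" unfolding computes_def by simp
  with T show "\<exists>c T. poly_bounded n T \<and> (\<forall>x s z. s 0 = 0 \<longrightarrow> (\<forall>r\<ge>m. s r = 0) \<longrightarrow>
        exec x c (s, z) (T x (env_of s rs)) (s(m := g x (env_of s rs)), z))"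
    unfolding computes_def by blast
qed

lemma comp_shift:
  assumes "comp n f" shows "comp (Suc n) (\<lambda>x E. f x (\<lambda>i. E (Suc i)))"
  by (rule comp_cong[OF comp_reindex[OF assms, of Suc]])
    (auto simp: is_env_def intro!: arg_cong[of _ _ "f _"])

lemma comp_1:
  assumes "comp 1 (\<lambda>x E. g x (E 0))" "comp n f"
  shows "comp n (\<lambda>x E. g x (f x E))"
  using comp_let[OF assms(2) comp_reindex[OF assms(1), of "\<lambda>i. 0"]] by simp

subsection \<open>Access to the input\<close>

lemma exec_scan_right:
  assumes "1 \<le> s 0" "s 0 \<le> Suc (length x)" "m \<noteq> 0"
  shows "exec x [While 0 0 [Inc 0, Inc m]] (s, z) (3 * (Suc (length x) - s 0) + 1)
    (s(0 := Suc (length x), m := s m + (Suc (length x) - s 0)), z)"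
  using assms
proof (induction "Suc (length x) - s 0" arbitrary: s)
  case 0
  then have "s 0 = Suc (length x)" by simp
  then have eq: "s(0 := Suc (length x), m := s m + (Suc (length x) - s 0)) = s" by (auto simp: fun_eq_iff)
  have "reg_symbol x 0 (s 0) = 0" using \<open>s 0 = Suc (length x)\<close> by (simp add: reg_symbol_def)
  then show ?case unfolding eq by (intro exec_mono[OF exec_While_stop]) auto
next
  case (Suc d)
  let ?s = "s(0 := Suc (s 0), m := Suc (s m))"
  have 1: "exec x [Inc 0, Inc m] (s, z) 2 (?s, z)"
    using exec_Cons[OF exec_Inc[of x 0 s z] exec_Inc[of x m]] \<open>m \<noteq> 0\<close> by (simp add: numeral_2_eq_2)
  have 2: "exec x [While 0 0 [Inc 0, Inc m]] (?s, z) (3 * (Suc (length x) - ?s 0) + 1)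
    (?s(0 := Suc (length x), m := ?s m + (Suc (length x) - ?s 0)), z)"
    using Suc by (intro Suc(1)) auto
  have "?s(0 := Suc (length x), m := ?s m + (Suc (length x) - ?s 0)) =
      s(0 := Suc (length x), m := s m + (Suc (length x) - s 0))"
    using Suc(2) \<open>m \<noteq> 0\<close> by (auto simp: fun_eq_iff)
  note 2 = 2[unfolded this]
  have "reg_symbol x 0 (s 0) \<noteq> 0" using Suc(2,3) by (auto simp: reg_symbol_def)
  from exec_While_step[OF this 1 2] show ?case
    using Suc(2) \<open>m \<noteq> 0\<close> by (auto elim!: exec_mono)
qed

lemma comp_length: "comp n (\<lambda>x E. length x)"
proof (rule compI, intro exI conjI allI impI)
  fix rs :: "nat list" and m :: nat and x z and s :: "nat \<Rightarrow> nat"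
  assume m: "0 < m" and s: "s 0 = 0" "\<forall>r\<ge>m. s r = (0 :: nat)"
  have 1: "exec x [Inc 0] (s, z) 1 (s(0 := 1), z)" using exec_Inc[of x 0 s z] s by simp
  have 2: "exec x [While 0 0 [Inc 0, Inc m]] (s(0 := 1), z) (3 * length x + 1)
      (s(0 := Suc (length x), m := length x), z)"
    using exec_scan_right[of "s(0 := 1)" x m z] m s by simp
  have "s(0 := Suc (length x), m := length x, 0 := 0) = s(m := length x)"
    using m s by (auto simp: fun_eq_iff)
  then have 3: "exec x [While 0 3 [Dec 0]] (s(0 := Suc (length x), m := length x), z) (2 * Suc (length x) + 1)
      (s(m := length x), z)"
    using exec_clear[of x 0 "s(0 := Suc (length x), m := length x)" z] m by simp
  show "exec x [Inc 0, While 0 0 [Inc 0, Inc m], While 0 3 [Dec 0]] (s, z)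
      (1 + ((3 * length x + 1) + (2 * Suc (length x) + 1))) (s(m := length x), z)"
    using exec_Cons[OF 1 exec_Cons[OF 2 3]] .
qed (intro pb_intros)

text \<open>Moving the index into register 0 positions the head that scans the input; one more
  \<open>Inc 0\<close> accounts for the mark at position 0. Positions outside the input scan a
  symbol other than 2 and so yield 0.\<close>

lemma comp_input:
  assumes "comp n f"
  shows "comp n (\<lambda>x E. of_bool (f x E < length x \<and> x ! f x E))"
proof (rule compI)
  fix rs :: "nat list" and m :: nat assume rs: "length rs = n" "set rs \<subseteq> {0<..<m}" "0 < m"
  obtain c T where T: "poly_bounded n T"
    and c0: "computes c T rs m f"
    by (rule compE[OF assms rs])
  note c = computesD[OF c0]
  let ?T = "\<lambda>x E. T x E + ((3 * f x E + 1) + (1 + (2 + (2 * Suc (f x E) + 1))))"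
  let ?g = "\<lambda>x E. of_bool (f x E < length x \<and> x ! f x E) :: nat"
  have "exec x (c @ [While m 3 [Dec m, Inc 0], Inc 0, If 0 2 [Inc m] [], While 0 3 [Dec 0]]) (s, z)
      (?T x (env_of s rs)) (s(m := ?g x (env_of s rs)), z)"
    if s: "s 0 = 0" "\<forall>r\<ge>m. s r = 0" for x s z
  proof -
    let ?E = "env_of s rs"
    let ?v = "f x ?E"
    have 1: "exec x c (s, z) (T x ?E) (s(m := ?v), z)" using c[of s x z] s by auto
    have "s(m := ?v, m := 0, 0 := ?v) = s(0 := ?v)" using s rs by (auto simp: fun_eq_iff)
    then have 2: "exec x [While m 3 [Dec m, Inc 0]] (s(m := ?v), z) (3 * ?v + 1) (s(0 := ?v), z)"
      using exec_move[of m 0 x "s(m := ?v)" z] rs s by simp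
    have 3: "exec x [Inc 0] (s(0 := ?v), z) 1 (s(0 := Suc ?v), z)" using exec_Inc[of x 0 "s(0 := ?v)" z] by simp
    have "exec x (if reg_symbol x 0 ((s(0 := Suc ?v)) 0) = 2 then [Inc m] else []) (s(0 := Suc ?v), z) 1
        (s(0 := Suc ?v, m := ?g x ?E), z)"
    proof (cases "?v < length x \<and> x ! ?v")
      case True
      then have "reg_symbol x 0 (Suc ?v) = 2" by (simp add: reg_symbol_def)
      then show ?thesis using exec_Inc[of x m "s(0 := Suc ?v)" z] True s rs by simp
    next
      case False
      then have "reg_symbol x 0 (Suc ?v) \<noteq> 2" by (auto simp: reg_symbol_def)
      moreover have s0: "s(0 := Suc ?v, m := 0) = s(0 := Suc ?v)" using s rs by (auto simp: fun_eq_iff)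
      moreover have g0: "?g x ?E = 0" using False by simp
      ultimately show ?thesis unfolding g0 s0 using exec_mono[OF exec_Nil, of 1] by simp
    qed
    from exec_If[where s = "s(0 := Suc ?v)", OF this]
    have 4: "exec x [If 0 2 [Inc m] []] (s(0 := Suc ?v), z) 2 (s(0 := Suc ?v, m := ?g x ?E), z)"
      by (simp add: numeral_2_eq_2)
    have "s(0 := Suc ?v, m := ?g x ?E, 0 := 0) = s(m := ?g x ?E)" using s rs by (auto simp: fun_eq_iff)
    then have 5: "exec x [While 0 3 [Dec 0]] (s(0 := Suc ?v, m := ?g x ?E), z) (2 * Suc ?v + 1) (s(m := ?g x ?E), z)"
      using exec_clear[of x 0 "s(0 := Suc ?v, m := ?g x ?E)" z] rs by simp
    show ?thesis using exec_append[OF 1 exec_Cons[OF 2 exec_Cons[OF 3 exec_Cons[OF 4 5]]]] .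
  qed
  moreover have "poly_bounded n ?T"
    using comp_bounded[OF assms(1)] T by (intro pb_intros)
  ultimately show "\<exists>c T. poly_bounded n T \<and> (\<forall>x s z. s 0 = 0 \<longrightarrow> (\<forall>r\<ge>m. s r = 0) \<longrightarrow>
     exec x c (s, z) (T x (env_of s rs)) (s(m := ?g x (env_of s rs)), z))"
    by blast
qed

subsection \<open>Iteration\<close>

text \<open>Iterating a polynomially bounded function can lead beyond polynomials, so a bound
  \<open>B\<close> on all intermediate values is demanded. Register \<open>m\<close> holds the
  accumulator, \<open>m + 1\<close> the index, \<open>m + 2\<close> the number of remaining rounds,
  and \<open>m + 3\<close> receives the new accumulator.\<close>

lemma comp_iterate:
  assumes f: "comp n f" and a: "comp n a"
    and g: "comp (Suc (Suc n)) (\<lambda>x E. g x (\<lambda>i. E (Suc (Suc i))) (E 1) (E 0))"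
    and B: "poly_bounded n B"
    and le: "\<And>x E j. is_env n E \<Longrightarrow> j \<le> f x E \<Longrightarrow> rec_nat (a x E) (g x E) j \<le> B x E"
  shows "comp n (\<lambda>x E. rec_nat (a x E) (g x E) (f x E))"
proof (rule compI)
  fix rs :: "nat list" and m :: nat assume rs: "length rs = n" "set rs \<subseteq> {0<..<m}" "0 < m"
  obtain ca Ta where Ta: "poly_bounded n Ta"
    and ca0: "computes ca Ta rs m a"
    by (rule compE[OF a rs])
  note ca = computesD[OF ca0]
  have "set rs \<subseteq> {0<..<m + 2}" "0 < m + 2" using rs by auto
  then obtain cf Tf where Tf: "poly_bounded n Tf"
    and cf0: "computes cf Tf rs (m + 2) f"
    by (rule compE[OF f rs(1)])
  note cf = computesD[OF cf0]
  have "length (m # (m + 1) # rs) = Suc (Suc n)" "set (m # (m + 1) # rs) \<subseteq> {0<..<m + 3}" "0 < m + 3"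
    using rs by auto
  then obtain cg Tg where Tg: "poly_bounded (Suc (Suc n)) Tg"
    and cg0: "computes cg Tg (m # (m + 1) # rs) (m + 3) (\<lambda>x E. g x (\<lambda>i. E (Suc (Suc i))) (E 1) (E 0))"
    by (rule compE[OF g])
  have cg: "exec x cg (s, z) (Tg x (case_nat (s m) (case_nat (s (m + 1)) (env_of s rs))))
        (s(m + 3 := g x (env_of s rs) (s (m + 1)) (s m)), z)"
    if "s 0 = 0" "\<And>r. r \<ge> m + 3 \<Longrightarrow> s r = 0" for x s z
    using computesD[OF cg0, of s x z] that by simp
  obtain k where k: "\<And>x E u v. is_env n E \<Longrightarrow>
      Tg x (case_nat u (case_nat v E)) \<le> (u + (v + env_size n x E)) ^ k"
    using pb_push[OF Tg] by (metis env_size_push is_env_push)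
  let ?D = "\<lambda>x E. (B x E + (f x E + env_size n x E)) ^ k + (5 * B x E + 5)"
  let ?body = "cg @ [While m 3 [Dec m], While (m + 3) 3 [Dec (m + 3), Inc m], Inc (m + 1), Dec (m + 2)]"
  let ?prog = "ca @ cf @ [While (m + 2) 3 ?body, While (m + 1) 3 [Dec (m + 1)]]"
  let ?T = "\<lambda>x E. Ta x E + (Tf x E + ((f x E * Suc (?D x E) + 1) + (2 * f x E + 1)))"
  have "exec x ?prog (s, z) (?T x (env_of s rs))
      (s(m := rec_nat (a x (env_of s rs)) (g x (env_of s rs)) (f x (env_of s rs))), z)"
    if s: "s 0 = 0" "\<forall>r\<ge>m. s r = 0" for x s z
  proof -
    let ?E = "env_of s rs"
    let ?F = "f x ?E"
    define I where "I j = rec_nat (a x ?E) (g x ?E) j" for j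
    define S where "S j = s(m := I j, m + 1 := j, m + 2 := ?F - j)" for j
    have E: "is_env n ?E" using rs by simp
    have env: "env_of (s(m := u, m + 1 := v, m + 2 := w)) rs = ?E" for u v w
      using rs by (intro env_of_cong) auto
    have I: "I j \<le> B x ?E" if "j \<le> ?F" for j using le[OF E that] by (simp add: I_def)
    have 1: "exec x ca (s, z) (Ta x ?E) (s(m := I 0), z)" using ca[of s x z] s by (auto simp: I_def)
    have 2: "exec x cf (s(m := I 0), z) (Tf x ?E) (S 0, z)"
    proof -
      have "env_of (s(m := I 0)) rs = ?E" using rs by (intro env_of_cong) auto
      moreover have "s(m := I 0, m + 2 := ?F) = S 0" using s by (auto simp: S_def fun_eq_iff)
      ultimately show ?thesis using cf[of "s(m := I 0)" x z] s rs by auto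
    qed
    have body: "exec x ?body (S j, z) (?D x ?E) (S (Suc j), z)" if j: "j < ?F" for j
    proof -
      let ?s1 = "(S j)(m + 3 := I (Suc j))"
      let ?s2 = "?s1(m := 0)"
      let ?s3 = "(S j)(m := I (Suc j))"
      let ?s4 = "?s3(m + 1 := Suc j)"
      have "exec x cg (S j, z) (Tg x (case_nat (I j) (case_nat j ?E))) (?s1, z)"
        using cg[of "S j" x z] s rs env[of "I j" j "?F - j"] by (auto simp: S_def I_def)
      moreover have "Tg x (case_nat (I j) (case_nat j ?E)) \<le> (B x ?E + (?F + env_size n x ?E)) ^ k"
        using j I[of j] by (intro order_trans[OF k[OF E]] power_mono add_mono) auto
      ultimately have b1: "exec x cg (S j, z) ((B x ?E + (?F + env_size n x ?E)) ^ k) (?s1, z)"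
        by (rule exec_mono)
      have b2: "exec x [While m 3 [Dec m]] (?s1, z) (2 * B x ?E + 1) (?s2, z)"
        using exec_clear[of x m ?s1 z] I[of j] j by (auto simp: S_def intro: exec_mono)
      have "?s2(m + 3 := 0, m := I (Suc j)) = ?s3" using s by (auto simp: fun_eq_iff S_def)
      then have b3: "exec x [While (m + 3) 3 [Dec (m + 3), Inc m]] (?s2, z) (3 * B x ?E + 1) (?s3, z)"
        using exec_move[of "m + 3" m x ?s2 z] I[of "Suc j"] j by (auto simp: S_def intro: exec_mono)
      have b4: "exec x [Inc (m + 1)] (?s3, z) 1 (?s4, z)"
        using exec_Inc[of x "m + 1" ?s3 z] by (simp add: S_def)
      have "?s4(m + 2 := ?s4 (m + 2) - 1) = S (Suc j)" using j by (auto simp: S_def fun_eq_iff)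
      then have b5: "exec x [Dec (m + 2)] (?s4, z) 1 (S (Suc j), z)"
        using exec_Dec[of x "m + 2" ?s4 z] by simp
      from exec_append[OF b1 exec_Cons[OF b2 exec_Cons[OF b3 exec_Cons[OF b4 b5]]]]
      show ?thesis by (rule exec_mono) simp
    qed
    have loop: "exec x [While (m + 2) 3 ?body] (S (?F - d), z) (d * Suc (?D x ?E) + 1) (S ?F, z)" if "d \<le> ?F" for d
      using that
    proof (induction d)
      case 0
      have "reg_symbol x (m + 2) (S ?F (m + 2)) = 3" by (simp add: S_def)
      from exec_While_stop[where s = "S ?F", OF this] show ?case by simp
    next
      case (Suc d)
      have 1: "reg_symbol x (m + 2) (S (?F - Suc d) (m + 2)) \<noteq> 3" using Suc.prems by (simp add: S_def)
      have 2: "?F - Suc d < ?F" "Suc (?F - Suc d) = ?F - d" "d \<le> ?F" using Suc.prems by simp_all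
      from exec_While_step[where s = "S (?F - Suc d)", OF 1 body[OF 2(1), unfolded 2(2)] Suc.IH[OF 2(3)]]
      show ?case by (rule exec_mono) simp
    qed
    have 3: "exec x [While (m + 2) 3 ?body] (S 0, z) (?F * Suc (?D x ?E) + 1) (S ?F, z)"
      using loop[of ?F] by simp
    have "(S ?F)(m + 1 := 0) = s(m := I ?F)" using s by (auto simp: S_def fun_eq_iff)
    then have 4: "exec x [While (m + 1) 3 [Dec (m + 1)]] (S ?F, z) (2 * ?F + 1) (s(m := I ?F), z)"
      using exec_clear[of x "m + 1" "S ?F" z] by (simp add: S_def)
    show ?thesis
      using exec_append[OF 1 exec_append[OF 2 exec_Cons[OF 3 4]]] by (simp add: I_def)
  qed
  moreover have "poly_bounded n ?T"
    using comp_bounded[OF f] Ta Tf B by (intro pb_intros)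
  ultimately show "\<exists>c T. poly_bounded n T \<and> (\<forall>x s z. s 0 = 0 \<longrightarrow> (\<forall>r\<ge>m. s r = 0) \<longrightarrow>
     exec x c (s, z) (T x (env_of s rs))
       (s(m := rec_nat (a x (env_of s rs)) (g x (env_of s rs)) (f x (env_of s rs))), z))"
    by blast
qed

subsection \<open>Arithmetic and bounded quantification\<close>

text \<open>An iteration that ignores its accumulator returns the last index, one less than the
  number of rounds.\<close>

lemma comp_pred: assumes "comp n f" shows "comp n (\<lambda>x E. f x E - 1)"
proof -
  have eq: "rec_nat 0 (\<lambda>i acc. i) b = b - 1" for b :: nat by (cases b) auto
  have "comp n (\<lambda>x E. rec_nat 0 (\<lambda>i acc. i) (f x E))"
    by (rule comp_iterate[OF assms comp_const, where B = "\<lambda>x E. f x E"])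
      (use comp_bounded[OF assms] in \<open>auto simp: eq intro: comp_nth\<close>)
  then show ?thesis by (simp only: eq)
qed

lemma comp_add: assumes "comp n f" "comp n g" shows "comp n (\<lambda>x E. f x E + g x E)"
proof -
  have eq: "rec_nat a (\<lambda>i acc. Suc acc) b = a + b" for a b :: nat by (induction b) auto
  have "comp n (\<lambda>x E. rec_nat (f x E) (\<lambda>i acc. Suc acc) (g x E))"
    by (rule comp_iterate[OF assms(2,1), where B = "\<lambda>x E. f x E + g x E"])
      (use assms[THEN comp_bounded] in \<open>auto simp: eq intro: comp_nth comp_Suc pb_add\<close>)
  then show ?thesis by (simp only: eq)
qed

lemma comp_diff: assumes "comp n f" "comp n g" shows "comp n (\<lambda>x E. f x E - g x E)"
proof -
  have eq: "rec_nat a (\<lambda>i acc. acc - 1) b = a - b" for a b :: nat by (induction b) auto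
  have "comp n (\<lambda>x E. rec_nat (f x E) (\<lambda>i acc. acc - 1) (g x E))"
    by (rule comp_iterate[OF assms(2,1), where B = "\<lambda>x E. f x E"])
      (use comp_bounded[OF assms(1)] in \<open>auto simp: eq simp del: One_nat_def intro: comp_nth comp_pred\<close>)
  then show ?thesis by (simp only: eq)
qed

lemma comp_sum:
  assumes f: "comp n f" and h: "comp (Suc n) (\<lambda>x E. h x (\<lambda>i. E (Suc i)) (E 0))"
  shows "comp n (\<lambda>x E. \<Sum>i<f x E. h x E i)"
proof -
  have eq: "rec_nat 0 (\<lambda>i acc. acc + h i) b = (\<Sum>i<b. h i)" for b and h :: "nat \<Rightarrow> nat"
    by (induction b) auto
  obtain k where k: "\<And>x E a. is_env n E \<Longrightarrow> h x E a \<le> (a + env_size n x E) ^ k"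
    using pb_push[OF comp_bounded[OF h]] by auto
  let ?B = "\<lambda>x E. f x E * (f x E + env_size n x E) ^ k"
  have "comp n (\<lambda>x E. rec_nat 0 (\<lambda>i acc. acc + h x E i) (f x E))"
  proof (rule comp_iterate[OF f comp_const, where B = ?B])
    show "comp (Suc (Suc n)) (\<lambda>x E. E 0 + h x (\<lambda>i. E (Suc (Suc i))) (E 1))"
      using comp_add[OF comp_nth[of 0] comp_shift[OF h]] by simp
    show "poly_bounded n ?B" using comp_bounded[OF f] by (intro pb_intros)
    fix x E j assume E: "is_env n E" and j: "j \<le> f x E"
    have "(\<Sum>i<j. h x E i) \<le> (\<Sum>i<j. (f x E + env_size n x E) ^ k)"
      using j by (intro sum_mono order_trans[OF k[OF E]] power_mono) auto
    also have "\<dots> \<le> ?B x E" using j by simp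
    finally show "rec_nat 0 (\<lambda>i acc. acc + h x E i) j \<le> ?B x E" by (simp only: eq)
  qed
  then show ?thesis by (simp only: eq)
qed

lemma comp_mult: assumes "comp n f" "comp n g" shows "comp n (\<lambda>x E. f x E * g x E)"
  using comp_sum[OF assms(1), of "\<lambda>x E i. g x E"] comp_shift[OF assms(2)] by simp

abbreviation pcomp :: "nat \<Rightarrow> (bool list \<Rightarrow> (nat \<Rightarrow> nat) \<Rightarrow> bool) \<Rightarrow> bool" where
  "pcomp n P \<equiv> comp n (\<lambda>x E. of_bool (P x E))"

lemma comp_if:
  assumes "pcomp n P" "comp n f" "comp n g"
  shows "comp n (\<lambda>x E. if P x E then f x E else g x E)"
  by (rule comp_cong[OF comp_if_0[OF assms(1,3,2)]]) auto

lemma pcomp_const: "pcomp n (\<lambda>x E. b)" by (rule comp_const)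

lemma pcomp_not: assumes "pcomp n P" shows "pcomp n (\<lambda>x E. \<not> P x E)"
  by (rule comp_cong[OF comp_if[OF assms comp_const[of _ 0] comp_const[of _ 1]]]) auto

lemma pcomp_conj: assumes "pcomp n P" "pcomp n Q" shows "pcomp n (\<lambda>x E. P x E \<and> Q x E)"
  by (rule comp_cong[OF comp_if[OF assms(1,2) comp_const[of _ 0]]]) auto

lemma pcomp_disj: assumes "pcomp n P" "pcomp n Q" shows "pcomp n (\<lambda>x E. P x E \<or> Q x E)"
  by (rule comp_cong[OF comp_if[OF assms(1) comp_const[of _ 1] assms(2)]]) auto

lemma pcomp_imp: assumes "pcomp n P" "pcomp n Q" shows "pcomp n (\<lambda>x E. P x E \<longrightarrow> Q x E)"
  by (rule comp_cong[OF comp_if[OF assms comp_const[of _ 1]]]) auto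

lemma pcomp_if:
  assumes "pcomp n P" "pcomp n Q" "pcomp n R" shows "pcomp n (\<lambda>x E. if P x E then Q x E else R x E)"
  by (rule comp_cong[OF comp_if[OF assms]]) auto

lemma pcomp_le: assumes "comp n f" "comp n g" shows "pcomp n (\<lambda>x E. f x E \<le> g x E)"
  by (rule comp_cong[OF comp_if_0[OF comp_diff[OF assms] comp_const[of _ 1] comp_const[of _ 0]]]) auto

lemma pcomp_less: assumes "comp n f" "comp n g" shows "pcomp n (\<lambda>x E. f x E < g x E)"
  using pcomp_le[OF comp_Suc[OF assms(1)] assms(2)] by (simp add: Suc_le_eq)

lemma pcomp_eq: assumes "comp n f" "comp n g" shows "pcomp n (\<lambda>x E. f x E = g x E)"
  by (rule comp_cong[OF pcomp_conj[OF pcomp_le[OF assms] pcomp_le[OF assms(2,1)]]]) auto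

lemma pcomp_iff: assumes "pcomp n P" "pcomp n Q" shows "pcomp n (\<lambda>x E. P x E \<longleftrightarrow> Q x E)"
  by (rule comp_cong[OF pcomp_eq[OF assms]]) auto

lemma pcomp_ex:
  assumes "comp n f" "pcomp (Suc n) (\<lambda>x E. P x (\<lambda>i. E (Suc i)) (E 0))"
  shows "pcomp n (\<lambda>x E. \<exists>i<f x E. P x E i)"
\<comment> \<open>A bounded existential quantifier holds iff the number of its witnesses is
  positive.\<close>
proof (rule comp_cong[OF pcomp_less[OF comp_const[of _ 0] comp_sum[OF assms(1)]]])
  show "comp (Suc n) (\<lambda>x E. of_bool (P x (\<lambda>i. E (Suc i)) (E 0)))" by (rule assms(2))
qed auto

lemma pcomp_all:
  assumes "comp n f" "pcomp (Suc n) (\<lambda>x E. P x (\<lambda>i. E (Suc i)) (E 0))"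
  shows "pcomp n (\<lambda>x E. \<forall>i<f x E. P x E i)"
  by (rule comp_cong[OF pcomp_not[OF pcomp_ex[OF assms(1) pcomp_not[OF assms(2)]]]]) auto

lemma sum_of_bool_card: "(\<Sum>i\<in>A. of_bool (P i) :: nat) = card {i \<in> A. P i}" if "finite A"
  using that by (simp only: card_eq_sum sum.inter_filter of_bool_def)

lemma comp_div: assumes "comp n f" "comp n g" shows "comp n (\<lambda>x E. f x E div g x E)"
proof -
  \<comment> \<open>The quotient counts the positive multiples of \<open>b\<close> up to
    \<open>a\<close>; as \<open>b > 0\<close>, multipliers up to \<open>a\<close> suffice.\<close>
  have eq: "(\<Sum>i<a. of_bool (Suc i * b \<le> a)) = a div b" if "b > 0" for a b :: nat
  proof -
    have "{i. i < a \<and> Suc i * b \<le> a} = {..<a div b}"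
    proof (intro set_eqI iffI)
      fix i assume "i \<in> {i. i < a \<and> Suc i * b \<le> a}"
      then have "Suc i \<le> a div b" using that by (simp add: less_eq_div_iff_mult_less_eq)
      then show "i \<in> {..<a div b}" by simp
    next
      fix i assume "i \<in> {..<a div b}"
      then have "Suc i \<le> a div b" by simp
      moreover from this have "Suc i \<le> a" using div_le_dividend le_trans by blast
      ultimately show "i \<in> {i. i < a \<and> Suc i * b \<le> a}" using that by (simp add: less_eq_div_iff_mult_less_eq)
    qed
    then show ?thesis by (simp only: sum_of_bool_card finite_lessThan lessThan_iff card_lessThan)
  qed
  have "comp n (\<lambda>x E. if g x E = 0 then 0 else \<Sum>i<f x E. of_bool (Suc i * g x E \<le> f x E))"
    by (intro comp_if_0 comp_sum comp_const pcomp_le comp_mult comp_Suc comp_nth comp_shift assms zero_less_Suc)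
  then show ?thesis
  proof (rule comp_cong)
    fix x E
    show "(if g x E = 0 then 0 else \<Sum>i<f x E. of_bool (Suc i * g x E \<le> f x E)) = f x E div g x E"
      by (cases "g x E = 0") (simp, simp only: eq neq0_conv, simp)
  qed
qed

lemma comp_mod: assumes "comp n f" "comp n g" shows "comp n (\<lambda>x E. f x E mod g x E)"
  using comp_diff[OF assms(1) comp_mult[OF comp_div[OF assms] assms(2)]]
  by (simp add: minus_div_mult_eq_mod)

text \<open>Here \<open>S\<close> belongs to the program and not to its input, so the disjunction
  has fixed length. In this way the tables of the boxes and the schemas of the machine enter a
  computation.\<close>

lemma pcomp_finite_ex:
  assumes "finite S" "\<And>a. a \<in> S \<Longrightarrow> pcomp n (P a)"
  shows "pcomp n (\<lambda>x E. \<exists>a\<in>S. P a x E)"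
  using assms
proof (induction S rule: finite_induct)
  case (insert a S)
  have "pcomp n (\<lambda>x E. P a x E \<or> (\<exists>a\<in>S. P a x E))"
    by (rule pcomp_disj) (use insert in auto)
  then show ?case by simp
qed (use pcomp_const[of n False] in simp)

lemma comp_poly: assumes "comp n f" shows "comp n (\<lambda>x E. poly p (f x E))"
proof (induction p)
  case (pCons a p)
  have "comp n (\<lambda>x E. a + f x E * poly p (f x E))"
    by (rule comp_add[OF comp_const comp_mult[OF assms pCons(2)]])
  then show ?case by simp
qed (simp add: comp_const)

text \<open>The least \<open>i < f\<close> satisfying \<open>P\<close>, or \<open>f\<close> if there is none.\<close>

definition first_below :: "nat \<Rightarrow> (nat \<Rightarrow> bool) \<Rightarrow> nat" where
  "first_below b P = (\<Sum>i<b. of_bool (\<forall>j<Suc i. \<not> P j))"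

lemma first_below_eq:
  assumes "i < b" "P i" "\<And>j. j < i \<Longrightarrow> \<not> P j" shows "first_below b P = i"
proof -
  have "(\<forall>k<Suc j. \<not> P k) \<longleftrightarrow> j < i" for j
    using assms(2,3) by (metis less_Suc_eq less_trans_Suc not_less_eq linorder_neqE_nat)
  then have "first_below b P = (\<Sum>j<b. of_bool (j < i))" by (simp add: first_below_def)
  also have "\<dots> = card {j. j < b \<and> j < i}"
    by (simp only: sum_of_bool_card finite_lessThan lessThan_iff)
  also have "{j. j < b \<and> j < i} = {..<i}" using assms(1) by auto
  finally show ?thesis by simp
qed

lemma comp_first_below:
  assumes "comp n f" "pcomp (Suc n) (\<lambda>x E. P x (\<lambda>i. E (Suc i)) (E 0))"
  shows "comp n (\<lambda>x E. first_below (f x E) (P x E))"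
proof -
  \<comment> \<open>Inside the sum and the universal quantifier the predicate stands under two
    binders and must skip the outer one.\<close>
  have "pcomp (Suc (Suc n)) (\<lambda>x E. P x (\<lambda>i. E (Suc (Suc i))) (E 0))"
  proof (rule comp_cong[OF comp_reindex[OF assms(2), of "case_nat 0 (\<lambda>i. Suc (Suc i))"]])
    fix x :: "bool list" and E :: "nat \<Rightarrow> nat" assume "is_env (Suc (Suc n)) E"
    then have "(\<lambda>i. if Suc i < Suc n then E (case Suc i of 0 \<Rightarrow> 0 | Suc i \<Rightarrow> Suc (Suc i)) else 0) =
        (\<lambda>i. E (Suc (Suc i)))"
      by (auto simp: is_env_def fun_eq_iff)
    then show "of_bool (P x (\<lambda>i. if Suc i < Suc n then E (case Suc i of 0 \<Rightarrow> 0 | Suc i \<Rightarrow> Suc (Suc i)) else 0)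
        (if 0 < Suc n then E (case 0 of 0 \<Rightarrow> 0 | Suc i \<Rightarrow> Suc (Suc i)) else 0)) =
        (of_bool (P x (\<lambda>i. E (Suc (Suc i))) (E 0)) :: nat)" by simp
  qed (auto split: nat.splits)
  then show ?thesis unfolding first_below_def
    by (intro comp_sum pcomp_all pcomp_not comp_Suc comp_nth assms(1) zero_less_Suc)
qed

lemmas comp_intros = comp_const comp_nth comp_Suc comp_add comp_diff comp_mult comp_div comp_mod
  comp_length comp_if pcomp_not pcomp_conj pcomp_disj pcomp_imp pcomp_if pcomp_le pcomp_less pcomp_eq
  pcomp_iff pcomp_ex pcomp_all comp_sum comp_first_below comp_input

subsection \<open>Computable strings\<close>

lemma poly_bounded_length:
  assumes "poly_bounded n g"
  shows "\<exists>q :: nat poly. \<forall>x. g x (\<lambda>_. 0) \<le> poly q (length x)"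
proof -
  obtain k where k: "\<And>x E. is_env n E \<Longrightarrow> g x E \<le> env_size n x E ^ k"
    using assms unfolding poly_bounded_def by blast
  have "g x (\<lambda>_. 0) \<le> poly ([:2, 1:] ^ k) (length x)" for x
    using k[of "\<lambda>_. 0" x] by (simp add: is_env_def env_size_def)
  then show ?thesis by blast
qed

text \<open>Register 1 holds the position of the next output bit and is the only argument, register
  2 counts the bits still to be written, and 3 receives the current bit. The length is computed
  while register 1 is still 0.\<close>

lemma poly_time_computable_comp:
  assumes N: "comp 1 (\<lambda>x E. N x)" and b: "pcomp 1 (\<lambda>x E. b x (E 0))"
  shows "poly_time_computable (\<lambda>x. map (b x) [0..<N x])"
proof -
  obtain cN TN where TN: "poly_bounded 1 TN" and cN: "computes cN TN [1] 2 (\<lambda>x E. N x)"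
    by (rule compE[OF N, of "[1]" 2]) auto
  obtain cb Tb where Tb: "poly_bounded 1 Tb" and cb: "computes cb Tb [1] 3 (\<lambda>x E. of_bool (b x (E 0)))"
    by (rule compE[OF b, of "[1]" 3]) auto
  obtain k where k0: "\<forall>x E a. is_env 0 E \<longrightarrow> Tb x (case_nat a E) \<le> (a + env_size 0 x E) ^ k"
    using pb_push[of 0 Tb] Tb by auto
  then have k: "Tb x (case_nat a (\<lambda>_. 0)) \<le> (a + env_size 0 x (\<lambda>_. 0)) ^ k" for x a
    by (simp add: is_env_def)
  let ?D = "\<lambda>x E. (N x + env_size 1 x E) ^ k + 5"
  let ?body = "cb @ [If 3 3 [Out False] [Dec 3, Out True], Inc 1, Dec 2]"
  let ?T = "\<lambda>x E. TN x E + (N x * Suc (?D x E) + 1)"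
  have "poly_bounded 1 ?T"
    using TN comp_bounded[OF N] by (intro pb_intros)
  then obtain q :: "nat poly" where q: "\<And>x. ?T x (\<lambda>_. 0) \<le> poly q (length x)"
    using poly_bounded_length by blast
  have env0: "env_of (\<lambda>_. 0) [1] = (\<lambda>_. 0)" by (auto simp: env_of_def fun_eq_iff simp del: env_of_Cons)
  show ?thesis
  proof (rule poly_time_computable_program)
    fix x
    let ?E = "\<lambda>_. 0 :: nat"
    define S :: "nat \<Rightarrow> nat \<Rightarrow> nat" where "S j = (\<lambda>_. 0)(1 := j, 2 := N x - j)" for j
    define Z where "Z j = map (b x) [0..<j]" for j
    have 1: "exec x cN (\<lambda>_. 0, []) (TN x ?E) (S 0, Z 0)"
    proof -
      have "(\<lambda>_. 0)(2 := N x) = S 0" by (auto simp: S_def fun_eq_iff)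
      then show ?thesis using computesD[OF cN, of "\<lambda>_. 0" x "[]"] env0 by (simp add: Z_def)
    qed
    have body: "exec x ?body (S j, Z j) (?D x ?E) (S (Suc j), Z (Suc j))" if j: "j < N x" for j
    proof -
      let ?b = "b x j"
      let ?s1 = "(S j)(3 := of_bool ?b)"
      have env: "env_of (S j) [1] = case_nat j (\<lambda>_. 0)"
        by (auto simp: env_of_def S_def fun_eq_iff split: nat.splits)
      have "exec x cb (S j, Z j) (Tb x (case_nat j (\<lambda>_. 0))) (?s1, Z j)"
        using computesD[OF cb, of "S j" x "Z j"] unfolding env by (simp add: S_def)
      moreover have "Tb x (case_nat j (\<lambda>_. 0)) \<le> (N x + env_size 1 x ?E) ^ k"
        using j by (intro order_trans[OF k] power_mono) (auto simp: env_size_def)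
      ultimately have b1: "exec x cb (S j, Z j) ((N x + env_size 1 x ?E) ^ k) (?s1, Z j)"
        by (rule exec_mono)
      have "exec x (if reg_symbol x 3 (?s1 3) = 3 then [Out False] else [Dec 3, Out True]) (?s1, Z j) 2
          (S j, Z (Suc j))"
      proof (cases ?b)
        case True
        have "?s1(3 := ?s1 3 - 1) = S j" using True by (auto simp: S_def fun_eq_iff)
        with exec_Cons[OF exec_Dec[of x 3 ?s1 "Z j"] exec_Out] True show ?thesis
          by (simp add: Z_def numeral_2_eq_2)
      next
        case False
        have "?s1 = S j" using False by (auto simp: S_def fun_eq_iff)
        with exec_mono[OF exec_Out[of x False "S j" "Z j"], of 2] False show ?thesis by (simp add: Z_def S_def)
      qed
      then have b2: "exec x [If 3 3 [Out False] [Dec 3, Out True]] (?s1, Z j) 3 (S j, Z (Suc j))"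
        using exec_If[where s = ?s1] by (simp only: numeral_3_eq_3 numeral_2_eq_2)
      let ?s2 = "(S j)(1 := Suc j)"
      have b3: "exec x [Inc 1] (S j, Z (Suc j)) 1 (?s2, Z (Suc j))"
        using exec_Inc[of x 1 "S j" "Z (Suc j)"] by (simp add: S_def)
      have "?s2(2 := ?s2 2 - 1) = S (Suc j)" using j by (auto simp: S_def fun_eq_iff)
      then have b4: "exec x [Dec 2] (?s2, Z (Suc j)) 1 (S (Suc j), Z (Suc j))"
        using exec_Dec[of x 2 ?s2 "Z (Suc j)"] by simp
      from exec_append[OF b1 exec_Cons[OF b2 exec_Cons[OF b3 b4]]] show ?thesis
        by (rule exec_mono) simp
    qed
    have loop: "exec x [While 2 3 ?body] (S (N x - d), Z (N x - d)) (d * Suc (?D x ?E) + 1) (S (N x), Z (N x))"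
      if "d \<le> N x" for d
      using that
    proof (induction d)
      case 0
      have "reg_symbol x 2 (S (N x) 2) = 3" by (simp add: S_def)
      from exec_While_stop[where s = "S (N x)", OF this] show ?case by simp
    next
      case (Suc d)
      have 1: "reg_symbol x 2 (S (N x - Suc d) 2) \<noteq> 3" using Suc.prems by (simp add: S_def)
      have 2: "N x - Suc d < N x" "Suc (N x - Suc d) = N x - d" "d \<le> N x" using Suc.prems by simp_all
      from exec_While_step[where s = "S (N x - Suc d)", OF 1 body[OF 2(1), unfolded 2(2)] Suc.IH[OF 2(3)]]
      show ?case by (rule exec_mono) simp
    qed
    have "exec x (cN @ [While 2 3 ?body]) (\<lambda>_. 0, []) (?T x ?E) (S (N x), Z (N x))"
      using exec_append[OF 1 loop[of "N x", simplified]] by simp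
    then show "\<exists>s. exec x (cN @ [While 2 3 ?body]) (\<lambda>_. 0, []) (poly q (length x)) (s, map (b x) [0..<N x])"
      using q exec_mono unfolding Z_def by blast
  qed
qed

section \<open>Computation tableaux as propositional formulas\<close>

lemma length_pair_string: "length (pair_string x w) = 2 * length x + 2 + length w"
  by (induction x) (auto simp: pair_string_def)

lemma pair_string_nth:
  "pair_string x w ! a =
     (if a < 2 * length x then x ! (a div 2) else if a = 2 * length x then False
      else if a = 2 * length x + 1 then True else w ! (a - 2 * length x - 2))"
proof (induction x arbitrary: a)
  case Nil
  then show ?case by (cases a rule: nat.exhaust; cases "a - 1") (auto simp: pair_string_def)
next
  case (Cons b x)
  have eq: "pair_string (b # x) w = b # b # pair_string x w" by (simp add: pair_string_def)
  consider "a = 0" | "a = 1" | c where "a = c + 2"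
    by (metis One_nat_def add_2_eq_Suc' not0_implies_Suc)
  then show ?case
  proof cases
    case 3
    then have "pair_string (b # x) w ! a = pair_string x w ! c" unfolding eq by simp
    moreover have "a div 2 = Suc (c div 2)" using 3 by simp
    ultimately show ?thesis using 3 Cons[of c] by auto
  qed (auto simp: eq)
qed

text \<open>
  Tape cells are addressed relative to the head, which stands at cell \<open>B\<close>; then every
  transition is expressed by implications whose premises only concern the state and the cells \<open>B\<close>,
  and no clause has to express that head positions or symbols are unique. The state is treated
  as a symbol of an additional tape \<open>K\<close>.
\<close>

datatype schema =
    KState nat "nat list"
  | KWrite nat "nat list" nat
  | KCopy nat "nat list" nat nat
  | KInit nat nat
  | KStart
  | KWit
  | KBlank
  | KFinal

type_synonym literal = "bool \<times> nat \<times> bool \<times> nat \<times> nat"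

locale tm_schemas =
  fixes M :: turing_machine
  assumes wf: "wf_tm M"
begin

abbreviation K where "K \<equiv> tm_tapes M"

text \<open>Completed by a stationary action in the halting state, so that all runs can be extended
  to the same length \<open>T\<close>.\<close>

definition delta :: "nat \<Rightarrow> nat list \<Rightarrow> nat \<times> (nat \<times> int) list" where
  "delta q ss = (if q = 1 then (1, map (\<lambda>s. (s, 0)) ss) else tm_delta M q ss)"

definition move :: "nat \<Rightarrow> nat list \<Rightarrow> nat \<Rightarrow> int" where
  "move q ss \<tau> = snd (snd (delta q ss) ! \<tau>)"

definition written :: "nat \<Rightarrow> nat list \<Rightarrow> nat \<Rightarrow> nat" where
  "written q ss \<tau> = fst (snd (delta q ss) ! \<tau>)"

definition scans :: "nat list set" where
  "scans = {ss. set ss \<subseteq> {..<tm_symbols M} \<and> length ss = K}"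

text \<open>The set depends on the machine alone. Clauses are the instances of its members at times
  \<open>t\<close> and cells \<open>i\<close>; only the ranges of these two numbers, and which
  instances are valid, vary with the input.\<close>

definition schemas :: "schema set" where
  "schemas = case_prod KState ` ({..<tm_states M} \<times> scans)
     \<union> (\<lambda>(q, ss, \<tau>). KWrite q ss \<tau>) ` ({..<tm_states M} \<times> scans \<times> {..<K})
     \<union> (\<lambda>(q, ss, \<tau>, s). KCopy q ss \<tau> s) ` ({..<tm_states M} \<times> scans \<times> {..<K} \<times> {..<tm_symbols M})
     \<union> case_prod KInit ` ({..<K} \<times> {..<3}) \<union> {KStart, KWit, KBlank, KFinal}"

lemma schemas_iff [simp]:
  "KState q ss \<in> schemas \<longleftrightarrow> q < tm_states M \<and> ss \<in> scans"
  "KWrite q ss \<tau> \<in> schemas \<longleftrightarrow> q < tm_states M \<and> ss \<in> scans \<and> \<tau> < K"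
  "KCopy q ss \<tau> s \<in> schemas \<longleftrightarrow> q < tm_states M \<and> ss \<in> scans \<and> \<tau> < K \<and> s < tm_symbols M"
  "KInit \<tau> s \<in> schemas \<longleftrightarrow> \<tau> < K \<and> s < 3"
  "KStart \<in> schemas" "KWit \<in> schemas" "KBlank \<in> schemas" "KFinal \<in> schemas"
  by (auto simp: schemas_def image_iff)

lemma finite_schemas: "finite schemas"
proof -
  have "finite scans" unfolding scans_def by (rule finite_lists_length_eq) simp
  then show ?thesis unfolding schemas_def by simp
qed

text \<open>A literal \<open>(dt, \<tau>, rel, c, s)\<close> refers to time \<open>t\<close> or \<open>t + 1\<close> and to cell \<open>i + c - 1\<close> or \<open>B + c - 1\<close>.\<close>

definition body_lits :: "nat \<Rightarrow> nat list \<Rightarrow> literal set" where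
  "body_lits q ss = insert (False, K, False, 1, q) ((\<lambda>\<tau>. (False, \<tau>, False, 1, ss ! \<tau>)) ` {..<K})"

text \<open>Offsets are increased by 1 to keep them natural numbers. If the head moves by
  \<open>d\<close>, the new cell \<open>i\<close> holds what was in cell \<open>i + d\<close>, and
  the cell just written, formerly \<open>B\<close>, becomes \<open>B - d\<close>. At time
  \<open>T\<close> tape 0 contains a single bit, and \<open>KFinal\<close> excludes symbol 1, which
  stands for \<open>False\<close>.\<close>

fun neg_lits :: "schema \<Rightarrow> literal set" where
  "neg_lits (KState q ss) = body_lits q ss"
| "neg_lits (KWrite q ss \<tau>) = body_lits q ss"
| "neg_lits (KCopy q ss \<tau> s) = insert (False, \<tau>, True, nat (1 + move q ss \<tau>), s) (body_lits q ss)"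
| "neg_lits KBlank = {(False, 0, True, 1, 0)}"
| "neg_lits KFinal = {(False, 0, True, 1, 1)}"
| "neg_lits _ = {}"

fun pos_lits :: "schema \<Rightarrow> literal set" where
  "pos_lits (KState q ss) = {(True, K, False, 1, fst (delta q ss))}"
| "pos_lits (KWrite q ss \<tau>) = {(True, \<tau>, False, nat (1 - move q ss \<tau>), written q ss \<tau>)}"
| "pos_lits (KCopy q ss \<tau> s) = {(True, \<tau>, True, 1, s)}"
| "pos_lits (KInit \<tau> s) = {(False, \<tau>, True, 1, s)}"
| "pos_lits KStart = {(False, K, False, 1, 0)}"
| "pos_lits KWit = {(False, 0, True, 1, 0), (False, 0, True, 1, 1), (False, 0, True, 1, 2)}"
| "pos_lits KBlank = {(False, 0, True, 2, 0)}"
| "pos_lits KFinal = {}"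

lemma finite_lits: "finite (neg_lits sc)" "finite (pos_lits sc)"
  by (cases sc; simp add: body_lits_def)+

lemma delta:
  assumes "q < tm_states M" "ss \<in> scans"
  shows "fst (delta q ss) < tm_states M" "length (snd (delta q ss)) = K"
    "\<And>\<tau>. \<tau> < K \<Longrightarrow> written q ss \<tau> < tm_symbols M" "\<And>\<tau>. \<tau> < K \<Longrightarrow> move q ss \<tau> \<in> {-1, 0, 1}"
proof -
  obtain q' acts where eq: "delta q ss = (q', acts)" by fastforce
  have "q' < tm_states M \<and> length acts = K \<and> set acts \<subseteq> {..<tm_symbols M} \<times> {-1, 0, 1}"
  proof (cases "q = 1")
    case True
    then show ?thesis using eq assms wf by (auto simp: delta_def scans_def wf_tm_def)
  next
    case False
    then have "tm_delta M q ss = (q', acts)" using eq by (simp add: delta_def)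
    then show ?thesis using wf assms unfolding wf_tm_def scans_def by fastforce
  qed
  then have *: "q' < tm_states M" "length acts = K" "\<And>\<tau>. \<tau> < K \<Longrightarrow> acts ! \<tau> \<in> {..<tm_symbols M} \<times> {-1, 0, 1}"
    by (auto dest: nth_mem)
  show "fst (delta q ss) < tm_states M" "length (snd (delta q ss)) = K" using * eq by auto
  fix \<tau> assume "\<tau> < K"
  from *(3)[OF this] show "written q ss \<tau> < tm_symbols M" "move q ss \<tau> \<in> {-1, 0, 1}"
    by (auto simp: written_def move_def eq)
qed

end

section \<open>The clauses for a fixed input and the runs they describe\<close>

locale tableau = tm_schemas +
  fixes x :: "bool list" and T P :: nat
begin

text \<open>At time \<open>t\<close> the clauses control the cells within distance
  \<open>B - t\<close> of the head. The output cell is at most \<open>T\<close> away from the head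
  at time \<open>T\<close>, which \<open>2 * T\<close> covers; the other summands are the length of
  \<open>pair_string x w\<close> for \<open>length w = P\<close>, which begins in cell
  \<open>B\<close>.\<close>

definition B :: nat where "B = 2 * T + 2 * length x + 2 + P"
definition W :: nat where "W = 2 * B + 1"

text \<open>The initial symbol of a cell, or 3 if it belongs to the witness.\<close>

definition init_symbol :: "nat \<Rightarrow> nat \<Rightarrow> nat" where
  "init_symbol \<tau> i =
     (if \<tau> \<noteq> 0 \<or> i < B then 0
      else if i - B < 2 * length x then (if x ! ((i - B) div 2) then 2 else 1)
      else if i - B = 2 * length x then 1 else if i - B = 2 * length x + 1 then 2
      else if i - B < 2 * length x + 2 + P then 3 else 0)"

text \<open>\<open>KCopy\<close> applies only if the old cell lies in the window and is not the
  scanned one, which is the business of \<open>KWrite\<close>. \<open>KBlank\<close> links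
  consecutive witness cells, so witnesses may be shorter than \<open>P\<close>.\<close>

fun valid :: "schema \<Rightarrow> nat \<Rightarrow> nat \<Rightarrow> bool" where
  "valid (KState q ss) t i \<longleftrightarrow> t < T"
| "valid (KWrite q ss \<tau>) t i \<longleftrightarrow> t < T"
| "valid (KCopy q ss \<tau> s) t i \<longleftrightarrow>
     t < T \<and> 1 \<le> i + nat (1 + move q ss \<tau>) \<and> i + nat (1 + move q ss \<tau>) \<le> W \<and> i + nat (1 + move q ss \<tau>) \<noteq> Suc B"
| "valid (KInit \<tau> s) t i \<longleftrightarrow> t = 0 \<and> init_symbol \<tau> i = s"
| "valid KStart t i \<longleftrightarrow> t = 0"
| "valid KWit t i \<longleftrightarrow> t = 0 \<and> init_symbol 0 i = 3"
| "valid KBlank t i \<longleftrightarrow> t = 0 \<and> init_symbol 0 i = 3 \<and> init_symbol 0 (Suc i) = 3"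
| "valid KFinal t i \<longleftrightarrow> t = T"

definition atom :: "literal \<Rightarrow> nat \<Rightarrow> nat \<Rightarrow> nat \<times> nat \<times> nat \<times> nat" where
  "atom = (\<lambda>(dt, \<tau>, rel, c, s) t i. (if dt then Suc t else t, \<tau>, (if rel then i else B) + c - 1, s))"

definition satisfies :: "(nat \<times> nat \<times> nat \<times> nat \<Rightarrow> bool) \<Rightarrow> bool" where
  "satisfies v \<longleftrightarrow> (\<forall>sc\<in>schemas. \<forall>t\<le>T. \<forall>i<W. valid sc t i \<longrightarrow>
     (\<exists>l\<in>pos_lits sc. v (atom l t i)) \<or> (\<exists>l\<in>neg_lits sc. \<not> v (atom l t i)))"

definition config :: "bool list \<Rightarrow> nat \<Rightarrow> tm_config" where
  "config w t = (tm_step M ^^ t) (tm_init M (pair_string x w))"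

definition state :: "bool list \<Rightarrow> nat \<Rightarrow> nat" where "state w t = fst (config w t)"
definition head :: "bool list \<Rightarrow> nat \<Rightarrow> nat \<Rightarrow> int" where "head w t \<tau> = fst (snd (config w t) ! \<tau>)"
definition tape :: "bool list \<Rightarrow> nat \<Rightarrow> nat \<Rightarrow> int \<Rightarrow> nat" where "tape w t \<tau> = snd (snd (config w t) ! \<tau>)"
definition cell :: "bool list \<Rightarrow> nat \<Rightarrow> nat \<Rightarrow> nat \<Rightarrow> nat" where
  "cell w t \<tau> i = tape w t \<tau> (head w t \<tau> + int i - int B)"
definition scanned :: "bool list \<Rightarrow> nat \<Rightarrow> nat list" where "scanned w t = map (\<lambda>\<tau>. cell w t \<tau> B) [0..<K]"

lemma K_pos: "K > 0" using wf by (simp add: wf_tm_def)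

lemma config_0:
  "state w 0 = 0" "length (snd (config w 0)) = K"
  "\<tau> < K \<Longrightarrow> head w 0 \<tau> = 0"
  "\<tau> < K \<Longrightarrow> tape w 0 \<tau> = (if \<tau> = 0 then string_tape (pair_string x w) else (\<lambda>_. 0))"
  using K_pos by (auto simp: state_def config_def tm_init_def head_def tape_def nth_Cons split: nat.splits)

lemma config_Suc:
  assumes "length (snd (config w t)) = K" "length (snd (delta (state w t) (scanned w t))) = K"
  shows "state w (Suc t) = fst (delta (state w t) (scanned w t))"
    "length (snd (config w (Suc t))) = K"
    "\<tau> < K \<Longrightarrow> head w (Suc t) \<tau> = head w t \<tau> + move (state w t) (scanned w t) \<tau>"
    "\<tau> < K \<Longrightarrow> tape w (Suc t) \<tau> = (tape w t \<tau>)(head w t \<tau> := written (state w t) (scanned w t) \<tau>)"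
proof -
  obtain q ts where eq: "config w t = (q, ts)" by fastforce
  have ss: "map (\<lambda>(h, t). t h) ts = scanned w t"
    using assms(1) eq by (intro nth_equalityI) (auto simp: scanned_def cell_def tape_def head_def case_prod_beta)
  have step: "config w (Suc t) = tm_step M (q, ts)" using eq by (simp add: config_def)
  obtain q' acts where d: "delta q (scanned w t) = (q', acts)" by fastforce
  have len: "length ts = K" "length acts = K" using assms eq d by (auto simp: state_def)
  have next_eq: "config w (Suc t) = (q', map2 (\<lambda>(s, d) (h, t). (h + d, t(h := s))) acts ts)"
  proof (cases "q = 1")
    case True
    then have "acts = map (\<lambda>s. (s, 0)) (map (\<lambda>(h, t). t h) ts)" "q' = 1"
      using d ss by (auto simp: delta_def)
    then have "map2 (\<lambda>(s, d) (h, t). (h + d, t(h := s))) acts ts = ts"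
      by (intro nth_equalityI) (auto simp: case_prod_beta)
    then show ?thesis using step True \<open>q' = 1\<close> by (simp add: tm_step_def)
  next
    case False
    then show ?thesis using step d ss by (simp add: tm_step_def delta_def)
  qed
  show "state w (Suc t) = fst (delta (state w t) (scanned w t))"
    using next_eq d eq by (simp add: state_def)
  show "length (snd (config w (Suc t))) = K" using next_eq len by simp
  show "\<tau> < K \<Longrightarrow> head w (Suc t) \<tau> = head w t \<tau> + move (state w t) (scanned w t) \<tau>"
    "\<tau> < K \<Longrightarrow> tape w (Suc t) \<tau> = (tape w t \<tau>)(head w t \<tau> := written (state w t) (scanned w t) \<tau>)"
    using next_eq len d eq
    by (simp_all add: state_def head_def tape_def move_def written_def case_prod_beta)
qed

lemma config_inv:
  "state w t < tm_states M \<and> length (snd (config w t)) = K \<and> (\<forall>\<tau><K. \<forall>a. tape w t \<tau> a < tm_symbols M)"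
proof (induction t)
  case 0
  have "string_tape y a < tm_symbols M" for y a using wf by (auto simp: string_tape_def wf_tm_def)
  then show ?case using config_0[where w = w] wf by (auto simp: wf_tm_def)
next
  case (Suc t)
  have ss: "scanned w t \<in> scans" using Suc by (auto simp: scans_def scanned_def cell_def)
  note d = delta[OF _ ss, of "state w t"]
  note c = config_Suc[OF _ d(2)]
  from Suc show ?case using d c by auto
qed

lemma scanned_in: "scanned w t \<in> scans"
  using config_inv[of w t] by (auto simp: scans_def scanned_def cell_def)

lemma delta_config:
  "fst (delta (state w t) (scanned w t)) < tm_states M"
  "length (snd (delta (state w t) (scanned w t))) = K"
  "\<tau> < K \<Longrightarrow> written (state w t) (scanned w t) \<tau> < tm_symbols M"
  "\<tau> < K \<Longrightarrow> move (state w t) (scanned w t) \<tau> \<in> {-1, 0, 1}"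
  using delta[OF conjunct1[OF config_inv[of w t]] scanned_in[of w t]] by auto

lemmas config_step = config_Suc[OF conjunct1[OF conjunct2[OF config_inv]] delta_config(2)]

lemma head_bound: "\<tau> < K \<Longrightarrow> \<bar>head w t \<tau>\<bar> \<le> int t"
proof (induction t)
  case (Suc t)
  then show ?case using config_step(3)[of \<tau> w t] delta_config(4)[of \<tau> w t] by auto
qed (simp add: config_0)

lemma cell_Suc:
  assumes "\<tau> < K" "i + nat (1 + move (state w t) (scanned w t) \<tau>) \<ge> 1"
  shows "cell w (Suc t) \<tau> i =
    (if i + nat (1 + move (state w t) (scanned w t) \<tau>) = Suc B then written (state w t) (scanned w t) \<tau>
     else cell w t \<tau> (i + nat (1 + move (state w t) (scanned w t) \<tau>) - 1))"
proof -
  define d where "d = move (state w t) (scanned w t) \<tau>"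
  have d: "d \<in> {-1, 0, 1}" using delta_config(4)[OF assms(1)] by (simp add: d_def)
  then have "int (i + nat (1 + d) - 1) = int i + d" using assms(2) by (auto simp: d_def[symmetric])
  moreover have "i + nat (1 + d) = Suc B \<longleftrightarrow> int i + d = int B" using d by auto
  ultimately show ?thesis
    using config_step(3,4)[OF assms(1), of w t] by (auto simp: cell_def d_def[symmetric] algebra_simps)
qed

lemma init_symbol:
  assumes "\<tau> < K" "length w \<le> P" "init_symbol \<tau> i \<noteq> 3"
  shows "cell w 0 \<tau> i = init_symbol \<tau> i"
  using assms config_0(3,4)[OF assms(1), of w]
  by (auto simp: cell_def init_symbol_def string_tape_def length_pair_string pair_string_nth nat_diff_distrib'
      split: if_splits)

lemma witness_symbol:
  assumes "length w \<le> P" "init_symbol 0 i = 3"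
  defines "a \<equiv> i - (B + 2 * length x + 2)"
  shows "i = B + 2 * length x + 2 + a \<and> a < P \<and>
    cell w 0 0 i = (if a < length w then (if w ! a then 2 else 1) else 0)"
proof -
  have i: "i \<ge> B" "i - B \<ge> 2 * length x + 2" "i - B < 2 * length x + 2 + P"
    using assms(2) by (auto simp: init_symbol_def split: if_splits)
  then have eq: "i = B + 2 * length x + 2 + a" "a < P" by (auto simp: a_def)
  have "nat (int i - int B) = 2 * length x + 2 + a" using eq by simp
  then show ?thesis using eq config_0(3,4)[OF K_pos, of w]
    by (auto simp: cell_def string_tape_def length_pair_string pair_string_nth)
qed

text \<open>The true atoms are the facts of the run on \<open>w\<close>. Witness cells beyond
  \<open>length w\<close> are blank, as permitted by \<open>KWit\<close> and
  \<open>KBlank\<close>.\<close>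

lemma satisfies_run:
  assumes "length w \<le> P" and acc: "\<And>i. i < W \<Longrightarrow> cell w T 0 i \<noteq> 1"
  shows "satisfies (\<lambda>(t, \<tau>, i, s). s = (if \<tau> = K then state w t else cell w t \<tau> i))"
    (is "satisfies ?v")
proof (unfold satisfies_def, intro ballI allI impI)
  fix sc t i assume sc: "sc \<in> schemas" and t: "t \<le> T" and i: "i < W" and valid: "valid sc t i"
  \<comment> \<open>An instance made for another state or for other scanned symbols has a false
    premise.\<close>
  have prem: "(\<exists>l\<in>body_lits q ss. \<not> ?v (atom l t i)) \<or> (state w t = q \<and> scanned w t = ss)"
    if "ss \<in> scans" for q ss
  proof (rule disjCI)
    assume no: "\<not> (state w t = q \<and> scanned w t = ss)"
    show "\<exists>l\<in>body_lits q ss. \<not> ?v (atom l t i)"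
    proof (cases "state w t = q")
      case False
      then show ?thesis by (auto simp: body_lits_def atom_def)
    next
      case True
      with no have "scanned w t \<noteq> ss" by simp
      moreover have "length (scanned w t) = K" "length ss = K" using that by (auto simp: scanned_def scans_def)
      ultimately obtain \<tau> where \<tau>: "\<tau> < K" "scanned w t ! \<tau> \<noteq> ss ! \<tau>" by (metis nth_equalityI)
      then have "\<not> ?v (atom (False, \<tau>, False, 1, ss ! \<tau>) t i)" by (auto simp: atom_def scanned_def)
      moreover have "(False, \<tau>, False, 1, ss ! \<tau>) \<in> body_lits q ss" using \<tau> by (auto simp: body_lits_def)
      ultimately show ?thesis by (rule bexI)
    qed
  qed
  show "(\<exists>l\<in>pos_lits sc. ?v (atom l t i)) \<or> (\<exists>l\<in>neg_lits sc. \<not> ?v (atom l t i))"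
  proof (cases sc)
    case (KState q ss)
    then have "ss \<in> scans" using sc by auto
    from prem[OF this, of q] show ?thesis
      using KState config_step(1)[of w t] by (auto simp: atom_def)
  next
    case (KWrite q ss \<tau>)
    then have ss: "ss \<in> scans" and \<tau>: "\<tau> < K" using sc by auto
    show ?thesis
    proof (cases "state w t = q \<and> scanned w t = ss")
      case True
      have m: "move q ss \<tau> \<in> {-1, 0, 1}" using delta_config(4)[OF \<tau>, of w t] True by simp
      have "B > 0" by (simp add: B_def)
      then have "B + nat (1 - move q ss \<tau>) - 1 + nat (1 + move q ss \<tau>) = Suc B" using m by auto
      then have "cell w (Suc t) \<tau> (B + nat (1 - move q ss \<tau>) - 1) = written q ss \<tau>"
        using cell_Suc[OF \<tau>, of "B + nat (1 - move q ss \<tau>) - 1" w t] True by simp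
      then show ?thesis using KWrite \<tau> by (auto simp: atom_def)
    qed (use prem[OF ss, of q] KWrite in auto)
  next
    case (KCopy q ss \<tau> s)
    then have ss: "ss \<in> scans" and \<tau>: "\<tau> < K" using sc by auto
    show ?thesis
    proof (cases "state w t = q \<and> scanned w t = ss")
      case True
      then have "cell w (Suc t) \<tau> i = cell w t \<tau> (i + nat (1 + move q ss \<tau>) - 1)"
        using cell_Suc[OF \<tau>, of i w t] valid KCopy by auto
      then show ?thesis using KCopy \<tau> by (auto simp: atom_def)
    qed (use prem[OF ss, of q] KCopy in auto)
  next
    case (KInit \<tau> s)
    then have "\<tau> < K" "s < 3" using sc by auto
    then show ?thesis using KInit valid init_symbol[OF _ assms(1), of \<tau> i] by (auto simp: atom_def)
  next
    case KStart
    then show ?thesis using valid config_0(1) by (auto simp: atom_def)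
  next
    case KWit
    then show ?thesis using valid K_pos witness_symbol[OF assms(1), of i]
      by (auto simp: atom_def split: if_splits)
  next
    case KBlank
    then have "init_symbol 0 i = 3" "init_symbol 0 (Suc i) = 3" "t = 0" using valid by auto
    from this witness_symbol[OF assms(1) this(1)] witness_symbol[OF assms(1) this(2)]
    show ?thesis using KBlank K_pos by (auto simp: atom_def split: if_splits)
  next
    case KFinal
    then show ?thesis using valid acc[OF i] K_pos by (auto simp: atom_def)
  qed
qed

text \<open>A satisfying valuation may declare several symbols for one cell. It is enough that those
  of some actual run are among them: premises occur only negatively, so every clause about this run
  still fires. The controlled window loses one cell at both ends per step.\<close>

lemma run_satisfies:
  assumes "satisfies v"
  obtains w where "length w \<le> P" "\<And>t \<tau> i. \<tau> < K \<Longrightarrow> t \<le> T \<Longrightarrow> \<bar>int i - int B\<bar> \<le> int B - int t \<Longrightarrow>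
    v (t, \<tau>, i, cell w t \<tau> i)"
proof -
  have clause: "(\<exists>l\<in>pos_lits sc. v (atom l t i)) \<or> (\<exists>l\<in>neg_lits sc. \<not> v (atom l t i))"
    if "sc \<in> schemas" "t \<le> T" "i < W" "valid sc t i" for sc t i
    using assms that unfolding satisfies_def by blast
  let ?c = "\<lambda>a. B + 2 * length x + 2 + a"
  have isym: "init_symbol 0 (?c a) = 3" if "a < P" for a using that by (simp add: init_symbol_def)
  have cW: "?c a < W" if "a < P" for a using that by (simp add: W_def B_def)
  have wit: "v (0, 0, ?c a, 0) \<or> v (0, 0, ?c a, 1) \<or> v (0, 0, ?c a, 2)" if "a < P" for a
    using clause[of KWit 0 "?c a"] isym[OF that] cW[OF that] by (auto simp: atom_def)
  have blank: "v (0, 0, ?c (Suc a), 0)" if "v (0, 0, ?c a, 0)" "Suc a < P" for a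
    using clause[of KBlank 0 "?c a"] isym[of a] isym[of "Suc a"] cW[of a] that by (auto simp: atom_def)
  \<comment> \<open>The witness ends before the first cell for which the blank is declared;
    \<open>KBlank\<close> propagates the blank to all later ones.\<close>
  define m where "m = (LEAST a. a = P \<or> (a < P \<and> v (0, 0, ?c a, 0)))"
  have m: "m = P \<or> (m < P \<and> v (0, 0, ?c m, 0))" unfolding m_def by (rule LeastI[of _ P]) simp
  then have "m \<le> P" by auto
  have before: "\<not> v (0, 0, ?c a, 0)" if "a < m" for a
    using that not_less_Least[of a "\<lambda>a. a = P \<or> (a < P \<and> v (0, 0, ?c a, 0))"] \<open>m \<le> P\<close>
    unfolding m_def[symmetric] by auto
  have after: "v (0, 0, ?c a, 0)" if "m \<le> a" "a < P" for a
    using that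
  proof (induction a)
    case (Suc a)
    then show ?case using blank[of a] m by (cases "m = Suc a") auto
  qed (use m in auto)
  \<comment> \<open>Before \<open>m\<close> the blank is not declared, so by \<open>KWit\<close>
    symbol 1 or 2 is; where both are, 2 wins.\<close>
  define w where "w = map (\<lambda>a. v (0, 0, ?c a, 2)) [0..<m]"
  have lw: "length w \<le> P" using \<open>m \<le> P\<close> by (simp add: w_def)
  have init: "v (0, \<tau>, i, cell w 0 \<tau> i)" if \<tau>: "\<tau> < K" and i: "i < W" for \<tau> i
  proof (cases "init_symbol \<tau> i = 3")
    case False
    have "init_symbol \<tau> i < 3" using False by (auto simp: init_symbol_def split: if_splits)
    then show ?thesis
      using clause[of "KInit \<tau> (init_symbol \<tau> i)" 0 i] init_symbol[OF \<tau> lw False] \<tau> i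
      by (auto simp: atom_def)
  next
    case True
    then have "\<tau> = 0" by (auto simp: init_symbol_def split: if_splits)
    define a where "a = i - (B + 2 * length x + 2)"
    have a: "i = ?c a" "a < P" "cell w 0 0 i = (if a < m then (if v (0, 0, ?c a, 2) then 2 else 1) else 0)"
      using witness_symbol[OF lw, of i] True \<open>\<tau> = 0\<close> by (auto simp: a_def w_def)
    show ?thesis using a wit[OF a(2)] before[of a] after[of a] \<open>\<tau> = 0\<close> by (auto split: if_splits)
  qed
  have main: "v (t, K, B, state w t) \<and> (\<forall>\<tau><K. \<forall>i. \<bar>int i - int B\<bar> \<le> int B - int t \<longrightarrow> v (t, \<tau>, i, cell w t \<tau> i))"
    if "t \<le> T" for t
    using that
  proof (induction t)
    case 0
    have "v (0, K, B, 0)" using clause[of KStart 0 0] by (auto simp: atom_def W_def)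
    moreover have "i < W" if "\<bar>int i - int B\<bar> \<le> int B" for i using that by (simp add: W_def)
    ultimately show ?case using init config_0(1) by auto
  next
    case (Suc t)
    define q where "q = state w t"
    define ss where "ss = scanned w t"
    have q: "q < tm_states M" using config_inv[of w t] by (simp add: q_def)
    have ss: "ss \<in> scans" using scanned_in by (simp add: ss_def)
    have TB: "int t < int B" using Suc.prems by (simp add: B_def)
    have st: "v (t, K, B, q)" using Suc by (simp add: q_def)
    have ce: "v (t, \<tau>, i, cell w t \<tau> i)" if "\<tau> < K" "\<bar>int i - int B\<bar> \<le> int B - int t" for \<tau> i
      using Suc that by auto
    have prem: "v (atom l t i)" if "l \<in> body_lits q ss" for l i
      using that st ce[of _ B] TB by (auto simp: body_lits_def atom_def ss_def scanned_def)
    have "v (Suc t, K, B, state w (Suc t))"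
      using clause[of "KState q ss" t 0] q ss prem[of _ 0] Suc.prems config_step(1)[of w t]
      by (auto simp: atom_def W_def q_def[symmetric] ss_def[symmetric])
    moreover have "v (Suc t, \<tau>, i, cell w (Suc t) \<tau> i)"
      if \<tau>: "\<tau> < K" and i: "\<bar>int i - int B\<bar> \<le> int B - int (Suc t)" for \<tau> i
    proof -
      define d where "d = move q ss \<tau>"
      have d: "d \<in> {-1, 0, 1}" using delta_config(4)[OF \<tau>, of w t] by (simp add: d_def q_def ss_def)
      have iW: "i < W" "i + nat (1 + d) \<ge> 1" "i + nat (1 + d) \<le> W" using i d by (auto simp: W_def)
      have cell: "cell w (Suc t) \<tau> i = (if i + nat (1 + d) = Suc B then written q ss \<tau> else cell w t \<tau> (i + nat (1 + d) - 1))"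
        using cell_Suc[OF \<tau>, of i w t] iW(2) by (simp add: d_def q_def ss_def)
      show ?thesis
      proof (cases "i + nat (1 + d) = Suc B")
        case True
        then have "i = B + nat (1 - d) - 1" using d TB by auto
        then show ?thesis
          using clause[of "KWrite q ss \<tau>" t 0] q ss \<tau> prem[of _ 0] Suc.prems cell True
          by (auto simp: atom_def W_def d_def[symmetric])
      next
        case False
        have "v (t, \<tau>, i + nat (1 + d) - 1, cell w t \<tau> (i + nat (1 + d) - 1))"
          using i d iW(2) by (intro ce \<tau>) auto
        moreover have "cell w t \<tau> (i + nat (1 + d) - 1) < tm_symbols M"
          using config_inv[of w t] \<tau> by (simp add: cell_def)
        ultimately show ?thesis
          using clause[of "KCopy q ss \<tau> (cell w (Suc t) \<tau> i)" t i] q ss \<tau> prem[of _ i] Suc.prems cell False iW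
          by (auto simp: atom_def d_def[symmetric])
      qed
    qed
    ultimately show ?case by blast
  qed
  show thesis using that[OF lw] main by blast
qed

lemma satisfiable_iff:
  assumes "\<And>w. length w \<le> P \<Longrightarrow> \<exists>t\<le>T. \<exists>ts. (tm_step M ^^ t) (tm_init M (pair_string x w)) = (1, ts) \<and>
     snd (hd ts) = string_tape [V (pair_string x w)]"
  shows "(\<exists>v. satisfies v) \<longleftrightarrow> (\<exists>w. length w \<le> P \<and> V (pair_string x w))"
proof -
  have final: "tape w T 0 = string_tape [V (pair_string x w)]" if w: "length w \<le> P" for w
  proof -
    obtain t ts where t: "t \<le> T" "config w t = (1, ts)" "snd (hd ts) = string_tape [V (pair_string x w)]"
      using assms[OF w] by (auto simp: config_def)
    have stay: "(tm_step M ^^ d) (1, ts) = (1, ts)" for d by (induction d) (auto simp: tm_step_def)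
    have "config w T = (tm_step M ^^ (T - t)) (config w t)"
      using t(1) by (simp add: config_def funpow_add[symmetric, THEN fun_cong, simplified])
    then have "config w T = (1, ts)" using t(2) stay by simp
    moreover have "ts \<noteq> []" using config_inv[of w T] K_pos calculation by auto
    ultimately show ?thesis using t(3) by (simp add: tape_def hd_conv_nth)
  qed
  show ?thesis
  proof
    assume "\<exists>v. satisfies v"
    then obtain v where v: "satisfies v" by blast
    obtain w where w: "length w \<le> P" "\<And>t \<tau> i. \<tau> < K \<Longrightarrow> t \<le> T \<Longrightarrow> \<bar>int i - int B\<bar> \<le> int B - int t \<Longrightarrow>
        v (t, \<tau>, i, cell w t \<tau> i)"
      using run_satisfies[OF v] by metis
    have "V (pair_string x w)"
    proof (rule ccontr)
      assume no: "\<not> V (pair_string x w)"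
      \<comment> \<open>The relative address, at time \<open>T\<close>, of tape cell 0, where the
        output bit stands.\<close>
      define i where "i = nat (int B - head w T 0)"
      have h: "\<bar>head w T 0\<bar> \<le> int T" using head_bound[OF K_pos] .
      then have i: "int i = int B - head w T 0" by (simp add: i_def B_def)
      have "cell w T 0 i = 1" using final[OF w(1)] no i by (simp add: cell_def string_tape_def)
      moreover have "v (T, 0, i, cell w T 0 i)" using w(2)[OF K_pos, of T i] h i by (simp add: B_def)
      moreover have "i < W" using h i by (simp add: W_def B_def)
      ultimately show False using v unfolding satisfies_def
        by (auto dest!: bspec[of _ _ KFinal] simp: atom_def)
    qed
    with w(1) show "\<exists>w. length w \<le> P \<and> V (pair_string x w)" by blast
  next
    assume "\<exists>w. length w \<le> P \<and> V (pair_string x w)"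
    then obtain w where w: "length w \<le> P" "V (pair_string x w)" by blast
    have "cell w T 0 i \<noteq> 1" for i using final[OF w(1)] w(2) by (auto simp: cell_def string_tape_def)
    from satisfies_run[OF w(1) this] show "\<exists>v. satisfies v" by blast
  qed
qed

text \<open>The numbering of atoms by mixed radix digits is injective on this range.\<close>

lemma atom_range:
  assumes sc: "sc \<in> schemas" "t \<le> T" "i < W" "valid sc t i" "l \<in> pos_lits sc \<union> neg_lits sc"
  shows "atom l t i \<in> {..T} \<times> {..K} \<times> {..<W} \<times> {..<tm_states M + tm_symbols M}"
proof -
  have sym: "3 \<le> tm_symbols M" "2 \<le> tm_states M" using wf by (auto simp: wf_tm_def)
  have BW: "B < W" "B + 1 < W" by (auto simp: W_def B_def)
  have prem: "atom l t i \<in> {..T} \<times> {..K} \<times> {..<W} \<times> {..<tm_states M + tm_symbols M}"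
    if "q < tm_states M" "ss \<in> scans" "l \<in> body_lits q ss" for q ss l
  proof -
    from that(3) consider "l = (False, K, False, 1, q)" | \<tau> where "\<tau> < K" "l = (False, \<tau>, False, 1, ss ! \<tau>)"
      by (auto simp: body_lits_def)
    then show ?thesis
    proof cases
      case 2
      then have "ss ! \<tau> \<in> set ss" using that(2) by (simp add: scans_def)
      then have "ss ! \<tau> < tm_symbols M" using that(2) by (auto simp: scans_def)
      then show ?thesis using 2 BW sc(2) by (simp add: atom_def)
    qed (use that(1) BW sc(2) in \<open>simp add: atom_def\<close>)
  qed
  show ?thesis
  proof (cases sc)
    case (KState q ss)
    then have *: "q < tm_states M" "ss \<in> scans" using sc by auto
    show ?thesis
    proof (cases "l \<in> body_lits q ss")
      case False
      then show ?thesis using KState sc delta(1)[OF *] BW by (auto simp: atom_def)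
    qed (rule prem[OF *])
  next
    case (KWrite q ss \<tau>)
    then have *: "q < tm_states M" "ss \<in> scans" "\<tau> < K" using sc by auto
    show ?thesis
    proof (cases "l \<in> body_lits q ss")
      case False
      then show ?thesis using KWrite sc delta(3,4)[OF *] BW *(3) by (auto simp: atom_def)
    qed (rule prem[OF *(1,2)])
  next
    case (KCopy q ss \<tau> s)
    then have *: "q < tm_states M" "ss \<in> scans" "\<tau> < K" "s < tm_symbols M" using sc by auto
    show ?thesis
    proof (cases "l \<in> body_lits q ss")
      case False
      then show ?thesis using KCopy sc * by (auto simp: atom_def)
    qed (rule prem[OF *(1,2)])
  next
    case KBlank
    then have "init_symbol 0 (Suc i) = 3" using sc by auto
    then have "Suc i < W" by (auto simp: init_symbol_def W_def B_def split: if_splits)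
    then show ?thesis using KBlank sc sym by (auto simp: atom_def)
  qed (use sc sym BW in \<open>auto simp: atom_def\<close>)
qed

text \<open>Within one clause, literals of different sign refer to different times or cells. So a
  matrix entry never asks for both kinds of literal, and its box type is well defined.\<close>

lemma pos_neg_disjoint:
  assumes "l \<in> pos_lits sc" "l' \<in> neg_lits sc" shows "atom l t i \<noteq> atom l' t i"
  using assms by (cases sc) (auto simp: atom_def body_lits_def)

end

section \<open>The boxes\<close>

text \<open>
  A box is a plane bipartite graph with the vertices \<open>{..<108}\<close>, even ones being clauses and odd ones
  variables. Its vertices \<open>{..<8}\<close> are ports, clockwise from the top: variables enter at 0 (from above),
  2 (from the right), 4 (from below), 6 (from the left) and leave at 1, 3, 5, 7.
  The neighbour 108 of a port stands for its neighbour outside the box.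

  If every clause has exactly one true neighbour, then 0 and 5 carry a common value \<open>v\<close>, 6 and 7 a
  value \<open>h\<close>, and 2 and 3 a value \<open>h'\<close>, where, depending on the type of the box, \<open>h' = h\<close> (type 0),
  \<open>h' \<in> {h, h \<or> v}\<close> (type 1), \<open>h' \<in> {h, h \<or> \<not> v}\<close> (type 2), or \<open>h = 1\<close> and \<open>h' = 0\<close> (type 3).
  The boxes were found by a computer search over small plane graphs. All tables are functions of the type
  and an index, written as search trees so that the simplifier evaluates them quickly.
\<close>

definition box_nbrs_0 :: "nat \<Rightarrow> nat list" where
  "box_nbrs_0 k =
    (if k < 54 then
     (if k < 30 then
      (if k < 18 then
       (if k < 12 then
        (if k < 6 then
         [[95, 107, 108], [102, 106, 108], [85, 105, 108], [80, 88, 108], [81, 103, 108], [86, 90, 108]] ! k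
        else
         [[9, 97, 108], [92, 94, 108], [9, 11, 97], [6, 8, 94], [11, 13, 97], [8, 10, 22]] ! (k - 6))
       else
        [[13, 15, 91], [10, 12, 22], [15, 17, 19], [12, 14, 16], [15, 31, 91], [14, 18, 98]] ! (k - 12))
      else
       (if k < 24 then
        [[17, 21, 29], [14, 86, 98], [21, 23, 29], [18, 20, 98], [11, 13, 25], [20, 86, 90]] ! (k - 18)
       else
        [[25, 27, 89], [22, 24, 26], [25, 33, 89], [24, 28, 30], [27, 91, 99], [18, 20, 90]] ! (k - 24)))
     else
      (if k < 42 then
       (if k < 36 then
        [[27, 89, 99], [16, 34, 100], [33, 35, 39], [26, 32, 40], [31, 37, 41], [32, 38, 40]] ! (k - 30)
       else
        [[37, 53, 99], [34, 36, 104], [35, 45, 47], [32, 92, 94], [33, 35, 43], [34, 100, 104]] ! (k - 36))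
      else
       (if k < 48 then
        [[43, 51, 53], [40, 42, 46], [45, 95, 107], [38, 44, 82], [43, 49, 95], [38, 82, 92]] ! (k - 42)
       else
        [[49, 59, 101], [46, 48, 52], [51, 59, 103], [42, 50, 100], [49, 55, 93], [36, 42, 104]] ! (k - 48))))
    else
     (if k < 84 then
      (if k < 72 then
       (if k < 66 then
        (if k < 60 then
         [[55, 57, 93], [52, 54, 106], [57, 93, 101], [54, 56, 70], [59, 61, 75], [48, 50, 58]] ! (k - 54)
        else
         [[61, 63, 87], [58, 60, 66], [63, 65, 87], [60, 62, 68], [65, 67, 69], [62, 64, 76]] ! (k - 60))
       else
        [[61, 75, 77], [64, 70, 76], [63, 71, 73], [64, 102, 106], [57, 67, 101], [68, 96, 102]] ! (k - 66))
      else
       (if k < 78 then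
        [[73, 85, 105], [68, 72, 96], [75, 79, 83], [58, 66, 74], [65, 67, 87], [66, 80, 88]] ! (k - 72)
       else
        [[79, 81, 83], [74, 78, 84], [3, 77, 105], [4, 78, 84], [45, 47, 107], [74, 78, 88]] ! (k - 78)))
     else
      (if k < 96 then
       (if k < 90 then
        [[79, 81, 103], [2, 72, 96], [5, 19, 23], [60, 62, 76], [3, 77, 83], [24, 26, 30]] ! (k - 84)
       else
        [[5, 23, 29], [12, 16, 28], [7, 39, 47], [52, 54, 56], [7, 9, 39], [0, 44, 46]] ! (k - 90))
      else
       (if k < 102 then
        [[71, 73, 85], [6, 8, 10], [17, 19, 21], [28, 30, 36], [31, 41, 51], [48, 56, 70]] ! (k - 96)
       else
        [[1, 69, 71], [4, 50, 84], [37, 41, 53], [2, 72, 80], [1, 55, 69], [0, 44, 82]] ! (k - 102)))))"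

definition box_nbrs_1 :: "nat \<Rightarrow> nat list" where
  "box_nbrs_1 k =
    (if k < 54 then
     (if k < 30 then
      (if k < 18 then
       (if k < 12 then
        (if k < 6 then
         [[91, 101, 108], [80, 90, 108], [85, 107, 108], [74, 96, 108], [43, 103, 108], [18, 104, 108]] ! k
        else
         [[9, 17, 108], [78, 94, 108], [9, 11, 75], [6, 8, 94], [11, 13, 75], [8, 10, 94]] ! (k - 6))
       else
        [[13, 15, 21], [10, 12, 106], [15, 21, 105], [12, 14, 16], [15, 19, 105], [6, 104, 106]] ! (k - 12))
      else
       (if k < 24 then
        [[5, 19, 87], [16, 18, 104], [21, 23, 89], [12, 14, 20], [23, 25, 89], [20, 22, 78]] ! (k - 18)
       else
        [[25, 27, 89], [22, 24, 32], [27, 29, 45], [24, 26, 30], [29, 31, 87], [26, 28, 34]] ! (k - 24)))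
     else
      (if k < 42 then
       (if k < 36 then
        [[27, 33, 45], [28, 38, 92], [25, 35, 95], [30, 86, 88], [29, 37, 39], [32, 36, 44]] ! (k - 30)
       else
        [[35, 95, 101], [34, 40, 86], [31, 41, 43], [34, 86, 88], [37, 87, 105], [38, 50, 98]] ! (k - 36))
      else
       (if k < 48 then
        [[43, 47, 103], [4, 38, 42], [35, 49, 101], [26, 30, 88], [47, 51, 81], [42, 46, 48]] ! (k - 42)
       else
        [[47, 81, 103], [44, 58, 92], [41, 53, 99], [46, 52, 98], [51, 55, 57], [50, 54, 60]] ! (k - 48))))
    else
     (if k < 84 then
      (if k < 72 then
       (if k < 66 then
        (if k < 60 then
         [[53, 59, 97], [52, 56, 98], [55, 61, 63], [52, 74, 96], [49, 65, 67], [54, 62, 64]] ! (k - 54)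
        else
         [[53, 69, 97], [56, 68, 102], [59, 77, 99], [56, 76, 102], [59, 77, 97], [58, 66, 82]] ! (k - 60))
       else
        [[65, 71, 91], [58, 82, 92], [61, 73, 93], [60, 76, 100], [71, 91, 99], [66, 70, 82]] ! (k - 66))
      else
       (if k < 78 then
        [[73, 85, 93], [68, 72, 90], [3, 57, 107], [8, 10, 106], [63, 69, 79], [62, 64, 80]] ! (k - 72)
       else
        [[7, 23, 95], [76, 100, 102], [1, 77, 83], [46, 48, 96], [65, 67, 71], [80, 90, 100]] ! (k - 78)))
     else
      (if k < 96 then
       (if k < 90 then
        [[85, 93, 107], [2, 72, 84], [33, 37, 39], [18, 28, 40], [33, 39, 45], [20, 22, 24]] ! (k - 84)
       else
        [[1, 73, 83], [0, 66, 70], [31, 49, 67], [68, 72, 84], [7, 9, 11], [32, 36, 78]] ! (k - 90))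
      else
       (if k < 102 then
        [[3, 57, 81], [54, 60, 64], [41, 51, 55], [50, 62, 70], [69, 79, 83], [0, 36, 44]] ! (k - 96)
       else
        [[61, 63, 79], [4, 42, 48], [5, 17, 19], [14, 16, 40], [13, 17, 75], [2, 74, 84]] ! (k - 102)))))"

definition box_nbrs_2 :: "nat \<Rightarrow> nat list" where
  "box_nbrs_2 k =
    (if k < 54 then
     (if k < 30 then
      (if k < 18 then
       (if k < 12 then
        (if k < 6 then
         [[89, 107, 108], [86, 106, 108], [91, 101, 108], [54, 78, 108], [95, 97, 108], [8, 12, 108]] ! k
        else
         [[9, 13, 108], [90, 100, 108], [5, 9, 11], [6, 8, 102], [11, 15, 17], [8, 10, 12]] ! (k - 6))
       else
        [[5, 11, 17], [6, 100, 102], [15, 21, 103], [10, 14, 18], [17, 19, 27], [10, 12, 16]] ! (k - 12))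
      else
       (if k < 24 then
        [[15, 23, 103], [16, 20, 30], [19, 25, 105], [14, 24, 98], [23, 35, 103], [18, 22, 94]] ! (k - 18)
       else
        [[21, 29, 41], [20, 26, 34], [25, 37, 105], [16, 52, 92], [29, 31, 87], [24, 28, 38]] ! (k - 24)))
     else
      (if k < 42 then
       (if k < 36 then
        [[19, 33, 95], [28, 94, 98], [33, 39, 69], [30, 32, 40], [25, 43, 89], [22, 94, 98]] ! (k - 30)
       else
        [[37, 53, 107], [26, 36, 64], [29, 47, 87], [32, 42, 48], [33, 45, 57], [24, 44, 102]] ! (k - 36))
      else
       (if k < 48 then
        [[39, 55, 69], [34, 46, 56], [41, 49, 51], [40, 50, 84], [43, 67, 89], [38, 92, 96]] ! (k - 42)
       else
        [[39, 61, 99], [44, 90, 100], [45, 59, 81], [44, 90, 96], [27, 63, 83], [36, 64, 84]] ! (k - 48))))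
    else
     (if k < 84 then
      (if k < 72 then
       (if k < 66 then
        (if k < 60 then
         [[3, 55, 99], [42, 54, 78], [43, 67, 83], [40, 66, 88], [59, 65, 81], [50, 58, 88]] ! (k - 54)
        else
         [[61, 95, 97], [48, 60, 62], [61, 97, 99], [52, 96, 104], [37, 53, 105], [58, 66, 88]] ! (k - 60))
       else
        [[57, 65, 79], [46, 56, 104], [69, 71, 93], [32, 42, 68], [71, 73, 75], [68, 70, 72]] ! (k - 66))
      else
       (if k < 78 then
        [[71, 77, 93], [70, 80, 86], [75, 91, 101], [70, 74, 80], [77, 79, 93], [72, 76, 82]] ! (k - 72)
       else
        [[3, 55, 91], [66, 76, 82], [73, 75, 101], [50, 58, 106], [77, 79, 85], [52, 56, 104]] ! (k - 78)))
     else
      (if k < 96 then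
       (if k < 90 then
        [[45, 53, 107], [82, 86, 106], [1, 73, 85], [28, 38, 92], [57, 59, 65], [0, 34, 46]] ! (k - 84)
       else
        [[7, 49, 51], [2, 74, 78], [27, 47, 87], [68, 72, 76], [23, 31, 35], [4, 30, 60]] ! (k - 90))
      else
       (if k < 102 then
        [[47, 51, 63], [4, 60, 62], [21, 31, 35], [48, 54, 62], [7, 13, 49], [2, 74, 80]] ! (k - 96)
       else
        [[9, 13, 41], [14, 18, 22], [63, 67, 83], [20, 26, 64], [1, 81, 85], [0, 36, 84]] ! (k - 102)))))"

definition box_nbrs_3 :: "nat \<Rightarrow> nat list" where
  "box_nbrs_3 k =
    (if k < 54 then
     (if k < 30 then
      (if k < 18 then
       (if k < 12 then
        (if k < 6 then
         [[53, 55, 108], [86, 88, 108], [25, 35, 108], [34, 50, 108], [99, 105, 108], [78, 84, 108]] ! k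
        else
         [[9, 11, 108], [20, 22, 108], [9, 21, 23], [6, 8, 10], [9, 13, 23], [6, 18, 22]] ! (k - 6))
       else
        [[13, 15, 19], [10, 12, 18], [15, 17, 19], [12, 14, 16], [15, 21, 23], [14, 20, 22]] ! (k - 12))
      else
       (if k < 24 then
        [[11, 13, 19], [12, 14, 18], [7, 17, 21], [8, 16, 20], [7, 11, 17], [8, 10, 16]] ! (k - 18)
       else
        [[25, 27, 35], [2, 24, 32], [27, 29, 31], [24, 26, 32], [29, 31, 33], [26, 28, 32]] ! (k - 24)))
     else
      (if k < 42 then
       (if k < 36 then
        [[31, 33, 35], [26, 28, 30], [25, 27, 29], [28, 30, 34], [3, 33, 37], [2, 24, 30]] ! (k - 30)
       else
        [[37, 39, 49], [34, 36, 48], [39, 41, 49], [36, 38, 40], [39, 41, 43], [38, 40, 50]] ! (k - 36))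
      else
       (if k < 48 then
        [[43, 45, 51], [40, 42, 46], [45, 47, 51], [42, 44, 48], [43, 47, 51], [44, 46, 48]] ! (k - 42)
       else
        [[37, 45, 47], [36, 38, 50], [3, 41, 49], [42, 44, 46], [53, 55, 57], [0, 52, 54]] ! (k - 48))))
    else
     (if k < 84 then
      (if k < 72 then
       (if k < 66 then
        (if k < 60 then
         [[53, 59, 61], [0, 52, 56], [55, 57, 63], [52, 56, 58], [57, 59, 63], [54, 58, 60]] ! (k - 54)
        else
         [[59, 61, 63], [54, 60, 62], [61, 65, 67], [56, 58, 60], [65, 67, 69], [62, 64, 66]] ! (k - 60))
       else
        [[65, 71, 73], [62, 64, 68], [67, 69, 75], [64, 68, 70], [69, 71, 75], [66, 70, 72]] ! (k - 66))
      else
       (if k < 78 then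
        [[71, 73, 75], [66, 72, 74], [73, 77, 79], [68, 70, 72], [77, 79, 81], [74, 76, 78]] ! (k - 72)
       else
        [[5, 77, 83], [74, 76, 80], [79, 81, 85], [76, 80, 82], [81, 83, 85], [78, 82, 84]] ! (k - 78)))
     else
      (if k < 96 then
       (if k < 90 then
        [[5, 83, 85], [80, 82, 84], [1, 87, 89], [86, 90, 92], [1, 89, 91], [86, 88, 94]] ! (k - 84)
       else
        [[87, 93, 95], [88, 94, 96], [87, 95, 97], [90, 98, 100], [89, 91, 97], [90, 92, 96]] ! (k - 90))
      else
       (if k < 102 then
        [[91, 95, 97], [92, 94, 96], [93, 99, 101], [4, 98, 102], [93, 101, 103], [98, 100, 104]] ! (k - 96)
       else
        [[99, 105, 107], [100, 104, 106], [101, 103, 107], [4, 102, 106], [103, 105, 107], [102, 104, 106]] ! (k - 102)))))"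

definition box_nbrs :: "nat \<Rightarrow> nat \<Rightarrow> nat list" where
  "box_nbrs t k = (if t = 0 then box_nbrs_0 k else if t = 1 then box_nbrs_1 k else if t = 2 then box_nbrs_2 k else box_nbrs_3 k)"

lemmas box_nbrs_tab = box_nbrs_def box_nbrs_0_def box_nbrs_1_def box_nbrs_2_def box_nbrs_3_def

text \<open>Ports stand at one third and two thirds of the sides of a square of side 2400, with the
  second coordinate pointing upwards. The other coordinates only have to make the straight line
  drawing free of crossings.\<close>

definition box_coord_0 :: "nat \<Rightarrow> int \<times> int" where
  "box_coord_0 k =
    (if k < 54 then
     (if k < 30 then
      (if k < 18 then
       (if k < 12 then
        (if k < 6 then
         [(800, 2400), (1600, 2400), (2400, 1600), (2400, 800), (1600, 0), (800, 0)] ! k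
        else
         [(0, 800), (0, 1600), (286, 919), (108, 1063), (383, 670), (367, 937)] ! (k - 6))
       else
        [(622, 504), (431, 673), (803, 326), (804, 326), (1038, 447), (602, 364)] ! (k - 12))
      else
       (if k < 24 then
        [(552, 346), (1004, 283), (692, 267), (705, 285), (420, 943), (806, 170)] ! (k - 18)
       else
        [(662, 931), (494, 988), (622, 1195), (722, 898), (819, 788), (536, 324)] ! (k - 24)))
     else
      (if k < 42 then
       (if k < 36 then
        [(816, 1049), (1106, 476), (532, 1407), (626, 1284), (1054, 636), (749, 1580)] ! (k - 30)
       else
        [(949, 957), (1001, 796), (734, 1708), (304, 1481), (858, 1462), (1124, 670)] ! (k - 36))
      else
       (if k < 48 then
        [(1133, 1051), (1079, 1384), (833, 1940), (812, 1831), (1179, 1665), (490, 1794)] ! (k - 42)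
       else
        [(1271, 1339), (1203, 1673), (1226, 726), (1203, 719), (1224, 1881), (1016, 992)] ! (k - 48))))
    else
     (if k < 84 then
      (if k < 72 then
       (if k < 66 then
        (if k < 60 then
         [(1384, 1848), (1352, 2002), (1341, 1584), (1438, 1697), (1509, 965), (1332, 1007)] ! (k - 54)
        else
         [(1754, 1309), (1746, 1154), (1726, 1631), (1910, 1543), (1589, 1748), (1702, 1640)] ! (k - 60))
       else
        [(1858, 1037), (1487, 1541), (1926, 1548), (1639, 1967), (1483, 1543), (1833, 1840)] ! (k - 66))
      else
       (if k < 78 then
        [(2115, 1517), (2011, 1503), (1672, 702), (1649, 845), (1589, 1444), (2076, 962)] ! (k - 72)
       else
        [(1786, 441), (1598, 565), (2246, 1055), (1765, 233), (621, 1955), (1906, 608)] ! (k - 78)))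
     else
      (if k < 96 then
       (if k < 90 then
        [(1573, 454), (2178, 1781), (1001, 129), (1612, 1436), (2138, 664), (758, 1085)] ! (k - 84)
       else
        [(601, 203), (823, 599), (243, 1758), (1290, 1736), (117, 1346), (981, 2034)] ! (k - 90))
      else
       (if k < 102 then
        [(2003, 1750), (232, 633), (804, 323), (945, 956), (1176, 510), (1371, 1431)] ! (k - 96)
       else
        [(1735, 2128), (1423, 362), (1070, 832), (2280, 1341), (1482, 2132), (636, 2165)] ! (k - 102)))))"

definition box_coord_1 :: "nat \<Rightarrow> int \<times> int" where
  "box_coord_1 k =
    (if k < 54 then
     (if k < 30 then
      (if k < 18 then
       (if k < 12 then
        (if k < 6 then
         [(800, 2400), (1600, 2400), (2400, 1600), (2400, 800), (1600, 0), (800, 0)] ! k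
        else
         [(0, 800), (0, 1600), (142, 983), (60, 1058), (250, 1139), (119, 1168)] ! (k - 6))
       else
        [(339, 988), (338, 987), (552, 903), (487, 809), (636, 632), (290, 551)] ! (k - 12))
      else
       (if k < 24 then
        [(913, 248), (680, 445), (435, 1136), (409, 1117), (566, 1313), (369, 1410)] ! (k - 18)
       else
        [(808, 1058), (790, 1297), (969, 992), (827, 1007), (1120, 671), (1048, 882)] ! (k - 24)))
     else
      (if k < 42 then
       (if k < 36 then
        [(732, 943), (1168, 698), (817, 1390), (721, 907), (939, 794), (853, 1410)] ! (k - 30)
       else
        [(648, 1716), (797, 794), (1226, 719), (834, 843), (807, 685), (1333, 1002)] ! (k - 36))
      else
       (if k < 48 then
        [(1570, 453), (1422, 359), (942, 1535), (851, 960), (1671, 698), (1596, 563)] ! (k - 42)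
       else
        [(1784, 441), (966, 1540), (1269, 1332), (1649, 841), (1860, 1035), (1371, 1426)] ! (k - 48))))
    else
     (if k < 84 then
      (if k < 72 then
       (if k < 66 then
        (if k < 60 then
         [(1337, 1579), (1747, 1152), (1756, 1307), (2077, 962), (954, 1691), (1287, 1730)] ! (k - 54)
        else
         [(1484, 1540), (1912, 1543), (1223, 1875), (1615, 1433), (1385, 1844), (983, 1710)] ! (k - 60))
       else
        [(1039, 1742), (1041, 1414), (1926, 1548), (1487, 1538), (1172, 1655), (1120, 1464)] ! (k - 66))
      else
       (if k < 78 then
        [(2004, 1750), (1833, 1839), (2247, 1055), (268, 950), (1591, 1442), (1350, 1997)] ! (k - 72)
       else
        [(293, 1674), (1703, 1639), (1480, 2131), (1906, 607), (1089, 1446), (1640, 1968)] ! (k - 78)))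
     else
      (if k < 96 then
       (if k < 90 then
        [(2117, 1517), (2179, 1782), (720, 868), (1005, 460), (827, 901), (612, 1112)] ! (k - 84)
       else
        [(1735, 2128), (984, 2030), (1068, 1117), (2012, 1502), (31, 1330), (598, 1684)] ! (k - 90))
      else
       (if k < 102 then
        [(2139, 664), (1438, 1693), (1509, 961), (1198, 1664), (1591, 1747), (830, 1963)] ! (k - 96)
       else
        [(1729, 1629), (1763, 235), (576, 301), (696, 688), (322, 766), (2282, 1340)] ! (k - 102)))))"

definition box_coord_2 :: "nat \<Rightarrow> int \<times> int" where
  "box_coord_2 k =
    (if k < 54 then
     (if k < 30 then
      (if k < 18 then
       (if k < 12 then
        (if k < 6 then
         [(800, 2400), (1600, 2400), (2400, 1600), (2400, 800), (1600, 0), (800, 0)] ! k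
        else
         [(0, 800), (0, 1600), (571, 293), (290, 550), (785, 586), (724, 432)] ! (k - 6))
       else
        [(930, 236), (127, 1049), (614, 718), (727, 701), (1113, 663), (1026, 486)] ! (k - 12))
      else
       (if k < 24 then
        [(818, 745), (1169, 697), (1068, 1115), (551, 809), (735, 784), (826, 776)] ! (k - 18)
       else
        [(517, 977), (965, 1539), (954, 1690), (927, 1002), (773, 951), (629, 1133)] ! (k - 24)))
     else
      (if k < 42 then
       (if k < 36 then
        [(1226, 717), (780, 865), (1508, 961), (1333, 1002), (941, 1532), (737, 811)] ! (k - 30)
       else
        [(1039, 1742), (984, 1708), (663, 1150), (1649, 841), (1269, 1332), (505, 975)] ! (k - 36))
      else
       (if k < 48 then
        [(1860, 1035), (855, 1407), (469, 1314), (1198, 1664), (650, 1715), (661, 1361)] ! (k - 42)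
       else
        [(1671, 698), (268, 1453), (1223, 1875), (443, 1657), (765, 1343), (1120, 1463)] ! (k - 48))))
    else
     (if k < 84 then
      (if k < 72 then
       (if k < 66 then
        (if k < 60 then
         [(2139, 664), (2077, 962), (825, 1399), (1370, 1426), (1385, 1843), (1286, 1730)] ! (k - 54)
        else
         [(1570, 453), (1596, 562), (1784, 441), (578, 1669), (1089, 1445), (1438, 1693)] ! (k - 60))
       else
        [(1483, 1540), (614, 1698), (1756, 1307), (1747, 1152), (1926, 1548), (1912, 1543)] ! (k - 66))
      else
       (if k < 78 then
        [(1729, 1629), (1833, 1839), (2117, 1517), (2012, 1502), (1590, 1442), (1703, 1639)] ! (k - 72)
       else
        [(2247, 1055), (1487, 1538), (2003, 1750), (1350, 1996), (1591, 1747), (824, 1399)] ! (k - 78)))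
     else
      (if k < 96 then
       (if k < 90 then
        [(1172, 1654), (1640, 1968), (1735, 2128), (798, 962), (1337, 1579), (830, 1962)] ! (k - 84)
       else
        [(241, 1757), (2282, 1340), (799, 1062), (1615, 1433), (830, 797), (1422, 358)] ! (k - 90))
      else
       (if k < 102 then
        [(526, 1659), (1763, 235), (659, 858), (1906, 607), (88, 1330), (2179, 1782)] ! (k - 96)
       else
        [(336, 849), (715, 735), (613, 1699), (1040, 1413), (1480, 2131), (984, 2029)] ! (k - 102)))))"

definition box_coord_3 :: "nat \<Rightarrow> int \<times> int" where
  "box_coord_3 k =
    (if k < 54 then
     (if k < 30 then
      (if k < 18 then
       (if k < 12 then
        (if k < 6 then
         [(800, 2400), (1600, 2400), (2400, 1600), (2400, 800), (1600, 0), (800, 0)] ! k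
        else
         [(0, 800), (0, 1600), (46, 1131), (31, 985), (130, 1013), (416, 1003)] ! (k - 6))
       else
        [(220, 1122), (211, 1021), (266, 1257), (185, 1216), (127, 1220), (258, 1360)] ! (k - 12))
      else
       (if k < 24 then
        [(304, 1045), (298, 1150), (65, 1418), (59, 1279), (419, 1398), (112, 1118)] ! (k - 18)
       else
        [(2267, 1534), (2344, 1529), (2232, 1452), (2257, 1495), (2259, 1357), (2280, 1415)] ! (k - 24)))
     else
      (if k < 42 then
       (if k < 36 then
        [(2148, 1420), (2204, 1419), (2311, 1476), (2233, 1270), (2231, 1126), (2227, 1580)] ! (k - 30)
       else
        [(2211, 987), (2169, 1081), (2242, 847), (2197, 890), (2186, 794), (2257, 776)] ! (k - 36))
      else
       (if k < 48 then
        [(2111, 892), (2138, 836), (2121, 951), (2105, 961), (2140, 900), (2137, 967)] ! (k - 42)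
       else
        [(2128, 1025), (2276, 879), (2325, 773), (2124, 911), (975, 2175), (1078, 2220)] ! (k - 48))))
    else
     (if k < 84 then
      (if k < 72 then
       (if k < 66 then
        (if k < 60 then
         [(1079, 1862), (832, 2229), (848, 2109), (951, 2085), (954, 1996), (977, 1910)] ! (k - 54)
        else
         [(831, 1850), (797, 1680), (802, 1561), (845, 1976), (972, 1333), (1084, 1380)] ! (k - 60))
       else
        [(1080, 1020), (831, 1386), (848, 1264), (952, 1248), (956, 1155), (975, 1069)] ! (k - 66))
      else
       (if k < 78 then
        [(829, 1013), (798, 838), (801, 718), (845, 1136), (972, 493), (1084, 541)] ! (k - 72)
       else
        [(1079, 180), (830, 548), (851, 428), (952, 406), (952, 316), (975, 229)] ! (k - 78)))
     else
      (if k < 96 then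
       (if k < 90 then
        [(831, 168), (848, 296), (1154, 2115), (1153, 1537), (1557, 2125), (1323, 2039)] ! (k - 84)
       else
        [(1601, 1246), (1523, 1927), (1322, 1615), (1599, 1153), (1356, 1896), (1555, 1521)] ! (k - 90))
      else
       (if k < 102 then
        [(1523, 1721), (1354, 1750), (1150, 861), (1152, 289), (1555, 882), (1323, 787)] ! (k - 96)
       else
        [(1322, 365), (1520, 685), (1353, 652), (1552, 274), (1524, 468), (1358, 499)] ! (k - 102)))))"

definition box_coord :: "nat \<Rightarrow> nat \<Rightarrow> int \<times> int" where
  "box_coord t k = (if t = 0 then box_coord_0 k else if t = 1 then box_coord_1 k else if t = 2 then box_coord_2 k else box_coord_3 k)"

lemmas box_coord_tab = box_coord_def box_coord_0_def box_coord_1_def box_coord_2_def box_coord_3_def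

text \<open>
  The edges of a box and the edges that join two ports on the same side at the border of the grid,
  directed from left to right and sorted by their left ends, and the numbers of the edges at a vertex.
\<close>

definition box_edge_0 :: "nat \<Rightarrow> nat \<times> nat" where
  "box_edge_0 i =
    (if i < 84 then
     (if i < 42 then
      (if i < 24 then
       (if i < 12 then
        (if i < 6 then
         [(6, 7), (6, 9), (7, 94), (6, 97), (7, 92), (9, 94)] ! i
        else
         [(9, 8), (94, 39), (97, 8), (97, 10), (92, 39), (92, 47)] ! (i - 6))
       else
        (if i < 18 then
         [(8, 11), (39, 32), (11, 10), (11, 22), (10, 13), (22, 13)] ! (i - 12)
        else
         [(22, 25), (13, 12), (47, 82), (47, 38), (25, 26), (25, 24)] ! (i - 18)))
      else
       (if i < 36 then
        (if i < 30 then
         [(32, 33), (32, 35), (29, 18), (29, 90), (29, 20), (18, 17)] ! (i - 24)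
        else
         [(18, 21), (90, 5), (90, 23), (17, 14), (17, 98), (82, 107)] ! (i - 30))
       else
        [(82, 45), (26, 33), (26, 89), (12, 15), (12, 91), (33, 40)] ! (i - 36)))
     else
      (if i < 66 then
       (if i < 54 then
        (if i < 48 then
         [(107, 0), (107, 44), (24, 27), (24, 89), (20, 21), (20, 23)] ! (i - 42)
        else
         [(21, 98), (27, 30), (27, 28), (38, 35), (38, 45), (35, 40)] ! (i - 48))
       else
        (if i < 60 then
         [(89, 30), (0, 95), (5, 86), (0, 1), (5, 4), (14, 15)] ! (i - 54)
        else
         [(14, 19), (98, 19), (15, 16), (23, 86), (45, 44), (30, 99)] ! (i - 60)))
      else
       (if i < 78 then
        (if i < 72 then
         [(28, 91), (28, 99), (91, 16), (44, 95), (40, 43), (99, 36)] ! (i - 66)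
        else
         [(36, 37), (36, 53), (95, 46), (86, 19), (37, 34), (37, 104)] ! (i - 72))
       else
        [(53, 104), (53, 42), (16, 31), (34, 31), (34, 41), (104, 41)] ! (i - 78))))
    else
     (if i < 126 then
      (if i < 108 then
       (if i < 96 then
        (if i < 90 then
         [(43, 42), (43, 46), (31, 100), (41, 100), (42, 51), (100, 51)] ! (i - 84)
        else
         [(46, 49), (49, 52), (51, 50), (49, 48), (52, 93), (52, 55)] ! (i - 90))
       else
        (if i < 102 then
         [(50, 59), (50, 103), (48, 59), (48, 101), (93, 56), (93, 54)] ! (i - 96)
        else
         [(59, 58), (56, 101), (56, 57), (55, 54), (55, 106), (101, 70)] ! (i - 102)))
      else
       (if i < 120 then
        (if i < 114 then
         [(54, 57), (103, 84), (103, 4), (57, 70), (106, 1), (106, 69)] ! (i - 108)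
        else
         [(70, 67), (67, 64), (67, 76), (58, 75), (58, 61), (84, 79)] ! (i - 114))
       else
        [(84, 81), (76, 87), (64, 69), (64, 65), (76, 65), (79, 74)] ! (i - 120)))
     else
      (if i < 144 then
       (if i < 138 then
        (if i < 132 then
         [(79, 78), (1, 102), (4, 81), (87, 62), (87, 60), (69, 102)] ! (i - 126)
        else
         [(75, 74), (75, 66), (74, 83), (65, 62), (62, 63), (102, 71)] ! (i - 132))
       else
        [(61, 60), (61, 66), (60, 63), (81, 78), (78, 83), (71, 68)] ! (i - 138))
      else
       (if i < 156 then
        (if i < 150 then
         [(71, 96), (66, 77), (83, 88), (63, 68), (68, 73), (96, 73)] ! (i - 144)
        else
         [(96, 85), (73, 72), (77, 88), (77, 80), (72, 85), (72, 105)] ! (i - 150))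
       else
        [(88, 3), (85, 2), (80, 105), (80, 3), (105, 2), (3, 2)] ! (i - 156)))))"

definition box_edge_1 :: "nat \<Rightarrow> nat \<times> nat" where
  "box_edge_1 i =
    (if i < 84 then
     (if i < 42 then
      (if i < 24 then
       (if i < 12 then
        (if i < 6 then
         [(6, 7), (7, 94), (6, 9), (6, 17), (7, 78), (94, 9)] ! i
        else
         [(94, 11), (9, 8), (11, 8), (11, 10), (8, 75), (10, 75)] ! (i - 6))
       else
        (if i < 18 then
         [(10, 13), (75, 106), (17, 106), (17, 104), (78, 23), (78, 95)] ! (i - 12)
        else
         [(106, 13), (13, 12), (12, 21), (12, 15), (23, 20), (23, 22)] ! (i - 18)))
      else
       (if i < 36 then
        (if i < 30 then
         [(21, 20), (21, 14), (20, 89), (15, 14), (15, 16), (14, 105)] ! (i - 24)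
        else
         [(22, 89), (22, 25), (104, 19), (104, 5), (95, 36), (95, 32)] ! (i - 30))
       else
        [(89, 24), (16, 19), (16, 105), (36, 101), (36, 35), (19, 18)] ! (i - 36)))
     else
      (if i < 66 then
       (if i < 54 then
        (if i < 48 then
         [(105, 40), (86, 33), (86, 37), (86, 39), (33, 30), (33, 88)] ! (i - 42)
        else
         [(30, 27), (30, 45), (25, 24), (25, 32), (37, 40), (37, 34)] ! (i - 48))
       else
        (if i < 60 then
         [(0, 101), (5, 18), (0, 91), (0, 1), (5, 4), (40, 87)] ! (i - 54)
        else
         [(24, 27), (32, 35), (88, 39), (88, 45), (27, 26), (101, 44)] ! (i - 60)))
      else
       (if i < 78 then
        (if i < 72 then
         [(39, 34), (45, 26), (35, 44), (18, 87), (34, 29), (44, 49)] ! (i - 66)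
        else
         [(58, 49), (58, 65), (58, 67), (49, 92), (26, 29), (65, 66)] ! (i - 72))
       else
        [(65, 82), (91, 66), (91, 70), (87, 28), (66, 71), (67, 92)] ! (i - 78))))
    else
     (if i < 126 then
      (if i < 108 then
       (if i < 96 then
        (if i < 90 then
         [(67, 82), (29, 28), (92, 31), (82, 71), (28, 31), (71, 70)] ! (i - 84)
        else
         [(31, 38), (70, 99), (99, 62), (99, 50), (62, 59), (62, 77)] ! (i - 90))
       else
        (if i < 102 then
         [(38, 41), (38, 43), (50, 41), (50, 53), (59, 54), (59, 64)] ! (i - 96)
        else
         [(41, 98), (54, 53), (54, 97), (77, 64), (77, 80), (53, 60)] ! (i - 102)))
      else
       (if i < 120 then
        (if i < 114 then
         [(64, 97), (43, 42), (43, 4), (97, 60), (80, 1), (80, 83)] ! (i - 108)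
        else
         [(60, 69), (69, 76), (69, 100), (98, 51), (98, 55), (42, 47)] ! (i - 114))
       else
        [(42, 103), (76, 63), (100, 83), (76, 79), (100, 79), (47, 46)] ! (i - 120)))
     else
      (if i < 144 then
       (if i < 138 then
        (if i < 132 then
         [(47, 48), (1, 90), (4, 103), (63, 102), (63, 56), (83, 90)] ! (i - 126)
        else
         [(51, 46), (51, 52), (46, 81), (79, 102), (102, 61), (90, 73)] ! (i - 132))
       else
        [(55, 56), (55, 52), (56, 61), (103, 48), (48, 81), (73, 68)] ! (i - 138))
      else
       (if i < 156 then
        (if i < 150 then
         [(73, 72), (52, 57), (81, 96), (61, 68), (68, 93), (72, 93)] ! (i - 144)
        else
         [(72, 85), (93, 84), (57, 96), (57, 74), (84, 85), (84, 107)] ! (i - 150))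
       else
        [(96, 3), (85, 2), (74, 107), (74, 3), (107, 2), (3, 2)] ! (i - 156)))))"

definition box_edge_2 :: "nat \<Rightarrow> nat \<times> nat" where
  "box_edge_2 i =
    (if i < 84 then
     (if i < 42 then
      (if i < 24 then
       (if i < 12 then
        (if i < 6 then
         [(6, 7), (7, 100), (6, 13), (7, 90), (6, 9), (100, 13)] ! i
        else
         [(100, 49), (13, 102), (90, 49), (90, 51), (49, 44), (9, 102)] ! (i - 6))
       else
        (if i < 18 then
         [(9, 8), (102, 41), (51, 44), (51, 96), (44, 41), (41, 24)] ! (i - 12)
        else
         [(24, 21), (24, 29), (96, 63), (96, 47), (21, 14), (21, 98)] ! (i - 18)))
      else
       (if i < 36 then
        (if i < 30 then
         [(8, 11), (8, 5), (63, 104), (63, 52), (104, 67), (104, 83)] ! (i - 24)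
        else
         [(67, 46), (14, 103), (14, 15), (67, 56), (29, 38), (29, 28)] ! (i - 30))
       else
        [(46, 89), (46, 43), (98, 35), (98, 31), (47, 38), (47, 92)] ! (i - 36)))
     else
      (if i < 66 then
       (if i < 54 then
        (if i < 48 then
         [(38, 87), (103, 22), (103, 18), (11, 10), (11, 12), (15, 10)] ! (i - 42)
        else
         [(15, 18), (22, 35), (22, 23), (35, 94), (52, 83), (52, 27)] ! (i - 48))
       else
        (if i < 60 then
         [(28, 31), (28, 87), (31, 94), (10, 17), (87, 92), (92, 27)] ! (i - 54)
        else
         [(0, 89), (5, 12), (0, 107), (0, 1), (5, 4), (18, 23)] ! (i - 60)))
      else
       (if i < 78 then
        (if i < 72 then
         [(83, 56), (56, 43), (23, 94), (89, 34), (43, 34), (27, 16)] ! (i - 66)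
        else
         [(12, 17), (34, 25), (26, 25), (26, 37), (26, 105), (25, 20)] ! (i - 72))
       else
        [(37, 36), (107, 36), (37, 64), (107, 84), (17, 16), (36, 53)] ! (i - 78))))
    else
     (if i < 126 then
      (if i < 108 then
       (if i < 96 then
        (if i < 90 then
         [(105, 20), (105, 64), (20, 19), (64, 53), (16, 19), (53, 84)] ! (i - 84)
        else
         [(19, 30), (84, 45), (45, 50), (45, 40), (50, 59), (50, 81)] ! (i - 90))
       else
        (if i < 102 then
         [(30, 33), (30, 95), (40, 33), (40, 57), (59, 88), (59, 58)] ! (i - 96)
        else
         [(33, 32), (88, 57), (88, 65), (81, 58), (81, 106), (57, 66)] ! (i - 102)))
      else
       (if i < 120 then
        (if i < 114 then
         [(58, 65), (95, 60), (95, 4), (65, 66), (106, 1), (106, 85)] ! (i - 108)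
        else
         [(66, 79), (79, 76), (79, 82), (32, 39), (32, 69), (60, 61)] ! (i - 114))
       else
        [(60, 97), (76, 93), (76, 77), (82, 85), (82, 77), (61, 48)] ! (i - 120)))
     else
      (if i < 144 then
       (if i < 138 then
        (if i < 132 then
         [(61, 62), (1, 86), (4, 97), (93, 72), (93, 68), (85, 86)] ! (i - 126)
        else
         [(39, 48), (39, 42), (48, 99), (77, 72), (72, 71), (86, 73)] ! (i - 132))
       else
        [(69, 68), (69, 42), (68, 71), (97, 62), (62, 99), (73, 70)] ! (i - 138))
      else
       (if i < 156 then
        (if i < 150 then
         [(73, 80), (42, 55), (99, 54), (71, 70), (70, 75), (80, 75)] ! (i - 144)
        else
         [(80, 101), (75, 74), (55, 54), (55, 78), (74, 101), (74, 91)] ! (i - 150))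
       else
        [(54, 3), (101, 2), (78, 91), (78, 3), (91, 2), (3, 2)] ! (i - 156)))))"

definition box_edge_3 :: "nat \<Rightarrow> nat \<times> nat" where
  "box_edge_3 i =
    (if i < 84 then
     (if i < 42 then
      (if i < 24 then
       (if i < 12 then
        (if i < 6 then
         [(6, 7), (6, 9), (7, 20), (6, 11), (7, 22), (9, 8)] ! i
        else
         [(9, 10), (8, 21), (8, 23), (21, 20), (21, 16), (20, 17)] ! (i - 6))
       else
        (if i < 18 then
         [(23, 16), (23, 10), (16, 15), (10, 13), (15, 12), (15, 14)] ! (i - 12)
        else
         [(13, 12), (13, 18), (12, 19), (17, 14), (17, 22), (14, 19)] ! (i - 18)))
      else
       (if i < 36 then
        (if i < 30 then
         [(19, 18), (18, 11), (11, 22), (61, 62), (61, 60), (61, 54)] ! (i - 24)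
        else
         [(73, 74), (73, 72), (73, 66), (5, 84), (0, 55), (0, 53)] ! (i - 30))
       else
        [(5, 78), (0, 1), (5, 4), (74, 79), (74, 77), (62, 67)] ! (i - 36)))
     else
      (if i < 66 then
       (if i < 54 then
        (if i < 48 then
         [(62, 65), (72, 75), (72, 71), (79, 80), (79, 76), (60, 63)] ! (i - 42)
        else
         [(67, 68), (84, 85), (67, 64), (84, 83), (60, 59), (55, 56)] ! (i - 48))
       else
        (if i < 60 then
         [(55, 52), (63, 56), (75, 68), (63, 58), (75, 70), (85, 80)] ! (i - 54)
        else
         [(56, 57), (68, 69), (85, 82), (80, 81), (57, 58), (57, 52)] ! (i - 60)))
      else
       (if i < 78 then
        (if i < 72 then
         [(82, 81), (69, 70), (69, 64), (81, 76), (82, 83), (58, 59)] ! (i - 66)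
        else
         [(70, 71), (64, 65), (76, 77), (52, 53), (83, 78), (71, 66)] ! (i - 72))
       else
        [(59, 54), (53, 54), (78, 77), (66, 65), (98, 99), (98, 101)] ! (i - 78))))
    else
     (if i < 126 then
      (if i < 108 then
       (if i < 96 then
        (if i < 90 then
         [(98, 93), (99, 102), (99, 4), (87, 86), (87, 92), (87, 90)] ! (i - 84)
        else
         [(86, 89), (86, 1), (92, 97), (102, 107), (102, 105), (92, 95)] ! (i - 90))
       else
        (if i < 102 then
         [(101, 104), (89, 94), (101, 100), (89, 88), (104, 107), (104, 103)] ! (i - 96)
        else
         [(97, 94), (97, 96), (94, 91), (107, 106), (103, 106), (103, 100)] ! (i - 102)))
      else
       (if i < 120 then
        (if i < 114 then
         [(96, 91), (96, 95), (91, 88), (106, 105), (105, 4), (100, 93)] ! (i - 108)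
        else
         [(95, 90), (88, 1), (93, 90), (45, 42), (45, 44), (45, 48)] ! (i - 114))
       else
        [(42, 51), (42, 43), (44, 51), (44, 47), (51, 46), (48, 47)] ! (i - 120)))
     else
      (if i < 144 then
       (if i < 138 then
        (if i < 132 then
         [(48, 37), (47, 46), (43, 46), (43, 40), (30, 31), (30, 35)] ! (i - 126)
        else
         [(30, 33), (37, 36), (37, 34), (40, 39), (40, 41), (39, 36)] ! (i - 132))
       else
        [(39, 38), (31, 26), (31, 28), (36, 49), (35, 24), (35, 2)] ! (i - 138))
      else
       (if i < 156 then
        (if i < 150 then
         [(34, 33), (34, 3), (26, 27), (26, 29), (33, 28), (38, 41)] ! (i - 144)
        else
         [(38, 49), (27, 24), (27, 32), (41, 50), (28, 29), (24, 25)] ! (i - 150))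
       else
        [(49, 50), (29, 32), (32, 25), (50, 3), (25, 2), (3, 2)] ! (i - 156)))))"

definition box_edge :: "nat \<Rightarrow> nat \<Rightarrow> nat \<times> nat" where
  "box_edge t i = (if t = 0 then box_edge_0 i else if t = 1 then box_edge_1 i else if t = 2 then box_edge_2 i else box_edge_3 i)"

lemmas box_edge_tab = box_edge_def box_edge_0_def box_edge_1_def box_edge_2_def box_edge_3_def

definition box_edges_at_0 :: "nat \<Rightarrow> nat list" where
  "box_edges_at_0 k =
    (if k < 54 then
     (if k < 30 then
      (if k < 18 then
       (if k < 12 then
        (if k < 6 then
         [[55, 42], [127, 112], [157, 160], [159, 156], [128, 110], [56, 31]] ! k
        else
         [[1, 3], [4, 2], [6, 12, 8], [1, 6, 5], [14, 16, 9], [12, 14, 15]] ! (k - 6))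
       else
        [[19, 39, 40], [16, 19, 17], [59, 33, 60], [39, 59, 62], [62, 80, 68], [33, 29, 34]] ! (k - 12))
      else
       (if k < 24 then
        [[29, 30, 26], [60, 75, 61], [46, 47, 28], [30, 46, 48], [15, 17, 18], [47, 63, 32]] ! (k - 18)
       else
        [[23, 44, 45], [18, 23, 22], [22, 37, 38], [44, 50, 49], [50, 66, 67], [26, 28, 27]] ! (k - 24)))
     else
      (if k < 42 then
       (if k < 36 then
        [[49, 54, 65], [80, 81, 86], [24, 25, 13], [37, 24, 41], [81, 76, 82], [25, 51, 53]] ! (k - 30)
       else
        [[72, 73, 71], [76, 72, 77], [51, 52, 21], [13, 10, 7], [41, 53, 70], [82, 87, 83]] ! (k - 36))
      else
       (if k < 48 then
        [[84, 88, 79], [70, 84, 85], [64, 69, 43], [52, 64, 36], [85, 90, 74], [21, 20, 11]] ! (k - 42)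
       else
        [[93, 98, 99], [90, 93, 91], [92, 96, 97], [88, 92, 89], [91, 95, 94], [73, 79, 78]] ! (k - 48))))
    else
     (if k < 84 then
      (if k < 72 then
       (if k < 66 then
        (if k < 60 then
         [[105, 108, 101], [95, 105, 106], [104, 100, 103], [108, 104, 111], [102, 118, 117], [98, 96, 102]] ! (k - 54)
        else
         [[138, 140, 130], [118, 138, 139], [136, 135, 129], [140, 136, 147], [123, 115, 122], [135, 123, 124]] ! (k - 60))
       else
        [[139, 133, 145], [115, 114, 116], [147, 143, 148], [122, 131, 113], [111, 114, 107], [143, 144, 137]] ! (k - 66))
      else
       (if k < 78 then
        [[151, 154, 155], [148, 151, 149], [132, 125, 134], [117, 133, 132], [124, 116, 121], [145, 153, 152]] ! (k - 72)
       else
        [[126, 141, 142], [125, 126, 119], [159, 153, 158], [128, 141, 120], [36, 20, 35], [134, 142, 146]] ! (k - 78)))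
     else
      (if k < 96 then
       (if k < 90 then
        [[119, 120, 109], [157, 154, 150], [56, 75, 63], [130, 129, 121], [156, 152, 146], [45, 38, 54]] ! (k - 84)
       else
        [[31, 32, 27], [40, 68, 66], [4, 10, 11], [94, 101, 100], [2, 5, 7], [55, 69, 74]] ! (k - 90))
      else
       (if k < 102 then
        [[144, 149, 150], [3, 8, 9], [34, 61, 48], [67, 65, 71], [86, 87, 89], [99, 103, 107]] ! (k - 96)
       else
        [[127, 131, 137], [110, 97, 109], [77, 83, 78], [160, 155, 158], [112, 106, 113], [42, 43, 35]] ! (k - 102)))))"

definition box_edges_at_1 :: "nat \<Rightarrow> nat list" where
  "box_edges_at_1 k =
    (if k < 54 then
     (if k < 30 then
      (if k < 18 then
       (if k < 12 then
        (if k < 6 then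
         [[56, 54], [112, 127], [157, 160], [159, 156], [110, 128], [55, 33]] ! k
        else
         [[2, 3], [4, 1], [7, 8, 10], [2, 7, 5], [9, 12, 11], [8, 9, 6]] ! (k - 6))
       else
        [[19, 21, 20], [12, 19, 18], [27, 25, 29], [21, 27, 28], [28, 37, 38], [3, 15, 14]] ! (k - 12))
      else
       (if k < 24 then
        [[55, 41, 69], [37, 41, 32], [24, 22, 26], [20, 25, 24], [23, 31, 30], [22, 23, 16]] ! (k - 18)
       else
        [[50, 60, 36], [31, 50, 51], [64, 76, 67], [60, 64, 48], [85, 88, 81], [76, 85, 70]] ! (k - 24)))
     else
      (if k < 42 then
       (if k < 36 then
        [[48, 46, 49], [88, 90, 86], [51, 61, 35], [46, 43, 47], [70, 53, 66], [61, 40, 68]] ! (k - 30)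
       else
        [[40, 34, 39], [53, 52, 44], [90, 96, 97], [66, 45, 62], [52, 59, 42], [96, 98, 102]] ! (k - 36))
      else
       (if k < 48 then
        [[109, 119, 120], [110, 97, 109], [68, 71, 65], [67, 49, 63], [125, 132, 134], [119, 125, 126]] ! (k - 42)
       else
        [[126, 142, 141], [71, 72, 75], [98, 99, 93], [132, 133, 117], [133, 139, 145], [99, 103, 107]] ! (k - 48))))
    else
     (if k < 84 then
      (if k < 72 then
       (if k < 66 then
        (if k < 60 then
         [[103, 100, 104], [139, 138, 118], [138, 140, 130], [145, 153, 152], [72, 73, 74], [100, 94, 101]] ! (k - 54)
        else
         [[107, 114, 111], [140, 147, 136], [94, 95, 92], [130, 121, 129], [101, 105, 108], [73, 77, 78]] ! (k - 60))
       else
        [[77, 82, 79], [74, 84, 83], [147, 143, 148], [114, 115, 116], [89, 80, 91], [82, 89, 87]] ! (k - 66))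
      else
       (if k < 78 then
        [[144, 150, 149], [143, 144, 137], [159, 153, 158], [10, 11, 13], [121, 115, 123], [95, 105, 106]] ! (k - 72)
       else
        [[4, 16, 17], [123, 124, 135], [112, 106, 113], [134, 142, 146], [78, 84, 87], [113, 131, 122]] ! (k - 78)))
     else
      (if k < 96 then
       (if k < 90 then
        [[154, 151, 155], [157, 150, 154], [43, 44, 45], [69, 81, 59], [47, 62, 63], [26, 30, 36]] ! (k - 84)
       else
        [[127, 137, 131], [56, 79, 80], [86, 75, 83], [148, 149, 151], [1, 5, 6], [35, 34, 17]] ! (k - 90))
      else
       (if k < 102 then
        [[156, 152, 146], [104, 111, 108], [102, 117, 118], [93, 92, 91], [116, 124, 122], [54, 39, 65]] ! (k - 96)
       else
        [[136, 129, 135], [128, 120, 141], [33, 15, 32], [29, 38, 42], [18, 14, 13], [160, 158, 155]] ! (k - 102)))))"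

definition box_edges_at_2 :: "nat \<Rightarrow> nat list" where
  "box_edges_at_2 k =
    (if k < 54 then
     (if k < 30 then
      (if k < 18 then
       (if k < 12 then
        (if k < 6 then
         [[60, 62], [127, 112], [160, 157], [156, 159], [110, 128], [25, 61]] ! k
        else
         [[4, 2], [3, 1], [25, 12, 24], [4, 12, 11], [45, 47, 57], [24, 45, 46]] ! (k - 6))
       else
        [[61, 46, 72], [2, 5, 7], [32, 22, 31], [47, 32, 48], [82, 88, 71], [57, 72, 82]] ! (k - 12))
      else
       (if k < 24 then
        [[48, 65, 44], [88, 86, 90], [86, 77, 84], [22, 18, 23], [50, 49, 43], [65, 50, 68]] ! (k - 18)
       else
        [[18, 19, 17], [77, 74, 73], [74, 75, 76], [71, 53, 59], [35, 54, 55], [19, 35, 34]] ! (k - 24)))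
     else
      (if k < 42 then
       (if k < 36 then
        [[90, 96, 97], [54, 56, 39], [102, 117, 118], [96, 102, 98], [73, 70, 69], [49, 51, 38]] ! (k - 30)
       else
        [[78, 83, 79], [75, 78, 80], [34, 40, 42], [117, 133, 132], [98, 93, 99], [17, 16, 13]] ! (k - 36))
      else
       (if k < 48 then
        [[133, 145, 139], [70, 37, 67], [16, 10, 14], [93, 92, 91], [37, 30, 36], [40, 41, 21]] ! (k - 42)
       else
        [[132, 125, 134], [10, 8, 6], [92, 94, 95], [14, 9, 15], [53, 27, 52], [83, 87, 89]] ! (k - 48))))
    else
     (if k < 84 then
      (if k < 72 then
       (if k < 66 then
        (if k < 60 then
         [[156, 152, 146], [145, 152, 153], [67, 33, 66], [99, 107, 103], [101, 108, 105], [94, 101, 100]] ! (k - 54)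
        else
         [[119, 109, 120], [125, 119, 126], [126, 141, 142], [27, 20, 26], [80, 87, 85], [108, 111, 104]] ! (k - 60))
       else
        [[107, 111, 114], [30, 33, 28], [138, 140, 130], [118, 139, 138], [147, 143, 148], [140, 147, 136]] ! (k - 66))
      else
       (if k < 78 then
        [[136, 135, 129], [143, 144, 137], [151, 155, 154], [148, 151, 149], [122, 115, 121], [135, 122, 124]] ! (k - 72)
       else
        [[159, 153, 158], [114, 115, 116], [144, 149, 150], [95, 105, 106], [124, 116, 123], [52, 66, 29]] ! (k - 78)))
     else
      (if k < 96 then
       (if k < 90 then
        [[91, 89, 81], [123, 131, 113], [127, 137, 131], [55, 42, 58], [103, 100, 104], [60, 69, 36]] ! (k - 84)
       else
        [[3, 8, 9], [160, 155, 158], [59, 41, 58], [130, 129, 121], [68, 56, 51], [110, 97, 109]] ! (k - 90))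
      else
       (if k < 102 then
        [[21, 15, 20], [128, 120, 141], [23, 39, 38], [134, 146, 142], [1, 5, 6], [157, 154, 150]] ! (k - 96)
       else
        [[11, 7, 13], [31, 44, 43], [26, 28, 29], [84, 76, 85], [112, 106, 113], [62, 79, 81]] ! (k - 102)))))"

definition box_edges_at_3 :: "nat \<Rightarrow> nat list" where
  "box_edges_at_3 k =
    (if k < 54 then
     (if k < 30 then
      (if k < 18 then
       (if k < 12 then
        (if k < 6 then
         [[35, 34], [91, 115], [160, 143], [145, 159], [86, 112], [36, 33]] ! k
        else
         [[1, 3], [2, 4], [5, 7, 8], [1, 5, 6], [6, 15, 13], [3, 25, 26]] ! (k - 6))
       else
        [[18, 16, 20], [15, 18, 19], [17, 21, 23], [16, 17, 14], [14, 10, 12], [21, 11, 22]] ! (k - 12))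
      else
       (if k < 24 then
        [[25, 19, 24], [20, 23, 24], [2, 11, 9], [7, 10, 9], [4, 26, 22], [8, 13, 12]] ! (k - 18)
       else
        [[155, 151, 142], [160, 155, 158], [146, 147, 139], [151, 146, 152], [154, 140, 148], [147, 154, 157]] ! (k - 24)))
     else
      (if k < 42 then
       (if k < 36 then
        [[130, 132, 131], [139, 140, 130], [158, 152, 157], [148, 132, 144], [145, 144, 134], [143, 142, 131]] ! (k - 30)
       else
        [[133, 137, 141], [134, 133, 126], [138, 149, 150], [137, 138, 135], [135, 136, 129], [149, 136, 153]] ! (k - 36))
      else
       (if k < 48 then
        [[121, 117, 120], [129, 121, 128], [118, 123, 122], [117, 118, 119], [128, 127, 124], [123, 127, 125]] ! (k - 42)
       else
        [[126, 119, 125], [141, 150, 156], [159, 153, 156], [120, 122, 124], [75, 54, 65], [35, 75, 79]] ! (k - 48))))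
    else
     (if k < 84 then
      (if k < 72 then
       (if k < 66 then
        (if k < 60 then
         [[79, 78, 29], [34, 54, 53], [53, 60, 55], [65, 60, 64], [64, 71, 57], [78, 71, 52]] ! (k - 54)
        else
         [[52, 28, 47], [29, 28, 27], [27, 42, 41], [55, 57, 47], [73, 50, 68], [42, 73, 81]] ! (k - 60))
       else
        [[81, 77, 32], [41, 50, 48], [48, 61, 56], [68, 61, 67], [67, 72, 58], [77, 72, 44]] ! (k - 66))
      else
       (if k < 78 then
        [[44, 31, 43], [32, 31, 30], [30, 40, 39], [56, 58, 43], [74, 46, 69], [40, 74, 80]] ! (k - 72)
       else
        [[36, 80, 76], [39, 46, 45], [45, 63, 59], [69, 63, 66], [66, 70, 62], [76, 70, 51]] ! (k - 78)))
     else
      (if k < 96 then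
       (if k < 90 then
        [[33, 51, 49], [59, 62, 49], [91, 87, 90], [87, 89, 88], [115, 99, 110], [90, 99, 97]] ! (k - 84)
       else
        [[89, 116, 114], [110, 104, 108], [88, 95, 92], [116, 84, 113], [97, 104, 102], [114, 95, 109]] ! (k - 90))
      else
       (if k < 102 then
        [[108, 109, 103], [92, 102, 103], [84, 82, 83], [86, 82, 85], [113, 98, 107], [83, 98, 96]] ! (k - 96)
       else
        [[85, 94, 93], [107, 101, 106], [96, 101, 100], [112, 94, 111], [106, 111, 105], [93, 100, 105]] ! (k - 102)))))"

definition box_edges_at :: "nat \<Rightarrow> nat \<Rightarrow> nat list" where
  "box_edges_at t k = (if t = 0 then box_edges_at_0 k else if t = 1 then box_edges_at_1 k else if t = 2 then box_edges_at_2 k else box_edges_at_3 k)"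

lemmas box_edges_at_tab = box_edges_at_def box_edges_at_0_def box_edges_at_1_def box_edges_at_2_def box_edges_at_3_def

definition border_edge :: "nat \<Rightarrow> nat \<Rightarrow> nat" where
  "border_edge t i = [[57, 161, 58, 0], [57, 161, 58, 0], [63, 161, 64, 0], [37, 161, 38, 0]] ! t ! i"

text \<open>
  A parent in a spanning tree. The vertices \<open>k \<ge> 8\<close> are connected to 6 via vertices \<open>\<ge> 8\<close>
  that precede them in the order 9, 8, 11, 10, ...; for type 3 this holds for the left component
  with \<open>k < 24\<close>, and the right component with \<open>24 \<le> k < 52\<close> is connected to 2.
\<close>

definition box_parent_0 :: "nat \<Rightarrow> nat" where
  "box_parent_0 k =
    (if k < 54 then
     (if k < 30 then
      (if k < 18 then
       (if k < 12 then
        (if k < 6 then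
         [95, 102, 85, 80, 81, 86] ! k
        else
         [6, 92, 9, 6, 11, 8] ! (k - 6))
       else
        [13, 10, 15, 12, 15, 14] ! (k - 12))
      else
       (if k < 24 then
        [17, 14, 21, 18, 11, 20] ! (k - 18)
       else
        [25, 22, 25, 24, 27, 18] ! (k - 24)))
     else
      (if k < 42 then
       (if k < 36 then
        [27, 16, 33, 26, 31, 32] ! (k - 30)
       else
        [37, 34, 35, 32, 33, 34] ! (k - 36))
      else
       (if k < 48 then
        [43, 40, 45, 38, 43, 38] ! (k - 42)
       else
        [49, 46, 51, 42, 49, 36] ! (k - 48))))
    else
     (if k < 84 then
      (if k < 72 then
       (if k < 66 then
        (if k < 60 then
         [55, 52, 57, 54, 59, 48] ! (k - 54)
        else
         [61, 58, 63, 60, 65, 62] ! (k - 60))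
       else
        [61, 64, 63, 64, 57, 68] ! (k - 66))
      else
       (if k < 78 then
        [73, 68, 75, 58, 65, 66] ! (k - 72)
       else
        [79, 74, 77, 78, 45, 74] ! (k - 78)))
     else
      (if k < 96 then
       (if k < 90 then
        [79, 72, 19, 60, 77, 24] ! (k - 84)
       else
        [23, 12, 39, 52, 9, 44] ! (k - 90))
      else
       (if k < 102 then
        [71, 6, 17, 28, 31, 48] ! (k - 96)
       else
        [69, 50, 37, 72, 55, 44] ! (k - 102)))))"

definition box_parent_1 :: "nat \<Rightarrow> nat" where
  "box_parent_1 k =
    (if k < 54 then
     (if k < 30 then
      (if k < 18 then
       (if k < 12 then
        (if k < 6 then
         [91, 80, 85, 74, 43, 18] ! k
        else
         [6, 78, 9, 6, 11, 8] ! (k - 6))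
       else
        [13, 10, 15, 12, 15, 6] ! (k - 12))
      else
       (if k < 24 then
        [19, 16, 21, 12, 23, 20] ! (k - 18)
       else
        [25, 22, 27, 24, 29, 26] ! (k - 24)))
     else
      (if k < 42 then
       (if k < 36 then
        [27, 28, 25, 30, 29, 32] ! (k - 30)
       else
        [35, 34, 31, 34, 37, 38] ! (k - 36))
      else
       (if k < 48 then
        [43, 38, 35, 26, 47, 42] ! (k - 42)
       else
        [47, 44, 41, 46, 51, 50] ! (k - 48))))
    else
     (if k < 84 then
      (if k < 72 then
       (if k < 66 then
        (if k < 60 then
         [53, 52, 55, 52, 49, 54] ! (k - 54)
        else
         [53, 56, 59, 56, 59, 58] ! (k - 60))
       else
        [65, 58, 61, 60, 71, 66] ! (k - 66))
      else
       (if k < 78 then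
        [73, 68, 57, 8, 63, 62] ! (k - 72)
       else
        [23, 76, 77, 46, 65, 80] ! (k - 78)))
     else
      (if k < 96 then
       (if k < 90 then
        [85, 72, 33, 18, 33, 20] ! (k - 84)
       else
        [73, 66, 31, 68, 9, 32] ! (k - 90))
      else
       (if k < 102 then
        [57, 54, 41, 50, 69, 36] ! (k - 96)
       else
        [61, 42, 17, 14, 13, 74] ! (k - 102)))))"

definition box_parent_2 :: "nat \<Rightarrow> nat" where
  "box_parent_2 k =
    (if k < 54 then
     (if k < 30 then
      (if k < 18 then
       (if k < 12 then
        (if k < 6 then
         [89, 86, 91, 54, 95, 8] ! k
        else
         [6, 90, 9, 6, 11, 8] ! (k - 6))
       else
        [11, 6, 15, 10, 17, 10] ! (k - 12))
      else
       (if k < 24 then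
        [15, 16, 19, 14, 23, 18] ! (k - 18)
       else
        [21, 20, 25, 16, 29, 24] ! (k - 24)))
     else
      (if k < 42 then
       (if k < 36 then
        [19, 28, 33, 30, 25, 22] ! (k - 30)
       else
        [37, 26, 29, 32, 33, 24] ! (k - 36))
      else
       (if k < 48 then
        [39, 34, 41, 40, 43, 38] ! (k - 42)
       else
        [39, 44, 45, 44, 27, 36] ! (k - 48))))
    else
     (if k < 84 then
      (if k < 72 then
       (if k < 66 then
        (if k < 60 then
         [55, 42, 43, 40, 59, 50] ! (k - 54)
        else
         [61, 48, 61, 52, 37, 58] ! (k - 60))
       else
        [57, 46, 69, 32, 71, 68] ! (k - 66))
      else
       (if k < 78 then
        [71, 70, 75, 70, 77, 72] ! (k - 72)
       else
        [55, 66, 73, 50, 77, 52] ! (k - 78)))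
     else
      (if k < 96 then
       (if k < 90 then
        [45, 82, 73, 28, 57, 34] ! (k - 84)
       else
        [49, 74, 27, 68, 23, 30] ! (k - 90))
      else
       (if k < 102 then
        [47, 60, 21, 48, 13, 74] ! (k - 96)
       else
        [9, 14, 63, 20, 81, 36] ! (k - 102)))))"

definition box_parent_3 :: "nat \<Rightarrow> nat" where
  "box_parent_3 k =
    (if k < 54 then
     (if k < 30 then
      (if k < 18 then
       (if k < 12 then
        (if k < 6 then
         [0, 1, 2, 34, 4, 5] ! k
        else
         [6, 7, 9, 6, 9, 6] ! (k - 6))
       else
        [13, 10, 15, 12, 15, 14] ! (k - 12))
      else
       (if k < 24 then
        [11, 12, 17, 8, 11, 8] ! (k - 18)
       else
        [25, 2, 27, 24, 29, 26] ! (k - 24)))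
     else
      (if k < 42 then
       (if k < 36 then
        [31, 26, 25, 28, 33, 2] ! (k - 30)
       else
        [37, 34, 39, 36, 39, 38] ! (k - 36))
      else
       (if k < 48 then
        [43, 40, 45, 42, 43, 44] ! (k - 42)
       else
        [37, 36, 41, 42, 52, 53] ! (k - 48))))
    else
     (if k < 84 then
      (if k < 72 then
       (if k < 66 then
        (if k < 60 then
         [54, 55, 56, 57, 58, 59] ! (k - 54)
        else
         [60, 61, 62, 63, 64, 65] ! (k - 60))
       else
        [66, 67, 68, 69, 70, 71] ! (k - 66))
      else
       (if k < 78 then
        [72, 73, 74, 75, 76, 77] ! (k - 72)
       else
        [78, 79, 80, 81, 82, 83] ! (k - 78)))
     else
      (if k < 96 then
       (if k < 90 then
        [84, 85, 86, 87, 88, 89] ! (k - 84)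
       else
        [90, 91, 92, 93, 94, 95] ! (k - 90))
      else
       (if k < 102 then
        [96, 97, 98, 99, 100, 101] ! (k - 96)
       else
        [102, 103, 104, 105, 106, 107] ! (k - 102)))))"

definition box_parent :: "nat \<Rightarrow> nat \<Rightarrow> nat" where
  "box_parent t k = (if t = 0 then box_parent_0 k else if t = 1 then box_parent_1 k else if t = 2 then box_parent_2 k else box_parent_3 k)"

lemmas box_parent_tab = box_parent_def box_parent_0_def box_parent_1_def box_parent_2_def box_parent_3_def

text \<open>The variables that are true for given \<open>v\<close>, \<open>h\<close> and \<open>h'\<close>.\<close>

definition box_solution :: "nat \<Rightarrow> bool \<Rightarrow> bool \<Rightarrow> bool \<Rightarrow> nat list" where
  "box_solution t v h h' = (
    if (t, v, h, h') = (0, False, False, False) then [9, 13, 17, 23, 27, 31, 33, 47, 53, 55, 61, 65, 71, 83, 95, 101, 103, 105] else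
    if (t, v, h, h') = (0, False, True, True) then [3, 7, 11, 17, 23, 35, 37, 49, 51, 57, 69, 73, 75, 81, 87, 89, 91, 107] else
    if (t, v, h, h') = (0, True, False, False) then [1, 5, 15, 21, 25, 39, 41, 43, 45, 59, 63, 67, 77, 79, 85, 93, 97, 99] else
    if (t, v, h, h') = (0, True, True, True) then [1, 3, 5, 7, 11, 15, 21, 27, 33, 37, 45, 49, 51, 57, 61, 65, 73, 79] else
    if (t, v, h, h') = (1, False, False, False) then [11, 15, 17, 23, 27, 35, 39, 43, 53, 55, 67, 73, 77, 79, 81, 87, 91, 107] else
    if (t, v, h, h') = (1, False, True, True) then [3, 7, 19, 21, 25, 31, 37, 45, 51, 63, 65, 75, 83, 93, 97, 99, 101, 103] else
    if (t, v, h, h') = (1, True, False, False) then [1, 5, 9, 13, 29, 33, 41, 47, 49, 57, 59, 61, 69, 71, 85, 89, 95, 105] else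
    if (t, v, h, h') = (1, True, False, True) then [1, 3, 5, 9, 13, 23, 27, 31, 35, 39, 47, 55, 65, 79, 93, 97, 99, 105] else
    if (t, v, h, h') = (1, True, True, True) then [1, 3, 5, 7, 15, 31, 35, 37, 45, 47, 55, 65, 75, 79, 89, 93, 97, 99] else
    if (t, v, h, h') = (2, False, False, False) then [9, 17, 21, 23, 43, 49, 57, 63, 69, 73, 77, 81, 87, 91, 95, 99, 105, 107] else
    if (t, v, h, h') = (2, False, False, True) then [3, 11, 13, 19, 21, 23, 37, 39, 45, 51, 65, 75, 83, 85, 87, 89, 93, 97] else
    if (t, v, h, h') = (2, False, True, True) then [3, 7, 11, 19, 31, 37, 39, 41, 45, 47, 65, 75, 83, 85, 89, 93, 97, 103] else
    if (t, v, h, h') = (2, True, False, False) then [1, 5, 13, 15, 25, 27, 29, 33, 35, 51, 53, 55, 59, 61, 67, 71, 79, 101] else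
    if (t, v, h, h') = (2, True, True, True) then [1, 3, 5, 7, 15, 19, 35, 37, 41, 43, 45, 61, 63, 65, 69, 75, 77, 87] else
    if (t, v, h, h') = (3, False, True, False) then [7, 19, 23, 25, 31, 37, 41, 51, 55, 59, 67, 71, 79, 83, 89, 95, 101, 105] else
    if (t, v, h, h') = (3, True, True, False) then [1, 5, 7, 19, 23, 25, 31, 37, 41, 51, 57, 61, 69, 73, 81, 93, 97, 107] else
    [])"

subsection \<open>Finite checks\<close>

definition opposite :: "nat \<Rightarrow> nat" where
  "opposite p = (if even p then p + 1 else p - 1)"

primrec all_below :: "nat \<Rightarrow> (nat \<Rightarrow> bool) \<Rightarrow> bool" where
  "all_below 0 P \<longleftrightarrow> True"
| "all_below (Suc n) P \<longleftrightarrow> P n \<and> all_below n P"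

text \<open>A form in which the simplifier can count down from a numeral.\<close>

lemma all_below_rec: "all_below n P \<longleftrightarrow> (if n = 0 then True else P (n - 1) \<and> all_below (n - 1) P)"
  by (cases n) auto

lemma all_below_iff: "all_below n P \<longleftrightarrow> (\<forall>k<n. P k)"
  by (induction n) (auto simp: less_Suc_eq)

text \<open>The third neighbour of a port, 108, is outside. A port must not be adjacent to its
  opposite inside the box: at the border of the grid the two are joined from outside, and a double
  edge would arise.\<close>

fun nbrs_ok_at :: "nat \<Rightarrow> nat \<Rightarrow> nat list \<Rightarrow> bool" where
  "nbrs_ok_at t k [a, b, c] \<longleftrightarrow> a < b \<and> b < c \<and> b < 108 \<and>
     even a \<noteq> even k \<and> even b \<noteq> even k \<and> k \<in> set (box_nbrs t a) \<and> k \<in> set (box_nbrs t b) \<and>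
     (if k < 8 then c = 108 \<and> opposite k \<noteq> a \<and> opposite k \<noteq> b
      else c < 108 \<and> even c \<noteq> even k \<and> k \<in> set (box_nbrs t c))"
| "nbrs_ok_at t k _ \<longleftrightarrow> False"

fun edge_is :: "nat \<Rightarrow> nat \<Rightarrow> nat \<Rightarrow> nat \<times> nat \<Rightarrow> bool" where
  "edge_is i k j (a, b) \<longleftrightarrow> i < 162 \<and> (a = k \<and> b = j \<or> a = j \<and> b = k)"

fun edges_ok_at :: "nat \<Rightarrow> nat \<Rightarrow> nat list \<Rightarrow> nat list \<Rightarrow> bool" where
  "edges_ok_at t k [] js \<longleftrightarrow> js = [] \<or> js = [108]"
| "edges_ok_at t k (i # is) (j # js) \<longleftrightarrow> edge_is i k j (box_edge t i) \<and> edges_ok_at t k is js"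
| "edges_ok_at t k _ _ \<longleftrightarrow> False"

fun in_box :: "int \<times> int \<Rightarrow> bool" where
  "in_box (x, y) \<longleftrightarrow> 0 \<le> x \<and> x \<le> 2400 \<and> 0 \<le> y \<and> y \<le> 2400"

fun cross_prod :: "int \<times> int \<Rightarrow> int \<times> int \<Rightarrow> int \<times> int \<Rightarrow> int" where
  "cross_prod (ax, ay) (bx, by) (cx, cy) = (bx - ax) * (cy - ay) - (by - ay) * (cx - ax)"

fun same_sign :: "int \<Rightarrow> int \<Rightarrow> bool" where
  "same_sign p q \<longleftrightarrow> (if 0 < p then 0 < q else p < 0 \<and> q < 0)"

type_synonym segment = "(int \<times> int) \<times> (int \<times> int)"

text \<open>The orientation test in integer arithmetic: segments with a common end must not be
  collinear, and otherwise the ends of one segment must lie strictly on the same side of the line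
  through the other.\<close>

fun noncrossing :: "segment \<Rightarrow> segment \<Rightarrow> bool" where
  "noncrossing (a, b) (c, d) \<longleftrightarrow>
     (if a = c then cross_prod a b d \<noteq> 0
      else if a = d then cross_prod a b c \<noteq> 0
      else if b = c then cross_prod b a d \<noteq> 0
      else if b = d then cross_prod b a c \<noteq> 0
      else if same_sign (cross_prod a b c) (cross_prod a b d) then True
      else same_sign (cross_prod c d a) (cross_prod c d b))"

fun left_of :: "segment \<Rightarrow> segment \<Rightarrow> bool" where
  "left_of ((ax, ay), (bx, by)) ((cx, cy), (dx, dy)) \<longleftrightarrow> bx < cx"

fun sorted_at :: "segment \<Rightarrow> segment \<Rightarrow> bool" where
  "sorted_at ((ax, ay), (bx, by)) ((cx, cy), (dx, dy)) \<longleftrightarrow> ax \<le> bx \<and> ax \<le> cx \<and> cx \<le> dx"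

fun coord_pair :: "nat \<Rightarrow> nat \<times> nat \<Rightarrow> segment" where
  "coord_pair t (k, j) = (box_coord t k, box_coord t j)"

definition box_segment :: "nat \<Rightarrow> nat \<Rightarrow> segment" where
  "box_segment t i = coord_pair t (box_edge t i)"

text \<open>A box has \<open>(3 * 108 - 8) / 2 = 158\<close> inner edges, and there are 4 edges
  between opposite ports.\<close>

definition box_segments :: "nat \<Rightarrow> segment list" where
  "box_segments t = map (box_segment t) [0..<162]"

fun y_apart :: "segment \<Rightarrow> segment \<Rightarrow> bool" where
  "y_apart ((ax, ay), (bx, by)) ((cx, cy), (dx, dy)) \<longleftrightarrow>
     (if ay < cy then (if ay < dy then (if by < cy then by < dy else False) else False)
      else if cy < ay then (if dy < ay then (if cy < by then dy < by else False) else False)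
      else False)"

text \<open>A sweep over segments sorted by their left ends: the first one that starts to the right
  of all of \<open>e\<close> ends the comparison, since all later ones do so too. The cheap test
  \<open>y_apart\<close> precedes the multiplications of \<open>noncrossing\<close>.\<close>

fun noncrossing_from :: "segment \<Rightarrow> segment list \<Rightarrow> bool" where
  "noncrossing_from e [] \<longleftrightarrow> True"
| "noncrossing_from e (f # fs) \<longleftrightarrow>
     (if left_of e f then True
      else if y_apart e f then noncrossing_from e fs
      else if noncrossing e f then noncrossing_from e fs else False)"

fun noncrossing_all :: "segment list \<Rightarrow> bool" where
  "noncrossing_all [] \<longleftrightarrow> True"
| "noncrossing_all (e # es) \<longleftrightarrow> (if noncrossing_from e es then noncrossing_all es else False)"

fun ordered :: "segment list \<Rightarrow> bool" where
  "ordered (e # f # fs) \<longleftrightarrow> (if sorted_at e f then ordered (f # fs) else False)"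
| "ordered _ \<longleftrightarrow> True"

definition one_of :: "bool \<Rightarrow> bool \<Rightarrow> bool \<Rightarrow> bool" where
  "one_of a b c \<longleftrightarrow> a \<and> \<not> b \<and> \<not> c \<or> \<not> a \<and> b \<and> \<not> c \<or> \<not> a \<and> \<not> b \<and> c"

fun exact_at :: "nat list \<Rightarrow> (nat \<Rightarrow> bool) \<Rightarrow> bool \<Rightarrow> bool" where
  "exact_at [a, b, c] s i \<longleftrightarrow> one_of (s a) (s b) (if c = 108 then i else s c)"
| "exact_at _ s i \<longleftrightarrow> False"

definition exact :: "nat \<Rightarrow> nat list \<Rightarrow> (nat \<Rightarrow> bool) \<Rightarrow> (nat \<Rightarrow> bool) \<Rightarrow> bool" where
  "exact t ks s i \<longleftrightarrow> list_all (\<lambda>k. exact_at (box_nbrs t k) s (i k)) ks"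

definition all_clauses :: "nat list" where
  "all_clauses = [0, 2, 4, 6, 8, 10, 12, 14, 16, 18, 20, 22, 24, 26, 28, 30, 32, 34, 36, 38, 40, 42, 44, 46, 48, 50, 52, 54, 56, 58, 60, 62, 64, 66, 68, 70, 72, 74, 76, 78, 80, 82, 84, 86, 88, 90, 92, 94, 96, 98, 100, 102, 104, 106]"

text \<open>In boxes of type 3, the clauses of the left component and the vertices of the right one.\<close>

definition left_clauses :: "nat list" where
  "left_clauses = [6, 8, 10, 12, 14, 16, 18, 20, 22]"

definition right_clauses :: "nat list" where
  "right_clauses = [2, 24, 26, 28, 30, 32, 34, 36, 38, 40, 42, 44, 46, 48, 50]"

definition right_variables :: "nat list" where
  "right_variables = [3, 25, 27, 29, 31, 33, 35, 37, 39, 41, 43, 45, 47, 49, 51]"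

text \<open>The outer neighbours of the even ports carry the signals: \<open>v\<close> at 0 and 4,
  \<open>h'\<close> at 2 and \<open>h\<close> at 6.\<close>

definition solution_ok :: "nat \<Rightarrow> bool \<Rightarrow> bool \<Rightarrow> bool \<Rightarrow> nat list \<Rightarrow> bool" where
  "solution_ok t v h h' S \<longleftrightarrow> list_all odd S \<and> (1 \<in> set S) = v \<and> (5 \<in> set S) = v \<and> (3 \<in> set S) = h' \<and> (7 \<in> set S) = h \<and>
     list_all (\<lambda>k. exact_at (box_nbrs t k) (\<lambda>j. j \<in> set S) (if k = 2 then h' else if k = 6 then h else v)) all_clauses"

section \<open>Evaluation of the checks for the four types of boxes\<close>

lemma less_4_cases: "t < 4 \<longleftrightarrow> t = 0 \<or> t = 1 \<or> t = 2 \<or> t = (3 :: nat)" by auto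

lemma nbrs_ok: "t < 4 \<Longrightarrow> all_below 108 (\<lambda>k. nbrs_ok_at t k (box_nbrs t k))"
  unfolding less_4_cases by (elim disjE; hypsubst) (simp add: all_below_rec box_nbrs_tab opposite_def)+

lemma edges_ok: "t < 4 \<Longrightarrow> all_below 108 (\<lambda>k. edges_ok_at t k (box_edges_at t k) (box_nbrs t k))"
  unfolding less_4_cases
  by (elim disjE; hypsubst) (simp add: all_below_rec box_nbrs_tab box_edges_at_tab box_edge_tab)+

lemma border_edges_ok: "t < 4 \<Longrightarrow> i < 4 \<Longrightarrow> edge_is (border_edge t i) (2 * i) (2 * i + 1) (box_edge t (border_edge t i))"
  unfolding less_4_cases by (elim disjE; hypsubst) (simp add: border_edge_def box_edge_tab)+

lemma coords_ok: "t < 4 \<Longrightarrow> all_below 108 (\<lambda>k. in_box (box_coord t k))"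
  unfolding less_4_cases by (elim disjE; hypsubst) (simp add: all_below_rec box_coord_tab)+

lemma edge_bounds: "t < 4 \<Longrightarrow> all_below 162 (\<lambda>i. fst (box_edge t i) < 108 \<and> snd (box_edge t i) < 108)"
  unfolding less_4_cases by (elim disjE; hypsubst) (simp add: all_below_rec box_edge_tab)+

lemma port_coords:
  assumes "t < 4"
  shows "box_coord t 0 = (800, 2400)" "box_coord t 1 = (1600, 2400)" "box_coord t 2 = (2400, 1600)"
    "box_coord t 3 = (2400, 800)" "box_coord t 4 = (1600, 0)" "box_coord t 5 = (800, 0)"
    "box_coord t 6 = (0, 800)" "box_coord t 7 = (0, 1600)"
  using assms unfolding less_4_cases by (elim disjE; simp add: box_coord_tab)+

lemma upt_rec_less: "[a..<numeral b] = (if a < numeral b then a # [Suc a..<numeral b] else [])"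
  by (simp add: upt_rec)

lemmas box_segment_simps = box_segments_def upt_rec_numeral upt_rec_less box_segment_def box_edge_tab box_coord_tab

\<comment> \<open>The tables are expanded into explicit lists once, so that the evaluations that
  follow work on literals.\<close>
schematic_goal box_segments_0: "box_segments 0 = ?L" by (simp add: box_segment_simps)
schematic_goal box_segments_1: "box_segments 1 = ?L" by (simp add: box_segment_simps)
schematic_goal box_segments_2: "box_segments 2 = ?L" by (simp add: box_segment_simps)
schematic_goal box_segments_3: "box_segments 3 = ?L" by (simp add: box_segment_simps)

lemma noncrossing_0: "noncrossing_all (box_segments 0)" unfolding box_segments_0 by code_simp
lemma noncrossing_1: "noncrossing_all (box_segments 1)" unfolding box_segments_1 by code_simp
lemma noncrossing_2: "noncrossing_all (box_segments 2)" unfolding box_segments_2 by code_simp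
lemma noncrossing_3: "noncrossing_all (box_segments 3)" unfolding box_segments_3 by code_simp

lemma segments_noncrossing: "t < 4 \<Longrightarrow> noncrossing_all (box_segments t)"
  unfolding less_4_cases using noncrossing_0 noncrossing_1 noncrossing_2 noncrossing_3 by blast

lemma ordered_0: "ordered (box_segments 0)" unfolding box_segments_0 by code_simp
lemma ordered_1: "ordered (box_segments 1)" unfolding box_segments_1 by code_simp
lemma ordered_2: "ordered (box_segments 2)" unfolding box_segments_2 by code_simp
lemma ordered_3: "ordered (box_segments 3)" unfolding box_segments_3 by code_simp

lemma segments_ordered: "t < 4 \<Longrightarrow> ordered (box_segments t)"
  unfolding less_4_cases using ordered_0 ordered_1 ordered_2 ordered_3 by blast

definition box_coords :: "nat \<Rightarrow> (int \<times> int) list" where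
  "box_coords t = map (box_coord t) [0..<108]"

lemmas box_coords_simps = box_coords_def upt_rec_numeral upt_rec_less box_coord_tab

schematic_goal box_coords_0: "box_coords 0 = ?L" by (simp add: box_coords_simps)
schematic_goal box_coords_1: "box_coords 1 = ?L" by (simp add: box_coords_simps)
schematic_goal box_coords_2: "box_coords 2 = ?L" by (simp add: box_coords_simps)
schematic_goal box_coords_3: "box_coords 3 = ?L" by (simp add: box_coords_simps)

lemma distinct_0: "distinct (box_coords 0)" unfolding box_coords_0 by code_simp
lemma distinct_1: "distinct (box_coords 1)" unfolding box_coords_1 by code_simp
lemma distinct_2: "distinct (box_coords 2)" unfolding box_coords_2 by code_simp
lemma distinct_3: "distinct (box_coords 3)" unfolding box_coords_3 by code_simp

lemma coords_distinct: "t < 4 \<Longrightarrow> distinct (box_coords t)"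
  unfolding less_4_cases using distinct_0 distinct_1 distinct_2 distinct_3 by blast

text \<open>\<open>opposite\<close> exchanges \<open>2 * i\<close> and \<open>2 * i + 1\<close>;
  comparing its values gives the order 9, 8, 11, 10, ... of the spanning trees.\<close>

definition precedes :: "nat \<Rightarrow> nat \<Rightarrow> nat \<Rightarrow> nat \<Rightarrow> bool" where
  "precedes r0 m p k \<longleftrightarrow> p = r0 \<or> m \<le> p \<and> opposite p < opposite k"

lemma parents_6: "t < 3 \<Longrightarrow> all_below 100 (\<lambda>k. precedes 6 8 (box_parent t (k + 8)) (k + 8))"
  "t < 3 \<Longrightarrow> all_below 8 (\<lambda>k. k = 6 \<or> 8 \<le> box_parent t k)"
proof -
  have *: "t < 3 \<longleftrightarrow> t = 0 \<or> t = 1 \<or> t = 2" by auto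
  show "t < 3 \<Longrightarrow> all_below 100 (\<lambda>k. precedes 6 8 (box_parent t (k + 8)) (k + 8))"
    unfolding * by (elim disjE; hypsubst) (simp add: all_below_rec precedes_def opposite_def box_parent_tab)+
  show "t < 3 \<Longrightarrow> all_below 8 (\<lambda>k. k = 6 \<or> 8 \<le> box_parent t k)"
    unfolding * by (elim disjE; hypsubst) (simp add: all_below_rec box_parent_tab)+
qed

lemma parents_3:
  "all_below 16 (\<lambda>k. precedes 6 8 (box_parent 3 (k + 8)) (k + 8))"
  "all_below 28 (\<lambda>k. precedes 2 24 (box_parent 3 (k + 24)) (k + 24))"
  "24 \<le> box_parent 3 3 \<and> box_parent 3 3 < 52"
  by (simp_all add: all_below_rec precedes_def opposite_def box_parent_tab)

lemma parents_ok: "t < 4 \<Longrightarrow> all_below 108 (\<lambda>k. box_parent t k = k \<or> box_parent t k < 108 \<and> box_parent t k \<in> set (box_nbrs t k))"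
  unfolding less_4_cases
  by (elim disjE; hypsubst) (simp add: all_below_rec box_parent_tab box_nbrs_tab)+

lemma solutions_ok:
  "solution_ok 0 v h h (box_solution 0 v h h)"
  "v \<or> h = h' \<Longrightarrow> h \<longrightarrow> h' \<Longrightarrow> solution_ok 1 v h h' (box_solution 1 v h h')"
  "\<not> v \<or> h = h' \<Longrightarrow> h \<longrightarrow> h' \<Longrightarrow> solution_ok 2 v h h' (box_solution 2 v h h')"
  "solution_ok 3 v True False (box_solution 3 v True False)"
  by (cases v; cases h; cases h';
    simp add: solution_ok_def box_solution_def one_of_def box_nbrs_tab all_clauses_def)+

lemmas exact_simps = exact_def all_clauses_def left_clauses_def right_clauses_def right_variables_def
  box_nbrs_tab

text \<open>Here \<open>i k\<close> is the value of the outer neighbour of port \<open>k\<close>: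
  \<open>i 0\<close> arrives from above and \<open>i 6\<close> from the left. The implication is
  purely propositional and is decided as such.\<close>

lemma box_relation_0: "exact 0 all_clauses s i \<Longrightarrow> (s 5 \<longleftrightarrow> i 0) \<and> (s 3 \<longleftrightarrow> i 6)"
  by (simp add: exact_simps) (simp only: one_of_def, sat)

text \<open>For literals the row value is only bounded from above: the box may switch the row on,
  but only if the literal is true.\<close>

lemma box_relation_1: "exact 1 all_clauses s i \<Longrightarrow> (s 5 \<longleftrightarrow> i 0) \<and> (s 3 \<longrightarrow> i 6 \<or> i 0)"
  by (simp add: exact_simps) (simp only: one_of_def, sat)

lemma box_relation_2: "exact 2 all_clauses s i \<Longrightarrow> (s 5 \<longleftrightarrow> i 0) \<and> (s 3 \<longrightarrow> i 6 \<or> \<not> i 0)"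
  by (simp add: exact_simps) (simp only: one_of_def, sat)

text \<open>The left component closes a row and accepts it only if it arrives true; the right
  component starts a row with false. The third part fixes the orientation: the right component
  cannot be covered with its odd vertices in the role of clauses.\<close>

lemma box_relation_3:
  "exact 3 left_clauses s i \<Longrightarrow> i 6" "exact 3 right_clauses s i \<Longrightarrow> \<not> s 3"
  "\<not> exact 3 right_variables s i"
  by (simp add: exact_simps, simp only: one_of_def, sat)+

section \<open>The grid\<close>

lemma nbrs_facts:
  assumes "t < 4" "k < 108"
  obtains a b c where "box_nbrs t k = [a, b, c]" "distinct [a, b, c]" "a < 108" "b < 108"
    "c = 108 \<longleftrightarrow> k < 8" "c \<le> 108" "k < 8 \<Longrightarrow> opposite k \<notin> {a, b}"
    "\<And>j. j \<in> {a, b, c} \<Longrightarrow> j \<noteq> 108 \<Longrightarrow> even k \<noteq> even j \<and> k \<in> set (box_nbrs t j)"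
proof -
  have ok: "nbrs_ok_at t k (box_nbrs t k)" using nbrs_ok[OF assms(1)] assms(2) by (simp add: all_below_iff)
  then obtain a b c where ns: "box_nbrs t k = [a, b, c]"
    by (cases "(t, k, box_nbrs t k)" rule: nbrs_ok_at.cases) auto
  show thesis
    by (rule that[of a b c]) (use ok[unfolded ns] ns in \<open>auto split: if_splits\<close>)
qed

lemma length_filter_one_of: "length (filter P [a, b, c]) = 1 \<longleftrightarrow> one_of (P a) (P b) (P c)"
  by (auto simp: one_of_def)

section \<open>Exact covers of the grid and satisfying assignments\<close>

type_synonym vertex = "nat \<times> nat \<times> nat"

locale grid =
  fixes R C :: nat and ty :: "nat \<Rightarrow> nat \<Rightarrow> nat"
  assumes R: "R > 0" and C: "C > 1"
    and ty_border: "\<And>r. ty r 0 = 3" "\<And>r. ty r (C - 1) = 3"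
    and ty_inner: "\<And>r c. 0 < c \<Longrightarrow> c < C - 1 \<Longrightarrow> ty r c < 3"
begin

definition verts :: "vertex set" where "verts = {..<R} \<times> {..<C} \<times> {..<108}"

text \<open>At the border of the grid a port is joined to its opposite, which keeps the graph cubic
  and bipartite. Elsewhere ports are paired so that connecting edges are parallel to the axes: 2
  with 7, 3 with 6, 4 with 1, and 5 with 0.\<close>

definition partner :: "vertex \<Rightarrow> vertex" where
  "partner = (\<lambda>(r, c, p).
     if p = 0 then (if r = 0 then (r, c, 1) else (r - 1, c, 5))
     else if p = 1 then (if r = 0 then (r, c, 0) else (r - 1, c, 4))
     else if p = 2 then (if Suc c = C then (r, c, 3) else (r, Suc c, 7))
     else if p = 3 then (if Suc c = C then (r, c, 2) else (r, Suc c, 6))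
     else if p = 4 then (if Suc r = R then (r, c, 5) else (Suc r, c, 1))
     else if p = 5 then (if Suc r = R then (r, c, 4) else (Suc r, c, 0))
     else if p = 6 then (if c = 0 then (r, c, 7) else (r, c - 1, 3))
     else (if c = 0 then (r, c, 6) else (r, c - 1, 2)))"

definition nbrs :: "vertex \<Rightarrow> vertex list" where
  "nbrs = (\<lambda>(r, c, k). map (\<lambda>j. if j = 108 then partner (r, c, k) else (r, c, j)) (box_nbrs (ty r c) k))"

lemma ty_less: "c < C \<Longrightarrow> ty r c < 4"
proof -
  assume "c < C"
  then consider "c = 0" | "c = C - 1" | "0 < c" "c < C - 1" by linarith
  then show ?thesis using ty_border[of r] ty_inner[of c r] by cases auto
qed

lemma less_8_cases: "p < 8 \<longleftrightarrow> p = 0 \<or> p = 1 \<or> p = 2 \<or> p = 3 \<or> p = 4 \<or> p = 5 \<or> p = 6 \<or> p = (7 :: nat)"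
  by auto

lemma partner_facts:
  assumes "r < R" "c < C" "p < 8"
  obtains r' c' p' where "partner (r, c, p) = (r', c', p')" "r' < R" "c' < C" "p' < 8" "even p' \<noteq> even p"
    "partner (r', c', p') = (r, c, p)" "r' = r \<Longrightarrow> c' = c \<Longrightarrow> p' = opposite p"
proof (rule that[of "fst (partner (r, c, p))" "fst (snd (partner (r, c, p)))" "snd (snd (partner (r, c, p)))"])
  let ?q = "partner (r, c, p)"
  have p: "p = 0 \<or> p = 1 \<or> p = 2 \<or> p = 3 \<or> p = 4 \<or> p = 5 \<or> p = 6 \<or> p = 7"
    using assms(3) less_8_cases by blast
  show "?q = (fst ?q, fst (snd ?q), snd (snd ?q))" by simp
  show "fst ?q < R" "fst (snd ?q) < C" "snd (snd ?q) < 8" "even (snd (snd ?q)) \<noteq> even p"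
    "partner (fst ?q, fst (snd ?q), snd (snd ?q)) = (r, c, p)"
    "fst ?q = r \<Longrightarrow> fst (snd ?q) = c \<Longrightarrow> snd (snd ?q) = opposite p"
    using p assms(1,2) R C by (elim disjE; auto simp: partner_def opposite_def split: if_splits)+
qed

lemma nbrs_box:
  assumes "r < R" "c < C" "k < 108"
  obtains a b d where "nbrs (r, c, k) = [(r, c, a), (r, c, b), d]" "box_nbrs (ty r c) k = [a, b, if k < 8 then 108 else snd (snd d)]"
    "a < 108" "b < 108" "d = (if k < 8 then partner (r, c, k) else (r, c, snd (snd d)))" "snd (snd d) < 108"
    "distinct (nbrs (r, c, k))"
proof -
  obtain a b e where ab: "box_nbrs (ty r c) k = [a, b, e]" "distinct [a, b, e]" "a < 108" "b < 108"
    "e = 108 \<longleftrightarrow> k < 8" "e \<le> 108" "k < 8 \<Longrightarrow> opposite k \<notin> {a, b}"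
    by (rule nbrs_facts[OF ty_less[OF assms(2)] assms(3), of r]) blast
  show thesis
  proof (cases "k < 8")
    case True
    obtain r' c' p' where p: "partner (r, c, k) = (r', c', p')" "p' < 8" "r' = r \<Longrightarrow> c' = c \<Longrightarrow> p' = opposite k"
      by (rule partner_facts[OF assms(1,2) True]) blast
    have "distinct (nbrs (r, c, k))" using ab p True by (auto simp: nbrs_def)
    then show thesis using ab True p by (intro that[of a b "partner (r, c, k)"]) (auto simp: nbrs_def)
  next
    case False
    have "distinct (nbrs (r, c, k))" using ab False by (auto simp: nbrs_def)
    then show thesis using ab False by (intro that[of a b "(r, c, e)"]) (auto simp: nbrs_def)
  qed
qed

lemma nbrs_sound:
  assumes "u \<in> verts" "v \<in> set (nbrs u)"
  shows "v \<in> verts" "u \<in> set (nbrs v)" "even (snd (snd u)) \<noteq> even (snd (snd v))"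
proof -
  obtain r c k where u: "u = (r, c, k)" "r < R" "c < C" "k < 108" using assms(1) by (auto simp: verts_def)
  obtain a b e where ab: "box_nbrs (ty r c) k = [a, b, e]" "a < 108" "b < 108" "e = 108 \<longleftrightarrow> k < 8" "e \<le> 108"
    and sym: "\<And>j. j \<in> {a, b, e} \<Longrightarrow> j \<noteq> 108 \<Longrightarrow> even k \<noteq> even j \<and> k \<in> set (box_nbrs (ty r c) j)"
    by (rule nbrs_facts[OF ty_less[OF u(3)] u(4), of r]) blast
  consider j where "v = (r, c, j)" "j \<in> {a, b, e}" "j < 108" | "k < 8" "v = partner (r, c, k)"
    using assms(2) ab by (force simp: u nbrs_def split: if_splits)
  then have "v \<in> verts \<and> u \<in> set (nbrs v) \<and> even (snd (snd u)) \<noteq> even (snd (snd v))"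
  proof cases
    case 1
    then have "k \<in> set (box_nbrs (ty r c) j)" "even k \<noteq> even j" using sym[of j] by auto
    moreover have "k \<noteq> 108" using u by simp
    ultimately show ?thesis using 1 u by (force simp: verts_def nbrs_def)
  next
    case 2
    obtain r' c' p' where p: "partner (r, c, k) = (r', c', p')" "r' < R" "c' < C" "p' < 8" "even p' \<noteq> even k"
      "partner (r', c', p') = (r, c, k)"
      by (rule partner_facts[OF u(2,3) 2(1)]) blast
    have "p' < 108" using p(4) by simp
    obtain a' b' where "box_nbrs (ty r' c') p' = [a', b', 108]"
      by (rule nbrs_facts[OF ty_less[OF p(3)] \<open>p' < 108\<close>, of r']) (use p(4) in auto)
    then have "u \<in> set (nbrs v)" using 2(2) p u by (auto simp: nbrs_def)
    then show ?thesis using 2(2) p u by (auto simp: verts_def)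
  qed
  then show "v \<in> verts" "u \<in> set (nbrs v)" "even (snd (snd u)) \<noteq> even (snd (snd v))" by auto
qed

definition count :: "(vertex \<Rightarrow> bool) \<Rightarrow> vertex \<Rightarrow> nat" where
  "count S u = length (filter S (nbrs u))"

text \<open>The counterpart of an exact set in terms of triples; it leaves open which parity class
  has count 1.\<close>

definition solves :: "(vertex \<Rightarrow> bool) \<Rightarrow> bool" where
  "solves S \<longleftrightarrow> (\<forall>u\<in>verts. count S u \<le> 1 \<and> (\<forall>v\<in>set (nbrs u). count S u \<noteq> count S v))"

definition satisfies_row :: "(nat \<Rightarrow> bool) \<Rightarrow> nat \<Rightarrow> bool" where
  "satisfies_row v r \<longleftrightarrow> (\<exists>c<C. ty r c = 1 \<and> v c \<or> ty r c = 2 \<and> \<not> v c)"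

lemma count_exact:
  assumes "r < R" "c < C" "set ks \<subseteq> {..<108}" "\<And>k. k \<in> set ks \<Longrightarrow> count S (r, c, k) = 1"
  shows "exact (ty r c) ks (\<lambda>j. S (r, c, j)) (\<lambda>k. S (partner (r, c, k)))"
  unfolding exact_def list_all_iff
proof
  fix k assume k: "k \<in> set ks"
  then have "k < 108" using assms(3) by auto
  obtain a b d where ab: "nbrs (r, c, k) = [(r, c, a), (r, c, b), d]"
    "box_nbrs (ty r c) k = [a, b, if k < 8 then 108 else snd (snd d)]"
    "d = (if k < 8 then partner (r, c, k) else (r, c, snd (snd d)))" "snd (snd d) < 108"
    by (rule nbrs_box[OF assms(1,2) \<open>k < 108\<close>]) blast
  have "one_of (S (r, c, a)) (S (r, c, b)) (S d)"
    using assms(4)[OF k] length_filter_one_of[of S "(r, c, a)" "(r, c, b)" d] by (simp add: count_def ab(1))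
  then show "exact_at (box_nbrs (ty r c) k) (\<lambda>j. S (r, c, j)) (S (partner (r, c, k)))"
    using ab(2-4) by (cases "k < 8") auto
qed

text \<open>Each row is oriented by its first box. Then every inner box obeys its relation, each
  column transports one truth value, and a row without a true literal would arrive with the value
  false at the last box, which refuses it.\<close>

lemma solves_imp_satisfies:
  assumes S: "solves S"
  shows "\<exists>v. \<forall>r<R. satisfies_row v r"
proof -
  \<comment> \<open>Adjacent vertices have different parities and, by \<open>solves\<close>, the
    counts 0 and 1; so agreement of count and parity is invariant along edges.\<close>
  define good where "good u \<longleftrightarrow> (count S u = (if even (snd (snd u)) then 1 else 0))" for u
  have good_nbr: "good u \<longleftrightarrow> good v" if "u \<in> verts" "v \<in> set (nbrs u)" for u v
    using S that nbrs_sound[OF that] by (fastforce simp: solves_def good_def le_Suc_eq)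
  have good_parent: "box_parent (ty r c) k < 108 \<and> (good (r, c, k) \<longleftrightarrow> good (r, c, box_parent (ty r c) k))"
    if "r < R" "c < C" "k < 108" for r c k
  proof -
    define j where "j = box_parent (ty r c) k"
    have j: "j = k \<or> j < 108 \<and> j \<in> set (box_nbrs (ty r c) k)"
      using parents_ok[OF ty_less[OF that(2)], of r] that(3) by (auto simp: all_below_iff j_def)
    have "(r, c, j) \<in> set (nbrs (r, c, k))" if "j < 108" "j \<in> set (box_nbrs (ty r c) k)"
      using that by (force simp: nbrs_def)
    with j good_nbr[of "(r, c, k)" "(r, c, j)"] that show ?thesis
      unfolding j_def[symmetric] by (auto simp: verts_def)
  qed
  \<comment> \<open>Parents are smaller in the order of \<open>precedes\<close>, hence the induction
    on \<open>opposite k\<close>; as \<open>hi\<close> is even, exchanging partners does not leave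
    the range.\<close>
  have tree: "good (r, c, k) \<longleftrightarrow> good (r, c, r0)"
    if rc: "r < R" "c < C" and k: "lo \<le> k" "k < hi" and hi: "hi \<le> 108" "even hi"
      and pre: "\<And>k. lo \<le> k \<Longrightarrow> k < hi \<Longrightarrow> precedes r0 lo (box_parent (ty r c) k) k" for r c k lo hi r0
    using k
  proof (induction "opposite k" arbitrary: k rule: less_induct)
    case less
    let ?p = "box_parent (ty r c) k"
    have gp: "good (r, c, k) \<longleftrightarrow> good (r, c, ?p)" using good_parent[OF rc, of k] less.prems hi by simp
    have "?p = r0 \<or> lo \<le> ?p \<and> opposite ?p < opposite k" using pre[OF less.prems] by (simp add: precedes_def)
    then show ?case
    proof
      assume p: "lo \<le> ?p \<and> opposite ?p < opposite k"
      have "opposite k < hi" using less.prems(2) hi(2) by (auto simp: opposite_def elim!: evenE)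
      then have "?p < hi" using p hi(2) by (auto simp: opposite_def elim!: evenE split: if_splits)
      then show ?thesis using less.hyps[of ?p] p gp by blast
    qed (use gp in simp)
  qed
  have spread: "good (r, c, k) \<longleftrightarrow> good (r, c, 6)" if rc: "r < R" "c < C" and t: "ty r c < 3" and k: "k < 108" for r c k
  proof -
    have big: "good (r, c, k) \<longleftrightarrow> good (r, c, 6)" if "8 \<le> k" "k < 108" for k
    proof (rule tree[OF rc that])
      fix k :: nat assume "8 \<le> k" "k < 108"
      then show "precedes 6 8 (box_parent (ty r c) k) k"
        using parents_6(1)[OF t] by (auto simp: all_below_iff dest!: spec[of _ "k - 8"])
    qed auto
    show ?thesis
    proof (cases "8 \<le> k \<or> k = 6")
      case False
      then have "8 \<le> box_parent (ty r c) k" using parents_6(2)[OF t] unfolding all_below_iff by (metis not_le)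
      then show ?thesis using big[of "box_parent (ty r c) k"] good_parent[OF rc k] by blast
    qed (use big k in auto)
  qed
  have right: "\<not> S (r, 0, 3)" "good (r, 0, 3)" if r: "r < R" for r
  proof -
    have C0: "0 < C" using C by simp
    have big: "good (r, 0, k) \<longleftrightarrow> good (r, 0, 2)" if "24 \<le> k" "k < 52" for k
    proof (rule tree[OF r C0 that])
      fix k :: nat assume "24 \<le> k" "k < 52"
      then show "precedes 2 24 (box_parent (ty r 0) k) k"
        using parents_3(2) ty_border(1) by (auto simp: all_below_iff dest!: spec[of _ "k - 24"])
    qed auto
    have sp: "good (r, 0, k) \<longleftrightarrow> good (r, 0, 2)" if k: "k \<in> set (right_clauses @ right_variables)" for k
    proof -
      have "k = 2 \<or> k = 3 \<or> 24 \<le> k \<and> k < 52" using k by (auto simp: right_clauses_def right_variables_def)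
      then show ?thesis
        using big[of k] big[of "box_parent 3 3"] parents_3(3) good_parent[OF r C0, of 3] ty_border(1) by auto
    qed
    \<comment> \<open>In the wrong orientation each odd vertex of the right component would have
      exactly one neighbour in \<open>S\<close>.\<close>
    have "good (r, 0, 2)"
    proof (rule ccontr)
      assume bad: "\<not> good (r, 0, 2)"
      have "count S (r, 0, k) = 1" if k: "k \<in> set right_variables" for k
      proof -
        have "odd k" "k < 108" using k by (auto simp: right_variables_def)
        moreover have "\<not> good (r, 0, k)" using sp[of k] bad k by simp
        moreover have "count S (r, 0, k) \<le> 1" using S r C0 \<open>k < 108\<close> by (auto simp: solves_def verts_def)
        ultimately show ?thesis by (auto simp: good_def)
      qed
      then have "exact 3 right_variables (\<lambda>j. S (r, 0, j)) (\<lambda>k. S (partner (r, 0, k)))"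
        using count_exact[OF r C0, of right_variables S] ty_border by (auto simp: right_variables_def)
      then show False using box_relation_3(3) by blast
    qed
    then have "count S (r, 0, k) = 1" if "k \<in> set right_clauses" for k
      using sp[of k] that by (auto simp: good_def right_clauses_def)
    then have "exact 3 right_clauses (\<lambda>j. S (r, 0, j)) (\<lambda>k. S (partner (r, 0, k)))"
      using count_exact[OF r C0, of right_clauses S] ty_border by (auto simp: right_clauses_def)
    then show "\<not> S (r, 0, 3)" by (rule box_relation_3(2))
    show "good (r, 0, 3)" using sp[of 3] \<open>good (r, 0, 2)\<close> by (simp add: right_variables_def)
  qed
  have step: "good (r, Suc c, 6) \<longleftrightarrow> good (r, c, 3)" if "r < R" "Suc c < C" for r c
  proof -
    have t: "ty r c < 4" using that ty_less by simp
    obtain a b where "box_nbrs (ty r c) 3 = [a, b, 108]"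
      by (rule nbrs_facts[OF t, of 3]) simp_all
    then have "(r, Suc c, 6) \<in> set (nbrs (r, c, 3))" using that by (simp add: nbrs_def partner_def)
    then show ?thesis using good_nbr[of "(r, c, 3)" "(r, Suc c, 6)"] that by (auto simp: verts_def)
  qed
  have enter: "good (r, Suc c, 6)" if r: "r < R" and c: "Suc c < C" for r c
    using c
  proof (induction c)
    case 0
    then show ?case using step[OF r 0] right(2)[OF r] by simp
  next
    case (Suc c)
    have "ty r (Suc c) < 3" using Suc.prems by (intro ty_inner) auto
    then have "good (r, Suc c, 3)" using spread[OF r, of "Suc c" 3] Suc by simp
    then show ?case using step[OF r Suc.prems] by simp
  qed
  have inner: "exact (ty r c) all_clauses (\<lambda>j. S (r, c, j)) (\<lambda>k. S (partner (r, c, k)))"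
    if r: "r < R" and c: "0 < c" "c < C - 1" for r c
  proof (rule count_exact[OF r])
    show "c < C" using c by simp
    have "good (r, c, 6)" using enter[OF r, of "c - 1"] c by simp
    then have "good (r, c, k)" if "k < 108" for k
      using spread[OF r \<open>c < C\<close> ty_inner[OF c] that] by blast
    then show "count S (r, c, k) = 1" if "k \<in> set all_clauses" for k
      using that by (auto simp: good_def all_clauses_def)
  qed (auto simp: all_clauses_def)
  \<comment> \<open>In the last column the row only reaches the left component, and this demands the
    value true from the left.\<close>
  have last: "S (partner (r, C - 1, 6))" if r: "r < R" for r
  proof -
    have C1: "C - 1 < C" using C by simp
    have "good (r, C - 1, 6)" using enter[OF r, of "C - 2"] C by (simp add: Suc_diff_Suc numeral_2_eq_2)
    then have "count S (r, C - 1, k) = 1" if "k \<in> set left_clauses" for k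
    proof -
      have "k = 6 \<or> 8 \<le> k \<and> k < 24" "even k" using that by (auto simp: left_clauses_def)
      moreover have "good (r, C - 1, k) \<longleftrightarrow> good (r, C - 1, 6)" if "8 \<le> k" "k < 24" for k
      proof (rule tree[OF r C1 that])
        fix k :: nat assume "8 \<le> k" "k < 24"
        then show "precedes 6 8 (box_parent (ty r (C - 1)) k) k"
          using parents_3(1) ty_border(2) by (auto simp: all_below_iff dest!: spec[of _ "k - 8"])
      qed auto
      ultimately have "good (r, C - 1, k)" using \<open>good (r, C - 1, 6)\<close> by blast
      then show ?thesis using \<open>even k\<close> by (simp add: good_def)
    qed
    then have "exact 3 left_clauses (\<lambda>j. S (r, C - 1, j)) (\<lambda>k. S (partner (r, C - 1, k)))"
      using count_exact[OF r C1, of left_clauses S] ty_border by (auto simp: left_clauses_def)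
    then show ?thesis by (rule box_relation_3(1))
  qed
  \<comment> \<open>The value of a column is read off at the top, where port 0 is joined to port 1
    of the same box.\<close>
  define v where "v c = S (partner (0, c, 0))" for c
  have col: "S (partner (r, c, 0)) = v c" if "r < R" "0 < c" "c < C - 1" for r c
    using that(1)
  proof (induction r)
    case (Suc r)
    have "ty r c < 3" using that by (intro ty_inner) auto
    then consider "ty r c = 0" | "ty r c = 1" | "ty r c = 2" by linarith
    then have "S (r, c, 5) = S (partner (r, c, 0))"
      using inner[of r c] Suc.prems that
      by cases (auto simp del: One_nat_def dest!: box_relation_0 box_relation_1 box_relation_2)
    moreover have "partner (Suc r, c, 0) = (r, c, 5)" by (simp add: partner_def)
    ultimately show ?case using Suc by simp
  qed (simp add: v_def)
  have "satisfies_row v r" if r: "r < R" for r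
  proof (rule ccontr)
    assume no: "\<not> satisfies_row v r"
    \<comment> \<open>The value false with which the first box starts the row persists, since no
      literal is true.\<close>
    have "\<not> S (r, c, 3)" if "c < C - 1" for c
      using that
    proof (induction c)
      case (Suc c)
      have p: "partner (r, Suc c, 6) = (r, c, 3)" by (simp add: partner_def)
      have t: "ty r (Suc c) < 3" using Suc.prems by (intro ty_inner) auto
      have c: "S (partner (r, Suc c, 0)) = v (Suc c)" using col[OF r, of "Suc c"] Suc.prems by simp
      note rel = inner[OF r, of "Suc c"]
      have lit: "ty r (Suc c) = 1 \<Longrightarrow> \<not> v (Suc c)" "ty r (Suc c) = 2 \<Longrightarrow> v (Suc c)"
        using no Suc.prems by (auto simp: satisfies_row_def)
      from t consider "ty r (Suc c) = 0" | "ty r (Suc c) = 1" | "ty r (Suc c) = 2" by linarith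
      then show ?case
        using rel Suc p c lit by cases (auto simp del: One_nat_def dest!: box_relation_0 box_relation_1 box_relation_2)
    qed (use right(1)[OF r] in simp)
    from this[of "C - 2"] last[OF r] C show False by (auto simp: partner_def numeral_2_eq_2)
  qed
  then show ?thesis by blast
qed

text \<open>The boxes are filled independently of each other with tabulated solutions; neighbouring
  boxes fit together because both are given the same column value and the same row value.\<close>

lemma satisfies_imp_solves:
  assumes v: "\<And>r. r < R \<Longrightarrow> satisfies_row v r"
  shows "\<exists>S. solves S"
proof -
  define lit where "lit r c \<longleftrightarrow> ty r c = 1 \<and> v c \<or> ty r c = 2 \<and> \<not> v c" for r c
  \<comment> \<open>The row value that enters column \<open>c\<close>. Boxes of type 3 need true on
    their left and false on their right, also towards the border; hence the exceptions at
    \<open>c = 0\<close> and \<open>c = C\<close>.\<close>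
  define h where "h r c \<longleftrightarrow> c = 0 \<or> c < C \<and> (\<exists>c'<c. lit r c')" for r c
  define S where "S = (\<lambda>(r, c, k). k \<in> set (box_solution (ty r c) (v c) (h r c) (h r (Suc c))))"
  have lit_border: "\<not> lit r 0" "\<not> lit r (C - 1)" for r using ty_border[of r] by (auto simp: lit_def)
  have ok: "solution_ok (ty r c) (v c) (h r c) (h r (Suc c)) (box_solution (ty r c) (v c) (h r c) (h r (Suc c)))" if r: "r < R" and c: "c < C" for r c
  proof -
    consider "c = 0" | "c = C - 1" "c \<noteq> 0" | "0 < c" "c < C - 1" using c by linarith
    then show ?thesis
    proof cases
      case 1
      then have "h r c" "\<not> h r (Suc c)" using lit_border[of r] by (auto simp: h_def)
      then show ?thesis using 1 ty_border solutions_ok(4) by simp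
    next
      case 2
      obtain c' where c': "c' < C" "lit r c'" using v[OF r] by (auto simp: satisfies_row_def lit_def)
      then have "c' < C - 1" using lit_border[of r] by (cases "c' = C - 1") auto
      then have "h r c" "\<not> h r (Suc c)" using 2 c' C by (auto simp: h_def)
      then show ?thesis using 2 ty_border solutions_ok(4) by simp
    next
      case 3
      have mono: "h r c \<longrightarrow> h r (Suc c)" and new: "h r (Suc c) \<Longrightarrow> \<not> h r c \<Longrightarrow> lit r c"
        using 3 by (auto simp: h_def less_Suc_eq)
      have "ty r c < 3" using ty_inner 3 by blast
      then consider "ty r c = 0" | "ty r c = 1" | "ty r c = 2" by linarith
      then show ?thesis
      proof cases
        case 1
        then have "h r (Suc c) = h r c" using mono new by (auto simp: lit_def)
        then show ?thesis using 1 solutions_ok(1) by simp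
      next
        case 2
        then show ?thesis using mono new solutions_ok(2)[of "v c" "h r c" "h r (Suc c)"] by (auto simp: lit_def)
      next
        case 3
        then show ?thesis using mono new solutions_ok(3)[of "v c" "h r c" "h r (Suc c)"] by (auto simp: lit_def)
      qed
    qed
  qed
  have S_odd: "odd k" if "r < R" "c < C" "S (r, c, k)" for r c k
    using ok[OF that(1,2)] that(3) by (auto simp: solution_ok_def S_def list_all_iff)
  have S_port: "S (r, c, 1) = v c" "S (r, c, 5) = v c" "S (r, c, 3) = h r (Suc c)" "S (r, c, 7) = h r c"
    if "r < R" "c < C" for r c
    using ok[OF that] by (simp_all add: solution_ok_def S_def)
  have cnt: "count S (r, c, k) = (if even k then 1 else 0)" if r: "r < R" and c: "c < C" and k: "k < 108" for r c k
  proof (cases "even k")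
    case False
    have "\<not> S u" if u: "u \<in> set (nbrs (r, c, k))" for u
    proof -
      have "(r, c, k) \<in> verts" using r c k by (simp add: verts_def)
      from nbrs_sound[OF this u] False have "u \<in> verts" "even (snd (snd u))" by auto
      then show ?thesis using S_odd[of "fst u" "fst (snd u)" "snd (snd u)"] by (auto simp: verts_def)
    qed
    then show ?thesis using False by (auto simp: count_def filter_empty_conv)
  next
    case True
    obtain a b d where ab: "nbrs (r, c, k) = [(r, c, a), (r, c, b), d]"
      "box_nbrs (ty r c) k = [a, b, if k < 8 then 108 else snd (snd d)]"
      "d = (if k < 8 then partner (r, c, k) else (r, c, snd (snd d)))" "snd (snd d) < 108"
      by (rule nbrs_box[OF r c k]) blast
    let ?i = "if k = 2 then h r (Suc c) else if k = 6 then h r c else v c"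
    have "k \<in> set all_clauses"
    proof -
      have "k \<in> (\<lambda>i. 2 * i) ` {..<54}" using True k by (auto elim!: evenE)
      also have "\<dots> \<subseteq> set all_clauses" by (simp add: all_clauses_def lessThan_nat_numeral lessThan_Suc)
      finally show ?thesis .
    qed
    then have "exact_at (box_nbrs (ty r c) k) (\<lambda>j. S (r, c, j)) ?i"
      using ok[OF r c] unfolding solution_ok_def list_all_iff S_def prod.case by blast
    then have one: "one_of (S (r, c, a)) (S (r, c, b)) (if k < 8 then ?i else S (r, c, snd (snd d)))"
      using ab(2,4) by (auto split: if_splits)
    have "S d = ?i" if "k < 8"
    proof -
      have "k = 0 \<or> k = 2 \<or> k = 4 \<or> k = 6" using that True unfolding less_8_cases by auto
      then show ?thesis
        using ab(3) that r c S_port[OF r c] S_port[of "r - 1" c] S_port[of "Suc r" c] S_port[of r "Suc c"] S_port[of r "c - 1"]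
        by (elim disjE) (auto simp: partner_def)
    qed
    with one ab(3) have "one_of (S (r, c, a)) (S (r, c, b)) (S d)" by (cases "k < 8") auto
    then show ?thesis using True length_filter_one_of[of S "(r, c, a)" "(r, c, b)" d] by (simp add: count_def ab(1))
  qed
  have "solves S" unfolding solves_def
  proof (intro ballI conjI)
    fix u assume u: "u \<in> verts"
    then show "count S u \<le> 1" using cnt by (auto simp: verts_def)
    fix w assume w: "w \<in> set (nbrs u)"
    from nbrs_sound[OF u w] u show "count S u \<noteq> count S w" using cnt by (auto simp: verts_def)
  qed
  then show ?thesis by blast
qed

end

section \<open>A plane drawing of the grid\<close>

definition int_point :: "real \<Rightarrow> real \<Rightarrow> int \<times> int \<Rightarrow> complex" where
  "int_point ox oy p = Complex (ox + of_int (fst p)) (oy + of_int (snd p))"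

lemma in_closed_segment_int_point:
  assumes "z \<in> closed_segment (int_point ox oy c) (int_point ox oy d)"
  obtains s :: real where "0 \<le> s" "s \<le> 1" "Re z = ox + (1 - s) * fst c + s * fst d" "Im z = oy + (1 - s) * snd c + s * snd d"
proof -
  from assms obtain s where s: "0 \<le> s" "s \<le> 1" "z = (1 - s) *\<^sub>R int_point ox oy c + s *\<^sub>R int_point ox oy d"
    by (auto simp: closed_segment_def)
  show thesis by (rule that[of s]) (use s(1,2) in \<open>simp_all add: s(3) int_point_def algebra_simps\<close>)
qed

text \<open>The affine function that extends \<open>cross_prod a b\<close> from integer points to
  the plane; along a segment it interpolates linearly between its values at the ends.\<close>

definition line_value :: "real \<Rightarrow> real \<Rightarrow> int \<times> int \<Rightarrow> int \<times> int \<Rightarrow> complex \<Rightarrow> real" where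
  "line_value ox oy a b z =
     of_int (fst b - fst a) * (Im z - oy - of_int (snd a)) - of_int (snd b - snd a) * (Re z - ox - of_int (fst a))"

lemma line_value_segment:
  assumes "z \<in> closed_segment (int_point ox oy c) (int_point ox oy d)"
  obtains s where "0 \<le> s" "s \<le> 1" "s = 0 \<Longrightarrow> z = int_point ox oy c" "s = 1 \<Longrightarrow> z = int_point ox oy d"
    "\<And>a b. line_value ox oy a b z = (1 - s) * of_int (cross_prod a b c) + s * of_int (cross_prod a b d)"
proof -
  obtain s :: real where s: "0 \<le> s" "s \<le> 1" "Re z = ox + (1 - s) * fst c + s * fst d" "Im z = oy + (1 - s) * snd c + s * snd d"
    by (rule in_closed_segment_int_point[OF assms])
  have "line_value ox oy a b z = (1 - s) * of_int (cross_prod a b c) + s * of_int (cross_prod a b d)" for a b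
    unfolding line_value_def s(3,4) by (cases a; cases b; cases c; cases d) (simp add: algebra_simps)
  then show thesis using s by (intro that[of s]) (auto simp: int_point_def complex_eq_iff)
qed

lemma cross_prod_self [simp]: "cross_prod a b a = 0" "cross_prod a b b = 0"
  by (cases a; cases b; simp)+

text \<open>Along the second segment the function that vanishes on the line through \<open>a\<close>
  and \<open>b\<close> is \<open>s\<close> times a nonzero number, which leaves only
  \<open>s = 0\<close>.\<close>

lemma noncrossing_touch:
  assumes "cross_prod a b d \<noteq> 0"
    and "z \<in> closed_segment (int_point ox oy a) (int_point ox oy b)"
    and "z \<in> closed_segment (int_point ox oy a) (int_point ox oy d)"
  shows "z = int_point ox oy a"
proof -
  have "line_value ox oy a b z = 0" by (rule line_value_segment[OF assms(2)]) simp
  moreover obtain s where s: "s = 0 \<Longrightarrow> z = int_point ox oy a"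
    "line_value ox oy a b z = (1 - s) * of_int (cross_prod a b a) + s * of_int (cross_prod a b d)"
    by (rule line_value_segment[OF assms(3)]) blast
  ultimately show ?thesis using assms(1) by simp
qed

lemma same_sign_disjoint:
  assumes "same_sign (cross_prod a b c) (cross_prod a b d)"
    and "z \<in> closed_segment (int_point ox oy a) (int_point ox oy b)"
    and "z \<in> closed_segment (int_point ox oy c) (int_point ox oy d)"
  shows False
proof -
  let ?p = "of_int (cross_prod a b c) :: real" and ?q = "of_int (cross_prod a b d) :: real"
  have "line_value ox oy a b z = 0" by (rule line_value_segment[OF assms(2)]) simp
  moreover obtain s where s: "0 \<le> s" "s \<le> 1" "line_value ox oy a b z = (1 - s) * ?p + s * ?q"
    by (rule line_value_segment[OF assms(3)]) blast
  moreover have "0 < (1 - s) * ?p + s * ?q" if "0 < ?p" "0 < ?q"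
    using s(1,2) that by (cases "s = 0") (auto intro: add_nonneg_pos)
  moreover have "(1 - s) * ?p + s * ?q < 0" if "?p < 0" "?q < 0"
    using s(1,2) that mult_pos_neg[of s ?q] mult_nonneg_nonpos[of "1 - s" ?p] by (cases "s = 0") auto
  ultimately show False using assms(1) by (auto split: if_splits)
qed

lemma noncrossing_sound:
  assumes nc: "noncrossing (a, b) (c, d)"
    and ab: "z \<in> closed_segment (int_point ox oy a) (int_point ox oy b)"
    and cd: "z \<in> closed_segment (int_point ox oy c) (int_point ox oy d)"
  shows "\<exists>p. z = int_point ox oy p \<and> p \<in> {a, b} \<and> p \<in> {c, d}"
proof -
  note ba = ab[unfolded closed_segment_commute[of "int_point ox oy a"]]
  note dc = cd[unfolded closed_segment_commute[of "int_point ox oy c"]]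
  show ?thesis
  proof (cases "a = c \<or> a = d \<or> b = c \<or> b = d")
    case True
    consider "a = c" | "a \<noteq> c" "a = d" | "a \<noteq> c" "a \<noteq> d" "b = c" | "a \<noteq> c" "a \<noteq> d" "b \<noteq> c" "b = d"
      using True by blast
    then show ?thesis
    proof cases
      case 1
      then have "z = int_point ox oy a" using noncrossing_touch[of a b d z ox oy] nc ab cd by auto
      then show ?thesis using 1 by blast
    next
      case 2
      then have "z = int_point ox oy a" using noncrossing_touch[of a b c z ox oy] nc ab dc by auto
      then show ?thesis using 2 by blast
    next
      case 3
      then have "z = int_point ox oy b" using noncrossing_touch[of b a d z ox oy] nc ba cd by auto
      then show ?thesis using 3 by blast
    next
      case 4
      then have "z = int_point ox oy b" using noncrossing_touch[of b a c z ox oy] nc ba dc by auto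
      then show ?thesis using 4 by blast
    qed
  next
    case False
    then have "same_sign (cross_prod a b c) (cross_prod a b d) \<or> same_sign (cross_prod c d a) (cross_prod c d b)"
      using nc by (auto simp del: same_sign.simps split: if_splits)
    then show ?thesis using same_sign_disjoint[OF _ ab cd] same_sign_disjoint[OF _ cd ab] by blast
  qed
qed

lemma left_of_disjoint:
  assumes "left_of (a, b) (c, d)" "fst a \<le> fst b" "fst c \<le> fst d"
    and "z \<in> closed_segment (int_point ox oy a) (int_point ox oy b)"
    and "z \<in> closed_segment (int_point ox oy c) (int_point ox oy d)"
  shows False
proof -
  obtain s :: real where s: "0 \<le> s" "s \<le> 1" "Re z = ox + (1 - s) * fst a + s * fst b"
    by (rule in_closed_segment_int_point[OF assms(4)])
  obtain s' :: real where s': "0 \<le> s'" "s' \<le> 1" "Re z = ox + (1 - s') * fst c + s' * fst d"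
    by (rule in_closed_segment_int_point[OF assms(5)])
  have "(1 - s) * real_of_int (fst a) + s * fst b \<le> (1 - s) * fst b + s * fst b"
    using s assms(2) by (intro add_right_mono mult_left_mono) auto
  moreover have "(1 - s') * real_of_int (fst c) + s' * fst c \<le> (1 - s') * fst c + s' * fst d"
    using s' assms(3) by (intro add_left_mono mult_left_mono) auto
  moreover have "real_of_int (fst b) < fst c" using assms(1) by (cases a; cases b; cases c; cases d) auto
  ultimately show False using s s' by (simp add: algebra_simps)
qed

lemma y_apart_disjoint:
  assumes "y_apart (a, b) (c, d)"
    and "z \<in> closed_segment (int_point ox oy a) (int_point ox oy b)"
    and "z \<in> closed_segment (int_point ox oy c) (int_point ox oy d)"
  shows False
proof -
  have between: "min p q \<le> (1 - s) * p + s * q \<and> (1 - s) * p + s * q \<le> max p q" if "0 \<le> s" "s \<le> 1" for p q s :: real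
  proof -
    have "(1 - s) * min p q + s * min p q \<le> (1 - s) * p + s * q"
      "(1 - s) * p + s * q \<le> (1 - s) * max p q + s * max p q"
      using that by (intro add_mono mult_left_mono; simp)+
    then show ?thesis by (simp add: algebra_simps)
  qed
  obtain s :: real where s: "0 \<le> s" "s \<le> 1" "Im z = oy + (1 - s) * snd a + s * snd b"
    by (rule in_closed_segment_int_point[OF assms(2)])
  obtain s' :: real where s': "0 \<le> s'" "s' \<le> 1" "Im z = oy + (1 - s') * snd c + s' * snd d"
    by (rule in_closed_segment_int_point[OF assms(3)])
  have "max (snd a) (snd b) < min (snd c) (snd d) \<or> max (snd c) (snd d) < min (snd a) (snd b)"
    using assms(1) by (cases a; cases b; cases c; cases d) (auto split: if_splits)
  then have "max (real_of_int (snd a)) (snd b) < min (real_of_int (snd c)) (snd d) \<or>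
      max (real_of_int (snd c)) (snd d) < min (real_of_int (snd a)) (snd b)"
    by (simp add: max_def min_def split: if_splits)
  then show False
    using s(3) s'(3) between[OF s(1,2), of "snd a" "snd b"] between[OF s'(1,2), of "snd c" "snd d"] by linarith
qed

text \<open>The third alternative reflects that the sweep may have stopped at an earlier segment
  \<open>m\<close>; the order of the left ends later turns this into a statement about the
  \<open>j\<close>-th one.\<close>

lemma noncrossing_from_sound:
  assumes "noncrossing_from e fs" "j < length fs"
  shows "noncrossing e (fs ! j) \<or> y_apart e (fs ! j) \<or> (\<exists>m\<le>j. left_of e (fs ! m))"
  using assms
proof (induction fs arbitrary: j)
  case (Cons f fs)
  show ?case
  proof (cases "left_of e f")
    case True
    then show ?thesis by (intro disjI2 exI[of _ 0]) simp
  next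
    case False
    then have f: "y_apart e f \<or> noncrossing e f" "noncrossing_from e fs" using Cons.prems(1) by (auto split: if_splits)
    show ?thesis
    proof (cases j)
      case (Suc i)
      from Cons.IH[OF f(2), of i] Cons.prems(2) Suc
      consider "noncrossing e (fs ! i)" | "y_apart e (fs ! i)" | m where "m \<le> i" "left_of e (fs ! m)" by auto
      then show ?thesis
      proof cases
        case 3
        then show ?thesis using Suc by (intro disjI2 exI[of _ "Suc m"]) simp
      qed (use Suc in auto)
    qed (use f in auto)
  qed
qed simp

lemma noncrossing_all_sound:
  assumes "noncrossing_all es" "i < j" "j < length es"
  shows "noncrossing (es ! i) (es ! j) \<or> y_apart (es ! i) (es ! j) \<or> (\<exists>m\<le>j. i < m \<and> left_of (es ! i) (es ! m))"
  using assms
proof (induction es arbitrary: i j)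
  case (Cons e es)
  have e: "noncrossing_from e es" "noncrossing_all es" using Cons.prems(1) by (auto split: if_splits)
  obtain j' where j: "j = Suc j'" using Cons.prems(2) by (cases j) auto
  show ?case
  proof (cases i)
    case 0
    then show ?thesis using noncrossing_from_sound[OF e(1), of j'] Cons.prems(3) j
      by (auto intro: exI[of _ "Suc _"])
  next
    case (Suc i')
    then have "noncrossing (es ! i') (es ! j') \<or> y_apart (es ! i') (es ! j') \<or>
        (\<exists>m\<le>j'. i' < m \<and> left_of (es ! i') (es ! m))"
      using Cons.IH[OF e(2), of i' j'] Cons.prems j by simp
    then show ?thesis unfolding Suc j by (auto intro: exI[of _ "Suc _"])
  qed
qed simp

lemma ordered_sound: "ordered es \<Longrightarrow> Suc i < length es \<Longrightarrow> sorted_at (es ! i) (es ! Suc i)"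
proof (induction es arbitrary: i rule: ordered.induct)
  case (1 e f fs)
  then show ?case by (cases i) (auto split: if_splits)
qed auto

lemma box_segments_nth: "i < 162 \<Longrightarrow> box_segments t ! i = box_segment t i" "length (box_segments t) = 162"
  by (simp_all add: box_segments_def)

lemma box_segments_disjoint:
  assumes t: "t < 4" and ij: "i < 162" "j < 162" "i \<noteq> j"
    and e: "box_segment t i = (a, b)" "box_segment t j = (c, d)"
    and z: "z \<in> closed_segment (int_point ox oy a) (int_point ox oy b)"
      "z \<in> closed_segment (int_point ox oy c) (int_point ox oy d)"
  shows "\<exists>p. z = int_point ox oy p \<and> p \<in> {a, b} \<and> p \<in> {c, d}"
proof -
  have main: "\<exists>p. z = int_point ox oy p \<and> p \<in> {a, b} \<and> p \<in> {c, d}"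
    if ij: "i < j" "j < 162" and e: "box_segment t i = (a, b)" "box_segment t j = (c, d)"
      and z: "z \<in> closed_segment (int_point ox oy a) (int_point ox oy b)"
        "z \<in> closed_segment (int_point ox oy c) (int_point ox oy d)" for i j a b c d
  proof -
    have srt: "sorted_at (box_segment t m) (box_segment t (m + 1))" if "m < 161" for m
      using ordered_sound[OF segments_ordered[OF t], of m] that by (simp add: box_segments_nth)
    have lr: "fst (fst (box_segment t m)) \<le> fst (snd (box_segment t m))" if "m < 162" for m
    proof (cases "m < 161")
      case True
      then show ?thesis using srt[of m] by (cases "(box_segment t m, box_segment t (m + 1))" rule: sorted_at.cases) auto
    next
      case False
      then have "m = 160 + 1" using that by simp
      then show ?thesis using srt[of 160] by (cases "(box_segment t 160, box_segment t (160 + 1))" rule: sorted_at.cases) auto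
    qed
    have mono: "fst (fst (box_segment t m)) \<le> fst (fst (box_segment t m'))" if "m \<le> m'" "m' < 162" for m m'
      using that
    proof (induction m' rule: nat_induct_at_least)
      case (Suc n)
      have "fst (fst (box_segment t n)) \<le> fst (fst (box_segment t (n + 1)))"
        using srt[of n] Suc by (cases "(box_segment t n, box_segment t (n + 1))" rule: sorted_at.cases) auto
      then show ?case using Suc by simp
    qed simp
    from noncrossing_all_sound[OF segments_noncrossing[OF t] ij(1)] ij e
    consider "noncrossing (a, b) (c, d)" | "y_apart (a, b) (c, d)"
      | m where "m \<le> j" "left_of (a, b) (box_segment t m)"
      by (auto simp: box_segments_nth simp del: noncrossing.simps y_apart.simps left_of.simps)
    then show ?thesis
    proof cases
      case 1
      then show ?thesis using noncrossing_sound[OF 1 z] by blast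
    next
      case 2
      then show ?thesis using y_apart_disjoint[OF 2 z] by blast
    next
      case 3
      have "left_of (a, b) (c, d)"
        using 3(2) mono[OF 3(1) ij(2)] e(2)
        by (cases "((a, b), box_segment t m)" rule: left_of.cases; cases c; cases d) auto
      then show ?thesis using left_of_disjoint[OF _ _ _ z] lr[of i] lr[of j] ij e by auto
    qed
  qed
  show ?thesis
  proof (cases "i < j")
    case True
    then show ?thesis using main[OF True ij(2) e z] by blast
  next
    case False
    then have "j < i" using ij by simp
    from main[OF this ij(1) e(2,1) z(2,1)] show ?thesis by blast
  qed
qed

lemma box_coord_inj:
  assumes "t < 4" "k < 108" "j < 108" "box_coord t k = box_coord t j" shows "k = j"
  using coords_distinct[OF assms(1)] assms(2-4)
    nth_eq_iff_index_eq[of "box_coords t" k j] by (simp add: box_coords_def)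

lemma box_coord_bounds:
  assumes "t < 4" "k < 108"
  shows "0 \<le> fst (box_coord t k)" "fst (box_coord t k) \<le> 2400" "0 \<le> snd (box_coord t k)" "snd (box_coord t k) \<le> 2400"
proof -
  have "in_box (box_coord t k)" using coords_ok[OF assms(1)] assms(2) by (simp add: all_below_iff)
  then show "0 \<le> fst (box_coord t k)" "fst (box_coord t k) \<le> 2400" "0 \<le> snd (box_coord t k)" "snd (box_coord t k) \<le> 2400"
    by (cases "box_coord t k"; simp)+
qed

lemma box_edge_of_nbr:
  assumes "t < 4" "k < 108" "j \<in> set (box_nbrs t k)" "j < 108"
  shows "\<exists>i<162. box_edge t i = (k, j) \<or> box_edge t i = (j, k)"
proof -
  have ok: "edges_ok_at t k (box_edges_at t k) (box_nbrs t k)"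
    using edges_ok[OF assms(1)] assms(2) by (simp add: all_below_iff)
  have "\<exists>i<162. box_edge t i = (k, j) \<or> box_edge t i = (j, k)"
    if "edges_ok_at t k is js" "j \<in> set js" "j < 108" for "is" js
    using that
  proof (induction t k "is" js rule: edges_ok_at.induct)
    case (2 t k i "is" j' js)
    then show ?case by (cases "j = j'"; cases "box_edge t i") auto
  qed auto
  from this[OF ok assms(3,4)] show ?thesis .
qed

lemma border_edge_of_port:
  assumes "t < 4" "p < 8"
  shows "\<exists>i<162. box_edge t i = (p, opposite p) \<or> box_edge t i = (opposite p, p)"
proof -
  have "edge_is (border_edge t (p div 2)) (2 * (p div 2)) (2 * (p div 2) + 1) (box_edge t (border_edge t (p div 2)))"
    using assms by (intro border_edges_ok) auto
  then have "border_edge t (p div 2) < 162" "box_edge t (border_edge t (p div 2)) \<in>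
      {(2 * (p div 2), 2 * (p div 2) + 1), (2 * (p div 2) + 1, 2 * (p div 2))}"
    by (cases "box_edge t (border_edge t (p div 2))"; auto)+
  moreover have "even p \<Longrightarrow> 2 * (p div 2) = p \<and> opposite p = p + 1"
    "odd p \<Longrightarrow> 2 * (p div 2) + 1 = p \<and> 2 * (p div 2) = opposite p"
    by (auto simp: opposite_def elim!: oddE)
  ultimately show ?thesis
    by (intro exI[of _ "border_edge t (p div 2)"]) (cases "even p"; auto)
qed

text \<open>The segments of \<open>Inner\<close> lie in one box, \<open>Across\<close> and \<open>Down\<close> join neighbouring boxes.\<close>

datatype edge = Inner nat nat nat | Across nat nat bool | Down nat nat bool

section \<open>Segments of the whole grid\<close>

context grid
begin

text \<open>Boxes of side 2400 in cells of side 3000 leave strips of width 600 for the connecting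
  edges; rows are numbered downwards.\<close>

definition pos :: "vertex \<Rightarrow> complex" where
  "pos = (\<lambda>(r, c, k). int_point (3000 * real c) (- 3000 * real r) (box_coord (ty r c) k))"

definition seg :: "vertex \<Rightarrow> vertex \<Rightarrow> complex set" where
  "seg u v = closed_segment (pos u) (pos v)"

lemma seg_commute: "seg u v = seg v u" by (simp add: seg_def closed_segment_commute)

lemma Re_pos: "Re (pos (r, c, k)) = 3000 * real c + fst (box_coord (ty r c) k)"
  and Im_pos: "Im (pos (r, c, k)) = - 3000 * real r + snd (box_coord (ty r c) k)"
  by (simp_all add: pos_def int_point_def)

lemma pos_inj: "inj_on pos verts"
proof (rule inj_onI)
  fix u v assume "u \<in> verts" "v \<in> verts" and eq: "pos u = pos v"
  then obtain r c k r' c' k' where u: "u = (r, c, k)" "c < C" "k < 108" and v: "v = (r', c', k')" "c' < C" "k' < 108"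
    by (auto simp: verts_def)
  note b = box_coord_bounds[OF ty_less[OF u(2)] u(3), of r]
  note b' = box_coord_bounds[OF ty_less[OF v(2)] v(3), of r']
  have "real_of_int (3000 * int c + fst (box_coord (ty r c) k)) = real_of_int (3000 * int c' + fst (box_coord (ty r' c') k'))"
    "real_of_int (- 3000 * int r + snd (box_coord (ty r c) k)) = real_of_int (- 3000 * int r' + snd (box_coord (ty r' c') k'))"
    using arg_cong[OF eq, of Re] arg_cong[OF eq, of Im] unfolding u v Re_pos Im_pos by simp_all
  then have x: "3000 * int c + fst (box_coord (ty r c) k) = 3000 * int c' + fst (box_coord (ty r' c') k')"
    and y: "- 3000 * int r + snd (box_coord (ty r c) k) = - 3000 * int r' + snd (box_coord (ty r' c') k')"
    by (simp_all only: of_int_eq_iff)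
  have "c = c'" "r = r'" using x y b b' by linarith+
  then have "box_coord (ty r c) k = box_coord (ty r c) k'" using x y by (simp add: prod_eq_iff)
  then have "k = k'" using box_coord_inj[OF ty_less[OF u(2)] u(3)] v(3) by blast
  then show "u = v" using u v \<open>c = c'\<close> \<open>r = r'\<close> by simp
qed

primrec ends :: "edge \<Rightarrow> vertex \<times> vertex" where
  "ends (Inner r c i) = ((r, c, fst (box_edge (ty r c) i)), (r, c, snd (box_edge (ty r c) i)))"
| "ends (Across r c b) = ((r, c, if b then 2 else 3), (r, Suc c, if b then 7 else 6))"
| "ends (Down r c b) = ((r, c, if b then 4 else 5), (Suc r, c, if b then 1 else 0))"

primrec valid_edge :: "edge \<Rightarrow> bool" where
  "valid_edge (Inner r c i) \<longleftrightarrow> r < R \<and> c < C \<and> i < 162"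
| "valid_edge (Across r c b) \<longleftrightarrow> r < R \<and> Suc c < C"
| "valid_edge (Down r c b) \<longleftrightarrow> Suc r < R \<and> c < C"

definition eseg :: "edge \<Rightarrow> complex set" where "eseg e = seg (fst (ends e)) (snd (ends e))"
definition eset :: "edge \<Rightarrow> vertex set" where "eset e = {fst (ends e), snd (ends e)}"

lemma edge_ex:
  assumes "u \<in> verts" "v \<in> set (nbrs u)"
  shows "\<exists>e. valid_edge e \<and> eset e = {u, v}"
proof -
  obtain r c k where u: "u = (r, c, k)" "r < R" "c < C" "k < 108" using assms(1) by (auto simp: verts_def)
  obtain a b d where ab: "box_nbrs (ty r c) k = [a, b, d]" "a < 108" "b < 108" "d = 108 \<longleftrightarrow> k < 8" "d \<le> 108"
    by (rule nbrs_facts[OF ty_less[OF u(3)] u(4), of r]) blast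
  consider j where "v = (r, c, j)" "j \<in> set (box_nbrs (ty r c) k)" "j < 108" | "k < 8" "v = partner (r, c, k)"
    using assms(2) ab by (force simp: u nbrs_def split: if_splits)
  then show ?thesis
  proof cases
    case 1
    then obtain i where "i < 162" "box_edge (ty r c) i = (k, j) \<or> box_edge (ty r c) i = (j, k)"
      using box_edge_of_nbr[OF ty_less[OF u(3)] u(4)] by blast
    then show ?thesis using u 1 by (intro exI[of _ "Inner r c i"]) (auto simp: eset_def)
  next
    case 2
    obtain i where i: "i < 162" "box_edge (ty r c) i = (k, opposite k) \<or> box_edge (ty r c) i = (opposite k, k)"
      using border_edge_of_port[OF ty_less[OF u(3)] 2(1)] by blast
    then have same: "?thesis" if "v = (r, c, opposite k)"
      using u that by (intro exI[of _ "Inner r c i"]) (auto simp: eset_def)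
    have cases8: "k = 0 \<or> k = 1 \<or> k = 2 \<or> k = 3 \<or> k = 4 \<or> k = 5 \<or> k = 6 \<or> k = 7"
      using 2(1) less_8_cases by blast
    show ?thesis
    proof (cases "v = (r, c, opposite k)")
      case False
      from cases8 show ?thesis
      proof (elim disjE)
        assume "k = 0"
        then show ?thesis using False 2(2) u
          by (intro exI[of _ "Down (r - 1) c False"]) (auto simp: partner_def eset_def opposite_def split: if_splits)
      next
        assume "k = 1"
        then show ?thesis using False 2(2) u
          by (intro exI[of _ "Down (r - 1) c True"]) (auto simp: partner_def eset_def opposite_def split: if_splits)
      next
        assume "k = 2"
        then show ?thesis using False 2(2) u
          by (intro exI[of _ "Across r c True"]) (auto simp: partner_def eset_def opposite_def split: if_splits)
      next
        assume "k = 3"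
        then show ?thesis using False 2(2) u
          by (intro exI[of _ "Across r c False"]) (auto simp: partner_def eset_def opposite_def split: if_splits)
      next
        assume "k = 4"
        then show ?thesis using False 2(2) u
          by (intro exI[of _ "Down r c True"]) (auto simp: partner_def eset_def opposite_def split: if_splits)
      next
        assume "k = 5"
        then show ?thesis using False 2(2) u
          by (intro exI[of _ "Down r c False"]) (auto simp: partner_def eset_def opposite_def split: if_splits)
      next
        assume "k = 6"
        then show ?thesis using False 2(2) u
          by (intro exI[of _ "Across r (c - 1) False"]) (auto simp: partner_def eset_def opposite_def split: if_splits)
      next
        assume "k = 7"
        then show ?thesis using False 2(2) u
          by (intro exI[of _ "Across r (c - 1) True"]) (auto simp: partner_def eset_def opposite_def split: if_splits)
      qed
    qed (rule same)
  qed
qed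

lemma box_edge_less:
  assumes "t < 4" "i < 162" shows "fst (box_edge t i) < 108" "snd (box_edge t i) < 108"
  using edge_bounds[OF assms(1)] assms(2) by (auto simp: all_below_iff)

lemma in_seg_bounds:
  assumes "z \<in> seg u v"
  shows "min (Re (pos u)) (Re (pos v)) \<le> Re z" "Re z \<le> max (Re (pos u)) (Re (pos v))"
    "min (Im (pos u)) (Im (pos v)) \<le> Im z" "Im z \<le> max (Im (pos u)) (Im (pos v))"
proof -
  obtain s where s: "0 \<le> s" "s \<le> 1" "z = (1 - s) *\<^sub>R pos u + s *\<^sub>R pos v"
    using assms by (auto simp: seg_def closed_segment_def)
  have conv: "min p q \<le> (1 - s) * p + s * q \<and> (1 - s) * p + s * q \<le> max p q" for p q :: real
  proof -
    have "(1 - s) * min p q + s * min p q \<le> (1 - s) * p + s * q"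
      "(1 - s) * p + s * q \<le> (1 - s) * max p q + s * max p q"
      using s by (intro add_mono mult_left_mono; simp)+
    then show ?thesis by (simp add: algebra_simps)
  qed
  show "min (Re (pos u)) (Re (pos v)) \<le> Re z" "Re z \<le> max (Re (pos u)) (Re (pos v))"
    "min (Im (pos u)) (Im (pos v)) \<le> Im z" "Im z \<le> max (Im (pos u)) (Im (pos v))"
    using conv[of "Re (pos u)" "Re (pos v)"] conv[of "Im (pos u)" "Im (pos v)"] by (simp_all add: s(3))
qed

lemma eseg_I:
  assumes "valid_edge (Inner r c i)" "z \<in> eseg (Inner r c i)"
  shows "3000 * real c \<le> Re z" "Re z \<le> 3000 * real c + 2400" "- 3000 * real r \<le> Im z" "Im z \<le> - 3000 * real r + 2400"
proof -
  obtain a b where ab: "box_edge (ty r c) i = (a, b)" by fastforce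
  have t: "ty r c < 4" "i < 162" using assms(1) ty_less by auto
  have l: "a < 108" "b < 108" using box_edge_less[OF t] ab by auto
  note * = box_coord_bounds[OF t(1) l(1)] box_coord_bounds[OF t(1) l(2)]
  have **: "0 \<le> real_of_int (fst (box_coord (ty r c) a))" "real_of_int (fst (box_coord (ty r c) a)) \<le> 2400"
    "0 \<le> real_of_int (snd (box_coord (ty r c) a))" "real_of_int (snd (box_coord (ty r c) a)) \<le> 2400"
    "0 \<le> real_of_int (fst (box_coord (ty r c) b))" "real_of_int (fst (box_coord (ty r c) b)) \<le> 2400"
    "0 \<le> real_of_int (snd (box_coord (ty r c) b))" "real_of_int (snd (box_coord (ty r c) b)) \<le> 2400"
    using * by simp_all
  have z: "z \<in> seg (r, c, a) (r, c, b)" using assms(2) ab by (simp add: eseg_def)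
  show "3000 * real c \<le> Re z"
    by (rule order.trans[OF _ in_seg_bounds(1)[OF z]]) (use ** in \<open>simp add: Re_pos\<close>)
  show "Re z \<le> 3000 * real c + 2400"
    by (rule order.trans[OF in_seg_bounds(2)[OF z]]) (use ** in \<open>simp add: Re_pos\<close>)
  show "- 3000 * real r \<le> Im z"
    by (rule order.trans[OF _ in_seg_bounds(3)[OF z]]) (use ** in \<open>simp add: Im_pos\<close>)
  show "Im z \<le> - 3000 * real r + 2400"
    by (rule order.trans[OF in_seg_bounds(4)[OF z]]) (use ** in \<open>simp add: Im_pos\<close>)
qed

text \<open>The ports at both ends have the same height, so the edge is a horizontal segment in the
  strip between two boxes.\<close>

lemma eseg_H:
  assumes "valid_edge (Across r c b)" "z \<in> eseg (Across r c b)"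
  shows "3000 * real c + 2400 \<le> Re z" "Re z \<le> 3000 * real c + 3000" "Im z = - 3000 * real r + (if b then 1600 else 800)"
proof -
  have t: "ty r c < 4" "ty r (Suc c) < 4" using assms(1) ty_less by auto
  have "z \<in> seg (r, c, if b then 2 else 3) (r, Suc c, if b then 7 else 6)" using assms(2) by (simp add: eseg_def)
  from in_seg_bounds[OF this] show "3000 * real c + 2400 \<le> Re z" "Re z \<le> 3000 * real c + 3000"
    "Im z = - 3000 * real r + (if b then 1600 else 800)"
    by (cases b; simp add: Re_pos Im_pos port_coords[OF t(1)] port_coords[OF t(2)])+
qed

lemma eseg_V:
  assumes "valid_edge (Down r c b)" "z \<in> eseg (Down r c b)"
  shows "- 3000 * real r - 600 \<le> Im z" "Im z \<le> - 3000 * real r" "Re z = 3000 * real c + (if b then 1600 else 800)"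
proof -
  have t: "ty r c < 4" "ty (Suc r) c < 4" using assms(1) ty_less by auto
  have "z \<in> seg (r, c, if b then 4 else 5) (Suc r, c, if b then 1 else 0)" using assms(2) by (simp add: eseg_def)
  note * = in_seg_bounds[OF this]
  show "- 3000 * real r - 600 \<le> Im z"
    by (rule order.trans[OF _ *(3)]) (cases b; simp add: Im_pos port_coords[OF t(1)] port_coords[OF t(2)] del: One_nat_def)
  show "Im z \<le> - 3000 * real r"
    by (rule order.trans[OF *(4)]) (cases b; simp add: Im_pos port_coords[OF t(1)] port_coords[OF t(2)] del: One_nat_def)
  show "Re z = 3000 * real c + (if b then 1600 else 800)"
    using *(1,2) by (cases b; simp add: Re_pos port_coords[OF t(1)] port_coords[OF t(2)] del: One_nat_def)
qed

lemma eseg_II: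
  assumes "valid_edge (Inner r c i)" "valid_edge (Inner r c j)" "i \<noteq> j" "z \<in> eseg (Inner r c i)" "z \<in> eseg (Inner r c j)"
  shows "z \<in> pos ` (eset (Inner r c i) \<inter> eset (Inner r c j))"
proof -
  have t: "ty r c < 4" "i < 162" "j < 162" using assms(1,2) ty_less by auto
  obtain a b where ab: "box_edge (ty r c) i = (a, b)" by fastforce
  obtain a' b' where ab': "box_edge (ty r c) j = (a', b')" by fastforce
  have l: "a < 108" "b < 108" "a' < 108" "b' < 108" using box_edge_less[OF t(1,2)] box_edge_less[OF t(1,3)] ab ab' by auto
  let ?q = "box_coord (ty r c)"
  obtain p where p: "z = int_point (3000 * real c) (- 3000 * real r) p" "p \<in> {?q a, ?q b}" "p \<in> {?q a', ?q b'}"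
    using box_segments_disjoint[OF t assms(3), of "?q a" "?q b" "?q a'" "?q b'" z "3000 * real c" "- 3000 * real r"]
      assms(4,5) ab ab' by (auto simp: box_segment_def eseg_def seg_def pos_def)
  then obtain k where k: "k \<in> {a, b}" "p = ?q k" by blast
  obtain k' where k': "k' \<in> {a', b'}" "p = ?q k'" using p(3) by blast
  have "k = k'" using box_coord_inj[OF t(1)] l k k' by auto
  then show ?thesis using p(1) k k' ab ab' by (auto simp: eset_def pos_def intro!: image_eqI[of _ _ "(r, c, k)"])
qed

text \<open>Some segment of the box ends at the vertex. If it is another one than the given segment,
  the two meet only in common ends, and injectivity of \<open>pos\<close> identifies the vertex
  among them.\<close>

lemma vertex_on_I:
  assumes "valid_edge (Inner r c i)" "k < 108" "pos (r, c, k) \<in> eseg (Inner r c i)"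
  shows "(r, c, k) \<in> eset (Inner r c i)"
proof -
  have rc: "r < R" "c < C" using assms(1) by auto
  obtain a where a: "a \<in> set (box_nbrs (ty r c) k)" "a < 108"
    by (rule nbrs_facts[OF ty_less[OF rc(2)] assms(2), of r]) auto
  obtain j where j: "j < 162" "box_edge (ty r c) j = (k, a) \<or> box_edge (ty r c) j = (a, k)"
    using box_edge_of_nbr[OF ty_less[OF rc(2)] assms(2) a] by blast
  then have kj: "(r, c, k) \<in> eset (Inner r c j)" by (auto simp: eset_def)
  show ?thesis
  proof (cases "i = j")
    case False
    have "pos (r, c, k) \<in> eseg (Inner r c j)"
      using j(2) by (auto simp: eseg_def seg_def)
    then have "pos (r, c, k) \<in> pos ` (eset (Inner r c i) \<inter> eset (Inner r c j))"
      using eseg_II[of r c i j] assms rc j(1) False by simp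
    then obtain w where w: "w \<in> eset (Inner r c i)" "pos w = pos (r, c, k)" by auto
    have "w \<in> verts" using w(1) box_edge_less[OF ty_less[OF rc(2)]] assms(1) rc
      by (auto simp: eset_def verts_def)
    then show ?thesis using inj_onD[OF pos_inj w(2)] w(1) assms(2) rc by (auto simp: verts_def)
  qed (use kj in simp)
qed

text \<open>Boxes and strips share only the sides of boxes; at the height of the connecting edge
  this leaves just the port, to which \<open>vertex_on_I\<close> applies.\<close>

lemma eseg_IH:
  assumes "valid_edge (Inner r c i)" "valid_edge (Across r' c' b)" "z \<in> eseg (Inner r c i)" "z \<in> eseg (Across r' c' b)"
  shows "z \<in> pos ` (eset (Inner r c i) \<inter> eset (Across r' c' b))"
proof -
  note 1 = eseg_I[OF assms(1,3)] and 2 = eseg_H[OF assms(2,4)]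
  have "real r < real r' + 1" "real r' < real r + 1" "real c' < real c + 1" "real c \<le> real c' + 1"
    using 1 2 by (auto split: if_splits)
  then have r: "r = r'" and "c = c' \<or> c = Suc c'" by linarith+
  have t: "ty r' c' < 4" "ty r' (Suc c') < 4" using assms(2) ty_less by auto
  from \<open>c = c' \<or> c = Suc c'\<close> show ?thesis
  proof
    assume c: "c = c'"
    then have z: "z = pos (r, c, if b then 2 else 3)"
      using 1 2 r t by (auto simp: complex_eq_iff Re_pos Im_pos port_coords simp del: One_nat_def)
    then have "(r, c, if b then 2 else 3) \<in> eset (Inner r c i)" using assms(1,3) by (intro vertex_on_I) auto
    then show ?thesis using z r c by (auto simp: eset_def)
  next
    assume c: "c = Suc c'"
    then have z: "z = pos (r, c, if b then 7 else 6)"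
      using 1 2 r t by (auto simp: complex_eq_iff Re_pos Im_pos port_coords simp del: One_nat_def)
    then have "(r, c, if b then 7 else 6) \<in> eset (Inner r c i)" using assms(1,3) by (intro vertex_on_I) auto
    then show ?thesis using z r c by (auto simp: eset_def)
  qed
qed

lemma eseg_IV:
  assumes "valid_edge (Inner r c i)" "valid_edge (Down r' c' b)" "z \<in> eseg (Inner r c i)" "z \<in> eseg (Down r' c' b)"
  shows "z \<in> pos ` (eset (Inner r c i) \<inter> eset (Down r' c' b))"
proof -
  note 1 = eseg_I[OF assms(1,3)] and 2 = eseg_V[OF assms(2,4)]
  have "real c < real c' + 1" "real c' < real c + 1" "real r' < real r + 1" "real r \<le> real r' + 1"
    using 1 2 by (auto split: if_splits)
  then have c: "c = c'" and "r = r' \<or> r = Suc r'" by linarith+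
  have t: "ty r' c' < 4" "ty (Suc r') c' < 4" using assms(2) ty_less by auto
  from \<open>r = r' \<or> r = Suc r'\<close> show ?thesis
  proof
    assume r: "r = r'"
    then have z: "z = pos (r, c, if b then 4 else 5)"
      using 1 2 c t by (auto simp: complex_eq_iff Re_pos Im_pos port_coords simp del: One_nat_def)
    then have "(r, c, if b then 4 else 5) \<in> eset (Inner r c i)" using assms(1,3) by (intro vertex_on_I) auto
    then show ?thesis using z r c by (auto simp: eset_def)
  next
    assume r: "r = Suc r'"
    then have z: "z = pos (r, c, if b then 1 else 0)"
      using 1 2 c t by (auto simp: complex_eq_iff Re_pos Im_pos port_coords simp del: One_nat_def)
    then have "(r, c, if b then 1 else 0) \<in> eset (Inner r c i)" using assms(1,3) by (intro vertex_on_I) auto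
    then show ?thesis using z r c by (auto simp: eset_def)
  qed
qed

lemma eseg_disjoint:
  assumes e: "valid_edge e" "valid_edge f" "eset e \<noteq> eset f" and z: "z \<in> eseg e" "z \<in> eseg f"
  shows "z \<in> pos ` (eset e \<inter> eset f)"
proof (cases e)
  case eI: (Inner r c i)
  show ?thesis
  proof (cases f)
    case (Inner r' c' j)
    have "real c < real c' + 1" "real c' < real c + 1" "real r < real r' + 1" "real r' < real r + 1"
      using eseg_I[of r c i z] eseg_I[of r' c' j z] e z eI Inner by auto
    then have "c = c'" "r = r'" by linarith+
    then show ?thesis using eseg_II[of r c i j z] e z eI Inner by auto
  next
    case (Across r' c' b)
    then show ?thesis using eseg_IH[of r c i r' c' b z] e z eI by auto
  next
    case (Down r' c' b)
    then show ?thesis using eseg_IV[of r c i r' c' b z] e z eI by auto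
  qed
next
  case eH: (Across r c b)
  show ?thesis
  proof (cases f)
    case (Inner r' c' j)
    then show ?thesis using eseg_IH[of r' c' j r c b z] e z eH by (auto simp: Int_commute)
  next
    case (Across r' c' b')
    have "real c < real c' + 1" "real c' < real c + 1" "real r < real r' + 1" "real r' < real r + 1"
      using eseg_H[of r c b z] eseg_H[of r' c' b' z] e z eH Across by (auto split: if_splits)
    then have "c = c'" "r = r'" by linarith+
    moreover from this have "b = b'" using eseg_H(3)[of r c b z] eseg_H(3)[of r' c' b' z] e z eH Across by (auto split: if_splits)
    ultimately show ?thesis using e(3) eH Across by simp
  next
    case (Down r' c' b')
    \<comment> \<open>A vertical connecting edge runs at 800 or 1600 modulo 3000, never in a strip
      between two columns.\<close>
    have "real c < real c'" "real c' < real c + 1"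
      using eseg_H[of r c b z] eseg_V[of r' c' b' z] e z eH Down by (auto split: if_splits)
    then have "c < c'" "c' < c + 1" by linarith+
    then show ?thesis by simp
  qed
next
  case eV: (Down r c b)
  show ?thesis
  proof (cases f)
    case (Inner r' c' j)
    then show ?thesis using eseg_IV[of r' c' j r c b z] e z eV by (auto simp: Int_commute)
  next
    case (Down r' c' b')
    have "real c < real c' + 1" "real c' < real c + 1" "real r < real r' + 1" "real r' < real r + 1"
      using eseg_V[of r c b z] eseg_V[of r' c' b' z] e z eV Down by (auto split: if_splits)
    then have "c = c'" "r = r'" by linarith+
    moreover from this have "b = b'" using eseg_V(3)[of r c b z] eseg_V(3)[of r' c' b' z] e z eV Down by (auto split: if_splits)
    ultimately show ?thesis using e(3) eV Down by simp
  next
    case (Across r' c' b')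
    have "real c' < real c" "real c < real c' + 1"
      using eseg_V[of r c b z] eseg_H[of r' c' b' z] e z eV Across by (auto split: if_splits)
    then have "c' < c" "c < c' + 1" by linarith+
    then show ?thesis by simp
  qed
qed

lemma seg_disjoint:
  assumes "u \<in> verts" "v \<in> set (nbrs u)" "x \<in> verts" "y \<in> set (nbrs x)" "{u, v} \<noteq> {x, y}"
  shows "seg u v \<inter> seg x y \<subseteq> pos ` ({u, v} \<inter> {x, y})"
proof
  fix z assume z: "z \<in> seg u v \<inter> seg x y"
  obtain e f where e: "valid_edge e" "eset e = {u, v}" and f: "valid_edge f" "eset f = {x, y}"
    using edge_ex assms by metis
  have "eseg e = seg u v" "eseg f = seg x y"
    using e(2) f(2) seg_commute unfolding eset_def eseg_def by (metis doubleton_eq_iff)+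
  then show "z \<in> pos ` ({u, v} \<inter> {x, y})" using eseg_disjoint[OF e(1) f(1), of z] assms(5) z e(2) f(2) by auto
qed

end

section \<open>Sigma colorings of cubic graphs with few vertices of one label\<close>

lemma pair_graphI:
  assumes "finite (pverts G)" "parcs G \<subseteq> pverts G \<times> pverts G"
    and "\<And>u v. (u, v) \<in> parcs G \<Longrightarrow> (v, u) \<in> parcs G" "\<And>v. (v, v) \<notin> parcs G"
  shows "pair_graph G"
proof
  show "finite (parcs G)" using assms(1,2) finite_subset by blast
  show "symmetric (with_proj G)"
    using assms(3) by (auto simp: symmetric_def sym_def)
qed (use assms in auto)

lemma out_degree_neighbors: "out_degree (with_proj G) v = card (neighbors G v)"
proof -
  have "out_arcs (with_proj G) v = Pair v ` neighbors G v"
    by (auto simp: out_arcs_def neighbors_def)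
  then show ?thesis by (simp add: out_degree_def card_image inj_on_def)
qed

locale cubic_graph =
  fixes G :: "nat pair_pre_digraph"
  assumes graph: "pair_graph G" and regular: "regular_graph 3 G"
begin

abbreviation V where "V \<equiv> pverts G"

definition nbrs_in :: "nat set \<Rightarrow> nat \<Rightarrow> nat" where
  "nbrs_in S u = card (neighbors G u \<inter> S)"

lemma finite_V: "finite V"
proof -
  interpret pair_graph G by (rule graph)
  show ?thesis by (rule pair_finite_verts)
qed

lemma sym: "(u, v) \<in> parcs G \<Longrightarrow> (v, u) \<in> parcs G"
proof -
  interpret pair_graph G by (rule graph)
  show "(u, v) \<in> parcs G \<Longrightarrow> (v, u) \<in> parcs G"
    using pair_sym_arcs by (auto simp: symmetric_def sym_def)
qed

lemma arc_in_V: "(u, v) \<in> parcs G \<Longrightarrow> u \<in> V \<and> v \<in> V"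
proof -
  interpret pair_graph G by (rule graph)
  show "(u, v) \<in> parcs G \<Longrightarrow> u \<in> V \<and> v \<in> V" using arc_fst_in_verts arc_snd_in_verts by force
qed

lemma neighbors_V: "neighbors G u \<subseteq> V" using arc_in_V by (auto simp: neighbors_def)

lemma finite_neighbors: "finite (neighbors G u)" using neighbors_V finite_V finite_subset by blast

lemma card_neighbors: "u \<in> V \<Longrightarrow> card (neighbors G u) = 3"
  using regular by (auto simp: regular_graph_def out_degree_neighbors)

lemma nbrs_in_le: "u \<in> V \<Longrightarrow> nbrs_in S u \<le> 3"
  using card_mono[OF finite_neighbors, of "neighbors G u \<inter> S" u] card_neighbors by (simp add: nbrs_in_def)

text \<open>Double counting of the edge ends at \<open>X\<close>.\<close>

lemma sum_nbrs_in:
  assumes "X \<subseteq> V" shows "(\<Sum>u\<in>V. nbrs_in X u) = 3 * card X"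
proof -
  have fX: "finite X" using assms finite_V finite_subset by blast
  have "nbrs_in X u = (\<Sum>x\<in>X. of_bool (x \<in> neighbors G u))" for u
    using fX finite_neighbors[of u] by (simp add: nbrs_in_def of_bool_def sum.If_cases Int_commute)
  then have "(\<Sum>u\<in>V. nbrs_in X u) = (\<Sum>x\<in>X. \<Sum>u\<in>V. of_bool (x \<in> neighbors G u))"
    by (simp add: sum.swap[of _ X])
  also have "\<dots> = (\<Sum>x\<in>X. 3)"
  proof (rule sum.cong[OF refl])
    fix x assume "x \<in> X"
    have "{u \<in> V. x \<in> neighbors G u} = neighbors G x"
      using sym arc_in_V by (auto simp: neighbors_def)
    then show "(\<Sum>u\<in>V. of_bool (x \<in> neighbors G u)) = (3 :: nat)"
      using finite_V card_neighbors[of x] \<open>x \<in> X\<close> assms by (auto simp: of_bool_def sum.If_cases Int_def)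
  qed
  finally show ?thesis by simp
qed

text \<open>With two labels and constant degree, neighbour sums depend only on the number of
  neighbours in one label class.\<close>

lemma sum_labels:
  assumes "u \<in> V" "\<And>v. v \<in> V \<Longrightarrow> c v = (if v \<in> S then l else l')"
  shows "(\<Sum>w\<in>neighbors G u. c w) = nbrs_in S u * l + (3 - nbrs_in S u) * (l' :: nat)"
proof -
  have "(\<Sum>w\<in>neighbors G u. c w) = (\<Sum>w\<in>neighbors G u. if w \<in> S then l else l')"
    using assms(2) neighbors_V[of u] by (intro sum.cong refl) auto
  also have "\<dots> = nbrs_in S u * l + card (neighbors G u - S) * l'"
    using finite_neighbors[of u] by (simp add: sum.If_cases nbrs_in_def Diff_eq Int_def)
  also have "card (neighbors G u - S) = 3 - nbrs_in S u"
    using card_Diff_subset_Int[of "neighbors G u" S] finite_neighbors[of u] card_neighbors[OF assms(1)]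
    by (simp add: nbrs_in_def)
  finally show ?thesis .
qed

definition exact_set :: "nat set \<Rightarrow> bool" where
  "exact_set S \<longleftrightarrow> S \<subseteq> V \<and> (\<forall>u\<in>V. nbrs_in S u \<le> 1) \<and> (\<forall>(u, v)\<in>parcs G. nbrs_in S u \<noteq> nbrs_in S v)"

text \<open>The vertices with one neighbour in \<open>S\<close> and those with none are the sides of
  a bipartition, which have equal size in a cubic graph. The former are counted by the edge ends at
  \<open>S\<close>, so \<open>3 * card S\<close> is half of \<open>card V\<close>.\<close>

lemma card_exact_set:
  assumes "exact_set S" shows "6 * card S = card V"
proof -
  let ?A = "{u \<in> V. nbrs_in S u = 0}"
  let ?B = "{u \<in> V. nbrs_in S u = 1}"
  have V: "V = ?A \<union> ?B" "?A \<inter> ?B = {}" using assms by (auto simp: exact_set_def le_Suc_eq)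
  have fin: "finite ?A" "finite ?B" using finite_V by auto
  have "nbrs_in ?B u = (if u \<in> ?A then 3 else 0)" if "u \<in> V" for u
  proof -
    have key: "w \<in> ?B \<longleftrightarrow> u \<in> ?A" if "w \<in> neighbors G u" for w
    proof -
      have uw: "(u, w) \<in> parcs G" using that by (simp add: neighbors_def)
      then have "nbrs_in S u \<noteq> nbrs_in S w" using assms by (simp only: exact_set_def) blast
      moreover have "w \<in> V" using arc_in_V[OF uw] by simp
      moreover have "nbrs_in S u \<le> 1" "nbrs_in S w \<le> 1"
        using assms \<open>u \<in> V\<close> \<open>w \<in> V\<close> by (simp_all only: exact_set_def)
      ultimately have "nbrs_in S w = 1 \<longleftrightarrow> nbrs_in S u = 0" by arith
      then show ?thesis using \<open>u \<in> V\<close> \<open>w \<in> V\<close> by simp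
    qed
    show ?thesis
    proof (cases "u \<in> ?A")
      case True
      then have "neighbors G u \<inter> ?B = neighbors G u" using key by blast
      then show ?thesis using True card_neighbors[OF that] by (simp add: nbrs_in_def)
    next
      case False
      then have "neighbors G u \<inter> ?B = {}" using key by blast
      then show ?thesis using False by (simp add: nbrs_in_def)
    qed
  qed
  then have "3 * card ?B = (\<Sum>u\<in>V. if u \<in> ?A then 3 else 0)"
    using sum_nbrs_in[of ?B] by simp
  also have "\<dots> = 3 * card ?A" using finite_V by (simp add: sum.If_cases Int_def)
  finally have AB: "card ?A = card ?B" by simp
  have "3 * card S = (\<Sum>u\<in>V. nbrs_in S u)" using sum_nbrs_in[of S] assms by (simp add: exact_set_def)
  also have "\<dots> = (\<Sum>u\<in>V. if u \<in> ?B then 1 else 0)"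
    using assms by (intro sum.cong) (auto simp: exact_set_def le_Suc_eq)
  also have "\<dots> = card ?B" using finite_V by (simp add: sum.If_cases Int_def)
  finally have "3 * card S = card ?B" .
  moreover have "card V = card ?A + card ?B"
    using card_Un_disjoint[OF fin V(2)] V(1) by simp
  ultimately show ?thesis using AB by simp
qed

text \<open>
  The vertices without a neighbour in \<open>S\<close> are independent, hence at most half of all vertices, and the
  others contribute at least \<open>1\<close> each to \<open>3 * card S\<close>.
\<close>

lemma exact_set_if_small:
  assumes "S \<subseteq> V" "6 * card S \<le> card V" "\<And>u v. (u, v) \<in> parcs G \<Longrightarrow> nbrs_in S u \<noteq> nbrs_in S v"
  shows "exact_set S"
proof -
  let ?A = "{u \<in> V. nbrs_in S u = 0}"
  have "nbrs_in ?A u + (if u \<in> ?A then 3 else 0) \<le> 3" if "u \<in> V" for u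
  proof (cases "u \<in> ?A")
    case True
    then have "neighbors G u \<inter> ?A = {}" using assms(3) by (force simp: neighbors_def)
    then show ?thesis by (simp add: nbrs_in_def)
  qed (use nbrs_in_le[OF that] in auto)
  then have "(\<Sum>u\<in>V. nbrs_in ?A u + (if u \<in> ?A then 3 else 0)) \<le> (\<Sum>u\<in>V. 3)" by (rule sum_mono)
  moreover have "(\<Sum>u\<in>V. if u \<in> ?A then 3 else 0) = 3 * card ?A"
    using finite_V by (simp add: sum.If_cases Int_def)
  ultimately have A: "2 * card ?A \<le> card V" using sum_nbrs_in[of ?A] by (simp add: sum.distrib)
  have "nbrs_in S u \<le> 1" if u: "u \<in> V" for u
  proof (rule ccontr)
    assume "\<not> nbrs_in S u \<le> 1"
    then have "(\<Sum>v\<in>V. if v \<in> ?A then 0 else 1) < (\<Sum>v\<in>V. nbrs_in S v)"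
      using u by (intro sum_strict_mono_ex1) (auto simp: finite_V intro!: bexI[of _ u])
    moreover have "(\<Sum>v\<in>V. if v \<in> ?A then 0 else 1 :: nat) + card ?A = card V"
    proof -
      have "(\<Sum>v\<in>V. if v \<in> ?A then 0 else 1 :: nat) + (\<Sum>v\<in>V. if v \<in> ?A then 1 else 0) = card V"
        unfolding sum.distrib[symmetric] by (simp add: if_distrib cong: if_cong sum.cong)
      moreover have "(\<Sum>v\<in>V. if v \<in> ?A then 1 else 0 :: nat) = card ?A"
        using finite_V by (simp add: sum.If_cases Int_def)
      ultimately show ?thesis by simp
    qed
    ultimately show False using A sum_nbrs_in[OF assms(1)] assms(2) by simp
  qed
  then show ?thesis using assms by (auto simp: exact_set_def)
qed

text \<open>Labelling the two sides 1 and 0 gives neighbour sums 0 and 3. With a single label the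
  sums at both ends of an edge agree, and a nonempty cubic graph has an edge.\<close>

lemma sigma_chromatic_number_bipartite:
  assumes ne: "V \<noteq> {}" and side: "\<And>u v. (u, v) \<in> parcs G \<Longrightarrow> side u \<noteq> (side v :: bool)"
  shows "sigma_chromatic_number G = 2"
proof -
  let ?S = "{v \<in> V. side v}"
  let ?c = "\<lambda>v. if v \<in> ?S then 1 else 0 :: nat"
  obtain u where u: "u \<in> V" using ne by blast
  have "neighbors G u \<noteq> {}" using card_neighbors[OF u] by auto
  then obtain w where w: "(u, w) \<in> parcs G" by (auto simp: neighbors_def)
  have nbrs: "nbrs_in ?S v = (if side v then 0 else 3)" if "v \<in> V" for v
  proof -
    have key: "w \<in> ?S \<longleftrightarrow> \<not> side v" if "w \<in> neighbors G v" for w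
      using that side[of v w] arc_in_V[of v w] by (simp add: neighbors_def)
    show ?thesis
    proof (cases "side v")
      case True
      then have "neighbors G v \<inter> ?S = {}" using key by blast
      then show ?thesis using True by (simp add: nbrs_in_def)
    next
      case False
      then have "neighbors G v \<inter> ?S = neighbors G v" using key by blast
      then show ?thesis using False card_neighbors[OF that] by (simp add: nbrs_in_def)
    qed
  qed
  have sum: "(\<Sum>w\<in>neighbors G v. ?c w) = (if side v then 0 else 3)" if "v \<in> V" for v
    using sum_labels[OF that, of ?c ?S 1 0] nbrs[OF that] by simp
  have "sigma_coloring G ?c"
    unfolding sigma_coloring_def
  proof (clarify)
    fix v v' assume v: "(v, v') \<in> parcs G" and eq: "(\<Sum>w\<in>neighbors G v. ?c w) = (\<Sum>w\<in>neighbors G v'. ?c w)"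
    have "v \<in> V" "v' \<in> V" using arc_in_V[OF v] by auto
    from eq[unfolded sum[OF this(1)] sum[OF this(2)]] show False using side[OF v] by (simp split: if_splits)
  qed
  moreover have "?c ` V = {0, 1}"
  proof -
    have uw: "u \<in> V" "w \<in> V" "side u \<noteq> side w" using arc_in_V[OF w] side[OF w] by auto
    then have "?c u \<in> ?c ` V" "?c w \<in> ?c ` V" by blast+
    then have "{0, 1} \<subseteq> ?c ` V" using uw by (cases "side u") simp_all
    then show ?thesis by auto
  qed
  ultimately have ex: "\<exists>c. sigma_coloring G c \<and> card (c ` V) = 2" by (intro exI[of _ ?c]) simp
  show ?thesis unfolding sigma_chromatic_number_def
  proof (rule Least_equality)
    show "\<exists>c. sigma_coloring G c \<and> card (c ` V) = 2" by (rule ex)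
  next
    fix k assume "\<exists>c. sigma_coloring G c \<and> card (c ` V) = k"
    then obtain c where c: "sigma_coloring G c" "card (c ` V) = k" by blast
    show "2 \<le> k"
    proof (rule ccontr)
      assume "\<not> 2 \<le> k"
      then have "card (c ` V) \<le> Suc 0" using c(2) by simp
      then have "\<forall>y\<in>c ` V. \<forall>z\<in>c ` V. y = z" by (rule iffD1[OF card_le_Suc0_iff_eq[OF finite_imageI[OF finite_V]]])
      then have const: "c a = c b" if "a \<in> V" "b \<in> V" for a b using that by blast
      have "(\<Sum>x\<in>neighbors G v. c x) = 3 * c u" if "v \<in> V" for v
      proof -
        have "(\<Sum>x\<in>neighbors G v. c x) = (\<Sum>x\<in>neighbors G v. c u)"
        proof (rule sum.cong[OF refl])
          fix x assume "x \<in> neighbors G v"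
          then have "x \<in> V" using neighbors_V by blast
          then show "c x = c u" using const u by blast
        qed
        then show ?thesis using card_neighbors[OF that] by simp
      qed
      then show False using c(1) w arc_in_V[OF w] by (auto simp: sigma_coloring_def)
    qed
  qed
qed

text \<open>In one direction, equal counts force equal neighbour sums whatever the two labels are;
  in the other, the labels 1 and 0 make the sum equal to the count.\<close>

lemma Theta_question_iff:
  assumes ne: "V \<noteq> {}" and two: "sigma_chromatic_number G = 2"
  shows "Theta_question G r \<longleftrightarrow> (\<exists>S\<subseteq>V. (\<forall>(u, v)\<in>parcs G. nbrs_in S u \<noteq> nbrs_in S v) \<and>
    of_nat (card S) \<le> r * of_nat (card V))"
proof
  assume "Theta_question G r"
  then obtain c l where c: "sigma_coloring G c" "card (c ` V) = 2" "l \<in> c ` V"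
    and small: "of_nat (card {v \<in> V. c v = l}) \<le> r * of_nat (card V)"
    using two by (auto simp: Theta_question_def)
  let ?S = "{v \<in> V. c v = l}"
  obtain a b where "c ` V = {a, b}" "a \<noteq> b" using c(2) by (metis card_2_iff)
  then obtain l' where l': "c ` V = {l, l'}" using c(3) by auto
  have lab: "c v = (if v \<in> ?S then l else l')" if "v \<in> V" for v using l' that by auto
  have "nbrs_in ?S u \<noteq> nbrs_in ?S v" if uv: "(u, v) \<in> parcs G" for u v
    using c(1) uv arc_in_V[OF uv] sum_labels[of u c ?S l l'] sum_labels[of v c ?S l l'] lab
    by (force simp: sigma_coloring_def)
  then show "\<exists>S\<subseteq>V. (\<forall>(u, v)\<in>parcs G. nbrs_in S u \<noteq> nbrs_in S v) \<and> of_nat (card S) \<le> r * of_nat (card V)"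
    using small by (intro exI[of _ ?S]) auto
next
  assume "\<exists>S\<subseteq>V. (\<forall>(u, v)\<in>parcs G. nbrs_in S u \<noteq> nbrs_in S v) \<and> of_nat (card S) \<le> r * of_nat (card V)"
  then obtain S where S0: "S \<subseteq> V" "\<forall>(u, v)\<in>parcs G. nbrs_in S u \<noteq> nbrs_in S v"
    "of_nat (card S) \<le> r * of_nat (card V)" by blast
  then have S: "S \<subseteq> V" "\<And>u v. (u, v) \<in> parcs G \<Longrightarrow> nbrs_in S u \<noteq> nbrs_in S v"
    "of_nat (card S) \<le> r * of_nat (card V)" by auto
  let ?c = "\<lambda>v. if v \<in> S then 1 else 0 :: nat"
  have sums: "(\<Sum>w\<in>neighbors G u. ?c w) = nbrs_in S u" if "u \<in> V" for u
    using sum_labels[OF that, of ?c S 1 0] by simp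
  have "sigma_coloring G ?c" unfolding sigma_coloring_def
  proof (clarify)
    fix v v' assume v: "(v, v') \<in> parcs G" and eq: "(\<Sum>w\<in>neighbors G v. ?c w) = (\<Sum>w\<in>neighbors G v'. ?c w)"
    then show False using S(2)[OF v] arc_in_V[OF v] sums[of v] sums[of v'] by simp
  qed
  moreover have "?c ` V = {0, 1}"
  proof -
    obtain u where u: "u \<in> V" using ne by blast
    then obtain w where w: "(u, w) \<in> parcs G"
      using card_neighbors[OF u] by (metis card.empty ex_in_conv neighbors_def mem_Collect_eq zero_neq_numeral)
    \<comment> \<open>For \<open>S\<close> empty all counts are 0, and for \<open>S = V\<close> all
      are 3; so both labels occur.\<close>
    have "S \<noteq> {}" using S(2)[OF w] by (auto simp: nbrs_in_def)
    moreover have "S \<noteq> V"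
      using S(2)[OF w] arc_in_V[OF w] neighbors_V[of u] neighbors_V[of w] card_neighbors[of u] card_neighbors[of w]
      by (auto simp: nbrs_in_def Int_absorb2)
    ultimately show ?thesis using S(1) by auto
  qed
  moreover have "{v \<in> V. ?c v = 1} = S" using S(1) by auto
  ultimately show "Theta_question G r"
    unfolding Theta_question_def two using S(3) by (intro exI[of _ ?c]) auto
qed

lemma Theta_question_sixth_iff:
  assumes "V \<noteq> {}" "sigma_chromatic_number G = 2"
  shows "Theta_question G (1 / 6) \<longleftrightarrow> (\<exists>S. exact_set S)"
proof -
  have *: "of_nat (card S) \<le> (1 / 6 :: rat) * of_nat (card V) \<longleftrightarrow> 6 * card S \<le> card V" for S :: "nat set"
  proof -
    have "of_nat (card S) \<le> (1 / 6 :: rat) * of_nat (card V) \<longleftrightarrow> of_nat (6 * card S) \<le> (of_nat (card V) :: rat)"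
      by (simp add: field_simps)
    then show ?thesis by (simp only: of_nat_le_iff)
  qed
  show ?thesis
  proof
    assume "Theta_question G (1 / 6)"
    then obtain S where "S \<subseteq> V" "\<forall>(u, v)\<in>parcs G. nbrs_in S u \<noteq> nbrs_in S v" "6 * card S \<le> card V"
      using Theta_question_iff[OF assms, of "1 / 6"] unfolding * by blast
    then show "\<exists>S. exact_set S" using exact_set_if_small[of S] by blast
  next
    assume "\<exists>S. exact_set S"
    then obtain S where S: "exact_set S" by blast
    then show "Theta_question G (1 / 6)"
      unfolding Theta_question_iff[OF assms, of "1 / 6"] * using card_exact_set[OF S]
      by (auto simp: exact_set_def)
  qed
qed

end

section \<open>The graph of the grid\<close>

lemma mult_add_div_mod:
  fixes a b n :: nat
  assumes "b < n" shows "(a * n + b) div n = a" "(a * n + b) mod n = b"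
  using assms by auto

context grid
begin

definition code :: "vertex \<Rightarrow> nat" where "code = (\<lambda>(r, c, k). (r * C + c) * 108 + k)"

definition decode :: "nat \<Rightarrow> vertex" where "decode u = (u div 108 div C, u div 108 mod C, u mod 108)"

definition grid_graph :: "nat pair_pre_digraph" where
  "grid_graph = \<lparr>pverts = {..<R * C * 108},
     parcs = {(u, v). u < R * C * 108 \<and> v < R * C * 108 \<and> decode v \<in> set (nbrs (decode u))}\<rparr>"

lemma pverts_grid_graph: "pverts grid_graph = {..<R * C * 108}"
  by (simp add: grid_graph_def)

lemma arc_iff: "(u, v) \<in> parcs grid_graph \<longleftrightarrow>
    u < R * C * 108 \<and> v < R * C * 108 \<and> decode v \<in> set (nbrs (decode u))"
  by (simp add: grid_graph_def)

lemma decode_code: assumes "u \<in> verts" shows "decode (code u) = u" "code u < R * C * 108"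
proof -
  obtain r c k where u: "u = (r, c, k)" "r < R" "c < C" "k < 108" using assms by (auto simp: verts_def)
  have cu: "code u = (r * C + c) * 108 + k" by (simp only: u(1) code_def prod.case)
  show "decode (code u) = u"
    by (simp only: decode_def cu mult_add_div_mod[OF u(4)] mult_add_div_mod[OF u(3)]) (simp only: u(1))
  have "Suc (r * C + c) \<le> Suc r * C" using u by simp
  also have "\<dots> \<le> R * C" using u by (intro mult_right_mono) auto
  finally have "Suc (r * C + c) * 108 \<le> R * C * 108" by (intro mult_right_mono) auto
  then show "code u < R * C * 108" using u by (simp add: code_def)
qed

lemma code_decode: assumes "u < R * C * 108" shows "code (decode u) = u" "decode u \<in> verts"
proof -
  show "code (decode u) = u" by (simp only: code_def decode_def prod.case div_mult_mod_eq)
  have "u div 108 < R * C" using assms by (simp add: less_mult_imp_div_less)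
  then have "u div 108 div C < R" by (simp add: less_mult_imp_div_less)
  then show "decode u \<in> verts" using C by (simp add: decode_def verts_def)
qed

lemma inj_on_code: "inj_on code verts" by (rule inj_on_inverseI[of _ decode]) (rule decode_code)

lemma pair_graph_grid: "pair_graph grid_graph"
proof (rule pair_graphI)
  show "(v, u) \<in> parcs grid_graph" if "(u, v) \<in> parcs grid_graph" for u v
    using that nbrs_sound(2) code_decode(2) by (auto simp: arc_iff)
  show "(v, v) \<notin> parcs grid_graph" for v
    using nbrs_sound(3)[of "decode v" "decode v"] code_decode(2) by (auto simp: arc_iff)
qed (auto simp: grid_graph_def)

lemma neighbors_grid: "u < R * C * 108 \<Longrightarrow> neighbors grid_graph u = code ` set (nbrs (decode u))"
proof (intro equalityI subsetI)
  fix v assume u: "u < R * C * 108" and "v \<in> code ` set (nbrs (decode u))"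
  then obtain w where w: "w \<in> set (nbrs (decode u))" "v = code w" by blast
  then have "w \<in> verts" using nbrs_sound(1) code_decode(2) u by blast
  then show "v \<in> neighbors grid_graph u" using u w decode_code by (simp add: neighbors_def arc_iff)
next
  fix v assume "u < R * C * 108" "v \<in> neighbors grid_graph u"
  then show "v \<in> code ` set (nbrs (decode u))"
    using code_decode(1)[of v] by (force simp: neighbors_def arc_iff)
qed

lemma nbrs_list: assumes "u \<in> verts" shows "length (nbrs u) = 3" "distinct (nbrs u)" "set (nbrs u) \<subseteq> verts"
proof -
  obtain r c k where u: "u = (r, c, k)" "r < R" "c < C" "k < 108" using assms by (auto simp: verts_def)
  show "length (nbrs u) = 3" "distinct (nbrs u)" unfolding u(1)
    by (rule nbrs_box[OF u(2-4)]; simp)+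
  show "set (nbrs u) \<subseteq> verts" using nbrs_sound(1)[OF assms] by blast
qed

lemma regular_grid: "regular_graph 3 grid_graph"
  unfolding regular_graph_def
proof
  fix u assume "u \<in> pverts grid_graph"
  then have u: "u < R * C * 108" by (simp add: grid_graph_def)
  note n = nbrs_list[OF code_decode(2)[OF u]]
  have "card (code ` set (nbrs (decode u))) = 3"
    using card_image[OF inj_on_subset[OF inj_on_code n(3)]] n(1,2) by (simp add: distinct_card)
  then show "out_degree (with_proj grid_graph) u = 3" by (simp add: out_degree_neighbors neighbors_grid[OF u])
qed

lemma planar_grid: "planar_graph grid_graph"
proof -
  define pt where "pt u = pos (decode u)" for u
  \<comment> \<open>The drawing is indexed by unordered edges; \<open>Min\<close> and
    \<open>Max\<close> choose a direction.\<close>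
  define \<gamma> where "\<gamma> e = linepath (pt (Min e)) (pt (Max e))" for e :: "nat set"
  have inj: "inj_on pt {..<R * C * 108}"
  proof (rule inj_onI)
    fix u v assume uv: "u \<in> {..<R * C * 108}" "v \<in> {..<R * C * 108}" "pt u = pt v"
    then have "decode u = decode v"
      using inj_onD[OF pos_inj, of "decode u" "decode v"] code_decode(2) by (simp add: pt_def)
    then show "u = v" using code_decode(1) uv by (metis lessThan_iff)
  qed
  have img: "path_image (\<gamma> {u, v}) = seg (decode u) (decode v)" for u v
    using seg_commute[of "decode u" "decode v"]
    by (cases "u \<le> v") (auto simp: \<gamma>_def pt_def seg_def max_def min_def)
  have decode_eq: "u = v" if "decode u = decode v" "u < R * C * 108" "v < R * C * 108" for u v
    using code_decode(1) that by metis
  have crossing: "\<exists>w. w \<in> {u, v} \<and> w \<in> {x, y} \<and> z = pt w"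
    if uv: "(u, v) \<in> parcs grid_graph" and xy: "(x, y) \<in> parcs grid_graph" and "{u, v} \<noteq> {x, y}"
      and z: "z \<in> seg (decode u) (decode v)" "z \<in> seg (decode x) (decode y)" for u v x y z
  proof -
    have "{decode u, decode v} \<noteq> {decode x, decode y}"
      using decode_eq uv xy that(3) unfolding arc_iff doubleton_eq_iff by metis
    then have "z \<in> pos ` ({decode u, decode v} \<inter> {decode x, decode y})"
      using seg_disjoint[of "decode u" "decode v" "decode x" "decode y"] uv xy code_decode(2) z
      by (auto simp: arc_iff)
    then obtain w' where w': "w' \<in> {decode u, decode v}" "w' \<in> {decode x, decode y}" "z = pos w'" by blast
    from w'(1) obtain w where w: "w \<in> {u, v}" "w' = decode w" by blast
    have "w \<in> {x, y}" using decode_eq uv xy w w'(2) unfolding arc_iff by blast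
    then show ?thesis using w w'(3) by (auto simp: pt_def)
  qed
  have "plane_drawing grid_graph pt \<gamma>"
    unfolding plane_drawing_def
  proof (intro conjI ballI; clarify?)
    show "inj_on pt (pverts grid_graph)" using inj by (simp add: grid_graph_def)
  next
    fix u v assume uv: "(u, v) \<in> parcs grid_graph"
    then have lt: "u < R * C * 108" "v < R * C * 108" by (auto simp: arc_iff)
    have "u \<noteq> v" using nbrs_sound(3)[of "decode u" "decode v"] uv code_decode(2) by (auto simp: arc_iff)
    then have ne: "pt u \<noteq> pt v" using inj_onD[OF inj, of u v] lt by auto
    have 1: "arc (\<gamma> {u, v})" using ne by (cases "u \<le> v") (auto simp: \<gamma>_def max_def min_def intro!: arc_linepath)
    have 2: "{pathstart (\<gamma> {u, v}), pathfinish (\<gamma> {u, v})} = {pt u, pt v}"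
      by (cases "u \<le> v") (auto simp: \<gamma>_def max_def min_def)
    \<comment> \<open>Every vertex \<open>x\<close> lies on some edge, and this edge meets the one
      from \<open>u\<close> to \<open>v\<close> in the point of \<open>x\<close>; but edges meet
      only in common ends.\<close>
    have "x \<in> {u, v}" if x: "x < R * C * 108" "pt x \<in> seg (decode u) (decode v)" for x
    proof (rule ccontr)
      assume "x \<notin> {u, v}"
      obtain w where w: "w \<in> set (nbrs (decode x))"
        using nbrs_list(1)[OF code_decode(2)[OF x(1)]] by (cases "nbrs (decode x)") auto
      then have xw: "(x, code w) \<in> parcs grid_graph"
        using neighbors_grid[OF x(1)] by (auto simp: neighbors_def)
      have "pt x \<in> seg (decode x) (decode (code w))" by (simp add: pt_def seg_def)
      then obtain y where "y \<in> {u, v}" "pt x = pt y"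
        using crossing[OF uv xw _ x(2)] \<open>x \<notin> {u, v}\<close> by blast
      then have "x = y" using inj_onD[OF inj, of x y] x(1) lt by auto
      then show False using \<open>x \<notin> {u, v}\<close> \<open>y \<in> {u, v}\<close> by simp
    qed
    moreover have "pt u \<in> seg (decode u) (decode v)" "pt v \<in> seg (decode u) (decode v)" by (auto simp: pt_def seg_def)
    ultimately have 3: "path_image (\<gamma> {u, v}) \<inter> pt ` pverts grid_graph = {pt u, pt v}"
      using lt unfolding img pverts_grid_graph by auto
    show "arc (\<gamma> {u, v}) \<and> {pathstart (\<gamma> {u, v}), pathfinish (\<gamma> {u, v})} = {pt u, pt v} \<and>
        path_image (\<gamma> {u, v}) \<inter> pt ` pverts grid_graph = {pt u, pt v}"
      using 1 2 3 by blast
  next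
    fix u v x y z
    assume uv: "(u, v) \<in> parcs grid_graph" and xy: "(x, y) \<in> parcs grid_graph" and ne: "{u, v} \<noteq> {x, y}"
      and z: "z \<in> path_image (\<gamma> {u, v})" "z \<in> path_image (\<gamma> {x, y})"
    from crossing[OF uv xy ne z[unfolded img]] obtain w where "w \<in> {u, v}" "z = pt w" by blast
    then show "z \<in> pt ` pverts grid_graph" using uv by (auto simp: arc_iff grid_graph_def)
  qed
  then show ?thesis by (auto simp: planar_graph_def)
qed

sublocale cubic_graph grid_graph
  by (rule cubic_graph.intro[OF pair_graph_grid regular_grid])

lemma grid_graph_nonempty: "pverts grid_graph \<noteq> {}"
proof -
  have "0 < R * C * 108" using R C by simp
  then have "0 \<in> pverts grid_graph" by (simp only: pverts_grid_graph lessThan_iff)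
  then show ?thesis by blast
qed

lemma sigma_chromatic_number_grid: "sigma_chromatic_number grid_graph = 2"
proof (rule sigma_chromatic_number_bipartite[OF grid_graph_nonempty])
  show "even (snd (snd (decode u))) \<noteq> even (snd (snd (decode v)))" if "(u, v) \<in> parcs grid_graph" for u v
    using nbrs_sound(3)[of "decode u" "decode v"] that code_decode(2) by (simp add: arc_iff)
qed

lemma nbrs_in_count:
  assumes u: "u < R * C * 108" and S: "\<And>w. w \<in> verts \<Longrightarrow> code w \<in> A \<longleftrightarrow> S w"
  shows "nbrs_in A u = count S (decode u)"
proof -
  note n = nbrs_list[OF code_decode(2)[OF u]]
  have "neighbors grid_graph u \<inter> A = code ` set (filter S (nbrs (decode u)))"
    using n(3) S unfolding neighbors_grid[OF u] by auto
  then have "nbrs_in A u = card (set (filter S (nbrs (decode u))))"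
    using n(3) by (auto simp: nbrs_in_def intro!: card_image inj_on_subset[OF inj_on_code])
  then show ?thesis using n(2) by (simp add: count_def distinct_card del: set_filter)
qed

lemma exact_set_iff_solves: "(\<exists>A. exact_set A) \<longleftrightarrow> (\<exists>S. solves S)"
proof
  assume "\<exists>A. exact_set A"
  then obtain A where A: "exact_set A" by blast
  let ?S = "\<lambda>w. code w \<in> A"
  have cnt: "count ?S u = nbrs_in A (code u)" if "u \<in> verts" for u
    using nbrs_in_count[of "code u" A ?S] decode_code[OF that] by simp
  have "solves ?S" unfolding solves_def
  proof (intro ballI conjI)
    fix u assume u: "u \<in> verts"
    show "count ?S u \<le> 1" using A decode_code[OF u] cnt[OF u] by (simp add: exact_set_def pverts_grid_graph)
    fix v assume v: "v \<in> set (nbrs u)"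
    have v': "v \<in> verts" using nbrs_sound(1)[OF u v] .
    have "(code u, code v) \<in> parcs grid_graph" using u v v' decode_code by (simp add: arc_iff)
    then show "count ?S u \<noteq> count ?S v" using A cnt[OF u] cnt[OF v'] by (auto simp: exact_set_def)
  qed
  then show "\<exists>S. solves S" by blast
next
  assume "\<exists>S. solves S"
  then obtain S where S: "solves S" by blast
  let ?A = "code ` {w \<in> verts. S w}"
  have cnt: "nbrs_in ?A u = count S (decode u)" if "u < R * C * 108" for u
    using that by (rule nbrs_in_count) (use inj_onD[OF inj_on_code] in blast)
  have "exact_set ?A" unfolding exact_set_def
  proof (intro conjI ballI; clarify?)
    fix u assume "u \<in> pverts grid_graph"
    then show "nbrs_in ?A u \<le> 1" using S cnt code_decode(2) by (simp add: pverts_grid_graph solves_def)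
  next
    fix u v assume "(u, v) \<in> parcs grid_graph" "nbrs_in ?A u = nbrs_in ?A v"
    then show False using S cnt code_decode(2) by (auto simp: arc_iff solves_def)
  qed (use decode_code in \<open>auto simp: pverts_grid_graph\<close>)
  then show "\<exists>A. exact_set A" by blast
qed

lemma Theta_question_grid: "Theta_question grid_graph (1 / 6) \<longleftrightarrow> (\<exists>v. \<forall>r<R. satisfies_row v r)"
proof -
  have "Theta_question grid_graph (1 / 6) \<longleftrightarrow> (\<exists>S. solves S)"
    using Theta_question_sixth_iff[OF grid_graph_nonempty sigma_chromatic_number_grid] exact_set_iff_solves by simp
  then show ?thesis using solves_imp_satisfies satisfies_imp_solves by blast
qed

end

section \<open>The grid of a tableau\<close>

lemma mult_add_inject:
  fixes a b n :: nat
  assumes "b < n" "b' < n" "a * n + b = a' * n + b'" shows "a = a' \<and> b = b'"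
  using assms mult_add_div_mod by metis

lemma mult_add_less:
  fixes a b m n :: nat
  assumes "a < m" "b < n" shows "a * n + b < m * n"
proof -
  have "a * n + b < Suc a * n" using assms(2) by simp
  also have "\<dots> \<le> m * n" using assms(1) by (intro mult_right_mono) auto
  finally show ?thesis .
qed

context tm_schemas
begin

definition schema_list :: "schema list" where "schema_list = (SOME es. set es = schemas)"

lemma set_schema_list: "set schema_list = schemas"
  unfolding schema_list_def by (rule someI_ex) (rule finite_list[OF finite_schemas])

abbreviation "N \<equiv> tm_states M + tm_symbols M"

end

context tableau
begin

text \<open>Variable 0 is a dummy that occurs, positively, in the clauses of invalid schema instances.\<close>

definition var :: "nat \<times> nat \<times> nat \<times> nat \<Rightarrow> nat" where
  "var = (\<lambda>(t, \<tau>, i, s). Suc (((t * Suc K + \<tau>) * W + i) * N + s))"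

text \<open>Row numbers are \<open>(e * Suc T + t) * W + i\<close> for the number \<open>e\<close>
  of the schema, the time and the cell.\<close>

definition has_pos :: "nat \<Rightarrow> nat \<Rightarrow> bool" where
  "has_pos r j \<longleftrightarrow> (let sc = schema_list ! (r div W div Suc T); t = r div W mod Suc T; i = r mod W in
     if valid sc t i then \<exists>l\<in>pos_lits sc. j = var (atom l t i) else j = 0)"

definition has_neg :: "nat \<Rightarrow> nat \<Rightarrow> bool" where
  "has_neg r j \<longleftrightarrow> (let sc = schema_list ! (r div W div Suc T); t = r div W mod Suc T; i = r mod W in
     valid sc t i \<and> (\<exists>l\<in>neg_lits sc. j = var (atom l t i)))"

definition rows :: nat where "rows = length schema_list * Suc T * W"
text \<open>One column for each variable, one for the dummy and two at the border.\<close>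

definition cols :: nat where "cols = Suc T * Suc K * W * N + 3"

definition box_type :: "nat \<Rightarrow> nat \<Rightarrow> nat" where
  "box_type r c = (if c = 0 \<or> c = cols - 1 then 3 else if has_pos r (c - 1) then 1
     else if has_neg r (c - 1) then 2 else 0)"

sublocale grid rows cols box_type
proof
  have "KStart \<in> set schema_list" by (simp add: set_schema_list)
  then show "0 < rows" by (cases schema_list) (auto simp: rows_def W_def)
qed (auto simp: cols_def box_type_def)

definition atoms :: "(nat \<times> nat \<times> nat \<times> nat) set" where
  "atoms = {..T} \<times> {..K} \<times> {..<W} \<times> {..<N}"

lemma inj_on_var: "inj_on var atoms"
proof (rule inj_onI)
  fix a b assume "a \<in> atoms" "b \<in> atoms" and eq: "var a = var b"
  then obtain t \<tau> i s t' \<tau>' i' s' where a: "a = (t, \<tau>, i, s)" "\<tau> < Suc K" "i < W" "s < N"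
    and b: "b = (t', \<tau>', i', s')" "\<tau>' < Suc K" "i' < W" "s' < N"
    by (auto simp: atoms_def)
  have "((t * Suc K + \<tau>) * W + i) * N + s = ((t' * Suc K + \<tau>') * W + i') * N + s'"
    using eq by (simp only: a b var_def prod.case nat.inject)
  from mult_add_inject[OF a(4) b(4) this] have "(t * Suc K + \<tau>) * W + i = (t' * Suc K + \<tau>') * W + i'" "s = s'"
    by auto
  from mult_add_inject[OF a(3) b(3) this(1)] this(2) mult_add_inject[OF a(2) b(2), of t t'] show "a = b"
    using a b by simp
qed

lemma var_bounds: assumes "a \<in> atoms" shows "0 < var a" "var a < cols - 2"
proof -
  obtain t \<tau> i s where a: "a = (t, \<tau>, i, s)" "t < Suc T" "\<tau> < Suc K" "i < W" "s < N"
    using assms by (auto simp: atoms_def)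
  show "0 < var a" by (simp add: a var_def)
  have "((t * Suc K + \<tau>) * W + i) * N + s < Suc T * Suc K * W * N" using a by (intro mult_add_less)
  then show "var a < cols - 2" by (simp only: a var_def prod.case cols_def)
qed

lemma clause_index:
  assumes "e < length schema_list" "t \<le> T" "i < W"
  defines "r \<equiv> (e * Suc T + t) * W + i"
  shows "r < rows" "r div W div Suc T = e" "r div W mod Suc T = t" "r mod W = i"
proof -
  show "r < rows" unfolding r_def rows_def using assms(1-3) by (intro mult_add_less) auto
  have "r div W = e * Suc T + t" using assms(3) by (simp add: r_def)
  then show "r div W div Suc T = e" "r div W mod Suc T = t" "r mod W = i"
    using assms(2,3) by (simp_all add: r_def del: mult_Suc_right)
qed

lemma row_index:
  assumes "r < rows"
  shows "r div W div Suc T < length schema_list" "r div W mod Suc T \<le> T" "r mod W < W"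
proof -
  have "r div W < length schema_list * Suc T" using assms by (simp add: rows_def less_mult_imp_div_less)
  then show "r div W div Suc T < length schema_list" by (rule less_mult_imp_div_less)
  show "r div W mod Suc T \<le> T" using mod_less_divisor[of "Suc T" "r div W"] by linarith
  show "r mod W < W" by (simp add: W_def)
qed

text \<open>Column 0 belongs to the border, so the variable with number \<open>j\<close> is found in
  column \<open>Suc j\<close>.\<close>

lemma rows_satisfiable_iff: "(\<exists>v. \<forall>r<rows. satisfies_row v r) \<longleftrightarrow> (\<exists>v. satisfies v)"
proof
  assume "\<exists>v. \<forall>r<rows. satisfies_row v r"
  then obtain v where v: "\<And>r. r < rows \<Longrightarrow> satisfies_row v r" by blast
  have "satisfies (\<lambda>a. v (Suc (var a)))" unfolding satisfies_def
  proof (intro ballI allI impI)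
    fix sc t i assume sc: "sc \<in> schemas" "t \<le> T" "i < W" "valid sc t i"
    then obtain e where e: "e < length schema_list" "schema_list ! e = sc"
      using set_schema_list by (metis in_set_conv_nth)
    note r = clause_index[OF e(1) sc(2,3)]
    obtain c where c: "box_type ((e * Suc T + t) * W + i) c = 1 \<and> v c \<or> box_type ((e * Suc T + t) * W + i) c = 2 \<and> \<not> v c"
      using v[OF r(1)] by (auto simp: satisfies_row_def)
    then have "c \<noteq> 0" by (auto simp: box_type_def split: if_splits)
    then obtain j where j: "c = Suc j" using not0_implies_Suc by blast
    then have "has_pos ((e * Suc T + t) * W + i) j \<and> v (Suc j) \<or> has_neg ((e * Suc T + t) * W + i) j \<and> \<not> v (Suc j)"
      using c by (auto simp: box_type_def split: if_splits)
    then show "(\<exists>l\<in>pos_lits sc. v (Suc (var (atom l t i)))) \<or> (\<exists>l\<in>neg_lits sc. \<not> v (Suc (var (atom l t i))))"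
      unfolding has_pos_def has_neg_def r Let_def e(2) using sc(4) by auto
  qed
  then show "\<exists>v. satisfies v" by blast
next
  assume "\<exists>v. satisfies v"
  then obtain v where v: "satisfies v" by blast
  \<comment> \<open>The dummy, in column 1, is made true; this satisfies the rows of invalid
    instances.\<close>
  define v' where "v' c \<longleftrightarrow> c = 1 \<or> (\<exists>a\<in>atoms. c = Suc (var a) \<and> v a)" for c
  have v'_var: "v' (Suc (var a)) \<longleftrightarrow> v a" if "a \<in> atoms" for a
    using var_bounds(1)[OF that] inj_onD[OF inj_on_var _ that] that by (auto simp: v'_def)
  have "satisfies_row v' r" if r: "r < rows" for r
  proof -
    let ?sc = "schema_list ! (r div W div Suc T)" and ?t = "r div W mod Suc T" and ?i = "r mod W"
    note ri = row_index[OF r]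
    have sc: "?sc \<in> schemas" using ri(1) set_schema_list nth_mem by blast
    show ?thesis
    proof (cases "valid ?sc ?t ?i")
      case False
      then have "box_type r 1 = 1" by (simp add: box_type_def has_pos_def cols_def)
      then show ?thesis unfolding satisfies_row_def by (intro exI[of _ 1]) (simp add: cols_def v'_def)
    next
      case True
      have range: "atom l ?t ?i \<in> atoms" if "l \<in> pos_lits ?sc \<union> neg_lits ?sc" for l
        unfolding atoms_def using atom_range[OF sc ri(2,3) True that] .
      have col: "box_type r (Suc (var (atom l ?t ?i))) = (if l \<in> pos_lits ?sc then 1 else 2)"
        "Suc (var (atom l ?t ?i)) < cols" if l: "l \<in> pos_lits ?sc \<union> neg_lits ?sc" for l
      proof -
        note b = var_bounds(2)[OF range[OF l]]
        \<comment> \<open>\<open>box_type\<close> looks for positive literals first, so a negative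
          one must not share its column with a positive one.\<close>
        have "\<not> has_pos r (var (atom l ?t ?i))" if n: "l \<notin> pos_lits ?sc"
        proof
          assume "has_pos r (var (atom l ?t ?i))"
          then obtain l' where l': "l' \<in> pos_lits ?sc" "var (atom l ?t ?i) = var (atom l' ?t ?i)"
            using True by (auto simp: has_pos_def Let_def)
          then have "atom l ?t ?i = atom l' ?t ?i" using inj_onD[OF inj_on_var] range l by blast
          then show False using pos_neg_disjoint[OF l'(1), of l ?t ?i] l n by auto
        qed
        moreover have "has_pos r (var (atom l ?t ?i))" if "l \<in> pos_lits ?sc"
          using that True by (auto simp: has_pos_def Let_def)
        moreover have "has_neg r (var (atom l ?t ?i))" if "l \<in> neg_lits ?sc"
          using that True by (auto simp: has_neg_def Let_def)
        ultimately show "box_type r (Suc (var (atom l ?t ?i))) = (if l \<in> pos_lits ?sc then 1 else 2)"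
          using b l by (auto simp: box_type_def)
        show "Suc (var (atom l ?t ?i)) < cols" using b by simp
      qed
      have "(\<exists>l\<in>pos_lits ?sc. v (atom l ?t ?i)) \<or> (\<exists>l\<in>neg_lits ?sc. \<not> v (atom l ?t ?i))"
        using v sc ri(2,3) True unfolding satisfies_def by blast
      then obtain l where l: "l \<in> pos_lits ?sc \<union> neg_lits ?sc"
        and "l \<in> pos_lits ?sc \<and> v (atom l ?t ?i) \<or> l \<in> neg_lits ?sc \<and> \<not> v (atom l ?t ?i)"
        by blast
      moreover have "l \<notin> pos_lits ?sc" if "l \<in> neg_lits ?sc" using pos_neg_disjoint that by blast
      ultimately show ?thesis unfolding satisfies_row_def
        using col[OF l] v'_var[OF range[OF l]] by (intro exI[of _ "Suc (var (atom l ?t ?i))"]) auto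
    qed
  qed
  then show "\<exists>v. \<forall>r<rows. satisfies_row v r" by blast
qed

lemma tableau_Theta_question: "Theta_question grid_graph (1 / 6) \<longleftrightarrow> (\<exists>v. satisfies v)"
  using Theta_question_grid rows_satisfiable_iff by simp

lemma tableau_Theta_instance: "Theta_instance grid_graph (1 / 6)"
  using pair_graph_grid planar_grid regular_grid by (simp add: Theta_instance_def)

end

section \<open>Membership in NP\<close>

lemma nat_string_value: "(\<Sum>i<length (nat_string m). 2 ^ i * of_bool (nat_string m ! i)) = m"
proof (induction m rule: nat_string.induct)
  case (1 m)
  show ?case
  proof (cases "m = 0")
    case False
    have "nat_string m = odd m # nat_string (m div 2)" using False by (subst nat_string.simps) simp
    then have "(\<Sum>i<length (nat_string m). 2 ^ i * of_bool (nat_string m ! i) :: nat) =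
        of_bool (odd m) + 2 * (\<Sum>i<length (nat_string (m div 2)). 2 ^ i * of_bool (nat_string (m div 2) ! i))"
      by (simp add: sum.lessThan_Suc_shift sum_distrib_left mult.assoc del: sum.lessThan_Suc sum_mult_of_bool_eq)
    also have "\<dots> = of_bool (odd m) + 2 * (m div 2)" using 1 False by simp
    also have "\<dots> = m" by (simp add: mult.commute flip: mod2_eq_if of_bool_odd_eq_mod_2)
    finally show ?thesis .
  qed (simp add: nat_string.simps)
qed

lemma bits_value:
  assumes "length (nat_string m) \<le> L"
  shows "(\<Sum>i<L. 2 ^ i * of_bool (i < length (nat_string m) \<and> nat_string m ! i)) = m"
proof -
  have "(\<Sum>i<L. 2 ^ i * of_bool (i < length (nat_string m) \<and> nat_string m ! i) :: nat) =
      (\<Sum>i<length (nat_string m). 2 ^ i * of_bool (i < length (nat_string m) \<and> nat_string m ! i))"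
    using assms by (intro sum.mono_neutral_right) auto
  also have "\<dots> = (\<Sum>i<length (nat_string m). 2 ^ i * of_bool (nat_string m ! i))" by (intro sum.cong) auto
  also have "\<dots> = m" by (rule nat_string_value)
  finally show ?thesis .
qed

text \<open>
  Two products are compared bit by bit, from the least significant one, carrying only a small number:
  after \<open>L\<close> steps the carry is \<open>\<lfloor>(n * a + k * (2 ^ L - b)) / 2 ^ L\<rfloor>\<close> for the numbers \<open>a\<close> and \<open>b\<close> with the given bits.
\<close>

definition carry :: "nat \<Rightarrow> nat \<Rightarrow> (nat \<Rightarrow> bool) \<Rightarrow> (nat \<Rightarrow> bool) \<Rightarrow> nat \<Rightarrow> nat" where
  "carry n k a b = rec_nat k (\<lambda>i c. (c + n * of_bool (a i) + k * of_bool (\<not> b i)) div 2)"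

lemma carry_simps [simp]:
  "carry n k a b 0 = k" "carry n k a b (Suc i) = (carry n k a b i + n * of_bool (a i) + k * of_bool (\<not> b i)) div 2"
  by (simp_all add: carry_def)

lemma carry_le: "carry n k a b i \<le> n + k"
proof (induction i)
  case (Suc i)
  have "n * of_bool (a i) \<le> n" "k * of_bool (\<not> b i) \<le> k" by auto
  from add_mono[OF add_mono[OF Suc this(1)] this(2)]
  have "carry n k a b i + n * of_bool (a i) + k * of_bool (\<not> b i) \<le> 2 * (n + k)" by simp
  moreover have "2 * (n + k) div 2 = n + k" by (rule nonzero_mult_div_cancel_left) simp
  ultimately show ?case using div_le_mono[of _ "2 * (n + k)" 2] unfolding carry_simps by metis
qed simp

text \<open>Successive halvings with rounding combine into a single rounded division, so the bits
  can be consumed one at a time.\<close>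

lemma carry_eq:
  "carry n k a b L = (k + (\<Sum>i<L. 2 ^ i * (n * of_bool (a i) + k * of_bool (\<not> b i)))) div 2 ^ L"
proof (induction L)
  case (Suc L)
  let ?s = "k + (\<Sum>i<L. 2 ^ i * (n * of_bool (a i) + k * of_bool (\<not> b i)))"
  let ?y = "n * of_bool (a L) + k * of_bool (\<not> b L)"
  have "carry n k a b (Suc L) = (?s div 2 ^ L + ?y) div 2" using Suc by simp
  also have "?s div 2 ^ L + ?y = (?s + 2 ^ L * ?y) div 2 ^ L" by simp
  also have "\<dots> div 2 = (?s + 2 ^ L * ?y) div 2 ^ Suc L" by (simp only: div_mult2_eq power_Suc2)
  finally show ?case by (simp only: sum.lessThan_Suc add.assoc)
qed simp

text \<open>The values of the bits \<open>b\<close> and of their complements add up to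
  \<open>2 ^ L - 1\<close>, and the initial carry \<open>k\<close> supplies the missing 1. Adding
  \<open>k * (2 ^ L - b)\<close> to \<open>n * a\<close> turns the comparison with
  \<open>k * b\<close> into one with \<open>k * 2 ^ L\<close>.\<close>

lemma carry_ge_iff:
  "k \<le> carry n k a b L \<longleftrightarrow> k * (\<Sum>i<L. 2 ^ i * of_bool (b i)) \<le> n * (\<Sum>i<L. 2 ^ i * of_bool (a i))"
proof -
  let ?a = "\<Sum>i<L. 2 ^ i * of_bool (a i) :: nat" and ?b = "\<Sum>i<L. 2 ^ i * of_bool (b i) :: nat"
    and ?c = "\<Sum>i<L. 2 ^ i * of_bool (\<not> b i) :: nat"
  have eq: "?b + ?c = (\<Sum>i<L. 2 ^ i)"
    unfolding sum.distrib[symmetric] by (intro sum.cong) auto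
  have bc: "Suc (?b + ?c) = 2 ^ L" unfolding eq by (induction L) auto
  have sum: "(\<Sum>i<L. 2 ^ i * (n * of_bool (a i) + k * of_bool (\<not> b i))) = n * ?a + k * ?c"
    by (simp add: sum_distrib_left distrib_left sum.distrib mult.left_commute del: sum_mult_of_bool_eq)
  have "k \<le> carry n k a b L \<longleftrightarrow> k * 2 ^ L \<le> k + (n * ?a + k * ?c)"
    unfolding carry_eq sum by (simp add: less_eq_div_iff_mult_less_eq)
  also have "\<dots> \<longleftrightarrow> k * ?b \<le> n * ?a" unfolding bc[symmetric] by (simp add: algebra_simps)
  finally show ?thesis .
qed

section \<open>Decoding of instance and certificate\<close>

definition bit_at :: "bool list \<Rightarrow> nat \<Rightarrow> bool" where "bit_at y i \<longleftrightarrow> i < length y \<and> y ! i"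

lemma bit_at_pair_string:
  "i < length u \<Longrightarrow> bit_at (pair_string u v) (2 * i) = u ! i"
  "i < length u \<Longrightarrow> bit_at (pair_string u v) (2 * i + 1) = u ! i"
  "bit_at (pair_string u v) (2 * length u) = False" "bit_at (pair_string u v) (2 * length u + 1) = True"
  "bit_at (pair_string u v) (2 * length u + 2 + i) = bit_at v i"
  by (auto simp: bit_at_def length_pair_string pair_string_nth)

text \<open>The bits of the first component are doubled, so the first unequal pair starting at an
  even position is the separator.\<close>

lemma bit_at_pair_string_split:
  "bit_at (pair_string u v) (2 * i) \<noteq> bit_at (pair_string u v) (2 * i + 1) \<Longrightarrow> i \<ge> length u"
  using bit_at_pair_string(1,2)[of i u v] by (metis not_le)

text \<open>
  The parts of \<open>pair_string (pair_string g (pair_string a b)) w\<close> in terms of single bits: the length of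
  the instance, the lengths of \<open>g\<close> and \<open>a\<close>, and the bits of \<open>a\<close>, \<open>b\<close> and \<open>w\<close>.
\<close>

definition instance_length :: "bool list \<Rightarrow> nat" where
  "instance_length y = first_below (length y) (\<lambda>i. bit_at y (2 * i) \<noteq> bit_at y (2 * i + 1))"

text \<open>The graph is the first component of a first component, so its bits are doubled twice:
  bit \<open>i\<close> stands at position \<open>2 * (2 * i)\<close>.\<close>

definition graph_length :: "bool list \<Rightarrow> nat" where
  "graph_length y = first_below (length y) (\<lambda>i. bit_at y (2 * (2 * i)) \<noteq> bit_at y (2 * (2 * i + 1)))"

definition order_of :: "bool list \<Rightarrow> nat" where
  "order_of y = first_below (length y) (\<lambda>i. graph_length y \<le> i * i)"

definition num_length :: "bool list \<Rightarrow> nat" where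
  "num_length y = first_below (length y) (\<lambda>i. bit_at y (2 * (2 * graph_length y + 2 + 2 * i)) \<noteq>
     bit_at y (2 * (2 * graph_length y + 2 + (2 * i + 1))))"

definition num_bit :: "bool list \<Rightarrow> nat \<Rightarrow> bool" where
  "num_bit y i \<longleftrightarrow> i < num_length y \<and> bit_at y (2 * (2 * graph_length y + 2 + 2 * i))"

definition denom_bit :: "bool list \<Rightarrow> nat \<Rightarrow> bool" where
  "denom_bit y i \<longleftrightarrow> 2 * graph_length y + 2 + (2 * num_length y + 2 + i) < instance_length y \<and>
     bit_at y (2 * (2 * graph_length y + 2 + (2 * num_length y + 2 + i)))"

definition adjacent :: "bool list \<Rightarrow> nat \<Rightarrow> nat \<Rightarrow> bool" where
  "adjacent y u v \<longleftrightarrow> bit_at y (2 * (2 * (u * order_of y + v)))"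

definition chosen :: "bool list \<Rightarrow> nat \<Rightarrow> bool" where
  "chosen y u \<longleftrightarrow> bit_at y (2 * instance_length y + 2 + u)"

definition chosen_nbrs :: "bool list \<Rightarrow> nat \<Rightarrow> nat" where
  "chosen_nbrs y u = (\<Sum>v<order_of y. of_bool (adjacent y u v \<and> chosen y v))"

definition chosen_count :: "bool list \<Rightarrow> nat" where
  "chosen_count y = (\<Sum>v<order_of y. of_bool (chosen y v))"

text \<open>In \<open>length y\<close> rounds the carry sees all bits of numerator and denominator;
  further bits count as 0.\<close>

definition accepts :: "bool list \<Rightarrow> bool" where
  "accepts y \<longleftrightarrow> (\<forall>u<order_of y. \<forall>v<order_of y. adjacent y u v \<longrightarrow> chosen_nbrs y u \<noteq> chosen_nbrs y v) \<and>
     chosen_count y \<le> carry (order_of y) (chosen_count y) (num_bit y) (denom_bit y) (length y)"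

lemma pcomp_bit_at: "comp n f \<Longrightarrow> pcomp n (\<lambda>x E. bit_at x (f x E))"
  unfolding bit_at_def by (rule comp_input)

lemma pcomp_neq: "pcomp n P \<Longrightarrow> pcomp n Q \<Longrightarrow> pcomp n (\<lambda>x E. P x E \<noteq> Q x E)"
  by (intro pcomp_not pcomp_iff)

lemma comp_instance_length: "comp n (\<lambda>x E. instance_length x)"
  unfolding instance_length_def by (intro comp_intros pcomp_neq pcomp_bit_at) auto

lemma comp_graph_length: "comp n (\<lambda>x E. graph_length x)"
  unfolding graph_length_def by (intro comp_intros pcomp_neq pcomp_bit_at) auto

lemma comp_order_of: "comp n (\<lambda>x E. order_of x)"
  unfolding order_of_def by (intro comp_intros comp_graph_length) auto

lemma comp_num_length: "comp n (\<lambda>x E. num_length x)"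
  unfolding num_length_def by (intro comp_intros comp_graph_length pcomp_neq pcomp_bit_at) auto

lemma pcomp_num_bit: "comp n f \<Longrightarrow> pcomp n (\<lambda>x E. num_bit x (f x E))"
  unfolding num_bit_def by (intro comp_intros comp_graph_length comp_num_length pcomp_bit_at)

lemma pcomp_denom_bit: "comp n f \<Longrightarrow> pcomp n (\<lambda>x E. denom_bit x (f x E))"
  unfolding denom_bit_def
  by (intro comp_intros comp_graph_length comp_num_length comp_instance_length pcomp_bit_at)

lemma pcomp_adjacent: "comp n f \<Longrightarrow> comp n g \<Longrightarrow> pcomp n (\<lambda>x E. adjacent x (f x E) (g x E))"
  unfolding adjacent_def by (intro comp_intros comp_order_of pcomp_bit_at)

lemma pcomp_chosen: "comp n f \<Longrightarrow> pcomp n (\<lambda>x E. chosen x (f x E))"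
  unfolding chosen_def by (intro comp_intros comp_instance_length pcomp_bit_at)

lemma comp_chosen_nbrs: "comp n f \<Longrightarrow> comp n (\<lambda>x E. chosen_nbrs x (f x E))"
  unfolding chosen_nbrs_def
  by (rule comp_1) (intro comp_sum comp_order_of pcomp_conj pcomp_adjacent pcomp_chosen comp_nth; simp)

lemma comp_chosen_count: "comp n (\<lambda>x E. chosen_count x)"
  unfolding chosen_count_def by (intro comp_sum comp_order_of pcomp_chosen comp_nth) simp

text \<open>The bound demanded by the iteration is the one on the carry, which does not depend on
  the values of numerator and denominator.\<close>

lemma comp_carry: "comp n (\<lambda>x E. carry (order_of x) (chosen_count x) (num_bit x) (denom_bit x) (length x))"
  unfolding carry_def
proof (rule comp_iterate[OF comp_length comp_chosen_count])
  show "comp (Suc (Suc n)) (\<lambda>x E. (E 0 + order_of x * of_bool (num_bit x (E 1)) +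
      chosen_count x * of_bool (\<not> denom_bit x (E 1))) div 2)"
    by (intro comp_intros comp_order_of comp_chosen_count pcomp_num_bit pcomp_denom_bit) auto
  show "poly_bounded n (\<lambda>x E. order_of x + chosen_count x)"
    by (intro comp_bounded comp_add comp_order_of comp_chosen_count)
  fix x and E :: "nat \<Rightarrow> nat" and j :: nat
  show "rec_nat (chosen_count x) (\<lambda>i c. (c + order_of x * of_bool (num_bit x i) +
      chosen_count x * of_bool (\<not> denom_bit x i)) div 2) j \<le> order_of x + chosen_count x"
    using carry_le[of "order_of x" "chosen_count x" "num_bit x" "denom_bit x" j] by (simp add: carry_def)
qed

lemma poly_time_decidable_accepts: "poly_time_decidable accepts"
proof -
  have "pcomp 1 (\<lambda>x E. accepts x)"
    unfolding accepts_def
    by (intro pcomp_conj pcomp_all pcomp_imp pcomp_not pcomp_eq pcomp_le comp_order_of pcomp_adjacent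
      comp_chosen_nbrs comp_chosen_count comp_carry comp_nth) auto
  from poly_time_computable_comp[OF comp_const[of 1 1] this] show ?thesis by (simp add: poly_time_decidable_def)
qed

lemma less_pair_string: "length u < length (pair_string u v)" by (simp add: length_pair_string)

lemma
  fixes g a b w
  defines "y \<equiv> pair_string (pair_string g (pair_string a b)) w"
  shows instance_length_eq: "instance_length y = length (pair_string g (pair_string a b))"
    and graph_length_eq: "graph_length y = length g"
    and num_length_eq: "num_length y = length a"
    and num_bit_eq: "num_bit y i \<longleftrightarrow> i < length a \<and> a ! i"
    and denom_bit_eq: "denom_bit y i \<longleftrightarrow> i < length b \<and> b ! i"
    and graph_bit: "i < length g \<Longrightarrow> bit_at y (2 * (2 * i)) \<longleftrightarrow> g ! i"
    and chosen_eq: "chosen y i \<longleftrightarrow> i < length w \<and> w ! i"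
proof -
  let ?z = "pair_string a b" and ?x = "pair_string g (pair_string a b)"
  note len = length_pair_string
  have x: "bit_at y (2 * i) = bit_at ?x i" if "i < length ?x" for i
    using bit_at_pair_string(1)[OF that] that by (simp add: y_def bit_at_def)
  have z: "bit_at y (2 * (2 * length g + 2 + i)) = bit_at ?z i" if "i < length ?z" for i
    using x[of "2 * length g + 2 + i"] that bit_at_pair_string(5)[of g ?z i] by (simp add: len)
  show il: "instance_length y = length ?x"
    unfolding instance_length_def
  proof (rule first_below_eq)
    show "length ?x < length y" by (simp add: y_def less_pair_string)
    show "bit_at y (2 * length ?x) \<noteq> bit_at y (2 * length ?x + 1)" unfolding y_def bit_at_pair_string by simp
    show "\<not> bit_at y (2 * j) \<noteq> bit_at y (2 * j + 1)" if "j < length ?x" for j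
      using bit_at_pair_string_split[of ?x w j] that unfolding y_def by auto
  qed
  show gl: "graph_length y = length g"
    unfolding graph_length_def
  proof (rule first_below_eq)
    show "length g < length y" by (simp add: y_def len)
    show "bit_at y (2 * (2 * length g)) \<noteq> bit_at y (2 * (2 * length g + 1))"
      using x[of "2 * length g"] x[of "2 * length g + 1"] bit_at_pair_string(3,4)[of g ?z] by (simp add: len)
    show "\<not> bit_at y (2 * (2 * j)) \<noteq> bit_at y (2 * (2 * j + 1))" if "j < length g" for j
      using x[of "2 * j"] x[of "2 * j + 1"] bit_at_pair_string_split[of g ?z j] that by (simp add: len) blast
  qed
  show nl: "num_length y = length a"
    unfolding num_length_def gl
  proof (rule first_below_eq)
    show "length a < length y" by (simp add: y_def len)
    show "bit_at y (2 * (2 * length g + 2 + 2 * length a)) \<noteq> bit_at y (2 * (2 * length g + 2 + (2 * length a + 1)))"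
      using z[of "2 * length a"] z[of "2 * length a + 1"] bit_at_pair_string(3,4)[of a b] by (simp add: len)
    show "\<not> bit_at y (2 * (2 * length g + 2 + 2 * j)) \<noteq> bit_at y (2 * (2 * length g + 2 + (2 * j + 1)))"
      if "j < length a" for j
      using z[of "2 * j"] z[of "2 * j + 1"] bit_at_pair_string_split[of a b j] that by (simp add: len) blast
  qed
  show "num_bit y i \<longleftrightarrow> i < length a \<and> a ! i"
    unfolding num_bit_def nl gl using z[of "2 * i"] bit_at_pair_string(1)[of i a b] by (auto simp: len)
  show "denom_bit y i \<longleftrightarrow> i < length b \<and> b ! i"
    unfolding denom_bit_def nl gl il
    using z[of "2 * length a + 2 + i"] bit_at_pair_string(5)[of a b i] by (auto simp: len bit_at_def)
  show "bit_at y (2 * (2 * i)) \<longleftrightarrow> g ! i" if "i < length g"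
    using x[of "2 * i"] bit_at_pair_string(1)[OF that, of ?z] that by (simp add: len)
  show "chosen y i \<longleftrightarrow> i < length w \<and> w ! i"
    unfolding chosen_def il unfolding y_def bit_at_pair_string(5) by (simp add: bit_at_def)
qed

lemma order_of_eq:
  assumes "length g = m * m"
  shows "order_of (pair_string (pair_string g (pair_string a b)) w) = m"
  unfolding order_of_def graph_length_eq assms
proof (rule first_below_eq)
  have "m \<le> m * m" by simp
  then show "m < length (pair_string (pair_string g (pair_string a b)) w)"
    by (rule le_less_trans) (simp add: length_pair_string assms)
  show "\<not> m * m \<le> j * j" if "j < m" for j using that by (simp add: not_le mult_strict_mono)
qed simp

lemma (in cubic_graph) accepts_iff:
  fixes r :: rat
  assumes V: "pverts G = {..<n}" and b: "b > 0" and r: "r = of_nat a / of_nat b"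
    and x: "x = pair_string (adjacency_string n (parcs G)) (pair_string (nat_string a) (nat_string b))"
  defines "S w \<equiv> {u. u < n \<and> u < length w \<and> w ! u}"
  shows "accepts (pair_string x w) \<longleftrightarrow>
    (\<forall>(u, v)\<in>parcs G. nbrs_in (S w) u \<noteq> nbrs_in (S w) v) \<and> of_nat (card (S w)) \<le> r * of_nat (card V)"
proof -
  let ?y = "pair_string x w"
  have len: "length (adjacency_string n (parcs G)) = n * n" by (simp add: adjacency_string_def)
  have n: "order_of ?y = n" unfolding x by (rule order_of_eq[OF len])
  have adj: "adjacent ?y u v \<longleftrightarrow> (u, v) \<in> parcs G" if "u < n" "v < n" for u v
  proof -
    have "u * n + v < Suc u * n" using that by simp
    also have "\<dots> \<le> n * n" using that by (intro mult_right_mono) auto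
    finally have k: "u * n + v < n * n" .
    have "adjacent ?y u v \<longleftrightarrow> adjacency_string n (parcs G) ! (u * n + v)"
      unfolding adjacent_def n unfolding x by (rule graph_bit) (simp add: len k)
    also have "\<dots> \<longleftrightarrow> (u, v) \<in> parcs G" using k that by (simp add: adjacency_string_def)
    finally show ?thesis .
  qed
  have ch: "chosen ?y u \<longleftrightarrow> u \<in> S w" if "u < n" for u using that unfolding x chosen_eq by (simp add: S_def)
  have cn: "chosen_nbrs ?y u = nbrs_in (S w) u" if "u < n" for u
  proof -
    have "chosen_nbrs ?y u = card {v \<in> {..<n}. adjacent ?y u v \<and> chosen ?y v}"
      unfolding chosen_nbrs_def n by (rule sum_of_bool_card) simp
    also have "{v \<in> {..<n}. adjacent ?y u v \<and> chosen ?y v} = neighbors G u \<inter> S w"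
      using adj[OF that] ch arc_in_V V by (auto simp: neighbors_def)
    finally show ?thesis by (simp add: nbrs_in_def)
  qed
  have "chosen_count ?y = card {v \<in> {..<n}. chosen ?y v}"
    unfolding chosen_count_def n by (rule sum_of_bool_card) simp
  also have "{v \<in> {..<n}. chosen ?y v} = S w" using ch by (auto simp: S_def)
  finally have cc: "chosen_count ?y = card (S w)" .
  have "length (nat_string a) \<le> length ?y" "length (nat_string b) \<le> length ?y"
    by (simp_all add: x length_pair_string)
  then have vals: "(\<Sum>i<length ?y. 2 ^ i * of_bool (num_bit ?y i)) = a" "(\<Sum>i<length ?y. 2 ^ i * of_bool (denom_bit ?y i)) = b"
    using bits_value unfolding x num_bit_eq denom_bit_eq by auto
  have "of_nat (card (S w)) \<le> r * of_nat (card V) \<longleftrightarrow> of_nat (card (S w) * b) \<le> (of_nat (n * a) :: rat)"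
    using b by (simp add: r V field_simps)
  also have "\<dots> \<longleftrightarrow> card (S w) * b \<le> n * a" by (simp only: of_nat_le_iff)
  also have "\<dots> \<longleftrightarrow> chosen_count ?y \<le> carry n (chosen_count ?y) (num_bit ?y) (denom_bit ?y) (length ?y)"
    unfolding carry_ge_iff vals cc by (simp add: mult.commute)
  finally have size: "of_nat (card (S w)) \<le> r * of_nat (card V) \<longleftrightarrow>
    chosen_count ?y \<le> carry n (chosen_count ?y) (num_bit ?y) (denom_bit ?y) (length ?y)" .
  have "(\<forall>u<n. \<forall>v<n. adjacent ?y u v \<longrightarrow> chosen_nbrs ?y u \<noteq> chosen_nbrs ?y v) \<longleftrightarrow>
    (\<forall>(u, v)\<in>parcs G. nbrs_in (S w) u \<noteq> nbrs_in (S w) v)"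
  proof (intro iffI allI impI ballI; clarify?)
    fix u v assume L: "\<forall>u<n. \<forall>v<n. adjacent ?y u v \<longrightarrow> chosen_nbrs ?y u \<noteq> chosen_nbrs ?y v"
      and uv: "(u, v) \<in> parcs G" and eq: "nbrs_in (S w) u = nbrs_in (S w) v"
    have lt: "u < n" "v < n" using arc_in_V[OF uv] V by auto
    have "adjacent ?y u v" using adj[OF lt] uv by blast
    then have "chosen_nbrs ?y u \<noteq> chosen_nbrs ?y v" using L lt by blast
    then show False using cn[OF lt(1)] cn[OF lt(2)] eq by simp
  next
    fix u v assume R: "\<forall>(u, v)\<in>parcs G. nbrs_in (S w) u \<noteq> nbrs_in (S w) v" and lt: "u < n" "v < n"
      and a: "adjacent ?y u v" and eq: "chosen_nbrs ?y u = chosen_nbrs ?y v"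
    have "(u, v) \<in> parcs G" using adj[OF lt] a by blast
    then show False using R eq cn[OF lt(1)] cn[OF lt(2)] by fastforce
  qed
  then show ?thesis unfolding accepts_def n size by blast
qed

text \<open>In this way the promise excludes the empty graph.\<close>

lemma sigma_chromatic_number_no_vertices:
  assumes "pair_graph G" "pverts G = {}" shows "sigma_chromatic_number G = 0"
proof -
  interpret pair_graph G by fact
  have "parcs G = {}" using assms(2) wellformed' by fastforce
  then have "sigma_coloring G (\<lambda>_. 0) \<and> card ((\<lambda>_. 0 :: nat) ` pverts G) = 0"
    using assms(2) by (simp add: sigma_coloring_def)
  then show ?thesis unfolding sigma_chromatic_number_def by (intro Least_eq_0) blast
qed

theorem Theta_in_promise_NP: "Theta \<in> promise_NP"
proof -
  have key: "x \<in> {x. \<exists>G r. encodes x G r \<and> Theta_instance G r \<and> Theta_question G r} \<longleftrightarrow>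
      (\<exists>w. length w \<le> poly [:0, 1:] (length x) \<and> accepts (pair_string x w))"
    if enc: "encodes x G r" and inst: "Theta_instance G r" and two: "sigma_chromatic_number G = 2" for x G r
  proof -
    interpret cubic_graph G by (rule cubic_graph.intro) (use inst in \<open>auto simp: Theta_instance_def\<close>)
    have ne: "V \<noteq> {}" using sigma_chromatic_number_no_vertices[OF graph] two by auto
    obtain n a b where n: "V = {..<n}" "b > 0" "r = of_nat a / of_nat b"
      "x = pair_string (adjacency_string n (parcs G)) (pair_string (nat_string a) (nat_string b))"
      using enc by (auto simp: encodes_def)
    have acc: "accepts (pair_string x w) \<longleftrightarrow> (\<forall>(u, v)\<in>parcs G. nbrs_in {u. u < n \<and> u < length w \<and> w ! u} u \<noteq>
        nbrs_in {u. u < n \<and> u < length w \<and> w ! u} v) \<and>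
        of_nat (card {u. u < n \<and> u < length w \<and> w ! u}) \<le> r * of_nat (card V)" for w
      using n by (rule accepts_iff)
    \<comment> \<open>A certificate has one bit per vertex, and already the adjacency matrix is at
      least as long; so the identity polynomial \<open>[:0, 1:]\<close> bounds it.\<close>
    have "n \<le> n * n" by simp
    moreover have "length (adjacency_string n (parcs G)) = n * n" by (simp add: adjacency_string_def)
    ultimately have nx: "n \<le> length x" unfolding n(4) length_pair_string by linarith
    \<comment> \<open>The question ranges over all decodings of \<open>x\<close>; uniqueness of the
      encoding brings it back to \<open>G\<close> and \<open>r\<close>.\<close>
    have "x \<in> {x. \<exists>G r. encodes x G r \<and> Theta_instance G r \<and> Theta_question G r} \<longleftrightarrow> Theta_question G r"
    proof
      assume "x \<in> {x. \<exists>G r. encodes x G r \<and> Theta_instance G r \<and> Theta_question G r}"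
      then obtain H r' where H: "encodes x H r'" "Theta_instance H r'" "Theta_question H r'" by blast
      have "pair_graph H" using H(2) by (simp add: Theta_instance_def)
      then show "Theta_question G r" using encodes_unique[OF enc H(1) graph] H(3) by simp
    qed (use enc inst in blast)
    also have "\<dots> \<longleftrightarrow> (\<exists>w. length w \<le> length x \<and> accepts (pair_string x w))"
      unfolding Theta_question_iff[OF ne two]
    proof
      assume "\<exists>S\<subseteq>V. (\<forall>(u, v)\<in>parcs G. nbrs_in S u \<noteq> nbrs_in S v) \<and> of_nat (card S) \<le> r * of_nat (card V)"
      then obtain S where S: "S \<subseteq> V" "\<forall>(u, v)\<in>parcs G. nbrs_in S u \<noteq> nbrs_in S v"
        "of_nat (card S) \<le> r * of_nat (card V)" by blast
      let ?w = "map (\<lambda>u. u \<in> S) [0..<n]"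
      have "{u. u < n \<and> u < length ?w \<and> ?w ! u} = S" using S(1) n(1) by auto
      then have "accepts (pair_string x ?w)" unfolding acc using S(2,3) by simp
      then show "\<exists>w. length w \<le> length x \<and> accepts (pair_string x w)"
        using nx by (intro exI[of _ ?w]) simp
    next
      assume "\<exists>w. length w \<le> length x \<and> accepts (pair_string x w)"
      then obtain w where "accepts (pair_string x w)" by blast
      then show "\<exists>S\<subseteq>V. (\<forall>(u, v)\<in>parcs G. nbrs_in S u \<noteq> nbrs_in S v) \<and> of_nat (card S) \<le> r * of_nat (card V)"
        unfolding acc using n(1) by (intro exI[of _ "{u. u < n \<and> u < length w \<and> w ! u}"]) auto
    qed
    finally show ?thesis by simp
  qed
  show ?thesis
    unfolding Theta_def promise_NP_def
    by (intro CollectI case_prodI exI[of _ accepts] exI[of _ "[:0, 1:]"] conjI ballI poly_time_decidable_accepts)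
      (elim CollectE exE conjE, rule key)
qed

section \<open>Computing the reduction\<close>

context grid
begin

lemma nbrs_iff: "w \<in> set (nbrs (r, c, k)) \<longleftrightarrow>
    (\<exists>j\<in>set (box_nbrs (ty r c) k). if j = 108 then w = partner (r, c, k) else w = (r, c, j))"
  by (auto simp: nbrs_def)

lemma partner_eq_iff: "(r', c', k') = partner (r, c, k) \<longleftrightarrow>
    (if k = 0 then (if r = 0 then r' = r \<and> c' = c \<and> k' = 1 else r' = r - 1 \<and> c' = c \<and> k' = 5)
     else if k = 1 then (if r = 0 then r' = r \<and> c' = c \<and> k' = 0 else r' = r - 1 \<and> c' = c \<and> k' = 4)
     else if k = 2 then (if Suc c = C then r' = r \<and> c' = c \<and> k' = 3 else r' = r \<and> c' = Suc c \<and> k' = 7)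
     else if k = 3 then (if Suc c = C then r' = r \<and> c' = c \<and> k' = 2 else r' = r \<and> c' = Suc c \<and> k' = 6)
     else if k = 4 then (if Suc r = R then r' = r \<and> c' = c \<and> k' = 5 else r' = Suc r \<and> c' = c \<and> k' = 1)
     else if k = 5 then (if Suc r = R then r' = r \<and> c' = c \<and> k' = 4 else r' = Suc r \<and> c' = c \<and> k' = 0)
     else if k = 6 then (if c = 0 then r' = r \<and> c' = c \<and> k' = 7 else r' = r \<and> c' = c - 1 \<and> k' = 3)
     else (if c = 0 then r' = r \<and> c' = c \<and> k' = 6 else r' = r \<and> c' = c - 1 \<and> k' = 2))"
  unfolding partner_def prod.case by (simp only: if_distrib[of "(=) (r', c', k')"] prod.inject)

text \<open>Box type and number within the box become the index of a finite disjunction, so that the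
  tables are consulted for constants only. The bound on the row accompanies the type because types
  are computed for rows of the grid only.\<close>

lemma arc_iff_box_nbrs: "(u, v) \<in> parcs grid_graph \<longleftrightarrow> u < R * C * 108 \<and> v < R * C * 108 \<and>
    (\<exists>a\<in>{..<4} \<times> {..<108}. (u div 108 div C < R \<and> ty (u div 108 div C) (u div 108 mod C) = fst a) \<and> u mod 108 = snd a \<and>
       (\<exists>j\<in>set (box_nbrs (fst a) (snd a)). if j = 108 then (v div 108 div C, v div 108 mod C, v mod 108) =
            partner (u div 108 div C, u div 108 mod C, snd a)
          else v div 108 div C = u div 108 div C \<and> v div 108 mod C = u div 108 mod C \<and> v mod 108 = j))"
proof (cases "u < R * C * 108")
  case True
  then have "u div 108 div C < R" "u div 108 mod C < C" using code_decode(2)[OF True] by (auto simp: decode_def verts_def)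
  then have "ty (u div 108 div C) (u div 108 mod C) < 4" by (intro ty_less)
  moreover have "u mod 108 < 108" by simp
  ultimately show ?thesis
    using True \<open>u div 108 div C < R\<close> unfolding arc_iff decode_def nbrs_iff by force
qed (simp add: arc_iff)

end

text \<open>Coefficients are natural numbers. Hence the running time for the longest certificate
  bounds that for all shorter ones, and a single \<open>T\<close> serves a whole tableau.\<close>

lemma poly_nat_mono: fixes p :: "nat poly" assumes "a \<le> b" shows "poly p a \<le> poly p b"
  using assms by (induction p) (auto intro: mult_mono)

section \<open>The reduction as a function of the input string\<close>

locale reduction = tm_schemas +
  fixes p q :: "nat poly"
begin

definition P :: "bool list \<Rightarrow> nat" where "P x = poly q (length x)"
definition T :: "bool list \<Rightarrow> nat" where "T x = poly p (2 * length x + 2 + P x)"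

lemma tab: "tableau M" by unfold_locales

text \<open>A tableau fixes \<open>x\<close>, while here \<open>x\<close> is the argument of the
  functions to be computed; so the constants of the tableau are used with \<open>x\<close>
  explicit.\<close>

abbreviation "B x \<equiv> tableau.B x (T x) (P x)"
abbreviation "W x \<equiv> tableau.W x (T x) (P x)"
abbreviation "init_symbol x \<equiv> tableau.init_symbol x (T x) (P x)"
abbreviation "valid x \<equiv> tableau.valid M x (T x) (P x)"
abbreviation "atom x \<equiv> tableau.atom x (T x) (P x)"
abbreviation "var x \<equiv> tableau.var M x (T x) (P x)"
abbreviation "has_pos x \<equiv> tableau.has_pos M x (T x) (P x)"
abbreviation "has_neg x \<equiv> tableau.has_neg M x (T x) (P x)"
abbreviation rows :: "bool list \<Rightarrow> nat" where "rows x \<equiv> tableau.rows M x (T x) (P x)"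
abbreviation "cols x \<equiv> tableau.cols M x (T x) (P x)"
abbreviation "box_type x \<equiv> tableau.box_type M x (T x) (P x)"
abbreviation "G x \<equiv> grid.grid_graph (rows x) (cols x) (box_type x)"

lemma is_grid: "grid (rows x) (cols x) (box_type x)"
proof -
  interpret tb: tableau M x "T x" "P x" by unfold_locales
  show ?thesis by unfold_locales
qed

lemmas unfold_B = tableau.B_def[OF tab]
lemmas unfold_W = tableau.W_def[OF tab]
lemmas unfold_init_symbol = tableau.init_symbol_def[OF tab]
lemmas unfold_atom = tableau.atom_def[OF tab]
lemmas unfold_var = tableau.var_def[OF tab]
lemmas unfold_has_pos = tableau.has_pos_def[OF tab]
lemmas unfold_has_neg = tableau.has_neg_def[OF tab]
lemmas unfold_rows = tableau.rows_def[OF tab]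
lemmas unfold_cols = tableau.cols_def[OF tab]
lemmas unfold_box_type = tableau.box_type_def[OF tab]

lemma comp_P: "comp n (\<lambda>x E. P x)" unfolding P_def by (intro comp_poly comp_length)

lemma comp_T: "comp n (\<lambda>x E. T x)"
  unfolding T_def by (intro comp_poly comp_add comp_mult comp_const comp_length comp_P)

lemma comp_B: "comp n (\<lambda>x E. B x)"
  unfolding unfold_B by (intro comp_add comp_mult comp_const comp_length comp_P comp_T)

lemma comp_W: "comp n (\<lambda>x E. W x)"
  unfolding unfold_W by (intro comp_add comp_mult comp_const comp_B)

lemma comp_rows: "comp n (\<lambda>x E. rows x)"
  unfolding unfold_rows by (intro comp_mult comp_const comp_Suc comp_T comp_W)

lemma comp_cols: "comp n (\<lambda>x E. cols x)"
  unfolding unfold_cols by (intro comp_add comp_mult comp_const comp_Suc comp_T comp_W)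

lemmas comp_sizes = comp_P comp_T comp_B comp_W comp_rows comp_cols

lemma comp_init_symbol:
  assumes "comp n f" shows "comp n (\<lambda>x E. init_symbol x \<tau> (f x E))"
proof -
  \<comment> \<open>Access to a bit of the input comes with a range test, which the preceding
    condition implies.\<close>
  have "comp n (\<lambda>x E. if \<tau> \<noteq> 0 \<or> f x E < B x then 0
      else if f x E - B x < 2 * length x then
        (if (f x E - B x) div 2 < length x \<and> x ! ((f x E - B x) div 2) then 2 else 1)
      else if f x E - B x = 2 * length x then 1 else if f x E - B x = 2 * length x + 1 then 2
      else if f x E - B x < 2 * length x + 2 + P x then 3 else 0)"
    by (intro comp_intros comp_sizes assms pcomp_const)
  then show ?thesis by (rule comp_cong) (auto simp: unfold_init_symbol)
qed

lemma pcomp_valid: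
  assumes "comp n t" "comp n i" shows "pcomp n (\<lambda>x E. valid x sc (t x E) (i x E))"
  by (cases sc; simp only: tableau.valid.simps[OF tab])
    (intro comp_intros comp_sizes assms comp_init_symbol pcomp_const)+

lemma comp_var_atom:
  assumes "comp n t" "comp n i" shows "comp n (\<lambda>x E. var x (atom x l (t x E) (i x E)))"
proof -
  obtain dt \<tau> rel c s where l: "l = (dt, \<tau>, rel, c, s)" by (cases l)
  show ?thesis unfolding unfold_var unfold_atom l prod.case
    by (intro comp_intros comp_sizes assms pcomp_const)
qed

text \<open>The number of the schema is computed from the row, whereas computability of
  \<open>Q e\<close> is known for each constant \<open>e\<close>; a disjunction over the finitely
  many schemas connects the two. For \<open>r < rows\<close> the number is in range.\<close>

lemma pcomp_row_cases:
  assumes r: "comp n r" and Q: "\<And>e. pcomp n (Q e)"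
  shows "pcomp n (\<lambda>x E. r x E < rows x \<and> Q (r x E div W x div Suc (T x)) x E)"
proof -
  have "pcomp n (\<lambda>x E. r x E < rows x \<and>
      (\<exists>e\<in>{..<length schema_list}. r x E div W x div Suc (T x) = e \<and> Q e x E))"
    by (intro comp_intros comp_sizes r Q pcomp_finite_ex finite_lessThan)
  then show ?thesis
    by (rule comp_cong) (use tableau.row_index(1)[OF tab] in \<open>auto intro!: arg_cong[of _ _ of_bool]\<close>)
qed

lemma pcomp_has_pos:
  assumes "comp n r" "comp n j" shows "pcomp n (\<lambda>x E. r x E < rows x \<and> has_pos x (r x E) (j x E))"
  unfolding unfold_has_pos Let_def
proof (rule pcomp_row_cases[OF assms(1), where Q = "\<lambda>e x E. if valid x (schema_list ! e) (r x E div W x mod Suc (T x)) (r x E mod W x)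
    then \<exists>l\<in>pos_lits (schema_list ! e). j x E = var x (atom x l (r x E div W x mod Suc (T x)) (r x E mod W x)) else j x E = 0"])
  fix e
  show "pcomp n (\<lambda>x E. if valid x (schema_list ! e) (r x E div W x mod Suc (T x)) (r x E mod W x)
    then \<exists>l\<in>pos_lits (schema_list ! e). j x E = var x (atom x l (r x E div W x mod Suc (T x)) (r x E mod W x)) else j x E = 0)"
    by (intro pcomp_if pcomp_valid pcomp_finite_ex finite_lits pcomp_eq comp_var_atom comp_mod comp_div comp_Suc
      comp_sizes comp_const assms)
qed

lemma pcomp_has_neg:
  assumes "comp n r" "comp n j" shows "pcomp n (\<lambda>x E. r x E < rows x \<and> has_neg x (r x E) (j x E))"
  unfolding unfold_has_neg Let_def
proof (rule pcomp_row_cases[OF assms(1), where Q = "\<lambda>e x E. valid x (schema_list ! e) (r x E div W x mod Suc (T x)) (r x E mod W x) \<and>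
    (\<exists>l\<in>neg_lits (schema_list ! e). j x E = var x (atom x l (r x E div W x mod Suc (T x)) (r x E mod W x)))"])
  fix e
  show "pcomp n (\<lambda>x E. valid x (schema_list ! e) (r x E div W x mod Suc (T x)) (r x E mod W x) \<and>
    (\<exists>l\<in>neg_lits (schema_list ! e). j x E = var x (atom x l (r x E div W x mod Suc (T x)) (r x E mod W x))))"
    by (intro pcomp_conj pcomp_valid pcomp_finite_ex finite_lits pcomp_eq comp_var_atom comp_mod comp_div comp_Suc
      comp_sizes comp_const assms)
qed

lemma pcomp_box_type:
  assumes "comp n r" "comp n c" shows "pcomp n (\<lambda>x E. r x E < rows x \<and> box_type x (r x E) (c x E) = t)"
proof -
  have "pcomp n (\<lambda>x E. r x E < rows x \<and> (if c x E = 0 \<or> c x E = cols x - 1 then t = 3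
      else if r x E < rows x \<and> has_pos x (r x E) (c x E - 1) then t = 1
      else if r x E < rows x \<and> has_neg x (r x E) (c x E - 1) then t = 2 else t = 0))"
    by (intro pcomp_has_pos pcomp_has_neg pcomp_conj pcomp_disj pcomp_if pcomp_less pcomp_eq pcomp_const comp_diff
      comp_sizes comp_const assms)
  then show ?thesis by (rule comp_cong) (auto simp: unfold_box_type)
qed

definition graph_order :: "bool list \<Rightarrow> nat" where "graph_order x = rows x * cols x * 108"

lemma comp_graph_order: "comp n (\<lambda>x E. graph_order x)"
  unfolding graph_order_def by (intro comp_mult comp_sizes comp_const)

lemma pcomp_arc:
  assumes u: "comp n u" and v: "comp n v" shows "pcomp n (\<lambda>x E. (u x E, v x E) \<in> parcs (G x))"
proof -
  have "pcomp n (\<lambda>x E. if j = 108 then (v x E div 108 div cols x, v x E div 108 mod cols x, v x E mod 108) =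
        grid.partner (rows x) (cols x) (u x E div 108 div cols x, u x E div 108 mod cols x, k)
      else v x E div 108 div cols x = u x E div 108 div cols x \<and>
        v x E div 108 mod cols x = u x E div 108 mod cols x \<and> v x E mod 108 = j)" for j k :: nat
    unfolding grid.partner_eq_iff[OF is_grid]
    by (intro pcomp_if pcomp_conj pcomp_eq pcomp_const comp_div comp_mod comp_diff comp_Suc comp_const comp_sizes u v)
  then show ?thesis
    unfolding grid.arc_iff_box_nbrs[OF is_grid]
    by (intro pcomp_conj pcomp_less pcomp_finite_ex pcomp_box_type pcomp_eq comp_div comp_mod comp_mult comp_const
      comp_sizes u v finite_cartesian_product finite_lessThan finite_set)
qed

definition fraction :: "bool list" where "fraction = pair_string (nat_string 1) (nat_string 6)"

definition reduce :: "bool list \<Rightarrow> bool list" where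
  "reduce x = pair_string (adjacency_string (graph_order x) (parcs (G x))) fraction"

lemma poly_time_computable_reduce: "poly_time_computable reduce"
proof -
  \<comment> \<open>Separator and fraction form a suffix that is the same for all \<open>x\<close>,
    so its true bits are a constant set \<open>A\<close> of positions.\<close>
  define tl where "tl = pair_string [] fraction"
  define A where "A = {a. a < length tl \<and> tl ! a}"
  define N where "N x = 2 * (graph_order x * graph_order x) + length tl" for x
  define b where "b x m \<longleftrightarrow> (if m < 2 * (graph_order x * graph_order x) then (m div 2 div graph_order x, m div 2 mod graph_order x) \<in> parcs (G x)
    else \<exists>a\<in>A. m - 2 * (graph_order x * graph_order x) = a)" for x m
  have N: "comp 1 (\<lambda>x E. N x)" unfolding N_def by (intro comp_add comp_mult comp_const comp_graph_order)
  have b: "pcomp 1 (\<lambda>x E. b x (E 0))"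
    unfolding b_def
    by (intro pcomp_if pcomp_less pcomp_arc pcomp_finite_ex pcomp_eq comp_diff comp_div comp_mod comp_mult comp_const
      comp_graph_order comp_nth) (auto simp: A_def)
  have "reduce x = map (b x) [0..<N x]" for x
  proof (rule nth_equalityI)
    let ?g = "adjacency_string (graph_order x) (parcs (G x))"
    have len: "length ?g = graph_order x * graph_order x" by (simp add: adjacency_string_def)
    then show "length (reduce x) = length (map (b x) [0..<N x])"
      by (simp add: reduce_def N_def tl_def length_pair_string)
    fix m assume "m < length (reduce x)"
    then have m: "m < N x" using len by (simp add: reduce_def N_def tl_def length_pair_string)
    have "reduce x ! m = b x m"
    proof (cases "m < 2 * (graph_order x * graph_order x)")
      case True
      then have "m div 2 < graph_order x * graph_order x" by simp
      then show ?thesis using True len by (simp add: reduce_def b_def pair_string_nth adjacency_string_def)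
    next
      case False
      then have "reduce x ! m = tl ! (m - 2 * (graph_order x * graph_order x))"
        using len by (auto simp: reduce_def tl_def pair_string_nth)
      moreover have "m - 2 * (graph_order x * graph_order x) < length tl" using m False by (simp add: N_def)
      ultimately show ?thesis using False by (simp add: b_def A_def)
    qed
    then show "reduce x ! m = map (b x) [0..<N x] ! m" using m by simp
  qed
  then have "reduce = (\<lambda>x. map (b x) [0..<N x])" by (rule ext)
  then show ?thesis using poly_time_computable_comp[OF N b] by (simp only:)
qed

lemma reduce_encodes: "encodes (reduce x) (G x) (1 / 6)"
  unfolding encodes_def
proof (intro exI conjI)
  show "pverts (G x) = {..<graph_order x}" by (simp add: grid.pverts_grid_graph[OF is_grid] graph_order_def)
  show "reduce x = pair_string (adjacency_string (graph_order x) (parcs (G x))) (pair_string (nat_string 1) (nat_string 6))"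
    by (simp add: reduce_def fraction_def)
qed simp_all

lemma reduce_question:
  assumes "tm_computes_within M (\<lambda>y. [V y]) (poly p)"
  shows "Theta_question (G x) (1 / 6) \<longleftrightarrow> (\<exists>w. length w \<le> poly q (length x) \<and> V (pair_string x w))"
proof -
  interpret tb: tableau M x "T x" "P x" by unfold_locales
  have "\<exists>t\<le>T x. \<exists>ts. (tm_step M ^^ t) (tm_init M (pair_string x w)) = (1, ts) \<and>
      snd (hd ts) = string_tape [V (pair_string x w)]" if "length w \<le> P x" for w
  proof -
    have "poly p (length (pair_string x w)) \<le> T x"
      unfolding T_def length_pair_string using that by (intro poly_nat_mono) simp
    then show ?thesis using assms le_trans unfolding tm_computes_within_def by meson
  qed
  from tb.satisfiable_iff[of V, OF this] show ?thesis
    using tb.tableau_Theta_question by (simp add: P_def)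
qed

end

theorem NP_hard_Theta: "NP_hard_promise Theta"
  unfolding NP_hard_promise_def Theta_def prod.case
proof
  fix L assume "L \<in> NP"
  then obtain V and q :: "nat poly" where V: "poly_time_decidable V"
    and L: "\<And>x. x \<in> L \<longleftrightarrow> (\<exists>w. length w \<le> poly q (length x) \<and> V (pair_string x w))"
    unfolding NP_def promise_NP_def by auto
  from V obtain M and p :: "nat poly" where M: "wf_tm M" "tm_computes_within M (\<lambda>y. [V y]) (poly p)"
    unfolding poly_time_decidable_def poly_time_computable_def by blast
  interpret reduction M p q using M(1) by unfold_locales
  have inst: "Theta_instance (G x) (1 / 6)" and two: "sigma_chromatic_number (G x) = 2" for x
    using tableau.tableau_Theta_instance[OF tab] grid.sigma_chromatic_number_grid[OF is_grid] by auto
  have "x \<in> L \<longleftrightarrow> reduce x \<in> {x. \<exists>G r. encodes x G r \<and> Theta_instance G r \<and> Theta_question G r}" for x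
  proof -
    have "x \<in> L \<longleftrightarrow> Theta_question (G x) (1 / 6)" using L reduce_question[OF M(2)] by simp
    also have "\<dots> \<longleftrightarrow> (\<exists>H r. encodes (reduce x) H r \<and> Theta_instance H r \<and> Theta_question H r)"
    proof
      assume "Theta_question (G x) (1 / 6)"
      then show "\<exists>H r. encodes (reduce x) H r \<and> Theta_instance H r \<and> Theta_question H r"
        using reduce_encodes inst by blast
    next
      assume "\<exists>H r. encodes (reduce x) H r \<and> Theta_instance H r \<and> Theta_question H r"
      then obtain H r where H: "encodes (reduce x) H r" "Theta_instance H r" "Theta_question H r" by blast
      have "pair_graph H" "pair_graph (G x)" using H(2) inst by (simp_all add: Theta_instance_def)
      \<comment> \<open>A yes-instance is witnessed by some decoding of the output, which can only
        be the constructed graph with \<open>1 / 6\<close>.\<close>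
      from encodes_unique[OF H(1) reduce_encodes this] have "H = G x" "r = 1 / 6" by blast+
      then show "Theta_question (G x) (1 / 6)" using H(3) by (simp only:)
    qed
    finally show ?thesis by simp
  qed
  then show "\<exists>f. poly_time_computable f \<and>
      (\<forall>x. f x \<in> {x. \<exists>G r. encodes x G r \<and> Theta_instance G r \<and> sigma_chromatic_number G = 2} \<and>
        (x \<in> L \<longleftrightarrow> f x \<in> {x. \<exists>G r. encodes x G r \<and> Theta_instance G r \<and> Theta_question G r}))"
    using poly_time_computable_reduce reduce_encodes inst two by (intro exI[of _ reduce]) blast
qed

theorem theorem4:
  shows "NP_complete_promise Theta"
  unfolding NP_complete_promise_def using Theta_in_promise_NP NP_hard_Theta by blast

end
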